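(* Let $\Omega$ be a simply connected, bounded uniform domain and $\psi:\mathbb D\to\Omega$ a conformal map of $\mathbb D$ onto $\Omega$. Then $|\psi'|^2\in\bigcap_{p>1}\mathrm{B}_p(\mathbb D)$ if and only if for each $1<p<\infty$ and each $\sigma\in\mathrm{D}_p(\Omega)$, the Bergman projection $\Pi_\Omega$ is bounded on $L^p(\Omega,\sigma)$.
   Context: $\mathbb D$ is the open unit disc, $\mathbb T$ the unit circle, $dA$ normalized area measure. A weight is a locally integrable, a.e. positive function. For measurable $f$, $0<p<\infty$, weight $v$, measurable $E$: $\langle f\rangle_{p,v,E}=\big(\int_E|f|^pv\,dA\big)^{1/p}/\big(\int_Ev\,dA\big)^{1/p}$; for $p=\infty$ it is $\|f\|_{L^\infty(E)}$; $v$ omitted when $v\equiv1$, $p$ omitted when $p=1$. For an arc $I\subset\mathbb T$ with center $e^{i\theta_0}$ and normalized arclength $\ell(I)$ ($\ell(\mathbb T)=1$), $Q_I=\{re^{i\theta}\in\mathbb D:1-r\le\ell(I),|\theta-\theta_0|\le\ell(I)/2\}$. For $1\le p<\infty$, $u\in\mathrm{B}_p(\mathbb D)$ means $\sup_I\langle u\rangle_{Q_I}\langle u^{-1}\rangle_{\frac1{p-1},Q_I}<\infty$ (over all arcs $I$). A weight $\sigma$ on $\Omega$ belongs to $\mathrm{D}_p(\Omega)$ if $\sup_D\langle\sigma\rangle_{D\cap\Omega}\langle\sigma^{-1}\rangle_{\frac1{p-1},D\cap\Omega}<\infty$, the supremum over all Euclidean discs $D$ centered on $\partial\Omega$. A simply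 connected domain $\Omega$ bounded by a Jordan curve is a uniform domain if there is $C>0$ such that for all $z_1,z_2\in\partial\Omega$, $\sup_{z\in\partial\Omega(z_1,z_2)}(|z_1-z|+|z_2-z|)\le C|z_1-z_2|$, where $\partial\Omega(z_1,z_2)$ is the smaller arc of $\partial\Omega$ between $z_1$ and $z_2$. $\Pi_\Omega$ is the orthogonal projection of $L^2(\Omega)$ onto its holomorphic subspace; bounded on $L^p(\Omega,\sigma)$ means it extends to a bounded operator on the $L^p$ space of $\sigma\,dA$. *)

theory Defs
  imports "HOL-Complex_Analysis.Complex_Analysis"
begin

text \<open>Area measure: Lebesgue measure on the complex plane. The normalisation constant of
  the normalised area measure dA cancels in all averages and does not affect boundedness,
  so we work with plain Lebesgue measure.\<close>

definition weight_on :: "complex set \<Rightarrow> (complex \<Rightarrow> real) \<Rightarrow> bool" where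
  "weight_on S v \<longleftrightarrow>
     (\<forall>K. compact K \<longrightarrow> K \<subseteq> S \<longrightarrow> set_integrable lebesgue K v) \<and>
     (AE z in lebesgue. z \<in> S \<longrightarrow> v z > 0)"

definition wavg :: "real \<Rightarrow> (complex \<Rightarrow> real) \<Rightarrow> complex set \<Rightarrow> (complex \<Rightarrow> real) \<Rightarrow> real" where
  "wavg p v E f =
     ((LINT z:E|lebesgue. \<bar>f z\<bar> powr p * v z) powr (1/p)) /
     ((LINT z:E|lebesgue. v z) powr (1/p))"

definition wavg_finite :: "real \<Rightarrow> (complex \<Rightarrow> real) \<Rightarrow> complex set \<Rightarrow> (complex \<Rightarrow> real) \<Rightarrow> bool" where
  "wavg_finite p v E f \<longleftrightarrow> set_integrable lebesgue E (\<lambda>z. \<bar>f z\<bar> powr p * v z)"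

definition carleson_box :: "real \<Rightarrow> real \<Rightarrow> complex set" where
  "carleson_box \<theta>0 l =
     {z. cmod z < 1 \<and> 1 - cmod z \<le> l \<and>
         (\<exists>\<theta>. z = complex_of_real (cmod z) * cis \<theta> \<and> \<bar>\<theta> - \<theta>0\<bar> \<le> l / 2)}"

text \<open>The class B_p(D) for 1 < p < infinity (arcs: centre angle theta0, length 0 < l <= 1).
  The supremum being finite includes finiteness of the averages involved.\<close>
definition in_Bp :: "real \<Rightarrow> (complex \<Rightarrow> real) \<Rightarrow> bool" where
  "in_Bp p u \<longleftrightarrow> weight_on (ball 0 1) u \<and>
     (\<exists>C. \<forall>\<theta>0 l. 0 < l \<longrightarrow> l \<le> 1 \<longrightarrow>
        wavg_finite 1 (\<lambda>_. 1) (carleson_box \<theta>0 l) u \<and>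
        wavg_finite (1/(p-1)) (\<lambda>_. 1) (carleson_box \<theta>0 l) (\<lambda>z. inverse (u z)) \<and>
        wavg 1 (\<lambda>_. 1) (carleson_box \<theta>0 l) u *
        wavg (1/(p-1)) (\<lambda>_. 1) (carleson_box \<theta>0 l) (\<lambda>z. inverse (u z)) \<le> C)"

definition in_Dp :: "complex set \<Rightarrow> real \<Rightarrow> (complex \<Rightarrow> real) \<Rightarrow> bool" where
  "in_Dp \<Omega> p \<sigma> \<longleftrightarrow> weight_on \<Omega> \<sigma> \<and>
     (\<exists>C. \<forall>c r. c \<in> frontier \<Omega> \<longrightarrow> 0 < r \<longrightarrow>
        wavg_finite 1 (\<lambda>_. 1) (ball c r \<inter> \<Omega>) \<sigma> \<and>
        wavg_finite (1/(p-1)) (\<lambda>_. 1) (ball c r \<inter> \<Omega>) (\<lambda>z. inverse (\<sigma> z)) \<and>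
        wavg 1 (\<lambda>_. 1) (ball c r \<inter> \<Omega>) \<sigma> *
        wavg (1/(p-1)) (\<lambda>_. 1) (ball c r \<inter> \<Omega>) (\<lambda>z. inverse (\<sigma> z)) \<le> C)"

definition L2_on :: "complex set \<Rightarrow> (complex \<Rightarrow> complex) \<Rightarrow> bool" where
  "L2_on \<Omega> f \<longleftrightarrow> set_borel_measurable lebesgue \<Omega> f \<and>
     set_integrable lebesgue \<Omega> (\<lambda>z. (cmod (f z))\<^sup>2)"

definition A2_on :: "complex set \<Rightarrow> (complex \<Rightarrow> complex) \<Rightarrow> bool" where
  "A2_on \<Omega> h \<longleftrightarrow> h holomorphic_on \<Omega> \<and> L2_on \<Omega> h"

text \<open>The Bergman projection: the orthogonal projection of L^2(Omega) onto A^2(Omega),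
  represented by its (unique) holomorphic representative, set to 0 off Omega.\<close>
definition bergman_proj :: "complex set \<Rightarrow> (complex \<Rightarrow> complex) \<Rightarrow> (complex \<Rightarrow> complex)" where
  "bergman_proj \<Omega> f = (THE g. A2_on \<Omega> g \<and> (\<forall>z. z \<notin> \<Omega> \<longrightarrow> g z = 0) \<and>
      (\<forall>h. A2_on \<Omega> h \<longrightarrow> (LINT z:\<Omega>|lebesgue. (f z - g z) * cnj (h z)) = 0))"

text \<open>Pi_Omega extends to a bounded operator on L^p(Omega, sigma): a uniform L^p(sigma)
  bound on the dense subspace L^2(Omega) (intersected with L^p(sigma)).\<close>
definition bergman_bounded :: "complex set \<Rightarrow> real \<Rightarrow> (complex \<Rightarrow> real) \<Rightarrow> bool" where
  "bergman_bounded \<Omega> p \<sigma> \<longleftrightarrow>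
     (\<exists>C::real. C \<ge> 0 \<and> (\<forall>f. L2_on \<Omega> f \<longrightarrow>
        set_nn_integral lebesgue \<Omega> (\<lambda>z. ennreal (cmod (bergman_proj \<Omega> f z) powr p * \<sigma> z))
        \<le> ennreal C * set_nn_integral lebesgue \<Omega> (\<lambda>z. ennreal (cmod (f z) powr p * \<sigma> z))))"

definition jordan_domain :: "complex set \<Rightarrow> bool" where
  "jordan_domain \<Omega> \<longleftrightarrow> open \<Omega> \<and> connected \<Omega> \<and> \<Omega> \<noteq> {} \<and> simply_connected \<Omega> \<and>
     (\<exists>\<gamma>. simple_path \<gamma> \<and> pathfinish \<gamma> = pathstart \<gamma> \<and> frontier \<Omega> = path_image \<gamma>)"

text \<open>Uniform domain: the arcs of the boundary between z1 and z2 are the closures of the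
  two connected components of the boundary minus {z1,z2}; for the smaller one the
  sup of |z1-z|+|z2-z| is at most C|z1-z2|.\<close>
definition uniform_domain :: "complex set \<Rightarrow> bool" where
  "uniform_domain \<Omega> \<longleftrightarrow> jordan_domain \<Omega> \<and>
     (\<exists>C>0. \<forall>z1\<in>frontier \<Omega>. \<forall>z2\<in>frontier \<Omega>. z1 \<noteq> z2 \<longrightarrow>
        (\<exists>A\<in>components (frontier \<Omega> - {z1, z2}).
           \<forall>z\<in>A. cmod (z1 - z) + cmod (z2 - z) \<le> C * cmod (z1 - z2)))"

end

theory Submission
  imports Defs
begin

text \<open>
  Let \<open>s = |\<psi>'(z\<^sub>Q)| l\<close> be the size of the image of the Carleson box \<open>Q\<close> of length \<open>l\<close> with centre
  \<open>z\<^sub>Q\<close>. A length-area argument gives crosscuts around \<open>Q\<close> whose images have diameter at most a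
  multiple of \<open>s\<close>, and since the boundary has bounded turning, Janiszewski's theorem confines
  \<open>\<psi>(Q)\<close> to a disc of radius a multiple of \<open>s\<close>.

  Conformal invariance turns the Bergman projection of \<open>\<Omega>\<close> on the weight \<open>\<sigma>\<close> into that of the disc on the weight
  \<open>(\<sigma> \<circ> \<psi>) |\<psi>'|\<^bsup>2-p\<^esup>\<close>. If it is bounded for \<open>\<sigma> = 1\<close>, testing it on indicators of hyperbolic discs
  bounds the average of \<open>|\<psi>'|\<^bsup>2-p\<^esup>\<close> over \<open>Q\<close> by its value at \<open>z\<^sub>Q\<close>, which is the condition \<open>B\<^sub>q\<close> with
  \<open>p = 2 + 2/(q-1)\<close>.

  Conversely, cut \<open>Q\<close> into the layers at distance about \<open>2\<^bsup>-m\<^esup> l\<close> from the circle. The condition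
  \<open>D\<^sub>p\<close> makes the pullbacks of \<open>\<sigma> dA\<close> and of the dual weight doubling on boxes, so that their
  masses on the layers of \<open>Q\<close> decay geometrically in \<open>m\<close>; the conditions \<open>B\<^sub>q\<close> for all \<open>q\<close> say that
  \<open>|\<psi>'|\<close> decays along the layers more slowly than any given geometric rate. Together these give a
  \<open>B\<^sub>p\<close> condition with geometric gain for pairs of layers, and the positive Bergman
  operator is bounded by a sum over pairs of layers of dyadic boxes that this gain makes
  summable.
\<close>

subsection \<open>Change of variables under conformal maps\<close>

text \<open>A single weight suffices for the necessity: with \<sigma> = 1 the exponent p = 2 +
  2/(q-1) runs through all p > 2 as q runs through all q > 1. In the converse the pulled-back weight
  is written as (\<sigma> o \<psi>) |\<psi>'|^2 times |\<psi>'|^(-p), and its dual as a pulled-back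
  density times |\<psi>'|^(-p/(p-1)). The masses of the densities are controlled by D_p, because
  \<psi>(Q) also lies in a disc centred on the boundary with radius comparable to s. The negative
  powers have no bound on the whole of Q; on the m-th layer they grow at most like a power of
  \<eta>^m. The decay rate of the masses depends on \<sigma> and p and may be close to 1, so \<eta>
  has to be taken arbitrarily close to 1; this is where every B_q enters. The Bergman kernel enters
  through its absolute value. Its sum over pairs of layers is handled by Jensen's inequality at each
  point and Holder's inequality for each pair; splitting the gain \<rho>^(m+k) by r^p = \<rho>
  leaves summable weights r^(m+k) for both.\<close>

definition c2v :: "complex \<Rightarrow> real^2" where "c2v z = vector [Re z, Im z]"
definition v2c :: "real^2 \<Rightarrow> complex" where "v2c v = Complex (v$1) (v$2)"

lemma v2c_c2v [simp]: "v2c (c2v z) = z" and c2v_v2c [simp]: "c2v (v2c v) = v"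
  by (simp_all add: c2v_def v2c_def vec_eq_iff forall_2)

lemma linear_c2v: "linear c2v" and linear_v2c: "linear v2c"
  by (auto intro!: linearI simp: c2v_def v2c_def vec_eq_iff forall_2 complex_eq_iff)

lemma bounded_linear_c2v: "bounded_linear c2v" and bounded_linear_v2c: "bounded_linear v2c"
  by (simp_all add: linear_c2v linear_v2c linear_conv_bounded_linear[symmetric])

lemma c2v_measurable [measurable]: "c2v \<in> borel \<rightarrow>\<^sub>M borel"
  by (intro borel_measurable_continuous_onI linear_continuous_on bounded_linear_c2v)

lemma distr_c2v_lborel: "distr lborel borel c2v = lborel"
proof (rule lborel_eqI[symmetric])
  fix l u :: "real^2" assume le: "\<And>b. b \<in> Basis \<Longrightarrow> l \<bullet> b \<le> u \<bullet> b"
  have l12: "l$1 \<le> u$1" "l$2 \<le> u$2"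
    using le[of "axis 1 1"] le[of "axis 2 1"] by (auto simp: inner_axis axis_in_Basis_iff)
  have B: "(Basis :: (real^2) set) = {axis 1 1, axis 2 1}"
    by (auto simp: Basis_vec_def UNIV_2)
  have ne: "axis 1 1 \<noteq> (axis 2 1 :: real^2)" by (simp add: axis_eq_axis)
  have "c2v -` box l u = box (v2c l) (v2c u)"
    by (auto simp: box_def B Basis_complex_def c2v_def v2c_def inner_axis inner_complex_def)
  then have "emeasure (distr lborel borel c2v) (box l u) = emeasure lborel (box (v2c l) (v2c u))"
    by (subst emeasure_distr) auto
  also have "\<dots> = (\<Prod>b\<in>Basis. (u - l) \<bullet> b)"
    using l12 by (subst emeasure_lborel_box_eq) (auto simp: B ne Basis_complex_def v2c_def inner_complex_def inner_axis)
  finally show "emeasure (distr lborel borel c2v) (box l u) = (\<Prod>b\<in>Basis. (u - l) \<bullet> b)" .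
qed simp

lemma c2v_lebesgue: "c2v \<in> lebesgue \<rightarrow>\<^sub>M lebesgue" and distr_c2v_lebesgue: "distr lebesgue lebesgue c2v = lebesgue"
proof -
  have m: "c2v \<in> lebesgue \<rightarrow>\<^sub>M lborel"
    by (simp add: measurable_completion)
  have eq: "distr lebesgue lborel c2v = lborel"
    using distr_c2v_lborel by (subst distr_completion) (auto cong: distr_cong)
  show "c2v \<in> lebesgue \<rightarrow>\<^sub>M lebesgue"
    by (rule completion.measurable_completion2[OF m]) (simp add: eq)
  show "distr lebesgue lebesgue c2v = lebesgue"
    using completion.completion_distr_eq[OF m] by (simp add: eq)
qed

lemma v2c_lebesgue_sets:
  assumes "A \<in> sets lebesgue" shows "c2v ` A \<in> sets lebesgue"
  by (rule differentiable_image_in_sets_lebesgue[OF assms])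
     (auto intro!: linear_imp_differentiable_on linear_c2v simp: DIM_complex)

lemma emeasure_c2v_image:
  assumes "A \<in> sets lebesgue" shows "emeasure lebesgue (c2v ` A) = emeasure lebesgue A"
proof -
  have "c2v -` (c2v ` A) = A" by (metis inj_onI inj_vimage_image_eq v2c_c2v)
  then show ?thesis
    by (subst distr_c2v_lebesgue[symmetric]) (simp add: emeasure_distr c2v_lebesgue v2c_lebesgue_sets assms)
qed

lemma nn_integral_c2v:
  assumes "f \<in> borel_measurable lebesgue"
  shows "(\<integral>\<^sup>+v. f v \<partial>lebesgue) = (\<integral>\<^sup>+z. f (c2v z) \<partial>lebesgue)"
  by (subst distr_c2v_lebesgue[symmetric], subst nn_integral_distr) (use assms c2v_lebesgue in auto)

text \<open>Multiplication by d = a + ib acts on the plane by the matrix with rows (a, -b) and (b,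
  a).\<close>

lemma det_complex_derivative:
  "det (matrix (\<lambda>v. c2v (d * v2c v))) = (cmod d)\<^sup>2"
  by (simp add: det_2 matrix_def c2v_def v2c_def axis_def cmod_power2) (simp add: power2_eq_square)

text \<open>The change of variables theorem is stated on \<open>real^'n\<close>, so \<open>f\<close>
  is conjugated by the isometry \<open>c2v\<close>. Boundedness makes the measure of the image
  finite, as the gauge integral form of that theorem requires.\<close>

lemma emeasure_image_holomorphic_bounded:
  fixes f :: "complex \<Rightarrow> complex"
  assumes S: "open S" and f: "f holomorphic_on S" "inj_on f S"
    and A: "A \<in> sets lebesgue" "A \<subseteq> S" and b: "bounded (f ` A)"
  shows "emeasure lebesgue (f ` A) = (\<integral>\<^sup>+z\<in>A. ennreal ((cmod (deriv f z))\<^sup>2) \<partial>lebesgue)"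
proof -
  define g where "g = c2v \<circ> f \<circ> v2c"
  have der: "(g has_derivative (\<lambda>v. c2v (deriv f (v2c x) * v2c v))) (at x within c2v ` A)" if "x \<in> c2v ` A" for x
  proof -
    have "v2c x \<in> S" using that A by auto
    then have "(f has_field_derivative deriv f (v2c x)) (at (v2c x))"
      using f S holomorphic_derivI by blast
    then have "(f has_derivative (*) (deriv f (v2c x))) (at (v2c x))"
      by (simp add: has_field_derivative_def)
    then have "(f \<circ> v2c has_derivative (*) (deriv f (v2c x)) \<circ> v2c) (at x)"
      by (rule diff_chain_at[OF bounded_linear_imp_has_derivative[OF bounded_linear_v2c]])
    then have "(c2v \<circ> (f \<circ> v2c) has_derivative c2v \<circ> ((*) (deriv f (v2c x)) \<circ> v2c)) (at x)"
      by (rule diff_chain_at[OF _ bounded_linear_imp_has_derivative[OF bounded_linear_c2v]])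
    then show ?thesis
      by (auto simp: g_def o_def intro: has_derivative_at_withinI)
  qed
  have inj: "inj_on g (c2v ` A)"
    using f(2) A(2) by (auto simp: g_def inj_on_def) (metis subsetD v2c_c2v)
  have gA: "g ` c2v ` A = c2v ` (f ` A)" by (auto simp: g_def image_image)
  have fA: "f ` A \<in> sets lebesgue"
    by (rule differentiable_image_in_sets_lebesgue[OF A(1)])
       (use f(1) A(2) S in \<open>auto intro!: holomorphic_on_imp_differentiable_on intro: holomorphic_on_subset\<close>)
  have cA: "c2v ` A \<in> sets lebesgue" using A v2c_lebesgue_sets by auto
  have "bounded (g ` c2v ` A)" unfolding gA by (intro bounded_linear_image b bounded_linear_c2v)
  then have lm: "g ` c2v ` A \<in> lmeasurable"
    unfolding gA using fA by (intro bounded_set_imp_lmeasurable v2c_lebesgue_sets) auto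
  have hi: "((\<lambda>x. \<bar>det (matrix (\<lambda>v. c2v (deriv f (v2c x) * v2c v)))\<bar>) has_integral measure lebesgue (g ` c2v ` A)) (c2v ` A)"
    using has_measure_differentiable_image[OF cA der inj] lm by blast
  then have hi': "((\<lambda>x. (cmod (deriv f (v2c x)))\<^sup>2) has_integral measure lebesgue (g ` c2v ` A)) (c2v ` A)"
    by (simp add: det_complex_derivative)
  have ind: "indicator (c2v ` A) x * (cmod (deriv f (v2c x)))\<^sup>2 = (if x \<in> c2v ` A then (cmod (deriv f (v2c x)))\<^sup>2 else 0)" for x
    by (simp add: indicator_def)
  have hi'': "((\<lambda>x. indicator (c2v ` A) x * (cmod (deriv f (v2c x)))\<^sup>2) has_integral measure lebesgue (g ` c2v ` A)) UNIV"
    unfolding ind has_integral_restrict_UNIV by (rule hi')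
  have me: "(\<lambda>x. indicator (c2v ` A) x * (cmod (deriv f (v2c x)))\<^sup>2) \<in> borel_measurable lebesgue"
    by (rule conjunct1[OF has_integral_iff_nn_integral_lebesgue[THEN iffD1, OF _ hi'']]) simp
  have "(\<integral>\<^sup>+ x. ennreal (indicator (c2v ` A) x * (cmod (deriv f (v2c x)))\<^sup>2) \<partial>lebesgue) = ennreal (measure lebesgue (g ` c2v ` A))"
    by (rule conjunct1[OF conjunct2[OF has_integral_iff_nn_integral_lebesgue[THEN iffD1, OF _ hi'']]]) simp
  also have "\<dots> = emeasure lebesgue (g ` c2v ` A)"
    using lm by (simp add: emeasure_eq_measure2)
  also have "\<dots> = emeasure lebesgue (f ` A)" unfolding gA by (rule emeasure_c2v_image[OF fA])
  also have "(\<integral>\<^sup>+ x. ennreal (indicator (c2v ` A) x * (cmod (deriv f (v2c x)))\<^sup>2) \<partial>lebesgue)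
     = (\<integral>\<^sup>+z\<in>A. ennreal ((cmod (deriv f z))\<^sup>2) \<partial>lebesgue)"
  proof -
    have "c2v z \<in> c2v ` A \<longleftrightarrow> z \<in> A" for z by (metis image_iff v2c_c2v)
    then have "indicator (c2v ` A) (c2v z) = (indicator A z :: real)" for z by (simp add: indicator_def)
    moreover have "(\<lambda>x. ennreal (indicator (c2v ` A) x * (cmod (deriv f (v2c x)))\<^sup>2)) \<in> borel_measurable lebesgue"
      using me by measurable
    ultimately show ?thesis
      by (subst nn_integral_c2v) (auto intro!: nn_integral_cong simp: ennreal_mult' mult.commute simp flip: ennreal_indicator)
  qed
  finally show ?thesis ..
qed

lemma holomorphic_image_lebesgue_sets:
  fixes f :: "complex \<Rightarrow> complex"
  assumes "open S" "f holomorphic_on S" "A \<in> sets lebesgue" "A \<subseteq> S"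
  shows "f ` A \<in> sets lebesgue"
proof (rule differentiable_image_in_sets_lebesgue[OF assms(3)])
  have "f field_differentiable at x" if "x \<in> S" for x
    using assms(1,2) that holomorphic_on_imp_differentiable_at by blast
  then show "f differentiable_on A"
    using assms(4) by (intro differentiable_at_imp_differentiable_on field_differentiable_imp_differentiable) blast
qed auto

text \<open>Images of compact sets are bounded, so monotone convergence along a compact exhaustion
  of \<open>S\<close> reduces to the bounded case.\<close>

lemma emeasure_image_holomorphic:
  fixes f :: "complex \<Rightarrow> complex"
  assumes S: "open S" and f: "f holomorphic_on S" "inj_on f S"
    and A: "A \<in> sets lebesgue" "A \<subseteq> S"
  shows "emeasure lebesgue (f ` A) = (\<integral>\<^sup>+z\<in>A. ennreal ((cmod (deriv f z))\<^sup>2) \<partial>lebesgue)"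
proof -
  obtain K :: "nat \<Rightarrow> complex set" where K0: "\<And>n. compact (K n)" "\<And>n. K n \<subseteq> S"
      "\<And>n. K n \<subseteq> interior (K (Suc n))" "\<Union>(range K) = S"
      "\<And>L. \<lbrakk>compact L; L \<subseteq> S\<rbrakk> \<Longrightarrow> \<exists>N. \<forall>n\<ge>N. L \<subseteq> K n"
    by (rule open_Union_compact_subsets[OF S]) (rule that)
  have "K n \<subseteq> K (Suc n)" for n
    using K0(3)[of n] interior_subset by (rule order_trans)
  with K0 have K: "\<And>n. compact (K n)" "\<And>n. K n \<subseteq> S" "\<And>n. K n \<subseteq> K (Suc n)" "(\<Union>n. K n) = S"
    by simp_all
  have Ks: "K n \<in> sets lebesgue" for n
    using K(1)[of n] by (intro lmeasurable_compact fmeasurableD)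
  have mono: "incseq K" using K(3) by (simp add: incseq_SucI)
  have An: "A \<inter> K n \<in> sets lebesgue" "A \<inter> K n \<subseteq> S" for n
    using A Ks[of n] by auto
  have eq: "emeasure lebesgue (f ` (A \<inter> K n)) = (\<integral>\<^sup>+z\<in>A \<inter> K n. ennreal ((cmod (deriv f z))\<^sup>2) \<partial>lebesgue)" for n
  proof (rule emeasure_image_holomorphic_bounded[OF S f An])
    have "compact (f ` K n)"
      using K f by (meson compact_continuous_image holomorphic_on_imp_continuous_on holomorphic_on_subset)
    then show "bounded (f ` (A \<inter> K n))"
      by (meson bounded_subset compact_imp_bounded image_mono inf_le2)
  qed
  have "A = (\<Union>n. A \<inter> K n)" using K(4) A(2) by blast
  then have U: "f ` A = (\<Union>n. f ` (A \<inter> K n))" by (metis image_UN)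
  have "emeasure lebesgue (f ` A) = (SUP n. emeasure lebesgue (f ` (A \<inter> K n)))"
    unfolding U
  proof (rule SUP_emeasure_incseq[symmetric])
    show "range (\<lambda>n. f ` (A \<inter> K n)) \<subseteq> sets lebesgue"
      using holomorphic_image_lebesgue_sets[OF S f(1) An] by blast
    show "incseq (\<lambda>n. f ` (A \<inter> K n))"
      using mono unfolding incseq_def by blast
  qed
  also have "\<dots> = (SUP n. \<integral>\<^sup>+z\<in>A \<inter> K n. ennreal ((cmod (deriv f z))\<^sup>2) \<partial>lebesgue)"
    by (simp add: eq)
  also have "\<dots> = (\<integral>\<^sup>+z. (SUP n. ennreal ((cmod (deriv f z))\<^sup>2) * indicator (A \<inter> K n) z) \<partial>lebesgue)"
  proof (rule nn_integral_monotone_convergence_SUP[symmetric])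
    show "incseq (\<lambda>n z. ennreal ((cmod (deriv f z))\<^sup>2) * indicator (A \<inter> K n) z)"
      using mono by (auto simp: incseq_def le_fun_def indicator_def intro!: mult_left_mono)
    have "deriv f holomorphic_on S" using f S by (simp add: holomorphic_deriv)
    then have "continuous_on (K n) (deriv f)" for n
      using K(2) holomorphic_on_imp_continuous_on holomorphic_on_subset by blast
    then have "deriv f \<in> borel_measurable (lebesgue_on (K n))" for n
      by (rule continuous_imp_measurable_on_sets_lebesgue[OF _ Ks])
    then have "(\<lambda>z. ennreal ((cmod (deriv f z))\<^sup>2)) \<in> borel_measurable (lebesgue_on (K n))" for n
      by measurable
    then have "(\<lambda>z. ennreal ((cmod (deriv f z))\<^sup>2) * indicator (K n) z) \<in> borel_measurable lebesgue" for n
      by (subst (asm) borel_measurable_restrict_space_iff_ennreal) (simp_all add: Ks)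
    then have "(\<lambda>z. ennreal ((cmod (deriv f z))\<^sup>2) * indicator (K n) z * indicator A z) \<in> borel_measurable lebesgue" for n
      using A by measurable
    then show "(\<lambda>z. ennreal ((cmod (deriv f z))\<^sup>2) * indicator (A \<inter> K n) z) \<in> borel_measurable lebesgue" for n
      by (simp add: indicator_inter_arith mult_ac)
  qed
  also have "\<dots> = (\<integral>\<^sup>+z\<in>A. ennreal ((cmod (deriv f z))\<^sup>2) \<partial>lebesgue)"
  proof (rule nn_integral_cong)
    fix z
    show "(SUP n. ennreal ((cmod (deriv f z))\<^sup>2) * indicator (A \<inter> K n) z) = ennreal ((cmod (deriv f z))\<^sup>2) * indicator A z"
    proof (cases "z \<in> A")
      case True
      then obtain m where "z \<in> K m" using A K(4) by auto
      then show ?thesis using True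
        by (intro antisym SUP_least SUP_upper2[of m]) (auto simp: indicator_def)
    qed auto
  qed
  finally show ?thesis .
qed

locale conformal =
  fixes f :: "complex \<Rightarrow> complex" and S T :: "complex set"
  assumes openS: "open S" and holf: "f holomorphic_on S" and injf: "inj_on f S" and fST: "f ` S = T"
begin

lemma openT: "open T"
  using open_mapping_thm3[OF holf openS injf] fST by simp

lemma S_sets [measurable, simp]: "S \<in> sets lebesgue" and T_sets [measurable, simp]: "T \<in> sets lebesgue"
  using openS openT by auto

lemma inverse_holomorphic:
  obtains g where "g holomorphic_on T" "\<And>z. z \<in> S \<Longrightarrow> g (f z) = z" "\<And>w. w \<in> T \<Longrightarrow> f (g w) = w"
    "\<And>w. w \<in> T \<Longrightarrow> g w \<in> S" "\<And>z. z \<in> S \<Longrightarrow> deriv f z * deriv g (f z) = 1"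
proof -
  obtain g where g: "g holomorphic_on f ` S" "\<And>z. z \<in> S \<Longrightarrow> deriv f z * deriv g (f z) = 1" "\<And>z. z \<in> S \<Longrightarrow> g (f z) = z"
    by (rule holomorphic_has_inverse[OF holf openS injf]) blast
  show thesis
    by (rule that[of g]) (use g fST in auto)
qed

lemma deriv_nz: "z \<in> S \<Longrightarrow> deriv f z \<noteq> 0"
  by (rule inverse_holomorphic) force

lemma deriv_cont: "continuous_on S (deriv f)"
  using holf openS holomorphic_deriv holomorphic_on_imp_continuous_on by blast

lemma deriv_measurable [measurable]: "deriv f \<in> borel_measurable (lebesgue_on S)"
  by (rule continuous_imp_measurable_on_sets_lebesgue[OF deriv_cont]) simp

text \<open>Preimages under \<open>f\<close> are images under its holomorphic inverse, and these
  preserve Lebesgue sets; continuity of \<open>f\<close> would give this for Borel sets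
  only.\<close>

lemma f_measurable: "f \<in> lebesgue_on S \<rightarrow>\<^sub>M lebesgue_on T"
proof (rule measurableI)
  fix B assume "B \<in> sets (lebesgue_on T)"
  then have B: "B \<in> sets lebesgue" "B \<subseteq> T" by (auto simp: sets_restrict_space_iff)
  obtain g where g: "g holomorphic_on T" "\<And>z. z \<in> S \<Longrightarrow> g (f z) = z" "\<And>w. w \<in> T \<Longrightarrow> f (g w) = w"
    "\<And>w. w \<in> T \<Longrightarrow> g w \<in> S" by (rule inverse_holomorphic) blast
  have "f -` B \<inter> S = g ` B" using g B(2) by force
  moreover have "g ` B \<in> sets lebesgue" by (rule holomorphic_image_lebesgue_sets[OF openT g(1) B])
  moreover have "g ` B \<subseteq> S" using g B(2) by auto
  ultimately show "f -` B \<inter> space (lebesgue_on S) \<in> sets (lebesgue_on S)"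
    by (auto simp: sets_restrict_space_iff)
qed (use fST in auto)

text \<open>As an identity of measures, the change of variables yields the formulas for nonnegative
  integrals, Bochner integrals and integrability at once.\<close>

lemma distr_conformal:
  "distr (density (lebesgue_on S) (\<lambda>z. ennreal ((cmod (deriv f z))\<^sup>2))) (lebesgue_on T) f = lebesgue_on T"
proof (rule measure_eqI)
  fix B assume "B \<in> sets (distr (density (lebesgue_on S) (\<lambda>z. ennreal ((cmod (deriv f z))\<^sup>2))) (lebesgue_on T) f)"
  then have B0: "B \<in> sets (lebesgue_on T)" by simp
  then have B: "B \<in> sets lebesgue" "B \<subseteq> T" by (auto simp: sets_restrict_space_iff)
  define A where "A = f -` B \<inter> S"
  have A0: "A \<in> sets (lebesgue_on S)"
    using measurable_sets[OF f_measurable B0] by (simp add: A_def)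
  then have A: "A \<in> sets lebesgue" "A \<subseteq> S" by (auto simp: sets_restrict_space_iff)
  have fA: "f ` A = B" using B(2) fST by (auto simp: A_def)
  have "emeasure (distr (density (lebesgue_on S) (\<lambda>z. ennreal ((cmod (deriv f z))\<^sup>2))) (lebesgue_on T) f) B
      = emeasure (density (lebesgue_on S) (\<lambda>z. ennreal ((cmod (deriv f z))\<^sup>2))) A"
    using f_measurable B0 by (subst emeasure_distr) (auto simp: A_def)
  also have "\<dots> = (\<integral>\<^sup>+z. ennreal ((cmod (deriv f z))\<^sup>2) * indicator A z \<partial>lebesgue_on S)"
    using A0 by (subst emeasure_density) auto
  also have "\<dots> = (\<integral>\<^sup>+z\<in>A. ennreal ((cmod (deriv f z))\<^sup>2) \<partial>lebesgue)"
    using A by (subst nn_integral_restrict_space) (auto intro!: nn_integral_cong simp: indicator_def)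
  also have "\<dots> = emeasure lebesgue B"
    using emeasure_image_holomorphic[OF openS holf injf A] fA by simp
  also have "\<dots> = emeasure (lebesgue_on T) B"
    using B by (simp add: emeasure_restrict_space)
  finally show "emeasure (distr (density (lebesgue_on S) (\<lambda>z. ennreal ((cmod (deriv f z))\<^sup>2))) (lebesgue_on T) f) B
     = emeasure (lebesgue_on T) B" .
qed simp

lemma nn_integral_conformal:
  assumes "h \<in> borel_measurable (lebesgue_on T)"
  shows "(\<integral>\<^sup>+w. h w \<partial>lebesgue_on T) = (\<integral>\<^sup>+z. ennreal ((cmod (deriv f z))\<^sup>2) * h (f z) \<partial>lebesgue_on S)"
proof -
  have hf: "(\<lambda>z. h (f z)) \<in> borel_measurable (lebesgue_on S)"
    using measurable_compose[OF f_measurable assms] .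
  show ?thesis
    by (subst distr_conformal[symmetric], subst nn_integral_distr, use f_measurable in simp, use assms in simp,
        subst nn_integral_density) (use hf in auto)
qed

lemma integral_conformal:
  fixes h :: "complex \<Rightarrow> 'b::{banach, second_countable_topology}"
  assumes "h \<in> borel_measurable (lebesgue_on T)"
  shows "(\<integral>w. h w \<partial>lebesgue_on T) = (\<integral>z. (cmod (deriv f z))\<^sup>2 *\<^sub>R h (f z) \<partial>lebesgue_on S)"
proof -
  have hf: "(\<lambda>z. h (f z)) \<in> borel_measurable (lebesgue_on S)"
    using measurable_compose[OF f_measurable assms] .
  show ?thesis
    by (subst distr_conformal[symmetric], subst integral_distr, use f_measurable in simp, use assms in simp,
        subst integral_density) (use hf in auto)
qed

lemma integrable_conformal:
  fixes h :: "complex \<Rightarrow> 'b::{banach, second_countable_topology}"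
  assumes "h \<in> borel_measurable (lebesgue_on T)"
  shows "integrable (lebesgue_on T) h \<longleftrightarrow> integrable (lebesgue_on S) (\<lambda>z. (cmod (deriv f z))\<^sup>2 *\<^sub>R h (f z))"
proof -
  have hf: "(\<lambda>z. h (f z)) \<in> borel_measurable (lebesgue_on S)"
    using measurable_compose[OF f_measurable assms] .
  show ?thesis
    by (subst distr_conformal[symmetric], subst integrable_distr_eq, use f_measurable in simp, use assms in simp,
        subst integrable_density) (use hf in auto)
qed

end

subsection \<open>Bergman projection and conformal invariance\<close>

abbreviation (input) disc :: "complex set" where "disc \<equiv> ball 0 1"

lemma L2_on_iff:
  assumes "\<Omega> \<in> sets lebesgue"
  shows "L2_on \<Omega> f \<longleftrightarrow> f \<in> borel_measurable (lebesgue_on \<Omega>) \<and> integrable (lebesgue_on \<Omega>) (\<lambda>z. (cmod (f z))\<^sup>2)"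
  unfolding L2_on_def set_borel_measurable_def set_integrable_def
  using assms by (subst borel_measurable_restrict_space_iff, simp, subst integrable_restrict_space) auto

lemma set_integral_lebesgue_on:
  fixes f :: "complex \<Rightarrow> 'b::{banach, second_countable_topology}"
  assumes "\<Omega> \<in> sets lebesgue"
  shows "(LINT z:\<Omega>|lebesgue. f z) = (\<integral>z. f z \<partial>lebesgue_on \<Omega>)"
  unfolding set_lebesgue_integral_def using assms by (subst integral_restrict_space) auto

lemma set_nn_integral_lebesgue_on:
  assumes "\<Omega> \<in> sets lebesgue"
  shows "(\<integral>\<^sup>+z\<in>\<Omega>. f z \<partial>lebesgue) = (\<integral>\<^sup>+z. f z \<partial>lebesgue_on \<Omega>)"
  using assms by (subst nn_integral_restrict_space) auto

lemma L2_mult_integrable: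
  fixes f g :: "complex \<Rightarrow> complex"
  assumes "L2_on \<Omega> f" "L2_on \<Omega> g" "\<Omega> \<in> sets lebesgue"
  shows "integrable (lebesgue_on \<Omega>) (\<lambda>z. f z * cnj (g z))"
proof (rule Bochner_Integration.integrable_bound)
  have fg: "f \<in> borel_measurable (lebesgue_on \<Omega>)" "g \<in> borel_measurable (lebesgue_on \<Omega>)"
    and i: "integrable (lebesgue_on \<Omega>) (\<lambda>z. (cmod (f z))\<^sup>2)" "integrable (lebesgue_on \<Omega>) (\<lambda>z. (cmod (g z))\<^sup>2)"
    using assms by (auto simp: L2_on_iff)
  show "integrable (lebesgue_on \<Omega>) (\<lambda>z. (cmod (f z))\<^sup>2 + (cmod (g z))\<^sup>2)" using i by simp
  have cg: "(\<lambda>z. cnj (g z)) \<in> borel_measurable (lebesgue_on \<Omega>)"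
    by (rule measurable_compose[OF fg(2)]) (intro borel_measurable_continuous_onI continuous_intros)
  then show "(\<lambda>z. f z * cnj (g z)) \<in> borel_measurable (lebesgue_on \<Omega>)" using fg by measurable
  show "AE z in lebesgue_on \<Omega>. norm (f z * cnj (g z)) \<le> norm ((cmod (f z))\<^sup>2 + (cmod (g z))\<^sup>2)"
  proof (rule AE_I2)
    fix z
    have "2 * (cmod (f z) * cmod (g z)) \<le> (cmod (f z))\<^sup>2 + (cmod (g z))\<^sup>2"
      using sum_squares_bound[of "cmod (f z)" "cmod (g z)"] by (simp add: mult_ac)
    moreover have "0 \<le> cmod (f z) * cmod (g z)" by simp
    ultimately have "cmod (f z) * cmod (g z) \<le> (cmod (f z))\<^sup>2 + (cmod (g z))\<^sup>2" by linarith
    then show "norm (f z * cnj (g z)) \<le> norm ((cmod (f z))\<^sup>2 + (cmod (g z))\<^sup>2)" by (simp add: norm_mult)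
  qed
qed

lemma L2_diff:
  assumes "L2_on \<Omega> f" "L2_on \<Omega> g" "\<Omega> \<in> sets lebesgue"
  shows "L2_on \<Omega> (\<lambda>z. f z - g z)"
  unfolding L2_on_iff[OF assms(3)]
proof
  have fg: "f \<in> borel_measurable (lebesgue_on \<Omega>)" "g \<in> borel_measurable (lebesgue_on \<Omega>)"
    and i: "integrable (lebesgue_on \<Omega>) (\<lambda>z. (cmod (f z))\<^sup>2)" "integrable (lebesgue_on \<Omega>) (\<lambda>z. (cmod (g z))\<^sup>2)"
    using assms by (auto simp: L2_on_iff)
  show m: "(\<lambda>z. f z - g z) \<in> borel_measurable (lebesgue_on \<Omega>)" using fg by measurable
  show "integrable (lebesgue_on \<Omega>) (\<lambda>z. (cmod (f z - g z))\<^sup>2)"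
  proof (rule Bochner_Integration.integrable_bound)
    show "integrable (lebesgue_on \<Omega>) (\<lambda>z. 2 * (cmod (f z))\<^sup>2 + 2 * (cmod (g z))\<^sup>2)" using i by simp
    show "(\<lambda>z. (cmod (f z - g z))\<^sup>2) \<in> borel_measurable (lebesgue_on \<Omega>)" using m by measurable
    show "AE z in lebesgue_on \<Omega>. norm ((cmod (f z - g z))\<^sup>2) \<le> norm (2 * (cmod (f z))\<^sup>2 + 2 * (cmod (g z))\<^sup>2)"
    proof (rule AE_I2)
      fix z
      have "(cmod (f z - g z))\<^sup>2 \<le> (cmod (f z) + cmod (g z))\<^sup>2" by (intro power_mono norm_triangle_ineq4) auto
      also have "\<dots> \<le> 2 * (cmod (f z))\<^sup>2 + 2 * (cmod (g z))\<^sup>2"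
        using sum_squares_bound[of "cmod (f z)" "cmod (g z)"] by (simp add: power2_sum)
      finally show "norm ((cmod (f z - g z))\<^sup>2) \<le> norm (2 * (cmod (f z))\<^sup>2 + 2 * (cmod (g z))\<^sup>2)" by simp
    qed
  qed
qed

section \<open>Area mean values, the reproducing kernel of the disc, uniqueness of the
  projection\<close>

lemma finite_measure_disc: "finite_measure (lebesgue_on (ball (c::complex) r))"
  by (rule finite_measure_lebesgue_on) simp

lemma L2_ball_integrable:
  assumes "L2_on (ball c r) f"
  shows "integrable (lebesgue_on (ball c r)) f"
proof (rule Bochner_Integration.integrable_bound)
  interpret finite_measure "lebesgue_on (ball c r)" by (rule finite_measure_disc)
  show "integrable (lebesgue_on (ball c r)) (\<lambda>z. 1 + (cmod (f z))\<^sup>2)" using assms by (simp add: L2_on_iff)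
  show "f \<in> borel_measurable (lebesgue_on (ball c r))" using assms by (simp add: L2_on_iff)
  have "t \<le> 1 + t\<^sup>2" for t :: real using zero_le_power2[of "t - 1/2"] by (simp add: power2_diff power_divide field_simps)
  then show "AE z in lebesgue_on (ball c r). norm (f z) \<le> norm (1 + (cmod (f z))\<^sup>2)" by simp
qed

text \<open>Rotation by the angle pi/n preserves the disc and multiplies z^n by -1.\<close>

lemma integral_power_ball:
  assumes n: "n \<ge> 1"
  shows "(\<integral>z. z ^ n \<partial>lebesgue_on (ball (0::complex) r)) = 0"
proof -
  have im: "(\<lambda>z. cis (pi / n) * z) ` ball 0 r = ball 0 r"
  proof safe
    fix x :: complex assume x: "x \<in> ball 0 r"
    have "x = cis (pi / n) * (cis (- (pi / n)) * x)" by (simp add: cis_mult flip: mult.assoc)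
    then show "x \<in> (\<lambda>z. cis (pi / n) * z) ` ball 0 r"
      using x by (intro image_eqI[of _ _ "cis (- (pi / n)) * x"]) (auto simp: norm_mult)
  qed (auto simp: norm_mult)
  interpret conformal "\<lambda>z. cis (pi / n) * z" "ball 0 r" "ball 0 r"
    by unfold_locales (auto intro!: holomorphic_intros inj_onI simp: im)
  have d: "deriv (\<lambda>z. cis (pi / n) * z) z = cis (pi / n)" for z
    by (rule DERIV_imp_deriv) (auto intro!: derivative_eq_intros)
  have c: "cis (pi / n) ^ n = -1"

  proof -
    have "real n * (pi / real n) = pi" using n by simp
    then have "cis (real n * (pi / real n)) = -1" by (simp only: cis_pi)
    then show ?thesis by (simp only: Complex.DeMoivre)
  qed
  have "(\<integral>z. z ^ n \<partial>lebesgue_on (ball (0::complex) r)) = (\<integral>z. (cis (pi / n) * z) ^ n \<partial>lebesgue_on (ball (0::complex) r))"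
    by (subst integral_conformal) (auto simp: d intro!: continuous_imp_measurable_on_sets_lebesgue continuous_intros)
  also have "\<dots> = - (\<integral>z. z ^ n \<partial>lebesgue_on (ball (0::complex) r))"
    by (simp add: power_mult_distrib c)
  finally show ?thesis by simp
qed

text \<open>The power series is integrated termwise and only the constant term survives. A radius s
  between r and R makes the series absolutely summable uniformly on the smaller disc.\<close>

lemma area_mean_value_inner:
  assumes G: "G holomorphic_on ball 0 R" and r: "0 < r" "r < R"
  shows "(\<integral>z. G z \<partial>lebesgue_on (ball 0 r)) = of_real (pi * r\<^sup>2) * G 0"
proof -
  let ?M = "lebesgue_on (ball (0::complex) r)"
  interpret finite_measure ?M by (rule finite_measure_disc)
  have mu: "measure ?M (space ?M) = pi * r\<^sup>2"
    using r by (simp add: measure_restrict_space content_ball DIM_complex unit_ball_vol_2)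
  define a where "a n = (deriv ^^ n) G 0 / fact n" for n
  have ps: "(\<lambda>n. a n * z ^ n) sums G z" if "z \<in> ball 0 R" for z
    using holomorphic_power_series[OF G that] by (simp add: a_def)
  obtain s where s: "r < s" "s < R" using r dense by blast
  have sumr: "summable (\<lambda>n. norm (a n * of_real r ^ n))"
    by (rule powser_insidea[of a "of_real s"]) (use ps[of "of_real s"] s r in \<open>auto simp: sums_iff\<close>)
  have m: "(\<lambda>z. a n * z ^ n) \<in> borel_measurable ?M" for n
    by (intro continuous_imp_measurable_on_sets_lebesgue continuous_intros) auto
  have bd: "norm (a n * z ^ n) \<le> norm (a n * of_real r ^ n)" if "z \<in> ball 0 r" for n z
    using that r by (auto simp: norm_mult norm_power intro!: mult_left_mono power_mono)
  have int: "integrable ?M (\<lambda>z. a n * z ^ n)" for n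
    by (rule integrable_const_bound[where B = "norm (a n * of_real r ^ n)"]) (use bd m in \<open>auto intro!: AE_I2\<close>)
  have "(\<integral>z. G z \<partial>?M) = (\<integral>z. (\<Sum>n. a n * z ^ n) \<partial>?M)"
    by (rule Bochner_Integration.integral_cong) (use ps r in \<open>auto simp: sums_iff\<close>)
  also have "\<dots> = (\<Sum>n. \<integral>z. a n * z ^ n \<partial>?M)"
  proof (rule integral_suminf[OF int])
    show "AE z in ?M. summable (\<lambda>n. norm (a n * z ^ n))"
    proof (rule AE_I2)
      fix z assume "z \<in> space ?M"
      then show "summable (\<lambda>n. norm (a n * z ^ n))"
        using bd by (intro summable_comparison_test'[OF sumr]) auto
    qed
    show "summable (\<lambda>n. \<integral>z. norm (a n * z ^ n) \<partial>?M)"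
    proof (rule summable_comparison_test'[OF summable_mult[OF sumr, of "pi * r\<^sup>2"]])
      fix n
      have "(\<integral>z. norm (a n * z ^ n) \<partial>?M) \<le> (\<integral>z. norm (a n * of_real r ^ n) \<partial>?M)"
        by (rule integral_mono) (use int bd in auto)
      then show "norm (\<integral>z. norm (a n * z ^ n) \<partial>?M) \<le> pi * r\<^sup>2 * norm (a n * of_real r ^ n)"
        using mu by (simp add: mult_ac)
    qed
  qed
  also have "\<dots> = (\<Sum>n. if n = 0 then of_real (pi * r\<^sup>2) * G 0 else 0)"
  proof -
    have "(\<integral>z. a n * z ^ n \<partial>?M) = (if n = 0 then of_real (pi * r\<^sup>2) * G 0 else 0)" for n
      using integral_power_ball[of n r] mu by (auto simp: a_def scaleR_conv_of_real)
    then show ?thesis by simp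
  qed
  also have "\<dots> = of_real (pi * r\<^sup>2) * G 0"
    by (subst suminf_finite[of "{0}"]) auto
  finally show ?thesis .
qed

text \<open>Termwise integration needs room beyond the disc of integration. The radii
  \<open>r n\<close> tend to 1 instead, with |G| as the dominating function.\<close>

lemma area_mean_value_disc:
  assumes G: "G holomorphic_on disc" and i: "integrable (lebesgue_on disc) G"
  shows "(\<integral>z. G z \<partial>lebesgue_on disc) = of_real pi * G 0"
proof -
  define r where "r n = 1 - 1 / (real n + 2)" for n
  have r: "0 < r n" "r n < 1" for n by (auto simp: r_def field_simps)
  have rl: "r \<longlonglongrightarrow> 1" unfolding r_def by real_asymp
  have eq: "(\<integral>z. indicator (ball 0 (r n)) z *\<^sub>R G z \<partial>lebesgue_on disc) = of_real (pi * (r n)\<^sup>2) * G 0" for n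
  proof -
    have sub: "ball 0 (r n) \<subseteq> disc" using r[of n] by auto
    have "(\<integral>z. indicator (ball 0 (r n)) z *\<^sub>R G z \<partial>lebesgue_on disc) = (\<integral>z. G z \<partial>lebesgue_on (ball 0 (r n)))"
      using sub by (subst (1 2) integral_restrict_space) (auto intro!: Bochner_Integration.integral_cong simp: indicator_def subset_iff)
    then show ?thesis using area_mean_value_inner[OF G r] by simp
  qed
  have "(\<lambda>n. \<integral>z. indicator (ball 0 (r n)) z *\<^sub>R G z \<partial>lebesgue_on disc) \<longlonglongrightarrow> (\<integral>z. G z \<partial>lebesgue_on disc)"
  proof (rule integral_dominated_convergence[where w = "\<lambda>z. norm (G z)"])
    show "integrable (lebesgue_on disc) (\<lambda>z. norm (G z))" using i by simp
    show "G \<in> borel_measurable (lebesgue_on disc)" using i by simp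
    have "ball (0::complex) s \<inter> space (lebesgue_on disc) \<in> sets (lebesgue_on disc)" for s
      by (auto simp: sets_restrict_space)
    then have ind: "(\<lambda>z. indicator (ball 0 s) z :: real) \<in> borel_measurable (lebesgue_on disc)" for s
      by (simp only: borel_measurable_indicator_iff)
    then show "(\<lambda>z. indicator (ball 0 (r n)) z *\<^sub>R G z) \<in> borel_measurable (lebesgue_on disc)" for n
      using i by (intro borel_measurable_scaleR) auto
    show "AE z in lebesgue_on disc. (\<lambda>n. indicator (ball 0 (r n)) z *\<^sub>R G z) \<longlonglongrightarrow> G z"
    proof (rule AE_I2)
      fix z :: complex assume "z \<in> space (lebesgue_on disc)"
      then have "cmod z < 1" by simp
      then have "\<forall>\<^sub>F n in sequentially. cmod z < r n" using order_tendstoD(1)[OF rl] by blast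
      then have "\<forall>\<^sub>F n in sequentially. indicator (ball 0 (r n)) z *\<^sub>R G z = G z" by eventually_elim simp
      then show "(\<lambda>n. indicator (ball 0 (r n)) z *\<^sub>R G z) \<longlonglongrightarrow> G z" by (rule tendsto_eventually)
    qed
  qed (auto simp: indicator_def)
  moreover have "(\<lambda>n. of_real (pi * (r n)\<^sup>2) * G 0) \<longlonglongrightarrow> of_real (pi * 1\<^sup>2) * G 0"
    by (intro tendsto_intros rl)
  ultimately show ?thesis unfolding eq using LIMSEQ_unique by fastforce
qed

lemma area_mean_value_ball:
  assumes H: "H holomorphic_on disc" and r: "0 < r" "r < 1 - cmod a"
  shows "(\<integral>z. H z \<partial>lebesgue_on (ball a r)) = of_real (pi * r\<^sup>2) * H a"
proof -
  have im: "(\<lambda>z. a + z) ` ball 0 r = ball a r" by (simp add: ball_translation[of a 0 r, simplified])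
  interpret conformal "\<lambda>z. a + z" "ball 0 r" "ball a r"
    by unfold_locales (auto intro!: holomorphic_intros inj_onI simp: im)
  have d: "deriv (\<lambda>z. a + z) z = 1" for z
    by (rule DERIV_imp_deriv) (auto intro!: derivative_eq_intros)
  have sub: "a + z \<in> disc" if "z \<in> ball 0 (1 - cmod a)" for z
    using that norm_triangle_ineq[of a z] by auto
  have Hc: "continuous_on (ball a r) H"
  proof (rule continuous_on_subset[OF holomorphic_on_imp_continuous_on[OF H]])
    show "ball a r \<subseteq> disc"
    proof
      fix x assume "x \<in> ball a r"
      then have "cmod (x - a) < r" by (simp add: dist_norm norm_minus_commute)
      then show "x \<in> disc" using r norm_triangle_sub[of x a] by simp
    qed
  qed
  have "(\<integral>z. H z \<partial>lebesgue_on (ball a r)) = (\<integral>z. H (a + z) \<partial>lebesgue_on (ball 0 r))"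
    by (subst integral_conformal) (use Hc in \<open>auto simp: d intro!: continuous_imp_measurable_on_sets_lebesgue\<close>)
  also have "\<dots> = of_real (pi * r\<^sup>2) * H (a + 0)"
  proof (rule area_mean_value_inner[OF _ r])
    show "(\<lambda>z. H (a + z)) holomorphic_on ball 0 (1 - cmod a)"
    proof (rule holomorphic_on_compose_gen[OF _ H, unfolded o_def])
      show "(\<lambda>z. a + z) ` ball 0 (1 - cmod a) \<subseteq> disc" using sub by (rule image_subsetI)
    qed (intro holomorphic_intros)
  qed
  finally show ?thesis by simp
qed

lemma one_minus_cnj_mult_nz:
  assumes "cmod a < 1" "cmod z < 1" shows "1 - cnj a * z \<noteq> 0" "1 + cnj a * z \<noteq> 0"
proof -
  have "cmod (cnj a * z) < 1" using norm_mult_less[of "cnj a" 1 z 1] assms by simp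
  then have "cnj a * z \<noteq> 1" "cnj a * z \<noteq> -1" by auto
  then show "1 - cnj a * z \<noteq> 0" "1 + cnj a * z \<noteq> 0" by (auto simp: add_eq_0_iff)
qed

text \<open>Substitute the disc automorphism m with m(0) = a. The kernel at m(z) equals 1/(s m'(z)),
  so it cancels one factor of the Jacobian |m'|^2, and the claim becomes the mean value property at
  0 of (H o m) m'.\<close>

lemma bergman_reproducing:
  assumes H: "H holomorphic_on disc" "L2_on disc H" and a: "a \<in> disc"
  shows "(\<integral>w. H w * cnj (1 / (1 - cnj a * w)\<^sup>2) \<partial>lebesgue_on disc) = of_real pi * H a"
proof -
  have a1: "cmod a < 1" using a by simp
  define s where "s = 1 - (cmod a)\<^sup>2"
  have "(cmod a)\<^sup>2 < 1" using a1 by (simp add: power_less_one_iff abs_square_less_1)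
  then have s: "s > 0" by (simp add: s_def)
  have sc: "of_real s = 1 - cnj a * a" by (simp add: s_def complex_norm_square mult.commute del: of_real_power)
  define m where "m = Moebius_function 0 (- a)"
  have m: "m z = (z + a) / (1 + cnj a * z)" for z by (simp add: m_def Moebius_function_simple)
  have mD: "m z \<in> disc" if "z \<in> disc" for z using Moebius_function_norm_lt_1[of "-a" z 0] a1 that by (simp add: m_def)
  have mm: "Moebius_function 0 a (m z) = z" "m (Moebius_function 0 a z) = z" if "z \<in> disc" for z
    using Moebius_function_compose[of a "-a" z] Moebius_function_compose[of "-a" a z] a1 that by (auto simp: m_def)
  have mh: "m holomorphic_on disc" unfolding m_def using a1 by (intro Moebius_function_holomorphic) simp
  have mim: "m ` disc = disc"
  proof safe
    fix x :: complex assume x: "x \<in> disc"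
    have "Moebius_function 0 a x \<in> disc" using Moebius_function_norm_lt_1[of a x 0] a1 x by simp
    then show "x \<in> m ` disc" using mm(2)[OF x] by (metis image_eqI)
  qed (use mD in auto)
  have minj: "inj_on m disc" by (rule inj_on_inverseI[of _ "Moebius_function 0 a"]) (rule mm(1))
  interpret conformal m disc disc
    by unfold_locales (simp_all add: mh mim minj)
  have dm: "deriv m z = of_real s / (1 + cnj a * z)\<^sup>2" if z: "z \<in> disc" for z
  proof -
    have nz: "1 + cnj a * z \<noteq> 0" using one_minus_cnj_mult_nz[OF a1] z by auto
    have "((\<lambda>z. (z + a) / (1 + cnj a * z)) has_field_derivative (1 * (1 + cnj a * z) - (z + a) * cnj a) / ((1 + cnj a * z) * (1 + cnj a * z))) (at z)"
      using nz by (auto intro!: derivative_eq_intros)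
    then have "deriv m z = (1 * (1 + cnj a * z) - (z + a) * cnj a) / ((1 + cnj a * z) * (1 + cnj a * z))"
      unfolding m by (rule DERIV_imp_deriv)
    then show ?thesis by (simp add: sc power2_eq_square algebra_simps)
  qed
  have Hm: "H \<in> borel_measurable (lebesgue_on disc)" using H by (simp add: L2_on_iff)
  have km: "(\<lambda>w. cnj (1 / (1 - cnj a * w)\<^sup>2)) \<in> borel_measurable (lebesgue_on disc)"
    using one_minus_cnj_mult_nz(1)[OF a1]
    by (intro continuous_imp_measurable_on_sets_lebesgue continuous_intros) auto
  have "(\<integral>w. H w * cnj (1 / (1 - cnj a * w)\<^sup>2) \<partial>lebesgue_on disc)
     = (\<integral>z. (cmod (deriv m z))\<^sup>2 *\<^sub>R (H (m z) * cnj (1 / (1 - cnj a * m z)\<^sup>2)) \<partial>lebesgue_on disc)"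
    by (intro integral_conformal borel_measurable_times Hm km)
  also have "\<dots> = (\<integral>z. H (m z) * deriv m z / of_real s \<partial>lebesgue_on disc)"
  proof (rule Bochner_Integration.integral_cong[OF refl])
    fix z :: complex assume "z \<in> space (lebesgue_on disc)"
    then have z: "z \<in> disc" by simp
    have nz: "1 + cnj a * z \<noteq> 0" using one_minus_cnj_mult_nz[OF a1] z by auto
    have "1 - cnj a * m z = of_real s / (1 + cnj a * z)" using nz by (simp add: m sc field_simps)
    then have "1 / (1 - cnj a * m z)\<^sup>2 = 1 / (of_real s * deriv m z)"
      using s nz by (simp add: dm[OF z] power2_eq_square power_divide)
    then have "cnj (1 / (1 - cnj a * m z)\<^sup>2) = 1 / (of_real s * cnj (deriv m z))" by simp
    moreover have "of_real ((cmod (deriv m z))\<^sup>2) = deriv m z * cnj (deriv m z)" by (simp add: complex_norm_square del: of_real_power)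
    ultimately show "(cmod (deriv m z))\<^sup>2 *\<^sub>R (H (m z) * cnj (1 / (1 - cnj a * m z)\<^sup>2)) = H (m z) * deriv m z / of_real s"
      using deriv_nz[OF z] s by (simp add: scaleR_conv_of_real del: of_real_power)
  qed
  also have "\<dots> = (\<integral>z. H (m z) * deriv m z \<partial>lebesgue_on disc) / of_real s" by simp
  also have "(\<integral>z. H (m z) * deriv m z \<partial>lebesgue_on disc) = of_real pi * (H (m 0) * deriv m 0)"
  proof (rule area_mean_value_disc)
    show "(\<lambda>z. H (m z) * deriv m z) holomorphic_on disc"
      by (intro holomorphic_on_mult holomorphic_deriv holomorphic_on_compose_gen[OF mh H(1), unfolded o_def] mh) (use mD in auto)
    have "L2_on disc (\<lambda>z. H (m z) * deriv m z)"
      unfolding L2_on_iff[OF S_sets]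
    proof
      show "(\<lambda>z. H (m z) * deriv m z) \<in> borel_measurable (lebesgue_on disc)"
        using measurable_compose[OF f_measurable Hm] deriv_measurable by measurable
      have "integrable (lebesgue_on disc) (\<lambda>z. (cmod (deriv m z))\<^sup>2 *\<^sub>R (cmod (H (m z)))\<^sup>2)"
        using H Hm by (subst integrable_conformal[symmetric]) (auto simp: L2_on_iff)
      then show "integrable (lebesgue_on disc) (\<lambda>z. (cmod (H (m z) * deriv m z))\<^sup>2)"
        by (simp add: norm_mult power_mult_distrib mult.commute)
    qed
    then show "integrable (lebesgue_on disc) (\<lambda>z. H (m z) * deriv m z)" by (rule L2_ball_integrable)
  qed
  also have "deriv m 0 = of_real s" by (simp add: dm)
  also have "m 0 = a" by (simp add: m)
  finally show ?thesis using s by simp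
qed

text \<open>The difference of two candidates lies in A^2 and is orthogonal to itself, hence vanishes
  almost everywhere, and everywhere by continuity. This justifies the definite description in
  \<open>bergman_proj\<close>.\<close>

lemma bergman_orth_unique:
  assumes \<Omega>: "open \<Omega>" and g: "A2_on \<Omega> g1" "A2_on \<Omega> g2" and f: "L2_on \<Omega> f"
    and o: "\<And>h. A2_on \<Omega> h \<Longrightarrow> (LINT z:\<Omega>|lebesgue. (f z - g1 z) * cnj (h z)) = 0"
      "\<And>h. A2_on \<Omega> h \<Longrightarrow> (LINT z:\<Omega>|lebesgue. (f z - g2 z) * cnj (h z)) = 0"
    and z: "z \<in> \<Omega>"
  shows "g1 z = g2 z"
proof -
  have \<Omega>s: "\<Omega> \<in> sets lebesgue" using \<Omega> by auto
  let ?M = "lebesgue_on \<Omega>"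
  define h where "h z = g1 z - g2 z" for z
  have L: "L2_on \<Omega> g1" "L2_on \<Omega> g2" using g by (auto simp: A2_on_def)
  have h: "A2_on \<Omega> h" unfolding h_def A2_on_def using g L2_diff[OF L \<Omega>s] by (auto simp: A2_on_def intro!: holomorphic_intros)
  then have hL: "L2_on \<Omega> h" by (simp add: A2_on_def)
  have "(\<integral>z. h z * cnj (h z) \<partial>?M) = (\<integral>z. (f z - g2 z) * cnj (h z) - (f z - g1 z) * cnj (h z) \<partial>?M)"
    by (rule Bochner_Integration.integral_cong) (auto simp: h_def algebra_simps)
  also have "\<dots> = (\<integral>z. (f z - g2 z) * cnj (h z) \<partial>?M) - (\<integral>z. (f z - g1 z) * cnj (h z) \<partial>?M)"
    by (intro Bochner_Integration.integral_diff L2_mult_integrable L2_diff f L hL \<Omega>s)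
  also have "\<dots> = 0" using o[OF h] by (simp add: set_integral_lebesgue_on[OF \<Omega>s])
  finally have "(\<integral>z. of_real ((cmod (h z))\<^sup>2) \<partial>?M) = (0::complex)"
    by (simp only: complex_norm_square)
  then have i0: "(\<integral>z. (cmod (h z))\<^sup>2 \<partial>?M) = 0"
    by (simp only: integral_complex_of_real of_real_eq_0_iff)
  have hi: "integrable ?M (\<lambda>z. (cmod (h z))\<^sup>2)" using hL \<Omega>s by (simp add: L2_on_iff)
  have "AE z in ?M. (cmod (h z))\<^sup>2 = 0"
    using integral_nonneg_eq_0_iff_AE[OF hi] i0 by simp
  then have ae: "AE z in lebesgue. z \<in> \<Omega> \<longrightarrow> h z = 0"
    using \<Omega>s by (subst (asm) AE_restrict_space_iff) auto
  define C where "C = - (\<Omega> \<inter> h -` (- {0}))"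
  have "continuous_on \<Omega> h" using h by (auto simp: A2_on_def intro: holomorphic_on_imp_continuous_on)
  then have "open (\<Omega> \<inter> h -` (- {0}))" using \<Omega> by (intro continuous_open_preimage) auto
  then have cC: "closed C" by (simp add: C_def closed_def)
  have "z \<in> C"
    using ae by (intro mem_closed_if_AE_lebesgue_open[OF \<Omega> cC _ z]) (auto simp: C_def)
  then show ?thesis using z by (simp add: C_def h_def)
qed

section \<open>Conformal invariance of the Bergman projection\<close>

context conformal
begin

lemma pullback_L2:
  assumes "h \<in> borel_measurable (lebesgue_on T)"
  shows "L2_on T h \<longleftrightarrow> L2_on S (\<lambda>z. h (f z) * deriv f z)"
proof -
  have "(\<lambda>z. h (f z) * deriv f z) \<in> borel_measurable (lebesgue_on S)"
    using measurable_compose[OF f_measurable assms] deriv_measurable by measurable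
  moreover have "integrable (lebesgue_on T) (\<lambda>w. (cmod (h w))\<^sup>2) \<longleftrightarrow> integrable (lebesgue_on S) (\<lambda>z. (cmod (h (f z) * deriv f z))\<^sup>2)"
    using assms by (subst integrable_conformal) (auto simp: norm_mult power_mult_distrib mult.commute)
  ultimately show ?thesis using assms by (simp add: L2_on_iff)
qed

text \<open>The map that sends h to (h o f) f' is unitary between the L^2 spaces and preserves
  holomorphy, so it intertwines the projections. Existence of the projection is not presupposed:
  each application supplies a candidate \<open>G\<close> on \<open>S\<close> with the orthogonality
  relation.\<close>

lemma bergman_proj_transfer:
  assumes F: "L2_on T F" and G: "A2_on S G"
    and orth: "\<And>H. A2_on S H \<Longrightarrow> (\<integral>z. (F (f z) * deriv f z - G z) * cnj (H z) \<partial>lebesgue_on S) = 0"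
    and z: "z \<in> S"
  shows "bergman_proj T F (f z) * deriv f z = G z"
proof -
  obtain k where k: "k holomorphic_on T" "\<And>z. z \<in> S \<Longrightarrow> k (f z) = z" "\<And>w. w \<in> T \<Longrightarrow> f (k w) = w"
    "\<And>w. w \<in> T \<Longrightarrow> k w \<in> S" by (rule inverse_holomorphic) (rule that)
  \<comment> \<open>The pullback is inverted through \<open>k\<close>; off \<open>T\<close> the
    value 0 is the one that \<open>bergman_proj\<close> prescribes.\<close>
  define g where "g w = (if w \<in> T then G (k w) / deriv f (k w) else 0)" for w
  have gf: "g (f z) * deriv f z = G z" if "z \<in> S" for z
    using that k(2) deriv_nz fST by (auto simp: g_def)
  have kT: "k ` T \<subseteq> S" using k(4) by blast
  have "G holomorphic_on S" using G by (simp add: A2_on_def)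
  then have "(\<lambda>w. G (k w)) holomorphic_on T" "(\<lambda>w. deriv f (k w)) holomorphic_on T"
    using holomorphic_on_compose_gen[OF k(1) _ kT] holomorphic_deriv[OF holf openS] by (auto simp: o_def)
  then have "(\<lambda>w. G (k w) / deriv f (k w)) holomorphic_on T"
    using deriv_nz k(4) by (intro holomorphic_on_divide) auto
  then have gh: "g holomorphic_on T"
    by (rule holomorphic_transform) (simp add: g_def)
  have gm: "g \<in> borel_measurable (lebesgue_on T)"
    using gh holomorphic_on_imp_continuous_on by (intro continuous_imp_measurable_on_sets_lebesgue) auto
  have Fm: "F \<in> borel_measurable (lebesgue_on T)" using F by (simp add: L2_on_iff)
  have "L2_on S (\<lambda>z. g (f z) * deriv f z) \<longleftrightarrow> L2_on S G"
    unfolding L2_on_iff[OF S_sets]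
    by (intro arg_cong2[where f = "(\<and>)"] measurable_cong Bochner_Integration.integrable_cong refl) (auto simp: gf)
  then have g: "A2_on T g" using G gh pullback_L2[OF gm] by (auto simp: A2_on_def)
  have g_orth: "(LINT w:T|lebesgue. (F w - g w) * cnj (h w)) = 0" if h: "A2_on T h" for h
  proof -
    have hm: "h \<in> borel_measurable (lebesgue_on T)" using h by (simp add: L2_on_iff A2_on_def)
    then have chm: "(\<lambda>w. cnj (h w)) \<in> borel_measurable (lebesgue_on T)"
      by (rule measurable_compose) (intro borel_measurable_continuous_onI continuous_intros)
    have "A2_on S (\<lambda>z. h (f z) * deriv f z)"
      using h pullback_L2[OF hm] fST
      by (auto simp: A2_on_def intro!: holomorphic_on_mult holomorphic_deriv holf openS holomorphic_on_compose_gen[OF holf, unfolded o_def])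
    then have "(\<integral>z. (F (f z) * deriv f z - G z) * cnj (h (f z) * deriv f z) \<partial>lebesgue_on S) = 0" by (rule orth)
    moreover have "(LINT w:T|lebesgue. (F w - g w) * cnj (h w)) = (\<integral>z. (cmod (deriv f z))\<^sup>2 *\<^sub>R ((F (f z) - g (f z)) * cnj (h (f z))) \<partial>lebesgue_on S)"
      unfolding set_integral_lebesgue_on[OF T_sets] using Fm gm chm by (intro integral_conformal) auto
    moreover have "\<dots> = (\<integral>z. (F (f z) * deriv f z - G z) * cnj (h (f z) * deriv f z) \<partial>lebesgue_on S)"
    proof (rule Bochner_Integration.integral_cong[OF refl])
      fix z assume "z \<in> space (lebesgue_on S)"
      then have z: "z \<in> S" by simp
      have "of_real ((cmod (deriv f z))\<^sup>2) = deriv f z * cnj (deriv f z)" by (simp add: complex_norm_square del: of_real_power)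
      then show "(cmod (deriv f z))\<^sup>2 *\<^sub>R ((F (f z) - g (f z)) * cnj (h (f z))) = (F (f z) * deriv f z - G z) * cnj (h (f z) * deriv f z)"
        unfolding gf[OF z, symmetric] scaleR_conv_of_real by (simp add: algebra_simps)
    qed
    ultimately show ?thesis by simp
  qed
  have "bergman_proj T F = g"
    unfolding bergman_proj_def
  proof (rule the_equality)
    show "A2_on T g \<and> (\<forall>z. z \<notin> T \<longrightarrow> g z = 0) \<and> (\<forall>h. A2_on T h \<longrightarrow> (LINT z:T|lebesgue. (F z - g z) * cnj (h z)) = 0)"
      using g g_orth by (auto simp: g_def)
    fix g' assume g': "A2_on T g' \<and> (\<forall>z. z \<notin> T \<longrightarrow> g' z = 0) \<and> (\<forall>h. A2_on T h \<longrightarrow> (LINT z:T|lebesgue. (F z - g' z) * cnj (h z)) = 0)"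
    show "g' = g"
    proof
      fix w show "g' w = g w"
        using bergman_orth_unique[OF openT _ g F, of g' w] g' g_orth by (cases "w \<in> T") (auto simp: g_def)
    qed
  qed
  then show ?thesis using gf[OF z] by simp
qed

end

subsection \<open>Distortion of univalent functions\<close>

text \<open>Otherwise the inverse function, which has values in the unit disc, would be holomorphic
  on a disc of radius larger than |f'(0)|, against Cauchy's estimate for its derivative
  1/f'(0).\<close>

lemma univalent_omitted_value:
  assumes f: "f holomorphic_on ball 0 1" "inj_on f (ball 0 1)" and R: "R > cmod (deriv f 0)"
  shows "\<exists>w. cmod (w - f 0) < R \<and> w \<notin> f ` ball 0 1"
proof (rule ccontr)
  assume "\<not> ?thesis"
  then have sub: "ball (f 0) R \<subseteq> f ` ball 0 1" by (auto simp: dist_norm norm_minus_commute)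
  obtain g where g: "g holomorphic_on f ` ball 0 1" "\<And>z. z \<in> ball 0 1 \<Longrightarrow> deriv f z * deriv g (f z) = 1"
    "\<And>z. z \<in> ball 0 1 \<Longrightarrow> g (f z) = z"
    by (rule holomorphic_has_inverse[OF f(1) open_ball f(2)]) (rule that)
  obtain r where r: "cmod (deriv f 0) < r" "r < R" using R dense by blast
  have r0: "0 < r" using r norm_ge_zero order_le_less_trans by blast
  have cb: "cball (f 0) r \<subseteq> f ` ball 0 1" using sub r by auto
  have gb: "cmod (g x) \<le> 1" if "x \<in> cball (f 0) r" for x
    using cb that g(3) by (smt (verit) image_iff mem_ball_0 subset_iff)
  have "cmod ((deriv ^^ 1) g (f 0)) \<le> fact 1 * 1 / r ^ 1"
  proof (rule Cauchy_inequality)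
    show "g holomorphic_on ball (f 0) r" using g(1) cb by (meson ball_subset_cball holomorphic_on_subset subset_trans)
    show "continuous_on (cball (f 0) r) g" using g(1) cb by (meson holomorphic_on_imp_continuous_on holomorphic_on_subset)
    show "\<And>x. cmod (f 0 - x) = r \<Longrightarrow> cmod (g x) \<le> 1" by (intro gb) (simp add: dist_norm)
  qed (use r0 in auto)
  then have le: "cmod (deriv g (f 0)) \<le> 1 / r" by simp
  have "1 = cmod (deriv f 0) * cmod (deriv g (f 0))" using g(2)[of 0] by (metis centre_in_ball norm_mult norm_one zero_less_one)
  also have "\<dots> \<le> cmod (deriv f 0) * (1 / r)" by (intro mult_left_mono le) auto
  also have "\<dots> < 1" using r r0 by simp
  finally show False by simp
qed

text \<open>The constant of Schottky's theorem for functions omitting 0 and 1 on \<open>|z| \<le> 2/3\<close>. It applies to the square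
  root \<open>h\<close> of \<open>(f - w) / (f(0) - w)\<close> with \<open>h(0) = -1\<close> and \<open>w\<close> an omitted value near \<open>f(0)\<close>: injectivity
  of \<open>f\<close> forbids \<open>h = 1\<close>.\<close>

definition schottky_bound :: real where "schottky_bound = exp (pi * exp (pi * (2 + 2 * 1 + 12 * (2/3) / (1 - 2/3))))"

lemma univalent_growth:
  assumes f: "f holomorphic_on ball 0 1" "inj_on f (ball 0 1)" and z: "cmod z \<le> 1/2"
  shows "cmod (f z - f 0) \<le> 2 * (1 + schottky_bound\<^sup>2) * cmod (deriv f 0)"
proof -
  have d0: "deriv f 0 \<noteq> 0"
    using holomorphic_has_inverse[OF f(1) open_ball f(2)] by (metis centre_in_ball mult_zero_left zero_less_one zero_neq_one)
  obtain w where w: "cmod (w - f 0) < 2 * cmod (deriv f 0)" "w \<notin> f ` ball 0 1"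
    using univalent_omitted_value[OF f, of "2 * cmod (deriv f 0)"] d0 by auto
  have ne: "f u \<noteq> w" if "u \<in> ball 0 1" for u using w(2) that by auto
  have f0w: "f 0 - w \<noteq> 0" using ne[of 0] by auto
  define k where "k u = (f u - w) / (f 0 - w)" for u
  have k: "k holomorphic_on ball 0 1" "\<And>u. u \<in> ball 0 1 \<Longrightarrow> k u \<noteq> 0"
    unfolding k_def using f0w ne f(1) by (auto intro!: holomorphic_intros)
  obtain h0 where h0: "h0 holomorphic_on ball 0 1" "\<And>u. u \<in> ball 0 1 \<Longrightarrow> k u = (h0 u)\<^sup>2"
    using contractible_imp_holomorphic_sqrt[OF k(1) convex_imp_contractible[OF convex_ball] k(2)] by metis
  have "(h0 0)\<^sup>2 = 1" using h0(2)[of 0] f0w by (simp add: k_def)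
  then have h00: "h0 0 = 1 \<or> h0 0 = -1" by (simp add: power2_eq_1_iff)
  define h where "h u = - h0 0 * h0 u" for u
  have h: "h holomorphic_on ball 0 1" "\<And>u. u \<in> ball 0 1 \<Longrightarrow> k u = (h u)\<^sup>2" "h 0 = -1"
    using h0 h00 unfolding h_def by (auto simp: power_mult_distrib intro!: holomorphic_intros)
  have h1: "h u \<noteq> 1" if u: "u \<in> ball 0 1" for u
  proof
    assume a: "h u = 1"
    then have "k u = 1" using h(2)[OF u] by simp
    then have "f u = f 0" using f0w by (simp add: k_def)
    then have "u = 0" using f(2) u by (auto simp: inj_on_def)
    then show False using a h(3) by simp
  qed
  have h0': "h u \<noteq> 0" if u: "u \<in> ball 0 1" for u
    using h(2)[OF u] k(2)[OF u] by auto
  \<comment> \<open>Schottky's theorem asks for holomorphy on the closed disc, which the factor 3/4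
    provides; 2/3 times 3/4 is the radius 1/2 of the claim.\<close>
  define H where "H u = h (of_real (3/4) * u)" for u
  have in34: "of_real (3/4) * u \<in> ball (0::complex) 1" if "u \<in> cball 0 1" for u :: complex
    using that by (simp add: norm_mult)
  have HH: "H holomorphic_on cball 0 1"
    unfolding H_def
    by (rule holomorphic_on_compose_gen[OF _ h(1), unfolded o_def]) (use in34 in \<open>auto intro!: holomorphic_intros\<close>)
  have "cmod (H (of_real (4/3) * z)) \<le> exp (pi * exp (pi * (2 + 2 * 1 + 12 * (2/3) / (1 - 2/3))))"
  proof (rule Schottky[OF HH])
    show "\<And>z. z \<in> cball 0 1 \<Longrightarrow> \<not> (H z = 0 \<or> H z = 1)"
      using in34 h1 h0' by (auto simp: H_def)
    show "cmod (H 0) \<le> 1" using h(3) by (simp add: H_def)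
    show "cmod (of_real (4/3) * z) \<le> 2/3" using z by (simp add: norm_mult)
  qed auto
  then have hz: "cmod (h z) \<le> schottky_bound" by (simp add: H_def schottky_bound_def)
  have zb: "z \<in> ball 0 1" using z by simp
  have "f z - f 0 = (f 0 - w) * (k z - 1)" using f0w by (simp add: k_def field_simps)
  also have "\<dots> = (f 0 - w) * ((h z)\<^sup>2 - 1)" using h(2)[OF zb] by simp
  finally have "cmod (f z - f 0) = cmod (w - f 0) * cmod ((h z)\<^sup>2 - 1)" by (simp add: norm_mult norm_minus_commute)
  also have "\<dots> \<le> (2 * cmod (deriv f 0)) * (1 + schottky_bound\<^sup>2)"
  proof (intro mult_mono)
    have "cmod ((h z)\<^sup>2 - 1) \<le> (cmod (h z))\<^sup>2 + 1" using norm_triangle_ineq4[of "(h z)\<^sup>2" 1] by (simp add: norm_power)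
    also have "\<dots> \<le> schottky_bound\<^sup>2 + 1" using hz by (simp add: power_mono)
    finally show "cmod ((h z)\<^sup>2 - 1) \<le> 1 + schottky_bound\<^sup>2" by simp
  qed (use w in auto)
  finally show ?thesis by (simp add: algebra_simps)
qed

lemma univalent_growth_ball:
  assumes R: "R > 0" and f: "f holomorphic_on ball a R" "inj_on f (ball a R)" and z: "cmod (z - a) \<le> R / 2"
  shows "cmod (f z - f a) \<le> 2 * (1 + schottky_bound\<^sup>2) * R * cmod (deriv f a)"
proof -
  define F where "F u = f (a + of_real R * u)" for u
  have im: "a + of_real R * u \<in> ball a R" if "u \<in> ball 0 1" for u
    using that R by (simp add: dist_norm norm_mult)
  have F: "F holomorphic_on ball 0 1" unfolding F_def
    by (rule holomorphic_on_compose_gen[OF _ f(1), unfolded o_def]) (use im in \<open>auto intro!: holomorphic_intros\<close>)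
  have inj: "inj_on F (ball 0 1)"
  proof (rule inj_onI)
    fix x y assume "x \<in> ball 0 1" "y \<in> ball 0 1" "F x = F y"
    then have "a + of_real R * x = a + of_real R * y"
      using inj_onD[OF f(2), of "a + of_real R * x" "a + of_real R * y"] im by (simp add: F_def)
    then show "x = y" using R by simp
  qed
  have "((\<lambda>u. f (a + of_real R * u)) has_field_derivative deriv f a * of_real R) (at 0)"
    using R by (intro DERIV_chain2[where f = f and g = "\<lambda>u. a + of_real R * u"])
       (auto intro!: derivative_eq_intros holomorphic_derivI[OF f(1)])
  then have d: "deriv F 0 = deriv f a * of_real R" unfolding F_def by (rule DERIV_imp_deriv)
  have "cmod (F ((z - a) / of_real R) - F 0) \<le> 2 * (1 + schottky_bound\<^sup>2) * cmod (deriv F 0)"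
    using z R by (intro univalent_growth F inj) (simp add: norm_divide field_simps)
  then show ?thesis using R by (simp add: F_def d norm_mult mult_ac)
qed

text \<open>The factor 8 is the 2 of the growth estimate divided by 1/4, since Cauchy's estimate is
  applied on circles of radius R/4.\<close>

definition growth_const :: real where "growth_const = 8 * (1 + schottky_bound\<^sup>2)"

lemma growth_const_ge1: "growth_const \<ge> 1"
  by (simp add: growth_const_def)

lemma univalent_distortion_ball:
  assumes R: "R > 0" and f: "f holomorphic_on ball a R" "inj_on f (ball a R)" and z: "cmod (z - a) \<le> R / 4"
  shows "cmod (deriv f z) \<le> growth_const * cmod (deriv f a)"
proof -
  have sub: "cmod (x - a) \<le> R / 2" if "cmod (z - x) \<le> R/4" for x
    using z that norm_triangle_ineq4[of "z - a" "z - x"] by simp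
  have sub2: "cball z (R/4) \<subseteq> ball a R"
  proof
    fix x assume "x \<in> cball z (R/4)"
    then have "cmod (x - a) \<le> R / 2" using sub by (simp add: dist_norm)
    then show "x \<in> ball a R" using R by (simp add: dist_norm norm_minus_commute)
  qed
  have "cmod ((deriv ^^ 1) (\<lambda>x. f x - f a) z) \<le> fact 1 * (2 * (1 + schottky_bound\<^sup>2) * R * cmod (deriv f a)) / (R/4) ^ 1"
  proof (rule Cauchy_inequality)
    have h: "(\<lambda>x. f x - f a) holomorphic_on cball z (R/4)"
      using holomorphic_on_subset[OF f(1) sub2] by (intro holomorphic_intros)
    then show "(\<lambda>x. f x - f a) holomorphic_on ball z (R/4)" "continuous_on (cball z (R/4)) (\<lambda>x. f x - f a)"
      using holomorphic_on_subset[OF h ball_subset_cball] holomorphic_on_imp_continuous_on[OF h] by auto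
    show "cmod (f x - f a) \<le> 2 * (1 + schottky_bound\<^sup>2) * R * cmod (deriv f a)" if "cmod (z - x) = R/4" for x
      using that sub by (intro univalent_growth_ball[OF R f]) auto
  qed (use R in auto)
  moreover have "deriv (\<lambda>x. f x - f a) z = deriv f z"
  proof -
    have "z \<in> ball a R" using subsetD[OF sub2, of z] R by simp
    then have "f field_differentiable at z" using f(1) holomorphic_on_imp_differentiable_at by blast
    then show ?thesis by simp
  qed
  ultimately have "R * cmod (deriv f z) \<le> R * (growth_const * cmod (deriv f a))"
    using R by (simp add: growth_const_def field_simps)
  then show ?thesis using R by simp
qed

lemma univalent_distortion_step:
  assumes f: "f holomorphic_on ball 0 1" "inj_on f (ball 0 1)"
    and e: "\<eta> > 0" "\<eta> \<le> 1 - cmod a" and z: "cmod (z - a) \<le> \<eta> / 4"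
  shows "cmod (deriv f z) \<le> growth_const * cmod (deriv f a)"
proof (rule univalent_distortion_ball[OF e(1) _ _ z])
  have "ball a \<eta> \<subseteq> ball 0 1"
    using e by (auto simp: subset_iff dist_norm intro: order_le_less_trans[OF norm_triangle_sub[of _ a]] simp: norm_minus_commute)
  then show "f holomorphic_on ball a \<eta>" "inj_on f (ball a \<eta>)"
    using f holomorphic_on_subset inj_on_subset by blast+
qed

text \<open>A chain of steps of length at most \<eta>/4 along the segment from \<open>a\<close> to
  \<open>b\<close>. Its points keep distance \<eta> from the circle because the norm is
  convex.\<close>

lemma univalent_distortion_chain:
  assumes f: "f holomorphic_on ball 0 1" "inj_on f (ball 0 1)"
    and e: "\<eta> > 0" "\<eta> \<le> 1 - cmod a" "\<eta> \<le> 1 - cmod b" and ab: "cmod (b - a) \<le> real n * (\<eta> / 4)"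
  shows "cmod (deriv f b) \<le> growth_const ^ n * cmod (deriv f a)"
  using e(3) ab
proof (induction n arbitrary: b)
  case 0
  then show ?case by simp
next
  case (Suc n)
  define c where "c = a + of_real (real n / real (Suc n)) * (b - a)"
  have tt: "real n / real (Suc n) = 1 - 1 / real (Suc n)" by (simp add: field_simps)
  have ca: "cmod (c - a) \<le> real n * (\<eta>/4)"
  proof -
    have "cmod (c - a) = real n / real (Suc n) * cmod (b - a)" by (simp add: c_def norm_mult norm_divide del: of_nat_Suc)
    also have "\<dots> \<le> real n / real (Suc n) * (real (Suc n) * (\<eta>/4))" by (intro mult_left_mono Suc) auto
    also have "\<dots> = real n * (\<eta>/4)" by (simp del: of_nat_Suc)
    finally show ?thesis .
  qed
  have bc: "cmod (b - c) \<le> \<eta>/4"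
  proof -
    have "b - c = of_real (1 / real (Suc n)) * (b - a)"
      unfolding c_def tt by (simp add: algebra_simps)
    then have "cmod (b - c) = 1 / real (Suc n) * cmod (b - a)" by (simp add: norm_mult norm_divide del: of_nat_Suc)
    also have "\<dots> \<le> 1 / real (Suc n) * (real (Suc n) * (\<eta>/4))" by (intro mult_left_mono Suc) auto
    finally show ?thesis by (simp del: of_nat_Suc)
  qed
  have cc: "\<eta> \<le> 1 - cmod c"
  proof -
    have "c = of_real (1 / real (Suc n)) * a + of_real (real n / real (Suc n)) * b"
      unfolding c_def tt by (simp add: algebra_simps diff_divide_distrib)
    then have "cmod c \<le> 1 / real (Suc n) * cmod a + real n / real (Suc n) * cmod b"
      by (metis (no_types, opaque_lifting) norm_triangle_ineq norm_mult norm_of_real abs_of_nonneg divide_nonneg_nonneg of_nat_0_le_iff zero_le_one)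
    also have "\<dots> \<le> 1 / real (Suc n) * (1 - \<eta>) + real n / real (Suc n) * (1 - \<eta>)"
      by (intro add_mono mult_left_mono) (use e Suc in auto)
    also have "\<dots> = 1 - \<eta>" unfolding tt by (simp add: algebra_simps)
    finally show ?thesis by simp
  qed
  have "cmod (deriv f b) \<le> growth_const * cmod (deriv f c)"
    by (rule univalent_distortion_step[OF f e(1) cc bc])
  also have "\<dots> \<le> growth_const * (growth_const ^ n * cmod (deriv f a))"
    using Suc.IH[OF cc ca] growth_const_ge1 by (intro mult_left_mono) auto
  finally show ?case by (simp add: mult_ac)
qed

text \<open>The constant depends on \<open>K\<close> alone, not on the map or the points. The
  hypotheses are symmetric in \<open>a\<close> and \<open>b\<close>, so two applications make the
  derivatives comparable.\<close>

lemma univalent_distortion: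
  obtains C :: "real \<Rightarrow> real" where "\<And>K. C K \<ge> 1"
    "\<And>K f \<eta> a b. f holomorphic_on ball 0 1 \<Longrightarrow> inj_on f (ball 0 1) \<Longrightarrow> \<eta> > 0 \<Longrightarrow> \<eta> \<le> 1 - cmod a \<Longrightarrow> \<eta> \<le> 1 - cmod b
      \<Longrightarrow> cmod (b - a) \<le> K * \<eta> \<Longrightarrow> cmod (deriv f b) \<le> C K * cmod (deriv f a)"
proof (rule that)
  let ?C = "\<lambda>K::real. growth_const ^ nat \<lceil>4 * K\<rceil>"
  show "?C K \<ge> 1" for K using growth_const_ge1 by simp
  show "cmod (deriv f b) \<le> ?C K * cmod (deriv f a)"
    if f: "f holomorphic_on ball 0 1" "inj_on f (ball 0 1)" and e: "\<eta> > 0" "\<eta> \<le> 1 - cmod a" "\<eta> \<le> 1 - cmod b"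
      and ab: "cmod (b - a) \<le> K * \<eta>" for K f \<eta> a b
  proof (rule univalent_distortion_chain[OF f e])
    have "K * \<eta> \<le> real (nat \<lceil>4 * K\<rceil>) / 4 * \<eta>"
      using e(1) by (intro mult_right_mono) linarith+
    then show "cmod (b - a) \<le> real (nat \<lceil>4 * K\<rceil>) * (\<eta> / 4)" using ab by simp
  qed
qed

text \<open>The mean value inequality on the intersection of a disc about \<open>a\<close> with a
  disc about 0: it is convex, and the derivative bound is asked for only where distortion from
  \<open>a\<close> can supply it.\<close>

lemma mean_value_deriv_bound:
  assumes f: "f holomorphic_on ball 0 1" and e: "\<eta> > 0" "\<eta> \<le> 1 - cmod a" "\<eta> \<le> 1 - cmod b"
    and B: "\<And>c. \<eta> \<le> 1 - cmod c \<Longrightarrow> cmod (c - a) \<le> cmod (b - a) \<Longrightarrow> cmod (deriv f c) \<le> B"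
  shows "cmod (f b - f a) \<le> B * cmod (b - a)"
proof (rule field_differentiable_bound)
  let ?S = "cball 0 (1 - \<eta>) \<inter> cball a (cmod (b - a))"
  show "convex ?S" by (intro convex_Int convex_cball)
  show "(f has_field_derivative deriv f z) (at z within ?S)" if "z \<in> ?S" for z
  proof -
    have "z \<in> ball 0 1" using that e by auto
    then show ?thesis using holomorphic_derivI[OF f open_ball] by blast
  qed
  show "cmod (deriv f z) \<le> B" if "z \<in> ?S" for z
    using that by (intro B) (auto simp: dist_norm norm_minus_commute)
  show "b \<in> ?S" "a \<in> ?S" using e by (auto simp: dist_norm norm_minus_commute)
qed

subsection \<open>Bounded turning\<close>

text \<open>The small open arc of the definition is replaced by a connected set that contains both
  end points, so that such sets with a common point have a connected union. The points
  \<open>z1\<close> and \<open>z2\<close> cut the Jordan curve into two arcs; the one that meets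
  \<open>A\<close> lies in \<open>A\<close> up to its end points.\<close>

lemma uniform_domain_bounded_turning:
  assumes "uniform_domain \<Omega>"
  obtains C where "C > 0" "\<And>z1 z2. z1 \<in> frontier \<Omega> \<Longrightarrow> z2 \<in> frontier \<Omega> \<Longrightarrow>
     \<exists>E. connected E \<and> z1 \<in> E \<and> z2 \<in> E \<and> E \<subseteq> frontier \<Omega> \<and> E \<subseteq> cball z1 (C * cmod (z1 - z2))"
proof -
  obtain \<gamma> where g: "simple_path \<gamma>" "pathfinish \<gamma> = pathstart \<gamma>" "frontier \<Omega> = path_image \<gamma>"
    using assms unfolding uniform_domain_def jordan_domain_def by blast
  obtain C where C: "C > 0"
    and A: "\<And>z1 z2. z1 \<in> frontier \<Omega> \<Longrightarrow> z2 \<in> frontier \<Omega> \<Longrightarrow> z1 \<noteq> z2 \<Longrightarrow>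
      \<exists>A\<in>components (frontier \<Omega> - {z1, z2}). \<forall>z\<in>A. cmod (z1 - z) + cmod (z2 - z) \<le> C * cmod (z1 - z2)"
    using assms unfolding uniform_domain_def by blast
  have "\<exists>E. connected E \<and> z1 \<in> E \<and> z2 \<in> E \<and> E \<subseteq> frontier \<Omega> \<and> E \<subseteq> cball z1 ((C + 1) * cmod (z1 - z2))"
    if z: "z1 \<in> frontier \<Omega>" "z2 \<in> frontier \<Omega>" for z1 z2
  proof (cases "z1 = z2")
    case True
    then show ?thesis using z by (intro exI[of _ "{z1}"]) auto
  next
    case False
    obtain A where A1: "A \<in> components (frontier \<Omega> - {z1, z2})"
      and A2: "\<And>z. z \<in> A \<Longrightarrow> cmod (z1 - z) + cmod (z2 - z) \<le> C * cmod (z1 - z2)"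
      using A[OF z False] by blast
    obtain u d where ud: "arc u" "arc d" "pathstart u = z1" "pathfinish u = z2" "pathstart d = z2" "pathfinish d = z1"
      "path_image u \<inter> path_image d = {z1, z2}" "path_image u \<union> path_image d = path_image \<gamma>"
      using exists_double_arc[OF g(1,2)] z False g(3) by metis
    obtain x where x: "x \<in> A" using A1 in_components_nonempty by blast
    have key: ?thesis if c: "arc c" "{pathstart c, pathfinish c} = {z1, z2}" "x \<in> path_image c" "path_image c \<subseteq> frontier \<Omega>" for c
    proof -
      have con: "connected (path_image c - {z1, z2})"
        using connected_simple_path_endless[OF arc_imp_simple_path[OF c(1)]] c(2) by simp
      have "x \<notin> {z1, z2}" using x A1 in_components_subset by blast
      then have sub: "path_image c - {z1, z2} \<subseteq> A"
        using components_maximal[OF A1 con] c(3,4) x by blast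
      \<comment> \<open>The definition bounds interior points of the arc only; the added 1 in the
        constant covers the end point \<open>z2\<close>.\<close>
      have "path_image c \<subseteq> cball z1 ((C + 1) * cmod (z1 - z2))"
      proof
        fix w assume w: "w \<in> path_image c"
        consider "w = z1" | "w = z2" | "w \<in> A" using sub w by blast
        then have "cmod (z1 - w) \<le> (C + 1) * cmod (z1 - z2)"
        proof cases
          case 3
          have "cmod (z1 - w) \<le> C * cmod (z1 - z2)"
            using A2[OF 3] norm_ge_zero[of "z2 - w"] by linarith
          then show ?thesis using norm_ge_zero[of "z1 - z2"] unfolding distrib_right by linarith
        qed (use C in \<open>auto simp: distrib_right\<close>)
        then show "w \<in> cball z1 ((C + 1) * cmod (z1 - z2))" by (simp add: dist_norm)
      qed
      moreover have "z1 \<in> path_image c" "z2 \<in> path_image c"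
        using c(2) pathstart_in_path_image[of c] pathfinish_in_path_image[of c] by (metis doubleton_eq_iff)+
      ultimately show ?thesis
        using c(1,4) arc_imp_path connected_path_image by blast
    qed
    have "x \<in> path_image u \<or> x \<in> path_image d"
      using x A1 in_components_subset ud(8) g(3) by blast
    then show ?thesis
      using key[OF ud(1)] key[OF ud(2)] ud g(3) by (metis Un_upper1 Un_upper2 insert_commute)
  qed
  with C show thesis by (intro that[of "C + 1"]) auto
qed

text \<open>The union of the turning arcs of the boundary points in the small disc is connected, so Janiszewski's
  theorem joins \<open>p\<close> and \<open>q\<close> off the union of that disc and the boundary.\<close>

lemma bounded_turning_separation:
  fixes \<Omega> :: "complex set"
  assumes \<Omega>: "open \<Omega>" "connected \<Omega>" "bounded \<Omega>" and C: "C > 0"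
    and turn: "\<And>z1 z2. z1 \<in> frontier \<Omega> \<Longrightarrow> z2 \<in> frontier \<Omega> \<Longrightarrow>
     \<exists>E. connected E \<and> z1 \<in> E \<and> z2 \<in> E \<and> E \<subseteq> frontier \<Omega> \<and> E \<subseteq> cball z1 (C * cmod (z1 - z2))"
    and \<delta>: "\<delta> > 0"
    and p: "p \<in> \<Omega>" "p \<notin> cball a ((1 + 2 * C) * \<delta>)" and q: "q \<in> \<Omega>" "q \<notin> cball a ((1 + 2 * C) * \<delta>)"
  shows "\<exists>T. connected T \<and> p \<in> T \<and> q \<in> T \<and> T \<subseteq> \<Omega> - cball a \<delta>"
proof -
  let ?J = "frontier \<Omega>" and ?R = "(1 + 2 * C) * \<delta>"
  have J: "closed ?J" "compact ?J" using \<Omega>(3) by (auto simp: compact_frontier_bounded)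
  have dR: "\<delta> \<le> ?R" using C \<delta> by (simp add: distrib_right)
  obtain F where F: "connected F" "compact F" "?J \<inter> cball a \<delta> \<subseteq> F" "F \<subseteq> ?J \<inter> cball a ?R"
  proof (cases "?J \<inter> cball a \<delta> = {}")
    case True
    then show thesis by (intro that[of "{}"]) auto
  next
    case False
    then obtain z1 where z1: "z1 \<in> ?J" "z1 \<in> cball a \<delta>" by auto
    have "\<exists>E. connected E \<and> z1 \<in> E \<and> z2 \<in> E \<and> E \<subseteq> ?J \<inter> cball a ?R" if z2: "z2 \<in> ?J \<inter> cball a \<delta>" for z2
    proof -
      obtain E where E: "connected E" "z1 \<in> E" "z2 \<in> E" "E \<subseteq> ?J" "E \<subseteq> cball z1 (C * cmod (z1 - z2))"
        using turn[OF z1(1), of z2] z2 by auto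
      \<comment> \<open>Two points of the small disc are at most 2\<delta> apart, so their turning
        set stays within 2C\<delta> of \<open>z1\<close>; hence the radius (1 + 2C)\<delta>.\<close>
      have "dist z1 z2 \<le> 2 * \<delta>" using z1 z2 dist_triangle2[of z1 z2 a] by (auto simp: dist_commute)
      then have "C * cmod (z1 - z2) \<le> 2 * C * \<delta>" using C by (simp add: dist_norm)
      then have "cball z1 (C * cmod (z1 - z2)) \<subseteq> cball a ?R"
        using z1(2) by (auto simp: subset_iff distrib_right intro: order_trans[OF dist_triangle[of a _ z1]])
      then show ?thesis using E by blast
    qed
    then obtain E where E: "\<And>z2. z2 \<in> ?J \<inter> cball a \<delta> \<Longrightarrow> connected (E z2) \<and> z1 \<in> E z2 \<and> z2 \<in> E z2 \<and> E z2 \<subseteq> ?J \<inter> cball a ?R"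
      by metis
    define G where "G = (\<Union>z2\<in>?J \<inter> cball a \<delta>. E z2)"
    have G: "connected G" unfolding G_def
    proof (rule connected_Union)
      show "\<And>S. S \<in> E ` (?J \<inter> cball a \<delta>) \<Longrightarrow> connected S" using E by auto
      show "\<Inter> (E ` (?J \<inter> cball a \<delta>)) \<noteq> {}" using E by blast
    qed
    have G2: "G \<subseteq> ?J \<inter> cball a ?R" unfolding G_def using E by blast
    then have cl: "closure G \<subseteq> ?J \<inter> cball a ?R"
      by (intro closure_minimal) (auto intro: J)
    show thesis
    proof (rule that[of "closure G"])
      show "connected (closure G)" using G connected_imp_connected_closure by blast
      show "compact (closure G)" using G2 by (meson bounded_cball bounded_subset compact_closure inf_le2)
      show "?J \<inter> cball a \<delta> \<subseteq> closure G" using E closure_subset[of G] unfolding G_def by blast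
      show "closure G \<subseteq> ?J \<inter> cball a ?R" by (rule cl)
    qed
  qed
  \<comment> \<open>\<open>F\<close> is added to the disc because Janiszewski's theorem requires the
    two sets to meet in a connected set, and the boundary points inside the disc alone need not form
    one.\<close>
  have JF: "(cball a \<delta> \<union> F) \<inter> ?J = F" using F by blast
  have "connected_component (- ((cball a \<delta> \<union> F) \<union> ?J)) p q"
  proof (rule Janiszewski)
    show "compact (cball a \<delta> \<union> F)" using F by auto
    show "closed ?J" by (rule J)
    show "connected ((cball a \<delta> \<union> F) \<inter> ?J)" using JF F by simp
    \<comment> \<open>\<open>p\<close> and \<open>q\<close> can be joined off the first set because
      they lie outside the larger disc, which contains both the small disc and
      \<open>F\<close>.\<close>
    have "connected (- cball a ?R)" by (rule connected_complement_bounded_convex) (auto simp: DIM_complex)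
    moreover have "- cball a ?R \<subseteq> - (cball a \<delta> \<union> F)" using F(4) dR by auto
    ultimately show "connected_component (- (cball a \<delta> \<union> F)) p q"
      using p q unfolding connected_component_def by (intro exI[of _ "- cball a ?R"]) auto
    have "\<Omega> \<subseteq> - ?J" using \<Omega>(1) by (auto simp: frontier_def interior_open)
    then show "connected_component (- ?J) p q"
      using p q \<Omega> unfolding connected_component_def by (intro exI[of _ \<Omega>]) auto
  qed
  then obtain T where T: "connected T" "p \<in> T" "q \<in> T" "T \<subseteq> - ((cball a \<delta> \<union> F) \<union> ?J)"
    unfolding connected_component_def by auto
  have "T \<subseteq> \<Omega>"
  proof (rule ccontr)
    assume "\<not> T \<subseteq> \<Omega>"
    then have "T \<inter> ?J \<noteq> {}"
      using T p(1) by (intro connected_Int_frontier) auto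
    then show False using T(4) by auto
  qed
  then show ?thesis using T by blast
qed

subsection \<open>Length-area estimates\<close>

lemma emeasure_ball_complex: "r \<ge> 0 \<Longrightarrow> emeasure lebesgue (ball (c::complex) r) = ennreal (pi * r\<^sup>2)"
  by (simp add: emeasure_ball DIM_complex unit_ball_vol_2)

lemma emeasure_lborel_ball_complex: "r \<ge> 0 \<Longrightarrow> emeasure lborel (ball (c::complex) r) = ennreal (pi * r\<^sup>2)"
  by (simp add: emeasure_ball DIM_complex unit_ball_vol_2)

lemma distr_Complex_lborel: "distr (lborel \<Otimes>\<^sub>M lborel) borel (\<lambda>(x, y). Complex x y) = lborel"
proof (rule lborel_eqI[symmetric])
  fix l u :: complex assume le: "\<And>b. b \<in> Basis \<Longrightarrow> l \<bullet> b \<le> u \<bullet> b"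
  have l12: "Re l \<le> Re u" "Im l \<le> Im u"
    using le[of 1] le[of \<i>] by (auto simp: Basis_complex_def)
  have m: "(\<lambda>(x, y). Complex x y) \<in> borel \<rightarrow>\<^sub>M borel"
    unfolding case_prod_beta by (intro borel_measurable_continuous_onI continuous_intros)
  have "(\<lambda>(x, y). Complex x y) -` box l u = box (Re l) (Re u) \<times> box (Im l) (Im u)"
    by (auto simp: box_def Basis_complex_def inner_complex_def)
  then have "emeasure (distr (lborel \<Otimes>\<^sub>M lborel) borel (\<lambda>(x, y). Complex x y)) (box l u)
      = emeasure (lborel \<Otimes>\<^sub>M lborel) (box (Re l) (Re u) \<times> box (Im l) (Im u))"
    using m by (subst emeasure_distr) (auto simp: lborel_prod)
  also have "\<dots> = emeasure lborel (box (Re l) (Re u)) * emeasure lborel (box (Im l) (Im u))"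
    by (rule lborel.emeasure_pair_measure_Times) auto
  also have "\<dots> = (\<Prod>b\<in>Basis. (u - l) \<bullet> b)"
    using l12 by (auto simp: Basis_complex_def inner_complex_def ennreal_mult')
  finally show "emeasure (distr (lborel \<Otimes>\<^sub>M lborel) borel (\<lambda>(x, y). Complex x y)) (box l u) = (\<Prod>b\<in>Basis. (u - l) \<bullet> b)" .
qed simp

lemma nn_integral_Complex:
  assumes [measurable]: "g \<in> borel_measurable borel"
  shows "(\<integral>\<^sup>+z. g z \<partial>lborel) = (\<integral>\<^sup>+y. \<integral>\<^sup>+x. g (Complex x y) \<partial>lborel \<partial>lborel)"
proof -
  have m: "(\<lambda>(x, y). Complex x y) \<in> (lborel \<Otimes>\<^sub>M lborel) \<rightarrow>\<^sub>M borel"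
    unfolding case_prod_beta lborel_prod
    by (simp, intro borel_measurable_continuous_onI continuous_intros)
  have m': "(\<lambda>(x, y). g (Complex x y)) \<in> borel_measurable (lborel \<Otimes>\<^sub>M lborel)"
    using measurable_compose[OF m assms] by (simp add: case_prod_beta)
  have "(\<integral>\<^sup>+z. g z \<partial>lborel) = (\<integral>\<^sup>+p. g (case p of (x, y) \<Rightarrow> Complex x y) \<partial>(lborel \<Otimes>\<^sub>M lborel))"
    by (subst distr_Complex_lborel[symmetric], subst nn_integral_distr[OF m]) auto
  also have "\<dots> = (\<integral>\<^sup>+y. \<integral>\<^sup>+x. g (Complex x y) \<partial>lborel \<partial>lborel)"
    using lborel_pair.nn_integral_snd[OF m'] by (simp add: case_prod_beta')
  finally show ?thesis .
qed

text \<open>The derivative of \<open>ln (1 + ln (1 + t\<^sup>2))\<close>: this function is unbounded, yet \<open>rho |w|\<close> is square integrable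
  over the plane, so the length-area argument bounds images that a priori may be large.\<close>

definition rho :: "real \<Rightarrow> real" where "rho t = 2 * t / ((1 + t\<^sup>2) * (1 + ln (1 + t\<^sup>2)))"

lemma rho_cont: "continuous_on UNIV rho"
proof -
  have "1 + t\<^sup>2 > 0" "1 + ln (1 + t\<^sup>2) > 0" for t :: real
    by (auto intro: add_pos_nonneg)
  then show ?thesis unfolding rho_def
    by (intro continuous_intros) (auto simp: less_imp_neq[symmetric])
qed

lemma rho_nonneg: "t \<ge> 0 \<Longrightarrow> rho t \<ge> 0"
  unfolding rho_def by (intro divide_nonneg_nonneg mult_nonneg_nonneg add_nonneg_nonneg) auto

lemma rho_le: "t \<ge> 0 \<Longrightarrow> rho t \<le> 1"
proof -
  assume t: "t \<ge> 0"
  have "2 * t \<le> 1 + t\<^sup>2" using zero_le_power2[of "t - 1"] by (simp add: power2_diff)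
  also have "\<dots> * 1 \<le> (1 + t\<^sup>2) * (1 + ln (1 + t\<^sup>2))" by (intro mult_left_mono) auto
  finally show ?thesis unfolding rho_def
    by (subst divide_le_eq_1) (auto intro!: add_pos_nonneg mult_pos_pos)
qed

text \<open>The disc of radius 2^(k+1) has area of order 4^k, so this bound leaves terms of order
  1/(1+k)^2 in the energy; the logarithm in \<open>rho\<close> produces the factor that makes them
  summable.\<close>

lemma rho_le_shell: assumes t: "t \<ge> 2 ^ k" shows "(rho t)\<^sup>2 \<le> 4 / (4 ^ k * (1 + real k)\<^sup>2)"
proof -
  have t0: "t > 0" using t by (smt (verit) zero_less_power)
  have "(2 ^ k)\<^sup>2 \<le> t\<^sup>2" using t by (intro power_mono) auto
  then have t2: "4 ^ k \<le> t\<^sup>2" by (simp add: power2_eq_square flip: power_mult_distrib)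
  have "real k \<le> real k * (2 * ln 2)" using ln2_ge_two_thirds using mult_left_mono[of 1 "2 * ln 2" "real k"] by simp
  also have "\<dots> = ln ((2::real) ^ (2 * k))" by (simp add: ln_realpow)
  also have "(2::real) ^ (2 * k) = 4 ^ k" by (simp add: power_mult)
  also have "ln (4 ^ k) \<le> ln (1 + t\<^sup>2)" using t2 by (intro ln_mono) auto
  finally have l: "1 + real k \<le> 1 + ln (1 + t\<^sup>2)" by simp
  have "rho t \<le> 2 * t / (t\<^sup>2 * (1 + real k))"
    unfolding rho_def using t0 l by (intro divide_left_mono mult_mono mult_pos_pos add_pos_nonneg) auto
  also have "\<dots> = 2 / (t * (1 + real k))" using t0 by (simp add: power2_eq_square)
  finally have "(rho t)\<^sup>2 \<le> (2 / (t * (1 + real k)))\<^sup>2" using t0 by (intro power_mono rho_nonneg) auto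
  also have "\<dots> = 4 / (t\<^sup>2 * (1 + real k)\<^sup>2)" by (simp add: power_divide power_mult_distrib)
  also have "\<dots> \<le> 4 / (4 ^ k * (1 + real k)\<^sup>2)" using t2 t0 by (intro divide_left_mono mult_right_mono mult_pos_pos) auto
  finally show ?thesis .
qed

lemma ennreal_term_le_suminf: "(G :: nat \<Rightarrow> ennreal) k \<le> (\<Sum>k. G k)"
  using sum_le_suminf[OF summableI, of "{k}" G] by simp

lemma rho_energy: "(\<integral>\<^sup>+w. ennreal ((rho (cmod w))\<^sup>2) \<partial>lebesgue) < \<infinity>"
proof -
  have pt: "ennreal ((rho (cmod w))\<^sup>2) \<le> indicator (ball 0 1) w +
      (\<Sum>k. ennreal (4 / (4 ^ k * (1 + real k)\<^sup>2)) * indicator (ball 0 (2 ^ Suc k)) w)" (is "_ \<le> _ + (\<Sum>k. ?g k)") for w :: complex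
  proof (cases "cmod w < 1")
    case True
    have "(rho (cmod w))\<^sup>2 \<le> 1" using rho_le[of "cmod w"] rho_nonneg[of "cmod w"] by (simp add: power_le_one)
    then have "ennreal ((rho (cmod w))\<^sup>2) \<le> 1" by (simp add: ennreal_le_1)
    then show ?thesis using True by (auto intro: add_increasing2)
  next
    case False
    define P where "P n \<longleftrightarrow> cmod w < 2 ^ Suc n" for n
    obtain n0 where "cmod w < 2 ^ n0" using real_arch_pow[of 2 "cmod w"] by auto
    then have "P n0" by (auto simp: P_def intro: order_less_trans[of _ "2^n0"])
    define k where "k = (LEAST n. P n)"
    have Pk: "P k" unfolding k_def by (rule LeastI[of P, OF \<open>P n0\<close>])
    have k: "cmod w \<ge> 2 ^ k"
    proof (cases k)
      case (Suc m)
      then have "\<not> P m" using not_less_Least[of m P] by (auto simp: k_def)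
      then show ?thesis using Suc by (simp add: P_def)
    qed (use False in auto)
    have "ennreal ((rho (cmod w))\<^sup>2) \<le> ?g k"
      using rho_le_shell[OF k] Pk by (auto simp: P_def intro!: ennreal_leI)
    also have "\<dots> \<le> (\<Sum>k. ?g k)"
      by (rule ennreal_term_le_suminf)
    finally show ?thesis by (simp add: add_increasing)
  qed
  have [measurable]: "ball (0::complex) r \<in> sets lebesgue" for r by simp
  have "(\<integral>\<^sup>+w. ennreal ((rho (cmod w))\<^sup>2) \<partial>lebesgue) \<le> (\<integral>\<^sup>+w. indicator (ball (0::complex) 1) w +
      (\<Sum>k. ennreal (4 / (4 ^ k * (1 + real k)\<^sup>2)) * indicator (ball 0 (2 ^ Suc k)) w) \<partial>lebesgue)"
    by (intro nn_integral_mono pt)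
  also have "\<dots> = (\<integral>\<^sup>+w. indicator (ball (0::complex) 1) w \<partial>lebesgue) +
      (\<Sum>k. \<integral>\<^sup>+w. ennreal (4 / (4 ^ k * (1 + real k)\<^sup>2)) * indicator (ball (0::complex) (2 ^ Suc k)) w \<partial>lebesgue)"
    by (subst nn_integral_add, simp, simp, subst nn_integral_suminf) auto
  also have "\<dots> = ennreal pi + (\<Sum>k. ennreal (16 * pi * (1 / (real k + 1)\<^sup>2)))"
  proof -
    have "ennreal (4 / (4 ^ k * (1 + real k)\<^sup>2)) * ennreal (pi * (2 ^ Suc k)\<^sup>2) = ennreal (16 * pi * (1 / (real k + 1)\<^sup>2))" for k
    proof -
      have e: "((2::real) ^ Suc k)\<^sup>2 = 4 * 4 ^ k" by (simp add: power2_eq_square flip: power_mult_distrib)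
      have "4 / (4 ^ k * (1 + real k)\<^sup>2) * (pi * (2 ^ Suc k)\<^sup>2) = 16 * pi * (1 / (real k + 1)\<^sup>2)"
        unfolding e by (simp add: add.commute)
      then show ?thesis by (subst ennreal_mult'[symmetric]) auto
    qed
    then show ?thesis
      by (simp add: nn_integral_cmult_indicator emeasure_lborel_ball_complex del: power_Suc)
  qed
  also have "\<dots> < \<infinity>"
  proof -
    have "summable (\<lambda>k. 16 * pi * (1 / (real k + 1)\<^sup>2))"
      using inverse_squares_sums by (intro summable_mult) (auto simp: sums_iff add.commute)
    then have "(\<Sum>k. ennreal (16 * pi * (1 / (real k + 1)\<^sup>2))) = ennreal (\<Sum>k. 16 * pi * (1 / (real k + 1)\<^sup>2))"
      by (intro suminf_ennreal_eq summable_sums) auto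
    then show ?thesis by simp
  qed
  finally show ?thesis .
qed

definition rho_total :: real where "rho_total = enn2real (\<integral>\<^sup>+w. ennreal ((rho (cmod w))\<^sup>2) \<partial>lebesgue)"

lemma rho_total: "(\<integral>\<^sup>+w. ennreal ((rho (cmod w))\<^sup>2) \<partial>lebesgue) = ennreal rho_total" "rho_total \<ge> 0"
  using rho_energy by (auto simp: rho_total_def)

text \<open>Along the segment the derivative of ln(1 + ln(1 + |u|^2)) is at most rho(|u|) |u'|, so
  the rho-length of the image bounds the increase of this function.\<close>

lemma rho_FTC:
  fixes u :: "complex \<Rightarrow> complex"
  assumes u: "u holomorphic_on S" "open S" and x: "x0 \<le> x1" and seg: "\<And>t. t \<in> {x0..x1} \<Longrightarrow> Complex t y \<in> S"
    and le: "(\<integral>\<^sup>+t\<in>{x0..x1}. ennreal (rho (cmod (u (Complex t y))) * cmod (deriv u (Complex t y))) \<partial>lborel) \<le> ennreal c" "c \<ge> 0"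
  shows "ln (1 + ln (1 + (cmod (u (Complex x1 y)))\<^sup>2)) \<le> ln (1 + ln (1 + (cmod (u (Complex x0 y)))\<^sup>2)) + c"
proof -
  define N where "N t = (cmod (u (Complex t y)))\<^sup>2" for t
  define N' where "N' t = 2 * (u (Complex t y) \<bullet> deriv u (Complex t y))" for t
  define g where "g t = rho (cmod (u (Complex t y))) * cmod (deriv u (Complex t y))" for t
  have N0: "N t \<ge> 0" "ln (1 + N t) \<ge> 0" for t by (auto simp: N_def)
  have dC: "((\<lambda>t. Complex t y) has_vector_derivative 1) (at t within A)" for t A
    unfolding has_vector_derivative_complex_iff by (auto intro!: derivative_eq_intros simp: has_real_derivative_iff_has_vector_derivative[symmetric])
  have du: "((\<lambda>t. u (Complex t y)) has_vector_derivative deriv u (Complex t y)) (at t within {x0..x1})" if "t \<in> {x0..x1}" for t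
    using field_vector_diff_chain_within[OF dC, of u "deriv u (Complex t y)" t "{x0..x1}"] holomorphic_derivI[OF u seg[OF that]]
    by (auto simp: o_def)
  have dN: "(N has_real_derivative N' t) (at t within {x0..x1})" if "t \<in> {x0..x1}" for t
  proof -
    have "((\<lambda>t. u (Complex t y) \<bullet> u (Complex t y)) has_derivative (\<lambda>h. u (Complex t y) \<bullet> (h *\<^sub>R deriv u (Complex t y)) + (h *\<^sub>R deriv u (Complex t y)) \<bullet> u (Complex t y))) (at t within {x0..x1})"
      using du[OF that] unfolding has_vector_derivative_def by (intro has_derivative_inner)
    then show ?thesis
      unfolding has_field_derivative_def N_def N'_def by (simp add: dot_square_norm inner_commute algebra_simps)
        (auto elim!: has_derivative_eq_rhs)
  qed
  have dPhi: "((\<lambda>t. ln (1 + ln (1 + N t))) has_real_derivative (N' t / (1 + N t)) / (1 + ln (1 + N t))) (at t within {x0..x1})"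
    if "t \<in> {x0..x1}" for t
    using N0[of t] by (auto intro!: derivative_eq_intros dN[OF that] add_pos_nonneg simp: field_simps)
  have "((\<lambda>t. (N' t / (1 + N t)) / (1 + ln (1 + N t))) has_integral (ln (1 + ln (1 + N x1)) - ln (1 + ln (1 + N x0)))) {x0..x1}"
    using dPhi x by (intro fundamental_theorem_of_calculus) (auto simp: has_real_derivative_iff_has_vector_derivative)
  moreover have cg: "continuous_on {x0..x1} g"
  proof -
    have c1: "continuous_on {x0..x1} (\<lambda>t. Complex t y)"
      by (intro continuous_intros)
    have c2: "continuous_on S u" "continuous_on S (deriv u)"
      using u holomorphic_on_imp_continuous_on holomorphic_deriv by blast+
    have "continuous_on {x0..x1} (\<lambda>t. u (Complex t y))" "continuous_on {x0..x1} (\<lambda>t. deriv u (Complex t y))"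
      using seg by (auto intro!: continuous_on_compose2[OF c2(1) c1] continuous_on_compose2[OF c2(2) c1])
    then show ?thesis unfolding g_def
      by (intro continuous_intros continuous_on_compose2[OF rho_cont]) auto
  qed
  then have gi: "(g has_integral integral {x0..x1} g) {x0..x1}"
    using integrable_continuous_real by blast
  ultimately have "ln (1 + ln (1 + N x1)) - ln (1 + ln (1 + N x0)) \<le> integral {x0..x1} g"
  proof (rule has_integral_le)
    fix t assume "t \<in> {x0..x1}"
    have "N' t \<le> 2 * (cmod (u (Complex t y)) * cmod (deriv u (Complex t y)))"
      unfolding N'_def by (intro mult_left_mono norm_cauchy_schwarz) auto
    then have "N' t / (1 + N t) / (1 + ln (1 + N t)) \<le> 2 * (cmod (u (Complex t y)) * cmod (deriv u (Complex t y))) / (1 + N t) / (1 + ln (1 + N t))"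
      using N0[of t] by (intro divide_right_mono) auto
    then show "N' t / (1 + N t) / (1 + ln (1 + N t)) \<le> g t"
      by (simp add: g_def rho_def N_def)
  qed
  moreover have "integral {x0..x1} g \<le> c"
  proof -
    have g0: "g t \<ge> 0" for t unfolding g_def by (intro mult_nonneg_nonneg rho_nonneg) auto
    have "(\<integral>\<^sup>+t\<in>{x0..x1}. ennreal (g t) \<partial>lborel) = ennreal (integral {x0..x1} g)"
    proof (rule set_nn_integral_lborel_eq_integral)
      show "set_borel_measurable borel {x0..x1} g"
        unfolding set_borel_measurable_def using cg by (intro borel_measurable_continuous_on_indicator) auto
      show "(\<integral>\<^sup>+t\<in>{x0..x1}. ennreal (g t) \<partial>lborel) < \<infinity>"
        using le(1) unfolding g_def by (rule order_le_less_trans) simp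
    qed (use g0 in auto)
    then have "ennreal (integral {x0..x1} g) \<le> ennreal c" using le by (simp add: g_def)
    then show ?thesis using le(2) by simp
  qed
  ultimately show ?thesis by (simp add: N_def)
qed

text \<open>The rho-energy of \<open>u\<close> over the region is at most the energy of the whole
  plane, by univalence, and the region has area at most 4 l^2. Hence the average rho-length over the
  horizontal segments is bounded independently of \<open>u\<close> and \<open>l\<close>.\<close>

lemma horizontal_crosscut:
  fixes u :: "complex \<Rightarrow> complex"
  assumes u: "u holomorphic_on ball 0 1" "inj_on u (ball 0 1)" and l: "l > 0"
  defines "x0 \<equiv> 1 - 4 * l"
  shows "\<exists>y\<in>{y1<..<y1 + l}. \<forall>x. x0 \<le> x \<and> Complex x y \<in> ball 0 1 \<longrightarrow>
     Complex x0 y \<in> ball 0 1 \<longrightarrow>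
     ln (1 + ln (1 + (cmod (u (Complex x y)))\<^sup>2)) \<le> ln (1 + ln (1 + (cmod (u (Complex x0 y)))\<^sup>2)) + (rho_total / 2 + 3)"
proof -
  let ?D = "ball (0::complex) 1"
  define g where "g z = rho (cmod (u z)) * cmod (deriv u z)" for z
  have g0: "g z \<ge> 0" for z unfolding g_def by (intro mult_nonneg_nonneg rho_nonneg) auto
  define R where "R = ?D \<inter> {z. 1 - 4 * l \<le> Re z \<and> y1 < Im z \<and> Im z < y1 + l}"
  interpret conformal u ?D "u ` ?D" by unfold_locales (use u in auto)
  have cont: "continuous_on ?D g"
    unfolding g_def by (intro continuous_intros continuous_on_compose2[OF rho_cont] deriv_cont holomorphic_on_imp_continuous_on u) auto
  have "(\<lambda>z. indicator ?D z *\<^sub>R g z) \<in> borel_measurable borel"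
    using cont by (intro borel_measurable_continuous_on_indicator) auto
  then have gm: "(\<lambda>z. indicator ?D z * g z) \<in> borel_measurable borel" by simp
  have Rb [measurable]: "R \<in> sets borel"
  proof -
    have "R = ?D \<inter> ({z. Re z \<ge> 1 - 4 * l} \<inter> {z. Im z > y1} \<inter> {z. Im z < y1 + l})" by (auto simp: R_def)
    also have "\<dots> \<in> sets borel"
      by (intro sets.Int borel_open borel_closed open_ball closed_halfspace_Re_ge open_halfspace_Im_gt open_halfspace_Im_lt)
    finally show ?thesis .
  qed
  have eqR: "ennreal (g z) * indicator R z = ennreal (indicator ?D z * g z) * indicator R z" for z
    by (auto simp: R_def indicator_def)
  have hm: "(\<lambda>z. ennreal (g z) * indicator R z) \<in> borel_measurable borel"
    unfolding eqR using gm Rb by measurable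
  have area: "emeasure lborel R \<le> ennreal (4 * l\<^sup>2)"
  proof -
    have "R \<subseteq> cbox (Complex (1 - 4 * l) y1) (Complex 1 (y1 + l))"
      using abs_Re_le_cmod by (auto simp: R_def cbox_def Basis_complex_def inner_complex_def intro: order_trans[OF abs_ge_self order_trans[OF abs_Re_le_cmod less_imp_le]])
    then have "emeasure lborel R \<le> emeasure lborel (cbox (Complex (1 - 4 * l) y1) (Complex 1 (y1 + l)))"
      by (intro emeasure_mono) auto
    also have "\<dots> = ennreal (4 * l\<^sup>2)"
      using l by (subst emeasure_lborel_cbox_eq) (auto simp: Basis_complex_def inner_complex_def power2_eq_square)
    finally show ?thesis .
  qed
  have energy: "(\<integral>\<^sup>+z. ennreal ((g z)\<^sup>2) * indicator R z \<partial>lborel) \<le> ennreal rho_total"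
  proof -
    have rm: "(\<lambda>w. ennreal ((rho (cmod w))\<^sup>2)) \<in> borel_measurable borel"
      by (intro measurable_compose[OF _ measurable_ennreal] borel_measurable_continuous_onI continuous_intros continuous_on_compose2[OF rho_cont]) auto
    have m2: "(\<lambda>z. ennreal ((g z)\<^sup>2) * indicator R z) \<in> borel_measurable borel"
    proof -
      have "(\<lambda>z. ennreal ((g z)\<^sup>2) * indicator R z) = (\<lambda>z. ennreal ((indicator ?D z * g z)\<^sup>2) * indicator R z)"
        by (auto simp: R_def indicator_def)
      then show ?thesis using gm Rb by simp
    qed
    have "(\<integral>\<^sup>+z. ennreal ((g z)\<^sup>2) * indicator R z \<partial>lborel) = (\<integral>\<^sup>+z. ennreal ((g z)\<^sup>2) * indicator R z \<partial>lebesgue)"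
      using m2 by (subst nn_integral_completion) auto
    also have "\<dots> \<le> (\<integral>\<^sup>+z. ennreal ((g z)\<^sup>2) * indicator ?D z \<partial>lebesgue)"
      by (intro nn_integral_mono) (auto simp: R_def indicator_def)
    also have "\<dots> = (\<integral>\<^sup>+z. ennreal ((cmod (deriv u z))\<^sup>2) * ennreal ((rho (cmod (u z)))\<^sup>2) \<partial>lebesgue_on ?D)"
      by (subst nn_integral_restrict_space) (auto intro!: nn_integral_cong simp: g_def power_mult_distrib ennreal_mult' mult_ac)
    also have "\<dots> = (\<integral>\<^sup>+w. ennreal ((rho (cmod w))\<^sup>2) \<partial>lebesgue_on (u ` ?D))"
      by (intro nn_integral_conformal[symmetric] measurable_restrict_space1 measurable_completion) (use rm in simp)
    also have "\<dots> \<le> (\<integral>\<^sup>+w. ennreal ((rho (cmod w))\<^sup>2) \<partial>lebesgue)"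
      by (subst nn_integral_restrict_space) (auto intro!: nn_integral_mono simp: indicator_def)
    finally show ?thesis by (simp add: rho_total)
  qed
  have total: "(\<integral>\<^sup>+z. ennreal (g z) * indicator R z \<partial>lborel) \<le> ennreal (l * (rho_total / 2 + 2))"
  proof -
    \<comment> \<open>The Cauchy-Schwarz inequality in additive form, with the weight l chosen so
      that the energy term and the area term both come out of order l.\<close>
    have am: "ennreal (g z) * indicator R z \<le> ennreal (l / 2) * (ennreal ((g z)\<^sup>2) * indicator R z) + ennreal (1 / (2 * l)) * indicator R z" for z
    proof -
      have "0 \<le> (l * g z - 1)\<^sup>2" by simp
      then have "2 * l * g z \<le> l\<^sup>2 * (g z)\<^sup>2 + 1" by (simp add: power2_eq_square algebra_simps)
      then have "g z \<le> l / 2 * (g z)\<^sup>2 + 1 / (2 * l)" using l by (simp add: field_simps power2_eq_square)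
      then have "ennreal (g z) \<le> ennreal (l / 2) * ennreal ((g z)\<^sup>2) + ennreal (1 / (2 * l))"
        using l by (simp add: ennreal_leI flip: ennreal_mult' ennreal_plus)
      then show ?thesis by (auto simp: indicator_def)
    qed
    have m2: "(\<lambda>z. ennreal ((g z)\<^sup>2) * indicator R z) \<in> borel_measurable lborel"
    proof -
      have "(\<lambda>z. ennreal ((g z)\<^sup>2) * indicator R z) = (\<lambda>z. ennreal ((indicator ?D z * g z)\<^sup>2) * indicator R z)"
        by (auto simp: R_def indicator_def)
      then show ?thesis using gm Rb by simp
    qed
    have "(\<integral>\<^sup>+z. ennreal (g z) * indicator R z \<partial>lborel)
        \<le> (\<integral>\<^sup>+z. ennreal (l / 2) * (ennreal ((g z)\<^sup>2) * indicator R z) + ennreal (1 / (2 * l)) * indicator R z \<partial>lborel)"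
      by (intro nn_integral_mono am)
    also have "\<dots> = ennreal (l / 2) * (\<integral>\<^sup>+z. ennreal ((g z)\<^sup>2) * indicator R z \<partial>lborel) + ennreal (1 / (2 * l)) * emeasure lborel R"
      using m2 by (subst nn_integral_add, simp, simp, subst nn_integral_cmult, simp, subst nn_integral_cmult_indicator) auto
    also have "\<dots> \<le> ennreal (l / 2) * ennreal rho_total + ennreal (1 / (2 * l)) * ennreal (4 * l\<^sup>2)"
      by (intro add_mono mult_left_mono energy area) auto
    also have "\<dots> = ennreal (l * (rho_total / 2 + 2))"
      using l rho_total(2) by (simp add: power2_eq_square algebra_simps flip: ennreal_mult' ennreal_plus)
    finally show ?thesis .
  qed
  \<comment> \<open>The mean over the heights is at most rho_total/2 + 2, so the strictly larger
    bound with 3 is attained at some height.\<close>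
  have "\<exists>y\<in>{y1<..<y1 + l}. (\<integral>\<^sup>+x. ennreal (g (Complex x y)) * indicator R (Complex x y) \<partial>lborel) \<le> ennreal (rho_total / 2 + 3)"
  proof (rule ccontr)
    assume "\<not> ?thesis"
    then have big: "ennreal (rho_total / 2 + 3) * indicator {y1<..<y1 + l} y \<le> (\<integral>\<^sup>+x. ennreal (g (Complex x y)) * indicator R (Complex x y) \<partial>lborel)" for y
      by (auto simp: indicator_def not_le less_imp_le)
    have "ennreal (rho_total / 2 + 3) * ennreal l = (\<integral>\<^sup>+y. ennreal (rho_total / 2 + 3) * indicator {y1<..<y1 + l} y \<partial>lborel)"
      using l by (subst nn_integral_cmult_indicator) auto
    also have "\<dots> \<le> (\<integral>\<^sup>+y. \<integral>\<^sup>+x. ennreal (g (Complex x y)) * indicator R (Complex x y) \<partial>lborel \<partial>lborel)"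
      by (intro nn_integral_mono big)
    also have "\<dots> = (\<integral>\<^sup>+z. ennreal (g z) * indicator R z \<partial>lborel)"
      by (rule nn_integral_Complex[symmetric, OF hm])
    also note total
    finally have "ennreal ((rho_total / 2 + 3) * l) \<le> ennreal (l * (rho_total / 2 + 2))"
      using rho_total(2) l by (simp add: ennreal_mult')
    then have "(rho_total / 2 + 3) * l \<le> l * (rho_total / 2 + 2)"
      using rho_total(2) l by (subst (asm) ennreal_le_iff) auto
    then show False using l by (simp add: algebra_simps)
  qed
  then obtain y where y: "y \<in> {y1<..<y1 + l}"
      "(\<integral>\<^sup>+x. ennreal (g (Complex x y)) * indicator R (Complex x y) \<partial>lborel) \<le> ennreal (rho_total / 2 + 3)" by blast
  have "ln (1 + ln (1 + (cmod (u (Complex x y)))\<^sup>2)) \<le> ln (1 + ln (1 + (cmod (u (Complex x0 y)))\<^sup>2)) + (rho_total / 2 + 3)"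
    if x: "x0 \<le> x" "Complex x y \<in> ?D" "Complex x0 y \<in> ?D" for x
  proof (rule rho_FTC[OF u(1) open_ball x(1)])
    show seg: "Complex t y \<in> ?D" if "t \<in> {x0..x}" for t
    proof -
      have "\<bar>t\<bar> \<le> \<bar>x0\<bar> \<or> \<bar>t\<bar> \<le> \<bar>x\<bar>" using that by auto
      then have "t\<^sup>2 \<le> x0\<^sup>2 \<or> t\<^sup>2 \<le> x\<^sup>2" by (simp add: abs_le_square_iff)
      then have "cmod (Complex t y) \<le> cmod (Complex x0 y) \<or> cmod (Complex t y) \<le> cmod (Complex x y)"
        by (auto simp: cmod_def intro!: real_sqrt_le_mono)
      then show ?thesis using x by auto
    qed
    have "(\<integral>\<^sup>+t\<in>{x0..x}. ennreal (rho (cmod (u (Complex t y))) * cmod (deriv u (Complex t y))) \<partial>lborel)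
        \<le> (\<integral>\<^sup>+x. ennreal (g (Complex x y)) * indicator R (Complex x y) \<partial>lborel)"
      using seg y(1) x0_def by (intro nn_integral_mono) (auto simp: g_def R_def indicator_def)
    then show "(\<integral>\<^sup>+t\<in>{x0..x}. ennreal (rho (cmod (u (Complex t y))) * cmod (deriv u (Complex t y))) \<partial>lborel) \<le> ennreal (rho_total / 2 + 3)"
      using y(2) by (rule order_trans)
  qed (use rho_total(2) in auto)
  then show ?thesis using y(1) by blast
qed

text \<open>Two horizontal crosscuts and a piece of the vertical line Re z = 1 - 4l enclose the box.
  After the normalisation \<open>u\<close> = (f - f(a)) / (|f'(a)| l), distortion bounds
  \<open>u\<close> on the vertical piece, and the length-area estimate carries this bound along the
  horizontal segments up to the circle.\<close>

lemma crosscut_bound: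
  obtains K where "K > 0" "\<And>f l. f holomorphic_on ball 0 1 \<Longrightarrow> inj_on f (ball 0 1) \<Longrightarrow> 0 < l \<Longrightarrow> l \<le> 1/20 \<Longrightarrow>
    \<exists>yp\<in>{l<..<2*l}. \<exists>ym\<in>{-2*l<..<-l}. \<forall>z\<in>ball 0 1.
      (Re z \<ge> 1 - 4*l \<and> (Im z = yp \<or> Im z = ym)) \<or> (Re z = 1 - 4*l \<and> ym \<le> Im z \<and> Im z \<le> yp) \<longrightarrow>
      cmod (f z - f (of_real (1 - 3*l/4))) \<le> K * (cmod (deriv f (of_real (1 - 3*l/4))) * l)"
proof -
  obtain Cd :: "real \<Rightarrow> real" where Cd: "\<And>K. Cd K \<ge> 1"
    "\<And>K f \<eta> a b. f holomorphic_on ball 0 1 \<Longrightarrow> inj_on f (ball 0 1) \<Longrightarrow> \<eta> > 0 \<Longrightarrow> \<eta> \<le> 1 - cmod a \<Longrightarrow> \<eta> \<le> 1 - cmod b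
      \<Longrightarrow> cmod (b - a) \<le> K * \<eta> \<Longrightarrow> cmod (deriv f b) \<le> Cd K * cmod (deriv f a)"
    by (rule univalent_distortion) (rule that)
  \<comment> \<open>Points of the vertical piece are within 6l of the centre, and 6l is 8 times
    \<eta> = 3l/4.\<close>
  define K0 where "K0 = 6 * Cd 8"
  define B where "B = ln (1 + ln (1 + K0\<^sup>2)) + (rho_total / 2 + 3)"
  \<comment> \<open>Solves ln(1 + ln(1 + t^2)) <= B for t, generously.\<close>
  define K1 where "K1 = sqrt (exp (exp B))"
  have K0: "K0 > 0" using Cd(1)[of 8] by (simp add: K0_def)
  have main: "\<exists>yp\<in>{l<..<2*l}. \<exists>ym\<in>{-2*l<..<-l}. \<forall>z\<in>ball 0 1.
      (Re z \<ge> 1 - 4*l \<and> (Im z = yp \<or> Im z = ym)) \<or> (Re z = 1 - 4*l \<and> ym \<le> Im z \<and> Im z \<le> yp) \<longrightarrow>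
      cmod (f z - f (of_real (1 - 3*l/4))) \<le> (K0 + K1) * (cmod (deriv f (of_real (1 - 3*l/4))) * l)"
    if f: "f holomorphic_on ball 0 1" "inj_on f (ball 0 1)" and l: "0 < l" "l \<le> 1/20" for f l
  proof -
    define a :: complex where "a = of_real (1 - 3*l/4)"
    define d where "d = cmod (deriv f a) * l"
    have aD: "1 - cmod a = 3*l/4" using l by (simp add: a_def norm_of_real del: of_real_diff)
    have "a \<in> ball 0 1" using aD l by auto
    then have "deriv f a \<noteq> 0"
      using holomorphic_has_inverse[OF f(1) open_ball f(2)] by (metis mult_zero_left zero_neq_one)
    then have d: "d > 0" using l by (simp add: d_def)
    define u where "u z = (f z - f a) / of_real d" for z
    have u: "u holomorphic_on ball 0 1" "inj_on u (ball 0 1)"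
      using f d unfolding u_def by (auto intro!: holomorphic_intros simp: inj_on_def)
    \<comment> \<open>These points stay at distance l from the circle, because (1 - 4l)^2 + (2l)^2
      <= (1 - l)^2 for l in the given range.\<close>
    have vert: "1 - cmod b \<ge> 3*l/4 \<and> cmod (u b) \<le> K0" if b: "Re b = 1 - 4*l" "\<bar>Im b\<bar> \<le> 2*l" for b
    proof -
      have "(cmod b)\<^sup>2 = (1 - 4*l)\<^sup>2 + (Im b)\<^sup>2" using b by (simp add: cmod_power2)
      also have "\<dots> \<le> (1 - 4*l)\<^sup>2 + (2*l)\<^sup>2" using power_mono[OF b(2), of 2] by simp
      also have "\<dots> = 1 - 8*l + 20*(l*l)" by (simp add: power2_eq_square algebra_simps)
      also have "\<dots> \<le> (1 - l)\<^sup>2"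
      proof -
        have "l * l \<le> l * (1/20)" by (rule mult_left_mono) (use l in auto)
        then have "19 * (l * l) \<le> 6 * l" using l(1) by linarith
        moreover have "(1 - l)\<^sup>2 = 1 - 2*l + l*l" by (simp add: power2_eq_square algebra_simps)
        ultimately show ?thesis by linarith
      qed
      finally have "cmod b \<le> 1 - l" by (rule power2_le_imp_le) (use l in simp)
      then have bD: "3*l/4 \<le> 1 - cmod b" using l by simp
      have ba: "cmod (b - a) \<le> 6*l"
        using cmod_le[of "b - a"] b l by (simp add: a_def)
      have "cmod (f b - f a) \<le> (Cd 8 * cmod (deriv f a)) * cmod (b - a)"
      proof (rule mean_value_deriv_bound[OF f(1)])
        show "0 < 3*l/4" "3*l/4 \<le> 1 - cmod a" "3*l/4 \<le> 1 - cmod b" using l aD bD by auto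
        show "cmod (deriv f c) \<le> Cd 8 * cmod (deriv f a)" if "3*l/4 \<le> 1 - cmod c" "cmod (c - a) \<le> cmod (b - a)" for c
          using that l aD ba by (intro Cd(2)[OF f, of "3*l/4"]) auto
      qed
      also have "\<dots> \<le> (Cd 8 * cmod (deriv f a)) * (6*l)"
        using ba Cd(1)[of 8] by (intro mult_left_mono) auto
      finally have "cmod (f b - f a) \<le> K0 * d" by (simp add: K0_def d_def mult_ac)
      then have "cmod (u b) \<le> K0" using d by (simp add: u_def norm_divide divide_le_eq)
      then show ?thesis using bD by simp
    qed
    have hor: "\<exists>y\<in>{y1<..<y1 + l}. \<forall>x\<ge>1 - 4*l. Complex x y \<in> ball 0 1 \<longrightarrow> cmod (u (Complex x y)) \<le> K1"
      if y1: "y1 \<ge> -2*l" "y1 + l \<le> 2*l" for y1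
    proof -
      obtain y where y: "y \<in> {y1<..<y1 + l}" and Y: "\<forall>x. 1 - 4*l \<le> x \<and> Complex x y \<in> ball 0 1 \<longrightarrow>
          Complex (1 - 4*l) y \<in> ball 0 1 \<longrightarrow>
        ln (1 + ln (1 + (cmod (u (Complex x y)))\<^sup>2)) \<le> ln (1 + ln (1 + (cmod (u (Complex (1 - 4*l) y)))\<^sup>2)) + (rho_total / 2 + 3)"
        using horizontal_crosscut[OF u l(1), of y1] by blast
      have v: "1 - cmod (Complex (1 - 4*l) y) \<ge> 3*l/4 \<and> cmod (u (Complex (1 - 4*l) y)) \<le> K0"
        using y y1 by (intro vert) auto
      have "cmod (u (Complex x y)) \<le> K1" if x: "x \<ge> 1 - 4*l" "Complex x y \<in> ball 0 1" for x
      proof -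
        let ?N = "(cmod (u (Complex x y)))\<^sup>2"
        have lnp: "0 \<le> ln (1 + t\<^sup>2)" for t :: real by simp
        have "Complex (1 - 4*l) y \<in> ball 0 1" using v l by auto
        then have "ln (1 + ln (1 + ?N)) \<le> ln (1 + ln (1 + (cmod (u (Complex (1 - 4*l) y)))\<^sup>2)) + (rho_total / 2 + 3)"
          using Y x by blast
        also have "\<dots> \<le> B"
        proof -
          have "(cmod (u (Complex (1 - 4*l) y)))\<^sup>2 \<le> K0\<^sup>2" using v by (intro power_mono) auto
          then have "ln (1 + (cmod (u (Complex (1 - 4*l) y)))\<^sup>2) \<le> ln (1 + K0\<^sup>2)" by (simp add: add_pos_nonneg)
          then have "ln (1 + ln (1 + (cmod (u (Complex (1 - 4*l) y)))\<^sup>2)) \<le> ln (1 + ln (1 + K0\<^sup>2))"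
            using lnp by (subst ln_le_cancel_iff) (auto intro: add_pos_nonneg)
          then show ?thesis by (simp add: B_def)
        qed
        finally have "1 + ln (1 + ?N) \<le> exp B"
          using lnp[of "cmod (u (Complex x y))"] by (metis add_pos_nonneg exp_le_cancel_iff exp_ln zero_less_one)
        then have "ln (1 + ?N) \<le> exp B" by simp
        then have "1 + ?N \<le> exp (exp B)"
          by (metis add_pos_nonneg exp_le_cancel_iff exp_ln zero_le_power2 zero_less_one)
        then have "?N \<le> exp (exp B)" by simp
        then show ?thesis unfolding K1_def by (rule real_le_rsqrt)
      qed
      then show ?thesis using y by blast
    qed
    obtain yp where yp: "yp \<in> {l<..<l + l}" "\<And>x. x \<ge> 1 - 4*l \<Longrightarrow> Complex x yp \<in> ball 0 1 \<Longrightarrow> cmod (u (Complex x yp)) \<le> K1"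
      using hor[of l] l by auto
    obtain ym where ym: "ym \<in> {-2*l<..<-2*l + l}" "\<And>x. x \<ge> 1 - 4*l \<Longrightarrow> Complex x ym \<in> ball 0 1 \<Longrightarrow> cmod (u (Complex x ym)) \<le> K1"
      using hor[of "-2*l"] l by auto
    have "cmod (f z - f a) \<le> (K0 + K1) * d"
      if z: "z \<in> ball 0 1" "(Re z \<ge> 1 - 4*l \<and> (Im z = yp \<or> Im z = ym)) \<or> (Re z = 1 - 4*l \<and> ym \<le> Im z \<and> Im z \<le> yp)" for z
    proof -
      have "cmod (u z) \<le> K0 + K1"
      proof (cases "Re z \<ge> 1 - 4*l \<and> (Im z = yp \<or> Im z = ym)")
        case True
        then have "cmod (u z) \<le> K1" using yp(2)[of "Re z"] ym(2)[of "Re z"] z(1) by (metis complex_surj)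
        then show ?thesis using K0 by simp
      next
        case False
        then have "cmod (u z) \<le> K0" using z(2) yp(1) ym(1) by (intro conjunct2[OF vert]) auto
        then show ?thesis by (simp add: K1_def add_increasing2)
      qed
      then show ?thesis using d by (simp add: u_def norm_divide divide_le_eq)
    qed
    then show ?thesis using yp(1) ym(1) unfolding a_def d_def by (intro bexI[of _ yp] bexI[of _ ym]) auto
  qed
  show thesis
    by (rule that[of "K0 + K1"]) (use K0 main in \<open>auto simp: K1_def add_pos_nonneg\<close>)
qed

lemma cos_ge_quadratic: "1 - x\<^sup>2 / 2 \<le> cos (x::real)"
proof -
  have "(sin (x/2))\<^sup>2 \<le> (x/2)\<^sup>2"
    using abs_sin_x_le_abs_x[of "x/2"] by (simp only: abs_le_square_iff)
  then show ?thesis using cos_double_sin[of "x/2"] by (simp add: power_divide)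
qed

text \<open>The cut separates a part \<open>U\<close> of the disc, which contains the box, from the
  rest \<open>V\<close>, and the image of the cut lies in a disc of radius K1 d about f(a). A
  connected subset of \<Omega> off that disc cannot join the images of \<open>U\<close> and
  \<open>V\<close>, so by the turning estimate one of the two images lies in the disc enlarged by
  the factor \<open>M\<close>. If it is that of \<open>V\<close>, then d has a fixed positive lower
  bound, because \<open>V\<close> contains the disc of radius 1/4, and the diameter of \<Omega> is
  at most a multiple of d. Boxes with l >= 1/20 are settled by the diameter as well.\<close>

lemma quasidisc_box_image:
  fixes \<Omega> :: "complex set" and \<psi> :: "complex \<Rightarrow> complex"
  assumes bd: "bounded \<Omega>" and ud: "uniform_domain \<Omega>"
    and psi: "\<psi> holomorphic_on ball 0 1" "inj_on \<psi> (ball 0 1)" "\<psi> ` ball 0 1 = \<Omega>"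
  obtains K where "K > 0" "\<And>\<theta> l. 0 < l \<Longrightarrow> l \<le> 1 \<Longrightarrow>
    \<psi> ` carleson_box \<theta> l \<subseteq> cball (\<psi> (of_real (1 - 3*l/4) * cis \<theta>)) (K * (cmod (deriv \<psi> (of_real (1 - 3*l/4) * cis \<theta>)) * l))"
proof -
  obtain C where C: "C > 0" and turn: "\<And>z1 z2. z1 \<in> frontier \<Omega> \<Longrightarrow> z2 \<in> frontier \<Omega> \<Longrightarrow>
     \<exists>E. connected E \<and> z1 \<in> E \<and> z2 \<in> E \<and> E \<subseteq> frontier \<Omega> \<and> E \<subseteq> cball z1 (C * cmod (z1 - z2))"
    by (rule uniform_domain_bounded_turning[OF ud]) (rule that)
  have \<Omega>: "open \<Omega>" "connected \<Omega>" using ud unfolding uniform_domain_def jordan_domain_def by auto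
  obtain K1 where K1: "K1 > 0" and cc: "\<And>f l. f holomorphic_on ball 0 1 \<Longrightarrow> inj_on f (ball 0 1) \<Longrightarrow> 0 < l \<Longrightarrow> l \<le> 1/20 \<Longrightarrow>
    \<exists>yp\<in>{l<..<2*l}. \<exists>ym\<in>{-2*l<..<-l}. \<forall>z\<in>ball 0 1.
      (Re z \<ge> 1 - 4*l \<and> (Im z = yp \<or> Im z = ym)) \<or> (Re z = 1 - 4*l \<and> ym \<le> Im z \<and> Im z \<le> yp) \<longrightarrow>
      cmod (f z - f (of_real (1 - 3*l/4))) \<le> K1 * (cmod (deriv f (of_real (1 - 3*l/4))) * l)"
    by (rule crosscut_bound) (rule that)
  obtain Cd :: "real \<Rightarrow> real" where Cd: "\<And>K. Cd K \<ge> 1"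
    "\<And>K f \<eta> a b. f holomorphic_on ball 0 1 \<Longrightarrow> inj_on f (ball 0 1) \<Longrightarrow> \<eta> > 0 \<Longrightarrow> \<eta> \<le> 1 - cmod a \<Longrightarrow> \<eta> \<le> 1 - cmod b
      \<Longrightarrow> cmod (b - a) \<le> K * \<eta> \<Longrightarrow> cmod (deriv f b) \<le> Cd K * cmod (deriv f a)"
    by (rule univalent_distortion) (rule that)
  obtain \<Delta> where D0: "\<And>x y. x \<in> \<Omega> \<Longrightarrow> y \<in> \<Omega> \<Longrightarrow> dist x y \<le> \<Delta>"
    using bd diameter_bounded(1) by (metis diameter_bounded_bound)
  have nz: "deriv \<psi> z \<noteq> 0" if "z \<in> ball 0 1" for z
    using holomorphic_has_inverse[OF psi(1) open_ball psi(2)] that by (metis mult_zero_left zero_neq_one)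
  have in\<Omega>: "\<psi> z \<in> \<Omega>" if "cmod z < 1" for z using psi(3) that by auto
  define c0 where "c0 = cmod (\<psi> (1/4) - \<psi> 0)"
  have c0: "c0 > 0" using inj_onD[OF psi(2), of "1/4" 0] by (auto simp: c0_def)
  define M where "M = 1 + 2 * C"
  have M: "M > 0" using C by (simp add: M_def)
  have \<Delta>: "\<Delta> > 0"
  proof -
    have "c0 \<le> \<Delta>" unfolding c0_def using D0[OF in\<Omega> in\<Omega>, of "1/4" 0] by (simp add: dist_norm)
    then show ?thesis using c0 by simp
  qed
  \<comment> \<open>For l >= 1/20 the centre and 0 both keep distance 3/80 from the circle, and they
    are less than 27 * 3/80 apart.\<close>
  define KA where "KA = \<Delta> * (20 * Cd 27) / cmod (deriv \<psi> 0)"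
  define KB where "KB = M * K1 + \<Delta> * (2 * M * K1 / c0)"
  have d00: "cmod (deriv \<psi> 0) > 0" using nz[of 0] by simp
  have KAB: "KA > 0" "KB > 0" "M * K1 > 0" using \<Delta> M K1 c0 d00 Cd(1)[of 27]
    by (auto simp: KA_def KB_def intro!: divide_pos_pos mult_pos_pos add_pos_pos)
  have small: "\<psi> ` carleson_box \<theta> l \<subseteq> cball (\<psi> (of_real (1 - 3*l/4) * cis \<theta>)) (KB * (cmod (deriv \<psi> (of_real (1 - 3*l/4) * cis \<theta>)) * l))"
    if l: "0 < l" "l \<le> 1/20" for \<theta> l
  proof -
    \<comment> \<open>A rotation moves the centre of the box to the positive real axis, where the
      cut is formulated.\<close>
    define f where "f z = \<psi> (cis \<theta> * z)" for z
    have rotD: "cis \<theta> * z \<in> ball 0 1" if "z \<in> ball 0 1" for z using that by (simp add: norm_mult)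
    have fh: "f holomorphic_on ball 0 1" unfolding f_def
      by (rule holomorphic_on_compose_gen[OF _ psi(1), unfolded o_def]) (use rotD in \<open>auto intro!: holomorphic_intros\<close>)
    have fi: "inj_on f (ball 0 1)"
    proof (rule inj_onI)
      fix x y assume "x \<in> ball 0 1" "y \<in> ball 0 1" "f x = f y"
      then have "cis \<theta> * x = cis \<theta> * y"
        using inj_onD[OF psi(2), of "cis \<theta> * x" "cis \<theta> * y"] rotD by (simp add: f_def)
      then show "x = y" by simp
    qed
    define a :: complex where "a = of_real (1 - 3*l/4)"
    have aD: "a \<in> ball 0 1" using l by (simp add: a_def norm_of_real del: of_real_diff)
    have fd: "deriv f a = deriv \<psi> (a * cis \<theta>) * cis \<theta>"
    proof -
      have "((\<lambda>u. \<psi> (cis \<theta> * u)) has_field_derivative deriv \<psi> (cis \<theta> * a) * cis \<theta>) (at a)"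
        using rotD[OF aD] by (intro DERIV_chain2[where f = \<psi> and g = "\<lambda>u. cis \<theta> * u"])
           (auto intro!: derivative_eq_intros holomorphic_derivI[OF psi(1)])
      then show ?thesis unfolding f_def by (simp add: DERIV_imp_deriv mult.commute)
    qed
    define d where "d = cmod (deriv f a) * l"
    have d: "d > 0" using nz[OF rotD[OF aD]] l by (simp add: d_def fd norm_mult mult.commute)
    have fa: "f a = \<psi> (a * cis \<theta>)" by (simp add: f_def mult.commute)
    obtain yp ym where yp: "yp \<in> {l<..<2*l}" and ym: "ym \<in> {-2*l<..<-l}"
      and cut: "\<And>z. z \<in> ball 0 1 \<Longrightarrow> (Re z \<ge> 1 - 4*l \<and> (Im z = yp \<or> Im z = ym)) \<or> (Re z = 1 - 4*l \<and> ym \<le> Im z \<and> Im z \<le> yp) \<Longrightarrow>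
        cmod (f z - f a) \<le> K1 * d"
      using cc[OF fh fi l] unfolding a_def d_def by blast
    define U where "U = ball 0 1 \<inter> {z. Re z > 1 - 4*l} \<inter> {z. Im z > ym} \<inter> {z. Im z < yp}"
    define V where "V = ball 0 1 \<inter> ({z. Re z < 1 - 4*l} \<union> {z. Im z < ym} \<union> {z. Im z > yp})"
    have opU: "open U" "open V" unfolding U_def V_def
      by (intro open_Int open_Un open_ball open_halfspace_Re_gt open_halfspace_Re_lt open_halfspace_Im_gt open_halfspace_Im_lt)+
    have UV: "U \<subseteq> ball 0 1" "V \<subseteq> ball 0 1" "U \<inter> V = {}" by (auto simp: U_def V_def)
    have open_im: "open (f ` U)" "open (f ` V)"
      using open_mapping_thm3[OF holomorphic_on_subset[OF fh UV(1)] opU(1) inj_on_subset[OF fi UV(1)]]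
        open_mapping_thm3[OF holomorphic_on_subset[OF fh UV(2)] opU(2) inj_on_subset[OF fi UV(2)]] by auto
    have disj: "f ` U \<inter> f ` V = {}" using UV fi by (auto simp: inj_on_def) (metis disjoint_iff subsetD)
    have f\<Omega>: "f z \<in> \<Omega>" if "z \<in> ball 0 1" for z using in\<Omega>[of "cis \<theta> * z"] that by (simp add: f_def norm_mult)
    have \<Omega>f: "\<exists>z\<in>ball 0 1. w = f z" if w: "w \<in> \<Omega>" for w
    proof -
      obtain z where z: "z \<in> ball 0 1" "w = \<psi> z" using psi(3) w by auto
      then show ?thesis by (intro bexI[of _ "cis (-\<theta>) * z"]) (auto simp: f_def norm_mult cis_mult simp flip: mult.assoc)
    qed
    have sep: "f ` U \<subseteq> cball (f a) (M * (K1 * d)) \<or> f ` V \<subseteq> cball (f a) (M * (K1 * d))"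
    proof (rule ccontr)
      assume "\<not> ?thesis"
      then obtain p q where p: "p \<in> U" "f p \<notin> cball (f a) (M * (K1 * d))" and q: "q \<in> V" "f q \<notin> cball (f a) (M * (K1 * d))"
        by blast
      have "\<exists>T. connected T \<and> f p \<in> T \<and> f q \<in> T \<and> T \<subseteq> \<Omega> - cball (f a) (K1 * d)"
        using bounded_turning_separation[OF \<Omega> bd C turn, of "K1 * d" "f p" "f a" "f q"] p q f\<Omega> UV K1 d
        unfolding M_def by (meson mult_pos_pos subsetD)
      then obtain T where T: "connected T" "f p \<in> T" "f q \<in> T" "T \<subseteq> \<Omega> - cball (f a) (K1 * d)" by blast
      have "T \<subseteq> f ` U \<union> f ` V"
      proof
        fix w assume w: "w \<in> T"
        then obtain z where z: "z \<in> ball 0 1" "w = f z" using \<Omega>f T(4) by blast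
        have "cmod (f z - f a) > K1 * d" using w z T(4) by (auto simp: dist_norm norm_minus_commute)
        then have "\<not> ((Re z \<ge> 1 - 4*l \<and> (Im z = yp \<or> Im z = ym)) \<or> (Re z = 1 - 4*l \<and> ym \<le> Im z \<and> Im z \<le> yp))"
          using cut[OF z(1)] by linarith
        then have "z \<in> U \<or> z \<in> V" using z(1) by (auto simp: U_def V_def)
        then show "w \<in> f ` U \<union> f ` V" using z by blast
      qed
      then show False
        using connectedD[OF T(1) open_im] T(2,3) p(1) q(1) disj by blast
    qed
    have fU: "f ` U \<subseteq> cball (f a) (KB * d)"
    proof -
      have KB1: "M * (K1 * d) \<le> KB * d" unfolding KB_def distrib_right using \<Delta> M K1 c0 d by simp
      show ?thesis using sep
      proof
        assume "f ` U \<subseteq> cball (f a) (M * (K1 * d))"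
        then show ?thesis using KB1 by (meson order_trans subset_cball)
      next
        assume V: "f ` V \<subseteq> cball (f a) (M * (K1 * d))"
        have inV: "z \<in> V" if "cmod z \<le> 1/4" for z
          using that l complex_Re_le_cmod[of z] by (auto simp: V_def)
        \<comment> \<open>The second point is rotated back, so that its image is \<psi>(1/4) for
          every angle and \<open>c0\<close> does not depend on the box.\<close>
        have "f 0 \<in> cball (f a) (M * (K1 * d))" "f (cis (-\<theta>) * (1/4)) \<in> cball (f a) (M * (K1 * d))"
          using V inV[of 0] inV[of "cis (-\<theta>) * (1/4)"] by (auto simp: norm_mult norm_divide)
        moreover have "f (cis (-\<theta>) * (1/4)) = \<psi> (1/4)" "f 0 = \<psi> 0" by (auto simp: f_def cis_mult simp flip: mult.assoc)
        ultimately have "dist (f a) (\<psi> (1/4)) \<le> M * (K1 * d)" "dist (f a) (\<psi> 0) \<le> M * (K1 * d)" by auto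
        then have "c0 \<le> 2 * (M * (K1 * d))"
          using dist_triangle3[of "\<psi> (1/4)" "\<psi> 0" "f a"] by (simp add: c0_def dist_norm)
        then have "\<Delta> * 1 \<le> \<Delta> * (2 * M * K1 * d / c0)" using c0 \<Delta> by (intro mult_left_mono) (auto simp: field_simps)
        also have "\<dots> \<le> KB * d" unfolding KB_def distrib_right using mult_pos_pos[OF KAB(3) d] by (simp add: mult_ac)
        finally have "\<Delta> \<le> KB * d" by simp
        moreover have "dist (f a) (f w) \<le> \<Delta>" if "w \<in> U" for w
          using D0[OF f\<Omega>[OF aD] f\<Omega>, of w] UV(1) that by blast
        ultimately show ?thesis by (meson image_subsetI mem_cball order_trans)
      qed
    qed
    have "\<psi> z \<in> cball (\<psi> (a * cis \<theta>)) (KB * (cmod (deriv \<psi> (a * cis \<theta>)) * l))" if z: "z \<in> carleson_box \<theta> l" for z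
    proof -
      obtain t where t: "z = of_real (cmod z) * cis t" "\<bar>t - \<theta>\<bar> \<le> l/2" and zz: "cmod z < 1" "1 - cmod z \<le> l"
        using z by (auto simp: carleson_box_def)
      define w where "w = of_real (cmod z) * cis (t - \<theta>)"
      have wz: "cis \<theta> * w = z" 
      proof -
        have "cis \<theta> * w = of_real (cmod z) * (cis \<theta> * cis (t - \<theta>))" by (simp add: w_def mult_ac)
        then show ?thesis using t(1) by (simp add: cis_mult)
      qed
      have "w \<in> U"
      proof -
        have "1 - (l/2)\<^sup>2 / 2 \<le> 1 - (t - \<theta>)\<^sup>2 / 2" using t(2) power_mono[OF t(2), of 2] by simp
        also have "\<dots> \<le> cos (t - \<theta>)" by (rule cos_ge_quadratic)
        finally have c: "1 - l*l/8 \<le> cos (t - \<theta>)" by (simp add: power2_eq_square)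
        have ll: "l * l \<le> l * (1/20)" using l by (intro mult_left_mono) auto
        have c': "1 - l/160 \<le> cos (t - \<theta>)" using c ll by linarith
        have "(1 - l) * (1 - l/160) \<le> cmod z * cos (t - \<theta>)"
          using zz l by (intro mult_mono c') auto
        moreover have "(1 - l) * (1 - l/160) > 1 - 4*l" 
        proof -
          have "0 < l * l" using l by simp
          moreover have "(1 - l) * (1 - l/160) = 1 - l - l/160 + l*l/160" by (simp add: field_simps)
          ultimately show ?thesis using l(1) by linarith
        qed
        moreover have "\<bar>cmod z * sin (t - \<theta>)\<bar> \<le> 1 * (l/2)"
          unfolding abs_mult using zz t(2) abs_sin_x_le_abs_x[of "t - \<theta>"] by (intro mult_mono) auto
        moreover have "cmod w < 1" using zz by (simp add: w_def norm_mult)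
        ultimately show ?thesis using yp ym l by (auto simp: U_def w_def)
      qed
      then have "f w \<in> cball (f a) (KB * d)" using fU by blast
      moreover have "f w = \<psi> z" by (simp add: f_def wz)
      ultimately show ?thesis by (simp add: fa d_def fd norm_mult)
    qed
    then show ?thesis unfolding a_def by blast
  qed
  have large: "\<psi> ` carleson_box \<theta> l \<subseteq> cball (\<psi> (of_real (1 - 3*l/4) * cis \<theta>)) (KA * (cmod (deriv \<psi> (of_real (1 - 3*l/4) * cis \<theta>)) * l))"
    if l: "1/20 \<le> l" "l \<le> 1" for \<theta> l
  proof -
    define a where "a = of_real (1 - 3*l/4) * cis \<theta>"
    have na: "cmod a = 1 - 3*l/4" using l by (simp add: a_def norm_mult del: of_real_diff)
    have "cmod (deriv \<psi> 0) \<le> Cd 27 * cmod (deriv \<psi> a)"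
      using l by (intro Cd(2)[OF psi(1,2), of "3/80"]) (auto simp: na)
    then have "\<Delta> \<le> KA * (cmod (deriv \<psi> a) * (1/20))"
      using d00 \<Delta> by (simp add: KA_def field_simps)
    also have "\<dots> \<le> KA * (cmod (deriv \<psi> a) * l)" using KAB l by (intro mult_left_mono) auto
    finally have "\<Delta> \<le> KA * (cmod (deriv \<psi> a) * l)" .
    moreover have "\<psi> a \<in> \<Omega>" using na l by (intro in\<Omega>) auto
    moreover have "\<psi> ` carleson_box \<theta> l \<subseteq> \<Omega>" using in\<Omega> by (auto simp: carleson_box_def)
    ultimately have "\<psi> ` carleson_box \<theta> l \<subseteq> cball (\<psi> a) (KA * (cmod (deriv \<psi> a) * l))"
      by (meson D0 subset_iff mem_cball order_trans)
    then show ?thesis unfolding a_def .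
  qed
  show thesis
  proof (rule that[of "KA + KB"])
    fix \<theta> l :: real assume l: "0 < l" "l \<le> 1"
    let ?s = "cmod (deriv \<psi> (of_real (1 - 3*l/4) * cis \<theta>)) * l"
    have "KA * ?s \<le> (KA + KB) * ?s" "KB * ?s \<le> (KA + KB) * ?s"
      using KAB l by (auto intro!: mult_right_mono)
    then show "\<psi> ` carleson_box \<theta> l \<subseteq> cball (\<psi> (of_real (1 - 3*l/4) * cis \<theta>)) ((KA + KB) * ?s)"
      using small[of l \<theta>] large[of l \<theta>] l by (meson linear order_trans subset_cball)
  qed (use KAB in simp)
qed

subsection \<open>Carleson boxes and dyadic layers\<close>

text \<open>Boxes over half-open arcs, so that the two halves of a box are disjoint. The signs of
  the imaginary parts of rotated points make them Borel sets and determine the arc, since l <= 1 is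
  less than pi; the strict sign also removes the origin.\<close>

definition hbox :: "real \<Rightarrow> real \<Rightarrow> complex set" where
  "hbox \<theta> l = {z. cmod z < 1 \<and> 1 - cmod z \<le> l \<and> 0 \<le> Im (z * cis (-\<theta>)) \<and> Im (z * cis (-(\<theta> + l))) < 0}"

definition strip :: "real \<Rightarrow> real \<Rightarrow> nat \<Rightarrow> complex set" where
  "strip \<theta> l m = {z \<in> hbox \<theta> l. 1 - cmod z \<le> l / 2 ^ m}"

definition layer :: "real \<Rightarrow> real \<Rightarrow> nat \<Rightarrow> complex set" where
  "layer \<theta> l m = {z \<in> hbox \<theta> l. l / 2 ^ Suc m < 1 - cmod z \<and> 1 - cmod z \<le> l / 2 ^ m}"

text \<open>The middle of the top half of the box: 3l/4 is the midpoint of the distances between l/2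
  and l.\<close>

definition zbox :: "real \<Rightarrow> real \<Rightarrow> complex" where
  "zbox \<theta> l = of_real (1 - 3*l/4) * cis (\<theta> + l/2)"

lemma cont_borel: "continuous_on UNIV (g :: complex \<Rightarrow> real) \<Longrightarrow> g \<in> borel_measurable borel"
  by (rule borel_measurable_continuous_onI)

lemma hbox_borel [measurable]: "hbox \<theta> l \<in> sets borel"
proof -
  have [measurable]: "(\<lambda>z. Im (z * c)) \<in> borel_measurable borel" for c by (intro cont_borel continuous_intros)
  show ?thesis unfolding hbox_def by measurable
qed

lemma strip_borel [measurable]: "strip \<theta> l m \<in> sets borel" and layer_borel [measurable]: "layer \<theta> l m \<in> sets borel"
  unfolding strip_def layer_def using hbox_borel by measurable

lemma hbox_lebesgue [simp]: "hbox \<theta> l \<in> sets lebesgue" "strip \<theta> l m \<in> sets lebesgue" "layer \<theta> l m \<in> sets lebesgue"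
  by auto

lemma hbox_disc: "hbox \<theta> l \<subseteq> disc" "strip \<theta> l m \<subseteq> hbox \<theta> l" "layer \<theta> l m \<subseteq> hbox \<theta> l"
  by (auto simp: hbox_def strip_def layer_def)

lemma polar_shift: "Im (of_real r * cis t * cis (-\<theta>)) = r * sin (t - \<theta>)"
  by (simp add: cis_mult mult.assoc)

lemma im_rot: "z = of_real r * cis t \<Longrightarrow> Im (z * cis (-\<theta>)) = r * sin (t - \<theta>)"
  by (simp only: polar_shift)

lemma Arg2pi_cis: "z = of_real (cmod z) * cis (Arg2pi z)"
  unfolding cis_conv_exp by (rule Arg2pi_eq)

lemma mem_hboxI:
  assumes "0 < r" "r < 1" "1 - r \<le> l" "l \<le> 1" "\<theta> \<le> t" "t < \<theta> + l"
  shows "of_real r * cis t \<in> hbox \<theta> l"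
proof -
  have "0 \<le> sin (t - \<theta>)" using assms pi_gt3 by (intro sin_ge_zero) auto
  moreover have "sin (\<theta> + l - t) > 0" using assms pi_gt3 by (intro sin_gt_zero) auto
  then have "sin (t - (\<theta> + l)) < 0" using sin_minus[of "\<theta> + l - t"] by simp
  ultimately show ?thesis
    using assms unfolding hbox_def mem_Collect_eq polar_shift by (auto simp: norm_mult mult_pos_neg)
qed

lemma hbox_polar:
  assumes z: "z \<in> hbox \<theta> l" and l: "0 < l" "l \<le> 1"
  obtains t where "z = of_real (cmod z) * cis t" "\<theta> \<le> t" "t < \<theta> + l" "0 < cmod z"
proof -
  define s where "s = Arg2pi (z * cis (-\<theta>))"
  have z0: "z \<noteq> 0" using z by (auto simp: hbox_def)
  have s: "0 \<le> s" "s < 2 * pi" 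
    using Arg2pi_ge_0 Arg2pi_lt_2pi by (simp_all add: s_def)
  have nrm: "cmod (z * cis (-\<theta>)) = cmod z" by (simp add: norm_mult)
  have zs: "z * cis (-\<theta>) = of_real (cmod z) * cis s"
    by (rule Arg2pi_cis[of "z * cis (-\<theta>)", unfolded nrm, folded s_def])
  have "z = z * cis (-\<theta>) * cis \<theta>" by (simp add: cis_mult mult.assoc)
  then have zt: "z = of_real (cmod z) * cis (\<theta> + s)" unfolding zs by (simp add: cis_mult mult.assoc add.commute)
  have "0 \<le> Im (z * cis (-\<theta>))" "Im (z * cis (-(\<theta> + l))) < 0" using z by (auto simp: hbox_def)
  then have "0 \<le> cmod z * sin s" "cmod z * sin (s - l) < 0"
    by (simp_all only: im_rot[OF zt] add_diff_cancel_left' add_diff_cancel_left)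
  then have sins: "0 \<le> sin s" "sin (s - l) < 0" using z0 by (auto simp: zero_le_mult_iff mult_less_0_iff)
  have "s \<le> pi" using sins(1) sin_lt_zero[of s] s by linarith
  then have "s < l" using sins(2) sin_ge_zero[of "s - l"] l by linarith
  with zt s z0 show thesis by (intro that[of "\<theta> + s"]) auto
qed

lemma hbox_subset_carleson:
  assumes l: "0 < l" "l \<le> 1"
  shows "hbox \<theta> l \<subseteq> carleson_box (\<theta> + l/2) l"
proof
  fix z assume z: "z \<in> hbox \<theta> l"
  obtain t where "z = of_real (cmod z) * cis t" "\<theta> \<le> t" "t < \<theta> + l" by (rule hbox_polar[OF z l])
  moreover from this(2,3) have "\<bar>t - (\<theta> + l/2)\<bar> \<le> l/2" by linarith
  ultimately show "z \<in> carleson_box (\<theta> + l/2) l" using z unfolding carleson_box_def hbox_def by blast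
qed

lemma hbox_half:
  assumes l: "0 < l" "l \<le> 1"
  shows "hbox \<theta> (l/2) \<subseteq> hbox \<theta> l" "hbox (\<theta> + l/2) (l/2) \<subseteq> hbox \<theta> l"
    "hbox \<theta> (l/2) \<inter> hbox (\<theta> + l/2) (l/2) = {}"
    "strip \<theta> l (Suc m) \<subseteq> strip \<theta> (l/2) m \<union> strip (\<theta> + l/2) (l/2) m"
    "hbox \<theta> (l/2) \<union> hbox (\<theta> + l/2) (l/2) \<subseteq> hbox \<theta> l - layer \<theta> l 0"
proof -
  show 1: "hbox \<theta> (l/2) \<subseteq> hbox \<theta> l"
  proof
    fix z assume z: "z \<in> hbox \<theta> (l/2)"
    obtain t where t: "z = of_real (cmod z) * cis t" "\<theta> \<le> t" "t < \<theta> + l/2" "0 < cmod z"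
      by (rule hbox_polar[OF z]) (use l in auto)
    have "of_real (cmod z) * cis t \<in> hbox \<theta> l" using t(2-) z l by (intro mem_hboxI) (auto simp: hbox_def)
    then show "z \<in> hbox \<theta> l" using t(1) by simp
  qed
  show 2: "hbox (\<theta> + l/2) (l/2) \<subseteq> hbox \<theta> l"
  proof
    fix z assume z: "z \<in> hbox (\<theta> + l/2) (l/2)"
    obtain t where t: "z = of_real (cmod z) * cis t" "\<theta> + l/2 \<le> t" "t < \<theta> + l/2 + l/2" "0 < cmod z"
      by (rule hbox_polar[OF z]) (use l in auto)
    have "of_real (cmod z) * cis t \<in> hbox \<theta> l" using t(2-) z l by (intro mem_hboxI) (auto simp: hbox_def)
    then show "z \<in> hbox \<theta> l" using t(1) by simp
  qed
  show "hbox \<theta> (l/2) \<inter> hbox (\<theta> + l/2) (l/2) = {}" unfolding hbox_def by auto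
  show "strip \<theta> l (Suc m) \<subseteq> strip \<theta> (l/2) m \<union> strip (\<theta> + l/2) (l/2) m"
  proof
    fix z assume z: "z \<in> strip \<theta> l (Suc m)"
    have "l / 2 ^ Suc m \<le> l / 2" using l by (intro divide_left_mono) auto
    then have "1 - cmod z \<le> l/2" "1 - cmod z \<le> (l/2) / 2 ^ m" using z by (auto simp: strip_def)
    moreover have eq: "\<theta> + l/2 + l/2 = \<theta> + l" by simp
    moreover have "cmod z < 1" "0 \<le> Im (z * cis (-\<theta>))" "Im (z * cis (-(\<theta> + l))) < 0"
      using z unfolding strip_def hbox_def by blast+
    ultimately show "z \<in> strip \<theta> (l/2) m \<union> strip (\<theta> + l/2) (l/2) m"
      unfolding strip_def hbox_def eq Un_iff mem_Collect_eq by linarith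
  qed
  have "z \<notin> layer \<theta> l 0" if "z \<in> hbox \<theta>' (l/2)" for z \<theta>' using that by (auto simp: layer_def hbox_def)
  then show "hbox \<theta> (l/2) \<union> hbox (\<theta> + l/2) (l/2) \<subseteq> hbox \<theta> l - layer \<theta> l 0" using 1 2 by blast
qed

text \<open>Follows m bisections. A point of the m-th layer is thereby recognised as a point of the
  top half of a smaller box, where distortion applies.\<close>

lemma strip_descend:
  assumes l: "0 < l" "l \<le> 1" and z: "z \<in> strip \<theta> l m"
  shows "\<exists>\<theta>'. z \<in> hbox \<theta>' (l / 2 ^ m) \<and> hbox \<theta>' (l / 2 ^ m) \<subseteq> hbox \<theta> l"
  using assms
proof (induction m arbitrary: \<theta> l)
  case 0
  then show ?case by (auto simp: strip_def)
next
  case (Suc m)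
  obtain \<theta>1 where 1: "z \<in> strip \<theta>1 (l/2) m" "hbox \<theta>1 (l/2) \<subseteq> hbox \<theta> l"
    using hbox_half(1,2,4)[OF Suc.prems(1,2)] Suc.prems(3) by blast
  obtain \<theta>' where "z \<in> hbox \<theta>' (l/2 / 2 ^ m)" "hbox \<theta>' (l/2 / 2 ^ m) \<subseteq> hbox \<theta>1 (l/2)"
    using Suc.IH[OF _ _ 1(1)] Suc.prems by auto
  then show ?case using 1(2) by (auto simp: field_simps)
qed

lemma zbox_norm: "0 < l \<Longrightarrow> l \<le> 1 \<Longrightarrow> cmod (zbox \<theta> l) = 1 - 3*l/4"
  by (simp add: zbox_def norm_mult del: of_real_diff)

lemma zbox_disc: "0 < l \<Longrightarrow> l \<le> 1 \<Longrightarrow> zbox \<theta> l \<in> disc"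
  by (simp add: zbox_norm)

lemma carleson_box_dist:
  assumes l: "0 < l" "l \<le> 1" and z: "z \<in> carleson_box \<theta> l"
  shows "cmod (z - of_real (1 - 3*l/4) * cis \<theta>) \<le> 2 * l"
proof -
  obtain t where t: "z = of_real (cmod z) * cis t" "\<bar>t - \<theta>\<bar> \<le> l/2" "cmod z < 1" "1 - cmod z \<le> l"
    using z by (auto simp: carleson_box_def)
  have "cmod (cis t - cis \<theta>) \<le> \<bar>t - \<theta>\<bar>"
  proof -
    have "cis t - cis \<theta> = cis \<theta> * (cis (t - \<theta>) - 1)" by (simp add: algebra_simps cis_mult)
    then have "cmod (cis t - cis \<theta>) = cmod (cis (t - \<theta>) - 1)" by (simp add: norm_mult)
    also have "\<dots> = 2 * \<bar>sin ((t - \<theta>) / 2)\<bar>" using dist_exp_i_1[of "t - \<theta>"] by (simp add: cis_conv_exp mult.commute)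
    also have "\<dots> \<le> \<bar>t - \<theta>\<bar>" using abs_sin_x_le_abs_x[of "(t - \<theta>) / 2"] by simp
    finally show ?thesis .
  qed
  then have c: "cmod (cis t - cis \<theta>) \<le> l/2" using t by simp
  have "z - of_real (1 - 3*l/4) * cis \<theta> = of_real (cmod z - (1 - 3*l/4)) * cis t + of_real (1 - 3*l/4) * (cis t - cis \<theta>)"
  proof -
    have "w - of_real c * cis \<theta> = of_real (r - c) * cis t + of_real c * (cis t - cis \<theta>)" if "w = of_real r * cis t" for w r c
      by (simp add: that algebra_simps)
    from this[OF t(1)] show ?thesis .
  qed
  then have "cmod (z - of_real (1 - 3*l/4) * cis \<theta>) \<le> cmod (of_real (cmod z - (1 - 3*l/4)) * cis t) + cmod (of_real (1 - 3*l/4) * (cis t - cis \<theta>))"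
    using norm_triangle_ineq by metis
  also have "\<dots> = \<bar>cmod z - (1 - 3*l/4)\<bar> + (1 - 3*l/4) * cmod (cis t - cis \<theta>)"
    using l by (simp add: norm_mult del: of_real_diff)
  also have "\<dots> \<le> l + 1 * (l/2)" using t l c by (intro add_mono mult_mono) auto
  finally show ?thesis using l by simp
qed

text \<open>Trades the existential over angles for sign conditions, from which Borel measurability
  is immediate. The bound l <= 1 < pi excludes the opposite arc.\<close>

lemma carleson_box_eq:
  assumes l: "0 < l" "l \<le> 1"
  shows "carleson_box \<theta> l = {z. cmod z < 1 \<and> 1 - cmod z \<le> l \<and> 0 \<le> Im (z * cis (-(\<theta> - l/2))) \<and> Im (z * cis (-(\<theta> + l/2))) \<le> 0}"
proof (intro equalityI subsetI)
  fix z assume z: "z \<in> carleson_box \<theta> l"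
  obtain t where t: "z = of_real (cmod z) * cis t" "\<bar>t - \<theta>\<bar> \<le> l/2" using z by (auto simp: carleson_box_def)
  have "0 \<le> sin (t - (\<theta> - l/2))" using t(2) l pi_gt3 by (intro sin_ge_zero) linarith+
  moreover have "0 \<le> sin (\<theta> + l/2 - t)" using t(2) l pi_gt3 by (intro sin_ge_zero) linarith+
  then have "sin (t - (\<theta> + l/2)) \<le> 0" using sin_minus[of "\<theta> + l/2 - t"] by simp
  ultimately have "0 \<le> Im (of_real (cmod z) * cis t * cis (-(\<theta> - l/2)))" "Im (of_real (cmod z) * cis t * cis (-(\<theta> + l/2))) \<le> 0"
    unfolding polar_shift by (auto simp: mult_nonneg_nonpos)
  then show "z \<in> {z. cmod z < 1 \<and> 1 - cmod z \<le> l \<and> 0 \<le> Im (z * cis (-(\<theta> - l/2))) \<and> Im (z * cis (-(\<theta> + l/2))) \<le> 0}"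
    using z t(1) by (simp add: carleson_box_def)
next
  fix z assume z: "z \<in> {z. cmod z < 1 \<and> 1 - cmod z \<le> l \<and> 0 \<le> Im (z * cis (-(\<theta> - l/2))) \<and> Im (z * cis (-(\<theta> + l/2))) \<le> 0}"
  define \<phi> where "\<phi> = \<theta> - l/2"
  define s where "s = Arg2pi (z * cis (-\<phi>))"
  show "z \<in> carleson_box \<theta> l"
  proof (cases "z = 0")
    case True
    then show ?thesis using z l by (auto simp: carleson_box_def intro!: exI[of _ \<theta>])
  next
    case False
    have s: "0 \<le> s" "s < 2 * pi" 
    using Arg2pi_ge_0 Arg2pi_lt_2pi by (simp_all add: s_def)
  have nrm: "cmod (z * cis (-\<phi>)) = cmod z" by (simp add: norm_mult)
  have zs: "z * cis (-\<phi>) = of_real (cmod z) * cis s"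
    by (rule Arg2pi_cis[of "z * cis (-\<phi>)", unfolded nrm, folded s_def])
    have "z = z * cis (-\<phi>) * cis \<phi>" by (simp add: cis_mult mult.assoc)
    then have zt: "z = of_real (cmod z) * cis (\<phi> + s)" unfolding zs by (simp add: cis_mult mult.assoc add.commute)
    have e: "\<phi> + l = \<theta> + l/2" "\<theta> - l/2 = \<phi>" by (simp_all add: \<phi>_def)
    have "0 \<le> Im (z * cis (-\<phi>))" "Im (z * cis (-(\<phi> + l))) \<le> 0" unfolding e(1) using z[unfolded e(2)] by blast+
    then have "0 \<le> cmod z * sin s" "cmod z * sin (s - l) \<le> 0"
      by (simp_all only: im_rot[OF zt] add_diff_cancel_left' add_diff_cancel_left)
    then have sins: "0 \<le> sin s" "sin (s - l) \<le> 0" using False by (auto simp: zero_le_mult_iff mult_le_0_iff)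
    have "s \<le> pi" using sins(1) sin_lt_zero[of s] s by linarith
    then have "s \<le> l" using sins(2) sin_gt_zero[of "s - l"] l by linarith
    then have "\<bar>\<phi> + s - \<theta>\<bar> \<le> l/2" using s(1) unfolding \<phi>_def by linarith
    then show ?thesis using z zt unfolding carleson_box_def by blast
  qed
qed

lemma carleson_box_borel:
  assumes l: "0 < l" "l \<le> 1"
  shows "carleson_box \<theta> l \<in> sets borel"
proof -
  have [measurable]: "(\<lambda>z. Im (z * c)) \<in> borel_measurable borel" for c by (intro cont_borel continuous_intros)
  show ?thesis unfolding carleson_box_eq[OF l] by measurable
qed

text \<open>Since sin(l/2) >= l/4 and 1 - 3l/4 >= 1/4, the two imaginary parts that define the box
  have absolute value at least l/16 at the centre, which survives a displacement of l/32.\<close>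

lemma zbox_ball:
  assumes l: "0 < l" "l \<le> 1"
  shows "ball (zbox \<theta> l) (l/32) \<subseteq> layer \<theta> l 0"
proof
  fix z assume "z \<in> ball (zbox \<theta> l) (l/32)"
  then have d: "cmod (z - zbox \<theta> l) < l/32" by (simp add: dist_norm norm_minus_commute)
  have n: "\<bar>cmod z - (1 - 3*l/4)\<bar> < l/32" using norm_triangle_ineq3[of z "zbox \<theta> l"] d zbox_norm[OF l, of \<theta>] by linarith
  have sl: "l/4 \<le> sin (l/2)"
  proof -
    have "1 - (l/2)\<^sup>2/6 \<ge> 1/2" using l power_mono[of "l/2" 1 2] by simp
    have "l/2 * cos (l/2) \<le> sin (l/2)"
    proof -
      have "\<exists>x. 0 < x \<and> x < l/2 \<and> sin (l/2) - sin 0 = (l/2 - 0) * cos x"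
        using l by (intro MVT2) (auto intro!: derivative_eq_intros)
      then obtain x where x: "0 < x" "x < l/2" "sin (l/2) = l/2 * cos x" by auto
      have "cos (l/2) \<le> cos x" using x l pi_gt3 by (intro cos_monotone_0_pi_le) auto
      then show ?thesis using x l by (simp add: mult_left_mono)
    qed
    moreover have "cos (l/2) \<ge> 1/2"
      using cos_monotone_0_pi_le[of "l/2" "pi/3"] l pi_gt3 by (simp add: cos_60)
    then have "l/2 * cos (l/2) \<ge> l/2 * (1/2)" using l by (intro mult_left_mono) auto
    ultimately show ?thesis by linarith
  qed
  have im: "\<bar>Im (z * cis c) - Im (zbox \<theta> l * cis c)\<bar> < l/32" for c
  proof -
    have "\<bar>Im (z * cis c) - Im (zbox \<theta> l * cis c)\<bar> = \<bar>Im ((z - zbox \<theta> l) * cis c)\<bar>" by (simp add: algebra_simps)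
    also have "\<dots> \<le> cmod ((z - zbox \<theta> l) * cis c)" by (rule abs_Im_le_cmod)
    finally show ?thesis using d by (simp add: norm_mult)
  qed
  have "(1 - 3*l/4) * sin (l/2) \<ge> 1/4 * (l/4)" using l sl by (intro mult_mono) auto
  moreover have "Im (zbox \<theta> l * cis (-\<theta>)) = (1 - 3*l/4) * sin (l/2)" "Im (zbox \<theta> l * cis (-(\<theta> + l))) = - ((1 - 3*l/4) * sin (l/2))"
    unfolding zbox_def polar_shift using sin_minus[of "l/2"] by (auto simp: algebra_simps)
  ultimately have "0 \<le> Im (z * cis (-\<theta>))" "Im (z * cis (-(\<theta> + l))) < 0"
    using im[of "-\<theta>"] im[of "-(\<theta> + l)"] l by linarith+
  moreover have "cmod z < 1" "1 - cmod z \<le> l" "l/2 < 1 - cmod z" using n l by linarith+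
  ultimately show "z \<in> layer \<theta> l 0" by (simp add: layer_def hbox_def)
qed

text \<open>The spacing (pi/8) 2^(-n) is less than half the length 2^(-n) of the boxes placed at
  these angles. The overlap guarantees that two nearby points share a box, which a partition into
  dyadic arcs would not.\<close>

definition grid :: "nat \<Rightarrow> nat \<Rightarrow> real" where "grid n j = 2 * pi * real j / (16 * 2 ^ n)"

text \<open>With z cnj(w) = \<rho> e^(-is), the real and imaginary parts of 1 - z cnj(w) bound 1 -
  \<rho> cos s and \<rho> sin s. Distance below 1/8 forces \<rho> and cos s to be at least 7/8, so
  |s| <= (8/7)^2 d <= 2d.\<close>

lemma bergman_kernel_angle:
  assumes z: "cmod z < 1" and w: "cmod w < 1" and d: "cmod (1 - z * cnj w) < 1/8"
  obtains s where "z \<noteq> 0" "w \<noteq> 0" "w / of_real (cmod w) = z / of_real (cmod z) * cis s" "\<bar>s\<bar> \<le> 2 * cmod (1 - z * cnj w)"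
    "1 - cmod z \<le> cmod (1 - z * cnj w)" "1 - cmod w \<le> cmod (1 - z * cnj w)"
proof -
  let ?d = "cmod (1 - z * cnj w)"
  define \<rho> where "\<rho> = cmod z * cmod w"
  have r: "1 - \<rho> \<le> ?d" using norm_triangle_ineq2[of 1 "z * cnj w"] by (simp add: \<rho>_def norm_mult)
  have "\<rho> \<le> cmod z" "\<rho> \<le> cmod w" using z w by (auto simp: \<rho>_def mult_left_le mult_left_le_one_le)
  then have h: "1 - cmod z \<le> ?d" "1 - cmod w \<le> ?d" using r by auto
  then have nz: "z \<noteq> 0" "w \<noteq> 0" using d by auto
  define s where "s = Arg (w / z)"
  have sb: "-pi < s" "s \<le> pi" using Arg_bounded[of "w / z"] by (auto simp: s_def)
  have e: "w / z = of_real (cmod w / cmod z) * cis s"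
    using nz Arg_eq[of "w / z"] by (simp add: s_def norm_divide cis_conv_exp mult.commute)
  then have ws: "w / of_real (cmod w) = z / of_real (cmod z) * cis s"
    using nz by (simp add: field_simps)
  have wz: "w = of_real (cmod w / cmod z) * cis s * z" using e nz by (simp add: field_simps)
  have cw: "cnj w = of_real (cmod w / cmod z) * cis (-s) * cnj z"
    using arg_cong[OF wz, of cnj] by (simp only: complex_cnj_mult complex_cnj_complex_of_real cis_cnj)
  have "z * cnj w = of_real (cmod w / cmod z) * cis (-s) * (z * cnj z)"
    by (subst cw) (simp only: mult_ac)
  also have "z * cnj z = of_real (cmod z * cmod z)" by (simp add: complex_norm_square[symmetric] power2_eq_square)
  finally have zw: "z * cnj w = of_real \<rho> * cis (-s)" using nz by (simp add: \<rho>_def)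
  have "\<bar>Re (1 - z * cnj w)\<bar> \<le> ?d" "\<bar>Im (1 - z * cnj w)\<bar> \<le> ?d" by (rule abs_Re_le_cmod abs_Im_le_cmod)+
  then have re: "1 - \<rho> * cos s \<le> ?d" and im: "\<bar>\<rho> * sin s\<bar> \<le> ?d" unfolding zw by auto
  have \<rho>: "7/8 < \<rho>" "\<rho> \<le> 1" using r d z \<open>\<rho> \<le> cmod z\<close> by auto
  have c: "cos s \<ge> 7/8"
  proof -
    have p: "\<rho> * cos s \<ge> 7/8" using re d by linarith
    then have "0 < cos s" using \<rho> zero_less_mult_pos[of \<rho> "cos s"] by linarith
    then have "\<rho> * cos s \<le> 1 * cos s" using \<rho> by (intro mult_right_mono) auto
    then show ?thesis using p by linarith
  qed
  have "7/8 * \<bar>s\<bar> \<le> \<bar>sin s\<bar>"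
  proof (cases "s = 0")
    case False
    have "\<exists>x. 0 < x \<and> x < \<bar>s\<bar> \<and> sin \<bar>s\<bar> - sin 0 = (\<bar>s\<bar> - 0) * cos x"
      using False by (intro MVT2) (auto intro!: derivative_eq_intros)
    then obtain x where x: "0 < x" "x < \<bar>s\<bar>" "sin \<bar>s\<bar> = \<bar>s\<bar> * cos x" by auto
    have "cos \<bar>s\<bar> \<le> cos x" using x sb by (intro cos_monotone_0_pi_le) auto
    then have "7/8 \<le> cos x" using c by simp
    then have "\<bar>s\<bar> * (7/8) \<le> sin \<bar>s\<bar>" unfolding x(3) by (intro mult_left_mono) auto
    moreover have "\<bar>sin s\<bar> = \<bar>sin \<bar>s\<bar>\<bar>" by (simp add: abs_if)
    ultimately show ?thesis by linarith
  qed simp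
  moreover have "7/8 * \<bar>sin s\<bar> \<le> ?d"
  proof -
    have "7/8 * \<bar>sin s\<bar> \<le> \<rho> * \<bar>sin s\<bar>" using \<rho> by (intro mult_right_mono) auto
    then show ?thesis using im \<rho> by (simp add: abs_mult)
  qed
  ultimately have "\<bar>s\<bar> \<le> 2 * ?d" using norm_ge_zero[of "1 - z * cnj w"] by linarith
  then show thesis using that nz ws h by blast
qed

lemma bergman_kernel_box_aux:
  assumes z: "cmod z < 1" "z \<noteq> 0" and w: "cmod w < 1" "w \<noteq> 0" and s: "0 \<le> s" "s \<le> 2 * d"
    and ws: "w / of_real (cmod w) = z / of_real (cmod z) * cis s"
    and h: "1 - cmod z \<le> d" "1 - cmod w \<le> d" and n: "8 * d \<le> 1 / 2 ^ n"
  shows "\<exists>j<16 * 2 ^ n. z \<in> hbox (grid n j) (1 / 2 ^ n) \<and> w \<in> hbox (grid n j) (1 / 2 ^ n)"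
proof -
  define \<alpha> where "\<alpha> = Arg2pi z"
  define N :: real where "N = 16 * 2 ^ n"
  have N: "N > 0" by (simp add: N_def)
  have \<alpha>: "0 \<le> \<alpha>" "\<alpha> < 2 * pi" 
    using Arg2pi_ge_0 Arg2pi_lt_2pi by (simp_all add: \<alpha>_def)
  have za: "z = of_real (cmod z) * cis \<alpha>" unfolding \<alpha>_def by (rule Arg2pi_cis)
  have wa: "w = of_real (cmod w) * cis (\<alpha> + s)"
  proof -
    have "z / of_real (cmod z) = cis \<alpha>" using za z(2) by (metis nonzero_mult_div_cancel_left norm_eq_zero of_real_eq_0_iff)
    then show ?thesis using ws w(2) by (simp add: cis_mult field_simps)
  qed
  \<comment> \<open>The grid angle just below that of \<open>z\<close>, less than half a box length
    away. Since s <= 2d is at most a quarter of a box length, the angle of \<open>w\<close> stays in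
    the same box.\<close>
  define j where "j = nat \<lfloor>\<alpha> * N / (2 * pi)\<rfloor>"
  have x0: "0 \<le> \<alpha> * N / (2 * pi)" using \<alpha> N by simp
  have "\<alpha> * N / (2 * pi) < N" using \<alpha> N by (simp add: divide_less_eq mult.commute)
  then have "real j < N" unfolding j_def using x0 by linarith
  then have jN: "j < 16 * 2 ^ n" unfolding N_def by (metis of_nat_less_iff of_nat_mult of_nat_numeral of_nat_power)
  have jx: "real j \<le> \<alpha> * N / (2 * pi)" "\<alpha> * N / (2 * pi) < real j + 1" unfolding j_def using x0 by linarith+
  have g: "grid n j = 2 * pi * real j / N" by (simp add: grid_def N_def)
  have g1: "grid n j \<le> \<alpha>" using jx(1) N unfolding g by (simp add: field_simps)
  have "\<alpha> < 2 * pi * (real j + 1) / N" using jx(2) N by (simp add: field_simps)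
  also have "\<dots> = grid n j + (pi / 8) * (1 / 2 ^ n)" unfolding g by (simp add: N_def field_simps)
  also have "\<dots> \<le> grid n j + 1/2 * (1 / 2 ^ n)" using pi_less_4 by (intro add_left_mono mult_right_mono) auto
  finally have g2: "\<alpha> < grid n j + 1/2 * (1 / 2 ^ n)" .
  have d0: "d > 0" using h z by simp
  have l: "(1::real) / 2 ^ n \<le> 1" by simp
  have zw0: "0 < cmod z" "0 < cmod w" using z w by simp_all
  have "of_real (cmod z) * cis \<alpha> \<in> hbox (grid n j) (1 / 2 ^ n)"
    using z(1) h n g1 g2 d0 l zw0 by (intro mem_hboxI) linarith+
  moreover have "of_real (cmod w) * cis (\<alpha> + s) \<in> hbox (grid n j) (1 / 2 ^ n)"
    using w(1) h n g1 g2 d0 l s zw0 by (intro mem_hboxI) linarith+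
  ultimately show ?thesis using jN za wa by metis
qed

text \<open>The generation is chosen with 8d <= 2^(-n) < 16d: the boxes are long enough to hold both
  points and short enough that 1/d^2 is at most 256 * 4^n. The sign of the angle only decides which
  point comes first.\<close>

lemma bergman_kernel_box:
  assumes z: "cmod z < 1" and w: "cmod w < 1" and d: "cmod (1 - z * cnj w) < 1/8"
  shows "\<exists>n. 1 / (cmod (1 - z * cnj w))\<^sup>2 \<le> 256 * 4 ^ n \<and>
     (\<exists>j<16 * 2 ^ n. z \<in> hbox (grid n j) (1 / 2 ^ n) \<and> w \<in> hbox (grid n j) (1 / 2 ^ n))"
proof -
  let ?d = "cmod (1 - z * cnj w)"
  obtain s where s: "z \<noteq> 0" "w \<noteq> 0" "w / of_real (cmod w) = z / of_real (cmod z) * cis s" "\<bar>s\<bar> \<le> 2 * ?d"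
    "1 - cmod z \<le> ?d" "1 - cmod w \<le> ?d" by (rule bergman_kernel_angle[OF assms])
  have d0: "?d > 0" using s(5) z by linarith
  define P where "P n \<longleftrightarrow> (1/2) ^ n < 16 * ?d" for n
  obtain n0 where "P n0" unfolding P_def using real_arch_pow_inv[of "16 * ?d" "1/2"] d0 by auto
  define n where "n = (LEAST n. P n)"
  have n1: "P n" unfolding n_def by (rule LeastI[of P, OF \<open>P n0\<close>])
  have n2: "8 * ?d \<le> 1 / 2 ^ n"
  proof (cases n)
    case 0
    then show ?thesis using d by simp
  next
    case (Suc m)
    then have "\<not> P m" using not_less_Least[of m P] by (auto simp: n_def)
    then show ?thesis using Suc by (simp add: P_def power_divide field_simps)
  qed
  have k: "1 / ?d\<^sup>2 \<le> 256 * 4 ^ n"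
  proof -
    have "1 / ?d \<le> 16 * 2 ^ n" using n1 d0 by (simp add: P_def field_simps power_divide)
    then have "(1 / ?d)\<^sup>2 \<le> (16 * 2 ^ n)\<^sup>2" using d0 by (intro power_mono) auto
    also have "(16 * 2 ^ n)\<^sup>2 = 256 * (4::real) ^ n" by (simp add: power_mult_distrib power2_eq_square flip: power_mult_distrib)
    finally show ?thesis by (simp add: power_divide)
  qed
  have "\<exists>j<16 * 2 ^ n. z \<in> hbox (grid n j) (1 / 2 ^ n) \<and> w \<in> hbox (grid n j) (1 / 2 ^ n)"
  proof (cases "s \<ge> 0")
    case True
    then show ?thesis using s z w n2 by (intro bergman_kernel_box_aux[where s = s and d = ?d]) auto
  next
    case False
    have "z / of_real (cmod z) = w / of_real (cmod w) * cis (-s)"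
      unfolding s(3) by (simp add: cis_mult mult.assoc)
    then have "\<exists>j<16 * 2 ^ n. w \<in> hbox (grid n j) (1 / 2 ^ n) \<and> z \<in> hbox (grid n j) (1 / 2 ^ n)"
      using s z w n2 False by (intro bergman_kernel_box_aux[where s = "-s" and d = ?d]) auto
    then show ?thesis by blast
  qed
  then show ?thesis using k by blast
qed

lemma hbox_layer:
  assumes "z \<in> hbox \<theta> l" shows "\<exists>m. z \<in> layer \<theta> l m"
proof -
  have h: "0 < 1 - cmod z" "1 - cmod z \<le> l" using assms by (auto simp: hbox_def)
  define P where "P n \<longleftrightarrow> l * (1/2) ^ Suc n < 1 - cmod z" for n
  obtain n0 where n0: "(1/2) ^ n0 < (1 - cmod z) / l" using real_arch_pow_inv[of "(1 - cmod z) / l" "1/2"] h by auto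
  have "(1/2::real) ^ Suc n0 \<le> (1/2) ^ n0" by simp
  then have "P n0" unfolding P_def using n0 h by (simp add: field_simps)
  define n where "n = (LEAST n. P n)"
  have n1: "P n" unfolding n_def by (rule LeastI[of P, OF \<open>P n0\<close>])
  have "1 - cmod z \<le> l * (1/2) ^ n"
  proof (cases n)
    case (Suc m)
    then have "\<not> P m" using not_less_Least[of m P] by (auto simp: n_def)
    then show ?thesis using Suc by (simp add: P_def)
  qed (use h in auto)
  then show ?thesis using n1 assms by (intro exI[of _ n]) (auto simp: layer_def P_def power_divide)
qed

text \<open>For fixed m the distance of \<open>z\<close> to the circle determines n. A box is 8/pi <
  3 grid spacings long, so the index j, read modulo 16 * 2^n because angles wrap around, takes at
  most three values.\<close>

lemma layer_overlap:
  "finite {(n, j). j < 16 * 2 ^ n \<and> z \<in> layer (grid n j) (1 / 2 ^ n) m}"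
  "card {(n, j). j < 16 * 2 ^ n \<and> z \<in> layer (grid n j) (1 / 2 ^ n) m} \<le> 3"
proof -
  let ?A = "{(n, j). j < 16 * 2 ^ n \<and> z \<in> layer (grid n j) (1 / 2 ^ n) m}"
  define \<alpha> where "\<alpha> = Arg2pi z"
  have za: "z = of_real (cmod z) * cis \<alpha>" unfolding \<alpha>_def by (rule Arg2pi_cis)
  have "\<exists>n0. ?A \<subseteq> (\<lambda>i. (n0, nat ((\<lfloor>\<alpha> * (16 * 2 ^ n0) / (2 * pi)\<rfloor> - i) mod (16 * 2 ^ n0)))) ` {0, 1, 2}"
  proof (cases "?A = {}")
    case False
    then obtain p where p: "p \<in> ?A" by blast
    obtain n0 j0 where "p = (n0, j0)" by (cases p)
    with p have nj0: "(n0, j0) \<in> ?A" by simp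
    have key: "(n, j) \<in> (\<lambda>i. (n0, nat ((\<lfloor>\<alpha> * (16 * 2 ^ n0) / (2 * pi)\<rfloor> - i) mod (16 * 2 ^ n0)))) ` {0, 1, 2}" if nj: "(n, j) \<in> ?A" for n j
    proof -
      have *: "\<not> n1 < n2" if "1 / 2 ^ n1 / 2 ^ Suc m < 1 - cmod z" "1 - cmod z \<le> 1 / 2 ^ n2 / 2 ^ m" for n1 n2
      proof
        assume "n1 < n2"
        then have "(2::real) ^ Suc n1 \<le> 2 ^ n2" by (intro power_increasing) auto
        then have "1 / 2 ^ n2 / 2 ^ m \<le> (1::real) / 2 ^ Suc n1 / 2 ^ m" by (intro divide_right_mono divide_left_mono) auto
        then show False using that by (simp add: mult_ac)
      qed
      have "n = n0" using *[of n n0] *[of n0 n] nj nj0 by (auto simp: layer_def)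
      define N :: int where "N = 16 * 2 ^ n"
      have N: "N > 0" by (simp add: N_def)
      have rN: "real_of_int N = 16 * 2 ^ n" by (simp add: N_def)
      have "z \<in> hbox (grid n j) (1 / 2 ^ n)" using nj by (auto simp: layer_def)
      then obtain t where t: "z = of_real (cmod z) * cis t" "grid n j \<le> t" "t < grid n j + 1 / 2 ^ n" "0 < cmod z"
        by (rule hbox_polar) auto
      have "cis t = cis \<alpha>" using t(1,4) za by (metis mult_cancel_left norm_zero of_real_eq_0_iff order_less_irrefl)
      then have "sin t = sin \<alpha> \<and> cos t = cos \<alpha>" by (simp add: complex_eq_iff)
      then obtain k :: int where k: "t = \<alpha> + 2 * pi * of_int k" using sin_cos_eq_iff by blast
      define x where "x = \<alpha> * of_int N / (2 * pi)"
      have tx: "t * of_int N / (2 * pi) = x + of_int (k * N)" unfolding k x_def by (simp add: field_simps)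
      have "grid n j * of_int N / (2 * pi) = real j" unfolding grid_def rN by simp
      moreover have "grid n j * of_int N / (2 * pi) \<le> t * of_int N / (2 * pi)" using t N by (intro divide_right_mono mult_right_mono) auto
      moreover have "t * of_int N / (2 * pi) < grid n j * of_int N / (2 * pi) + 3"
      proof -
        have "t * of_int N / (2 * pi) < (grid n j + 1 / 2 ^ n) * of_int N / (2 * pi)" using t N by (intro divide_strict_right_mono mult_strict_right_mono) auto
        also have "\<dots> = grid n j * of_int N / (2 * pi) + 8 / pi" unfolding rN by (simp add: field_simps)
        also have "\<dots> < grid n j * of_int N / (2 * pi) + 3" using pi_gt3 by (simp add: field_simps)
        finally show ?thesis .
      qed
      ultimately have "real j \<le> x + of_int (k * N)" "x + of_int (k * N) < real j + 3" unfolding tx by auto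
      then have "int j - k * N \<le> \<lfloor>x\<rfloor>" "\<lfloor>x\<rfloor> < int j - k * N + 3" by (auto simp: le_floor_iff floor_less_iff)
      then have "\<lfloor>x\<rfloor> - (int j - k * N) \<in> {0, 1, 2}" unfolding insert_iff empty_iff by linarith
      then obtain i where i: "i \<in> {0, 1, 2}" "int j - k * N = \<lfloor>x\<rfloor> - i"
        by (intro that[of "\<lfloor>x\<rfloor> - (int j - k * N)"]) auto
      have "j < 16 * 2 ^ n" using nj by simp
      then have "int j < int (16 * 2 ^ n)" by (simp only: of_nat_less_iff)
      then have "int j < N" by (simp add: N_def)
      then have "int j mod N = int j" by simp
      moreover have "(int j - k * N) mod N = int j mod N"
        using mod_mult_self1[of "int j" "- k" N] by simp
      ultimately have "int j = (int j - k * N) mod N" by simp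
      then have "int j = (\<lfloor>x\<rfloor> - i) mod N" using i(2) by simp
      then have "j = nat ((\<lfloor>x\<rfloor> - i) mod N)" by linarith
      then show ?thesis using i(1) \<open>n = n0\<close> unfolding x_def N_def by (intro image_eqI[of _ _ i]) auto
    qed
    show ?thesis
    proof (rule exI[of _ n0], rule subsetI)
      fix q assume q: "q \<in> ?A"
      obtain n j where "q = (n, j)" by (cases q)
      with q key show "q \<in> (\<lambda>i. (n0, nat ((\<lfloor>\<alpha> * (16 * 2 ^ n0) / (2 * pi)\<rfloor> - i) mod (16 * 2 ^ n0)))) ` {0, 1, 2}" by simp
    qed
  next
    case True
    then show ?thesis by (simp only: empty_subsetI) simp
  qed
  then obtain n0 where sub: "?A \<subseteq> (\<lambda>i. (n0, nat ((\<lfloor>\<alpha> * (16 * 2 ^ n0) / (2 * pi)\<rfloor> - i) mod (16 * 2 ^ n0)))) ` {0, 1, 2}" by blast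
  show "finite ?A" using finite_subset[OF sub] by simp
  have "card ?A \<le> card ((\<lambda>i::int. (n0, nat ((\<lfloor>\<alpha> * (16 * 2 ^ n0) / (2 * pi)\<rfloor> - i) mod (16 * 2 ^ n0)))) ` {0, 1, 2})"
    using sub by (intro card_mono) auto
  also have "\<dots> \<le> card {0, 1, 2 :: int}" by (rule card_image_le) simp
  finally show "card ?A \<le> 3" by simp
qed

subsection \<open>Conformal maps onto uniform domains: necessity\<close>

lemma integral_le_of_nn_integral:
  assumes "f \<in> borel_measurable M" "\<And>x. x \<in> space M \<Longrightarrow> 0 \<le> f x" "(\<integral>\<^sup>+x. ennreal (f x) \<partial>M) \<le> ennreal c" "0 \<le> c"
  shows "integrable M f" "(\<integral>x. f x \<partial>M) \<le> c"
proof -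
  have ae: "AE x in M. 0 \<le> f x" using assms(2) by (rule AE_I2)
  show i: "integrable M f"
    using assms ae by (intro integrableI_nonneg) (auto intro: order_le_less_trans[OF assms(3)])
  have "ennreal (\<integral>x. f x \<partial>M) \<le> ennreal c"
    using nn_integral_eq_integral[OF i ae] assms(3) by simp
  then show "(\<integral>x. f x \<partial>M) \<le> c" using assms(4) by simp
qed

locale quasidisc_map =
  fixes \<Omega> :: "complex set" and \<psi> :: "complex \<Rightarrow> complex"
  assumes bounded_Omega: "bounded \<Omega>" and uniform: "uniform_domain \<Omega>"
    and hol: "\<psi> holomorphic_on disc" and inj: "inj_on \<psi> disc" and image: "\<psi> ` disc = \<Omega>"
begin

sublocale conformal \<psi> disc \<Omega>
  by unfold_locales (auto simp: hol inj image)

definition zc :: "real \<Rightarrow> real \<Rightarrow> complex" where "zc \<theta> l = of_real (1 - 3*l/4) * cis \<theta>"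

lemma zbox_zc: "zbox \<theta> l = zc (\<theta> + l/2) l" "zc \<theta> l = zbox (\<theta> - l/2) l"
  by (simp_all add: zbox_def zc_def)

lemma zc_disc: "0 < l \<Longrightarrow> l \<le> 1 \<Longrightarrow> zc \<theta> l \<in> disc"
  unfolding zbox_zc(2) by (rule zbox_disc)

lemma carleson_disc: "carleson_box \<theta> l \<subseteq> disc" by (auto simp: carleson_box_def)

lemma carleson_image:
  obtains K where "K > 0" "\<And>\<theta> l. 0 < l \<Longrightarrow> l \<le> 1 \<Longrightarrow> \<psi> ` carleson_box \<theta> l \<subseteq> cball (\<psi> (zc \<theta> l)) (K * (cmod (deriv \<psi> (zc \<theta> l)) * l))"
proof (rule quasidisc_box_image[OF bounded_Omega uniform hol inj image])
  fix K assume "K > 0" "\<And>\<theta> l. 0 < l \<Longrightarrow> l \<le> 1 \<Longrightarrow>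
    \<psi> ` carleson_box \<theta> l \<subseteq> cball (\<psi> (of_real (1 - 3*l/4) * cis \<theta>)) (K * (cmod (deriv \<psi> (of_real (1 - 3*l/4) * cis \<theta>)) * l))"
  then show thesis by (intro that[of K]) (simp_all only: zc_def)
qed

lemma layer_distortion:
  obtains C where "C \<ge> 1" "\<And>\<theta> l z. 0 < l \<Longrightarrow> l \<le> 1 \<Longrightarrow> z \<in> layer \<theta> l 0 \<Longrightarrow>
    cmod (deriv \<psi> z) \<le> C * cmod (deriv \<psi> (zbox \<theta> l)) \<and> cmod (deriv \<psi> (zbox \<theta> l)) \<le> C * cmod (deriv \<psi> z)"
proof -
  obtain Cd :: "real \<Rightarrow> real" where Cd: "\<And>K. Cd K \<ge> 1"
    "\<And>K f \<eta> a b. f holomorphic_on ball 0 1 \<Longrightarrow> inj_on f (ball 0 1) \<Longrightarrow> \<eta> > 0 \<Longrightarrow> \<eta> \<le> 1 - cmod a \<Longrightarrow> \<eta> \<le> 1 - cmod b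
      \<Longrightarrow> cmod (b - a) \<le> K * \<eta> \<Longrightarrow> cmod (deriv f b) \<le> Cd K * cmod (deriv f a)"
    by (rule univalent_distortion) (rule that)
  show thesis
  proof (rule that[of "Cd 4"])
    fix \<theta> l z assume l: "0 < l" "l \<le> 1" and z: "z \<in> layer \<theta> l 0"
    have "z \<in> carleson_box (\<theta> + l/2) l" using z hbox_subset_carleson[OF l] hbox_disc(3) by blast
    then have d: "cmod (z - zbox \<theta> l) \<le> 4 * (l/2)" using carleson_box_dist[OF l] by (simp add: zbox_def)
    have h: "l/2 \<le> 1 - cmod z" "l/2 \<le> 1 - cmod (zbox \<theta> l)" using z l by (auto simp: layer_def zbox_norm)
    have "0 < l/2" using l by simp
    then show "cmod (deriv \<psi> z) \<le> Cd 4 * cmod (deriv \<psi> (zbox \<theta> l)) \<and> cmod (deriv \<psi> (zbox \<theta> l)) \<le> Cd 4 * cmod (deriv \<psi> z)"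
      using Cd(2)[OF hol inj _ h(2,1) d] Cd(2)[OF hol inj _ h(1,2), of 4] d by (simp add: norm_minus_commute)
  qed (rule Cd(1))
qed

section \<open>Areas of boxes and moments of the derivative\<close>

lemma carleson_area:
  assumes l: "0 < l" "l \<le> 1"
  shows "emeasure lebesgue (carleson_box \<theta> l) \<le> ennreal (16 * pi * l\<^sup>2)" "ennreal (pi * (l/32)\<^sup>2) \<le> emeasure lebesgue (carleson_box \<theta> l)"
    "measure lebesgue (carleson_box \<theta> l) \<le> 16 * pi * l\<^sup>2" "pi * (l/32)\<^sup>2 \<le> measure lebesgue (carleson_box \<theta> l)"
proof -
  have s: "carleson_box \<theta> l \<in> sets lebesgue" using carleson_box_borel[OF l] by auto
  have "carleson_box \<theta> l \<subseteq> ball (zc \<theta> l) (4*l)"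
  proof
    fix z assume "z \<in> carleson_box \<theta> l"
    then have "cmod (z - zc \<theta> l) \<le> 2*l" using carleson_box_dist[OF l] by (simp add: zc_def)
    then show "z \<in> ball (zc \<theta> l) (4*l)" using l by (simp add: dist_norm norm_minus_commute)
  qed
  then have "emeasure lebesgue (carleson_box \<theta> l) \<le> emeasure lebesgue (ball (zc \<theta> l) (4*l))" by (intro emeasure_mono) auto
  also have "\<dots> = ennreal (16 * pi * l\<^sup>2)" using emeasure_ball_complex[of "4*l" "zc \<theta> l"] l by (simp add: power_mult_distrib mult_ac)
  finally show 1: "emeasure lebesgue (carleson_box \<theta> l) \<le> ennreal (16 * pi * l\<^sup>2)" .
  have "ball (zbox (\<theta> - l/2) l) (l/32) \<subseteq> carleson_box (\<theta> - l/2 + l/2) l"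
    using zbox_ball[OF l] hbox_disc(3) hbox_subset_carleson[OF l] by blast
  then have "emeasure lebesgue (ball (zbox (\<theta> - l/2) l) (l/32)) \<le> emeasure lebesgue (carleson_box \<theta> l)"
    using s by (intro emeasure_mono) auto
  then show 2: "ennreal (pi * (l/32)\<^sup>2) \<le> emeasure lebesgue (carleson_box \<theta> l)"
    using emeasure_ball_complex[of "l/32" "zbox (\<theta> - l/2) l"] l by simp
  have "emeasure lebesgue (carleson_box \<theta> l) \<noteq> \<infinity>" using 1 by (metis ennreal_neq_top infinity_ennreal_def top.extremum_unique)
  then have e: "emeasure lebesgue (carleson_box \<theta> l) = ennreal (measure lebesgue (carleson_box \<theta> l))"
    by (simp add: emeasure_eq_ennreal_measure)
  show "measure lebesgue (carleson_box \<theta> l) \<le> 16 * pi * l\<^sup>2" using 1 unfolding e by (subst (asm) ennreal_le_iff) auto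
  show "pi * (l/32)\<^sup>2 \<le> measure lebesgue (carleson_box \<theta> l)" using 2 unfolding e by (subst (asm) ennreal_le_iff) auto
qed

text \<open>The integral is the area of the image of the box. It reduces B_q to a statement about
  negative moments, because the first average is now bounded by its value at the centre.\<close>

lemma carleson_deriv_area:
  obtains K where "K > 0" "\<And>\<theta> l. 0 < l \<Longrightarrow> l \<le> 1 \<Longrightarrow>
    (\<integral>\<^sup>+z. ennreal ((cmod (deriv \<psi> z))\<^sup>2) \<partial>lebesgue_on (carleson_box \<theta> l)) \<le> ennreal (K * (cmod (deriv \<psi> (zc \<theta> l)) * l)\<^sup>2)"
proof -
  obtain K where K: "K > 0" "\<And>\<theta> l. 0 < l \<Longrightarrow> l \<le> 1 \<Longrightarrow> \<psi> ` carleson_box \<theta> l \<subseteq> cball (\<psi> (zc \<theta> l)) (K * (cmod (deriv \<psi> (zc \<theta> l)) * l))"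
    by (rule carleson_image) (rule that)
  show thesis
  proof (rule that[of "4 * pi * K\<^sup>2"])
    fix \<theta> l :: real assume l: "0 < l" "l \<le> 1"
    define s where "s = K * (cmod (deriv \<psi> (zc \<theta> l)) * l)"
    have "cmod (deriv \<psi> (zc \<theta> l)) > 0" using deriv_nz[OF zc_disc[OF l]] by simp
    then have s: "s > 0" using K(1) l by (simp add: s_def)
    have Q: "carleson_box \<theta> l \<in> sets lebesgue" using carleson_box_borel[OF l] by auto
    have "(\<integral>\<^sup>+z. ennreal ((cmod (deriv \<psi> z))\<^sup>2) \<partial>lebesgue_on (carleson_box \<theta> l)) = emeasure lebesgue (\<psi> ` carleson_box \<theta> l)"
      using emeasure_image_holomorphic[OF openS holf injf Q carleson_disc] Q by (simp add: nn_integral_restrict_space)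
    also have "\<dots> \<le> emeasure lebesgue (ball (\<psi> (zc \<theta> l)) (2 * s))"
      using K(2)[OF l, of \<theta>] s unfolding s_def[symmetric] by (intro emeasure_mono) (auto simp: subset_iff)
    also have "\<dots> = ennreal (4 * pi * K\<^sup>2 * (cmod (deriv \<psi> (zc \<theta> l)) * l)\<^sup>2)"
      using emeasure_ball_complex[of "2 * s" "\<psi> (zc \<theta> l)"] s by (simp add: s_def power_mult_distrib mult_ac)
    finally show "(\<integral>\<^sup>+z. ennreal ((cmod (deriv \<psi> z))\<^sup>2) \<partial>lebesgue_on (carleson_box \<theta> l)) \<le> ennreal (4 * pi * K\<^sup>2 * (cmod (deriv \<psi> (zc \<theta> l)) * l)\<^sup>2)" .
  qed (use K in simp)
qed

lemma deriv_sq_weight: "weight_on disc (\<lambda>z. (cmod (deriv \<psi> z))\<^sup>2)"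
  unfolding weight_on_def
proof (intro conjI allI impI)
  fix K assume K: "compact K" "K \<subseteq> disc"
  have "continuous_on K (\<lambda>z. (cmod (deriv \<psi> z))\<^sup>2)"
    by (intro continuous_intros continuous_on_subset[OF deriv_cont K(2)])
  then have i: "integrable lborel (\<lambda>x. indicator K x *\<^sub>R (cmod (deriv \<psi> x))\<^sup>2)" using K(1) by (intro borel_integrable_compact)
  show "set_integrable lebesgue K (\<lambda>z. (cmod (deriv \<psi> z))\<^sup>2)"
    unfolding set_integrable_def integrable_completion[OF borel_measurable_integrable[OF i]] by (rule i)
next
  show "AE z in lebesgue. z \<in> disc \<longrightarrow> 0 < (cmod (deriv \<psi> z))\<^sup>2" using deriv_nz by (intro AE_I2) simp
qed

lemma deriv_meas_sub:
  assumes "A \<in> sets lebesgue" "A \<subseteq> disc"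
  shows "deriv \<psi> \<in> borel_measurable (lebesgue_on A)"
  by (rule continuous_imp_measurable_on_sets_lebesgue[OF continuous_on_subset[OF deriv_cont assms(2)] assms(1)])

lemma deriv_powr_meas:
  assumes "A \<in> sets lebesgue" "A \<subseteq> disc"
  shows "(\<lambda>z. cmod (deriv \<psi> z) powr t) \<in> borel_measurable (lebesgue_on A)"
  using deriv_meas_sub[OF assms] by measurable

lemma Bp_expand:
  assumes s: "s > 0" and Q: "Q \<in> sets lebesgue" "Q \<subseteq> disc" and A: "A = lebesgue_on Q"
  shows "wavg_finite 1 (\<lambda>_. 1) Q (\<lambda>z. (cmod (deriv \<psi> z))\<^sup>2) \<longleftrightarrow> integrable A (\<lambda>z. (cmod (deriv \<psi> z))\<^sup>2)"
    "wavg_finite s (\<lambda>_. 1) Q (\<lambda>z. inverse ((cmod (deriv \<psi> z))\<^sup>2)) \<longleftrightarrow> integrable A (\<lambda>z. cmod (deriv \<psi> z) powr (- 2 * s))"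
    "wavg 1 (\<lambda>_. 1) Q (\<lambda>z. (cmod (deriv \<psi> z))\<^sup>2) = (\<integral>z. (cmod (deriv \<psi> z))\<^sup>2 \<partial>A) / measure lebesgue Q"
    "wavg s (\<lambda>_. 1) Q (\<lambda>z. inverse ((cmod (deriv \<psi> z))\<^sup>2)) = ((\<integral>z. cmod (deriv \<psi> z) powr (- 2 * s) \<partial>A) / measure lebesgue Q) powr (1/s)"
proof -
  have e: "\<bar>inverse ((cmod (deriv \<psi> z))\<^sup>2)\<bar> powr s * 1 = cmod (deriv \<psi> z) powr (- 2 * s)" if "z \<in> space A" for z
  proof -
    have "cmod (deriv \<psi> z) > 0" using that deriv_nz[of z] Q A by auto
    then show ?thesis by (simp add: powr_minus powr_powr inverse_powr flip: powr_numeral)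
  qed
  have e1: "\<bar>(cmod (deriv \<psi> z))\<^sup>2\<bar> powr 1 * 1 = (cmod (deriv \<psi> z))\<^sup>2" for z by simp
  have si: "set_integrable lebesgue Q f \<longleftrightarrow> integrable A f" for f :: "complex \<Rightarrow> real"
    unfolding set_integrable_def A using Q by (subst integrable_restrict_space) auto
  have m1: "(LINT z:Q|lebesgue. (1::real)) = measure lebesgue Q"
    using Q unfolding set_lebesgue_integral_def by simp
  show "wavg_finite 1 (\<lambda>_. 1) Q (\<lambda>z. (cmod (deriv \<psi> z))\<^sup>2) \<longleftrightarrow> integrable A (\<lambda>z. (cmod (deriv \<psi> z))\<^sup>2)"
    unfolding wavg_finite_def si e1 ..
  show "wavg_finite s (\<lambda>_. 1) Q (\<lambda>z. inverse ((cmod (deriv \<psi> z))\<^sup>2)) \<longleftrightarrow> integrable A (\<lambda>z. cmod (deriv \<psi> z) powr (- 2 * s))"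
    unfolding wavg_finite_def si by (intro Bochner_Integration.integrable_cong refl e)
  have nn: "0 \<le> (\<integral>z. (cmod (deriv \<psi> z))\<^sup>2 \<partial>A)" by (rule integral_nonneg_AE) simp
  show "wavg 1 (\<lambda>_. 1) Q (\<lambda>z. (cmod (deriv \<psi> z))\<^sup>2) = (\<integral>z. (cmod (deriv \<psi> z))\<^sup>2 \<partial>A) / measure lebesgue Q"
    unfolding wavg_def e1 m1 set_integral_lebesgue_on[OF Q(1)] A[symmetric] using nn by simp
  have "(\<integral>z. \<bar>inverse ((cmod (deriv \<psi> z))\<^sup>2)\<bar> powr s * 1 \<partial>A) = (\<integral>z. cmod (deriv \<psi> z) powr (- 2 * s) \<partial>A)"
    by (intro Bochner_Integration.integral_cong refl e)
  moreover have "0 \<le> (\<integral>z. cmod (deriv \<psi> z) powr (- 2 * s) \<partial>A)" by (rule integral_nonneg_AE) simp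
  ultimately show "wavg s (\<lambda>_. 1) Q (\<lambda>z. inverse ((cmod (deriv \<psi> z))\<^sup>2)) = ((\<integral>z. cmod (deriv \<psi> z) powr (- 2 * s) \<partial>A) / measure lebesgue Q) powr (1/s)"
    unfolding wavg_def m1 set_integral_lebesgue_on[OF Q(1)] A[symmetric] by (simp add: powr_divide)
qed

text \<open>With P = |\<psi>'| at the centre, the two averages are at most multiples of P^2 and,
  after taking the root of order 1/(q-1), of P^(-2).\<close>

lemma negative_moments_imp_Bp:
  assumes q: "q > 1"
    and mom: "\<And>\<theta> l. 0 < l \<Longrightarrow> l \<le> 1 \<Longrightarrow>
      (\<integral>\<^sup>+z. ennreal (cmod (deriv \<psi> z) powr (- 2 * (1 / (q - 1)))) \<partial>lebesgue_on (carleson_box \<theta> l)) \<le> ennreal (C * (l\<^sup>2 * cmod (deriv \<psi> (zc \<theta> l)) powr (- 2 * (1 / (q - 1)))))"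
    and C: "C \<ge> 0"
  shows "in_Bp q (\<lambda>z. (cmod (deriv \<psi> z))\<^sup>2)"
proof -
  define s where "s = 1/(q-1)"
  have s: "s > 0" using q by (simp add: s_def)
  obtain K where K: "K > 0" "\<And>\<theta> l. 0 < l \<Longrightarrow> l \<le> 1 \<Longrightarrow>
    (\<integral>\<^sup>+z. ennreal ((cmod (deriv \<psi> z))\<^sup>2) \<partial>lebesgue_on (carleson_box \<theta> l)) \<le> ennreal (K * (cmod (deriv \<psi> (zc \<theta> l)) * l)\<^sup>2)"
    by (rule carleson_deriv_area) (rule that)
  \<comment> \<open>The box contains a disc of radius l/32, and 32^2 = 1024.\<close>
  define c where "c = pi / 1024"
  have c: "c > 0" by (simp add: c_def)
  have "wavg_finite 1 (\<lambda>_. 1) (carleson_box \<theta> l) (\<lambda>z. (cmod (deriv \<psi> z))\<^sup>2) \<and>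
      wavg_finite s (\<lambda>_. 1) (carleson_box \<theta> l) (\<lambda>z. inverse ((cmod (deriv \<psi> z))\<^sup>2)) \<and>
      wavg 1 (\<lambda>_. 1) (carleson_box \<theta> l) (\<lambda>z. (cmod (deriv \<psi> z))\<^sup>2) *
        wavg s (\<lambda>_. 1) (carleson_box \<theta> l) (\<lambda>z. inverse ((cmod (deriv \<psi> z))\<^sup>2)) \<le> K/c * (C/c) powr (1/s)"
    if l: "0 < l" "l \<le> 1" for \<theta> l
  proof -
    let ?Q = "carleson_box \<theta> l"
    define P where "P = cmod (deriv \<psi> (zc \<theta> l))"
    have P: "P > 0" using deriv_nz[OF zc_disc[OF l]] by (simp add: P_def)
    have Q: "?Q \<in> sets lebesgue" "?Q \<subseteq> disc" using carleson_box_borel[OF l] carleson_disc by auto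
    define A where "A = lebesgue_on ?Q"
    note ex = Bp_expand[OF s Q A_def]
    define V where "V = measure lebesgue ?Q"
    have V: "c * l\<^sup>2 \<le> V" using carleson_area(4)[OF l, of \<theta>] by (simp add: V_def c_def power_divide)
    have cl: "c * l\<^sup>2 > 0" using c l by simp
    then have V0: "V > 0" "c * l\<^sup>2 > 0" using V by linarith+
    have m: "deriv \<psi> \<in> borel_measurable A" unfolding A_def by (rule deriv_meas_sub[OF Q])
    have X: "integrable A (\<lambda>z. (cmod (deriv \<psi> z))\<^sup>2)" "(\<integral>z. (cmod (deriv \<psi> z))\<^sup>2 \<partial>A) \<le> K * (P * l)\<^sup>2"
    proof -
      have m2: "(\<lambda>z. (cmod (deriv \<psi> z))\<^sup>2) \<in> borel_measurable A" using m by measurable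
      have n: "(\<integral>\<^sup>+z. ennreal ((cmod (deriv \<psi> z))\<^sup>2) \<partial>A) \<le> ennreal (K * (P * l)\<^sup>2)"
        using K(2)[OF l, of \<theta>] by (simp add: A_def P_def)
      show "integrable A (\<lambda>z. (cmod (deriv \<psi> z))\<^sup>2)" "(\<integral>z. (cmod (deriv \<psi> z))\<^sup>2 \<partial>A) \<le> K * (P * l)\<^sup>2"
        using integral_le_of_nn_integral[OF m2 _ n] K(1) by auto
    qed
    have Y: "integrable A (\<lambda>z. cmod (deriv \<psi> z) powr (- 2 * s))" "(\<integral>z. cmod (deriv \<psi> z) powr (- 2 * s) \<partial>A) \<le> C * (l\<^sup>2 * P powr (- 2 * s))"
    proof -
      have m2: "(\<lambda>z. cmod (deriv \<psi> z) powr (- 2 * s)) \<in> borel_measurable A" using m by measurable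
      have n: "(\<integral>\<^sup>+z. ennreal (cmod (deriv \<psi> z) powr (- 2 * s)) \<partial>A) \<le> ennreal (C * (l\<^sup>2 * P powr (- 2 * s)))"
        using mom[OF l, of \<theta>] by (simp add: A_def P_def s_def)
      show "integrable A (\<lambda>z. cmod (deriv \<psi> z) powr (- 2 * s))" "(\<integral>z. cmod (deriv \<psi> z) powr (- 2 * s) \<partial>A) \<le> C * (l\<^sup>2 * P powr (- 2 * s))"
        using integral_le_of_nn_integral[OF m2 _ n] C by auto
    qed
    have x: "(\<integral>z. (cmod (deriv \<psi> z))\<^sup>2 \<partial>A) / V \<le> K/c * P\<^sup>2"
    proof -
      have "(\<integral>z. (cmod (deriv \<psi> z))\<^sup>2 \<partial>A) / V \<le> (K * (P * l)\<^sup>2) / (c * l\<^sup>2)"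
        using X(2) V V0 K(1) by (intro frac_le) auto
      then show ?thesis using l by (simp add: power_mult_distrib)
    qed
    have "(\<integral>z. cmod (deriv \<psi> z) powr (- 2 * s) \<partial>A) / V \<le> (C * (l\<^sup>2 * P powr (- 2 * s))) / (c * l\<^sup>2)"
      using Y(2) V V0 C by (intro frac_le) auto
    also have "\<dots> = C/c * P powr (- 2 * s)" using l by simp
    finally have "((\<integral>z. cmod (deriv \<psi> z) powr (- 2 * s) \<partial>A) / V) powr (1/s) \<le> (C/c * P powr (- 2 * s)) powr (1/s)"
      using s V0 by (intro powr_mono2) (auto intro!: divide_nonneg_pos integral_nonneg_AE)
    also have "\<dots> = (C/c) powr (1/s) * P powr (-2)"
      using s C c by (subst powr_mult) (auto simp: powr_powr)
    finally have y: "((\<integral>z. cmod (deriv \<psi> z) powr (- 2 * s) \<partial>A) / V) powr (1/s) \<le> (C/c) powr (1/s) * P powr (-2)" .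
    have "(\<integral>z. (cmod (deriv \<psi> z))\<^sup>2 \<partial>A) / V * ((\<integral>z. cmod (deriv \<psi> z) powr (- 2 * s) \<partial>A) / V) powr (1/s)
        \<le> (K/c * P\<^sup>2) * ((C/c) powr (1/s) * P powr (-2))"
      using K(1) c by (intro mult_mono x y) auto
    also have "\<dots> = K/c * (C/c) powr (1/s)" using P by (simp add: powr_minus divide_simps)
    finally show ?thesis unfolding ex V_def[symmetric] using X(1) Y(1) by simp
  qed
  then show ?thesis unfolding in_Bp_def s_def[symmetric] using deriv_sq_weight by blast
qed

text \<open>The disc of radius l/32 about the centre already contributes an amount of order (P l)^2
  to the first integral, by distortion, so the B_q bound can be solved for the second
  average.\<close>

lemma Bp_imp_negative_moments:
  assumes s: "s > 0" and Bp: "in_Bp (1 + 1/s) (\<lambda>z. (cmod (deriv \<psi> z))\<^sup>2)"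
  obtains C where "C > 0" "\<And>\<theta> l. 0 < l \<Longrightarrow> l \<le> 1 \<Longrightarrow>
      (\<integral>\<^sup>+z. ennreal (cmod (deriv \<psi> z) powr (- 2 * s)) \<partial>lebesgue_on (carleson_box \<theta> l)) \<le> ennreal (C * (l\<^sup>2 * cmod (deriv \<psi> (zc \<theta> l)) powr (- 2 * s)))"
proof -
  have se: "1 / (1 + 1/s - 1) = s" using s by simp
  obtain C0 where B0: "\<And>\<theta> l. 0 < l \<Longrightarrow> l \<le> 1 \<Longrightarrow>
      wavg_finite 1 (\<lambda>_. 1) (carleson_box \<theta> l) (\<lambda>z. (cmod (deriv \<psi> z))\<^sup>2) \<and>
      wavg_finite s (\<lambda>_. 1) (carleson_box \<theta> l) (\<lambda>z. inverse ((cmod (deriv \<psi> z))\<^sup>2)) \<and>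
      wavg 1 (\<lambda>_. 1) (carleson_box \<theta> l) (\<lambda>z. (cmod (deriv \<psi> z))\<^sup>2) *
        wavg s (\<lambda>_. 1) (carleson_box \<theta> l) (\<lambda>z. inverse ((cmod (deriv \<psi> z))\<^sup>2)) \<le> C0"
    using Bp unfolding in_Bp_def se by blast
  define C1 where "C1 = \<bar>C0\<bar> + 1"
  have C1: "C1 > 0" "C0 \<le> C1" by (auto simp: C1_def)
  obtain Cd where Cd: "Cd \<ge> 1" "\<And>\<theta> l z. 0 < l \<Longrightarrow> l \<le> 1 \<Longrightarrow> z \<in> layer \<theta> l 0 \<Longrightarrow>
    cmod (deriv \<psi> z) \<le> Cd * cmod (deriv \<psi> (zbox \<theta> l)) \<and> cmod (deriv \<psi> (zbox \<theta> l)) \<le> Cd * cmod (deriv \<psi> z)"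
    by (rule layer_distortion) (rule that)
  define c where "c = pi / 1024 / Cd\<^sup>2"
  have c: "c > 0" using Cd(1) by (simp add: c_def)
  define E where "E = C1 * (16 * pi) / c"
  have E: "E > 0" using C1 c by (simp add: E_def)
  show thesis
  proof (rule that[of "16 * pi * E powr s"])
    show "16 * pi * E powr s > 0" using E by simp
    fix \<theta> l :: real assume l: "0 < l" "l \<le> 1"
    let ?Q = "carleson_box \<theta> l"
    define P where "P = cmod (deriv \<psi> (zc \<theta> l))"
    have P: "P > 0" using deriv_nz[OF zc_disc[OF l]] by (simp add: P_def)
    have Q: "?Q \<in> sets lebesgue" "?Q \<subseteq> disc" using carleson_box_borel[OF l] carleson_disc by auto
    define A where "A = lebesgue_on ?Q"
    note ex = Bp_expand[OF s Q A_def]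
    define V where "V = measure lebesgue ?Q"
    have V: "pi * (l/32)\<^sup>2 \<le> V" "V \<le> 16 * pi * l\<^sup>2" using carleson_area(3,4)[OF l, of \<theta>] by (simp_all add: V_def)
    have V0: "V > 0" by (rule less_le_trans[OF _ V(1)]) (use l in simp)
    define X where "X = (\<integral>z. (cmod (deriv \<psi> z))\<^sup>2 \<partial>A)"
    define Y where "Y = (\<integral>z. cmod (deriv \<psi> z) powr (- 2 * s) \<partial>A)"
    have B: "integrable A (\<lambda>z. (cmod (deriv \<psi> z))\<^sup>2)" "integrable A (\<lambda>z. cmod (deriv \<psi> z) powr (- 2 * s))"
      and XY: "X / V * (Y / V) powr (1/s) \<le> C1"
      using B0[OF l, of \<theta>] C1(2) unfolding ex V_def[symmetric] X_def Y_def by auto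
    have X: "c * l\<^sup>2 * P\<^sup>2 \<le> X"
    proof -
      let ?B = "ball (zc \<theta> l) (l/32)"
      have BL: "?B \<subseteq> layer (\<theta> - l/2) l 0" unfolding zbox_zc(2) by (rule zbox_ball[OF l])
      have "hbox (\<theta> - l/2) l \<subseteq> ?Q" using hbox_subset_carleson[OF l, of "\<theta> - l/2"] by simp
      then have BQ: "?B \<subseteq> ?Q" using hbox_disc(3)[of "\<theta> - l/2" l 0] BL by blast
      have dd: "(P / Cd)\<^sup>2 \<le> (cmod (deriv \<psi> z))\<^sup>2" if "z \<in> ?B" for z
      proof (rule power_mono)
        have "P \<le> Cd * cmod (deriv \<psi> z)" using Cd(2)[OF l, of z "\<theta> - l/2"] BL that by (auto simp: P_def zbox_zc(2))
        then show "P / Cd \<le> cmod (deriv \<psi> z)" using Cd(1) by (simp add: divide_le_eq mult.commute)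
      qed (use P Cd in auto)
      have "ennreal (c * l\<^sup>2 * P\<^sup>2) = ennreal ((P / Cd)\<^sup>2) * emeasure lebesgue ?B"
        using l by (subst emeasure_ball_complex) (auto simp: c_def power_divide mult_ac simp flip: ennreal_mult')
      also have "\<dots> = (\<integral>\<^sup>+z. ennreal ((P / Cd)\<^sup>2) * indicator ?B z \<partial>lebesgue)"
        by (subst nn_integral_cmult_indicator) auto
      also have "\<dots> \<le> (\<integral>\<^sup>+z. ennreal ((cmod (deriv \<psi> z))\<^sup>2) * indicator ?Q z \<partial>lebesgue)"
        using BQ dd by (intro nn_integral_mono) (auto simp: indicator_def intro!: ennreal_leI)
      also have "\<dots> = (\<integral>\<^sup>+z. ennreal ((cmod (deriv \<psi> z))\<^sup>2) \<partial>A)"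
        unfolding A_def using Q by (subst nn_integral_restrict_space) auto
      also have "\<dots> = ennreal X" unfolding X_def by (rule nn_integral_eq_integral[OF B(1)]) simp
      finally show ?thesis by (subst (asm) ennreal_le_iff) (auto simp: X_def intro!: integral_nonneg_AE)
    qed
    have cP: "c * l\<^sup>2 * P\<^sup>2 > 0" using c l P by simp
    have X0: "X > 0" using X cP by linarith
    have Y0: "Y \<ge> 0" unfolding Y_def by (intro integral_nonneg_AE) simp
    have "(Y / V) powr (1/s) \<le> C1 * V / X" using XY X0 V0 by (simp add: field_simps)
    also have "\<dots> \<le> C1 * (16 * pi * l\<^sup>2) / (c * l\<^sup>2 * P\<^sup>2)"
      using X V(2) C1 cP V0 by (intro frac_le mult_left_mono) auto
    also have "\<dots> = E * P powr (-2)" using l P by (simp add: E_def powr_minus divide_simps)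
    finally have "((Y / V) powr (1/s)) powr s \<le> (E * P powr (-2)) powr s" using s by (intro powr_mono2) auto
    then have "Y / V \<le> E powr s * P powr (- 2 * s)" using s Y0 V0 E by (simp add: powr_powr powr_mult)
    then have "Y \<le> V * (E powr s * P powr (- 2 * s))" using V0 by (simp add: divide_le_eq mult.commute)
    also have "\<dots> \<le> 16 * pi * l\<^sup>2 * (E powr s * P powr (- 2 * s))" using V(2) by (intro mult_right_mono) auto
    finally have "Y \<le> 16 * pi * E powr s * (l\<^sup>2 * P powr (- 2 * s))" by (simp add: mult_ac)
    then show "(\<integral>\<^sup>+z. ennreal (cmod (deriv \<psi> z) powr (- 2 * s)) \<partial>lebesgue_on ?Q) \<le> ennreal (16 * pi * E powr s * (l\<^sup>2 * cmod (deriv \<psi> (zc \<theta> l)) powr (- 2 * s)))"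
      unfolding P_def[symmetric] A_def[symmetric]
      by (subst nn_integral_eq_integral[OF B(2)]) (auto simp: Y_def intro!: ennreal_leI)
  qed
qed

text \<open>The pullback of the test function is the indicator of a disc around \<open>zc \<theta> l\<close>; by the mean value
  property its projection is an explicit multiple of the Bergman kernel, comparable to a constant on the box.\<close>

lemma bergman_bounded_imp_negative_moments:
  assumes s: "s > 0" and bb: "bergman_bounded \<Omega> (2 + 2 * s) (\<lambda>_. 1)"
  obtains C where "C \<ge> 0" "\<And>\<theta> l. 0 < l \<Longrightarrow> l \<le> 1 \<Longrightarrow>
      (\<integral>\<^sup>+z. ennreal (cmod (deriv \<psi> z) powr (- 2 * s)) \<partial>lebesgue_on (carleson_box \<theta> l)) \<le> ennreal (C * (l\<^sup>2 * cmod (deriv \<psi> (zc \<theta> l)) powr (- 2 * s)))"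
proof -
  define p where "p = 2 + 2 * s"
  have p: "p > 0" "2 - p = - 2 * s" using s by (auto simp: p_def)
  obtain C where C: "C \<ge> 0" "\<And>f. L2_on \<Omega> f \<Longrightarrow>
      (\<integral>\<^sup>+z. ennreal (cmod (bergman_proj \<Omega> f z) powr p) \<partial>lebesgue_on \<Omega>) \<le> ennreal C * (\<integral>\<^sup>+z. ennreal (cmod (f z) powr p) \<partial>lebesgue_on \<Omega>)"
    using bb unfolding bergman_bounded_def p_def[symmetric] set_nn_integral_lebesgue_on[OF T_sets] by auto
  obtain Cd where Cd: "Cd \<ge> 1" "\<And>\<theta> l z. 0 < l \<Longrightarrow> l \<le> 1 \<Longrightarrow> z \<in> layer \<theta> l 0 \<Longrightarrow>
    cmod (deriv \<psi> z) \<le> Cd * cmod (deriv \<psi> (zbox \<theta> l)) \<and> cmod (deriv \<psi> (zbox \<theta> l)) \<le> Cd * cmod (deriv \<psi> z)"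
    by (rule layer_distortion) (rule that)
  obtain k where k: "k holomorphic_on \<Omega>" "\<And>z. z \<in> disc \<Longrightarrow> k (\<psi> z) = z" "\<And>w. w \<in> \<Omega> \<Longrightarrow> \<psi> (k w) = w"
    "\<And>w. w \<in> \<Omega> \<Longrightarrow> k w \<in> disc" by (rule inverse_holomorphic) (rule that)
  \<comment> \<open>With r = l/32 the projection \<open>G\<close> has modulus at least r^2 / (4l)^2
    = 1/16384 on the box.\<close>
  define g0 :: real where "g0 = (1 / 16384) powr p"
  have g0: "g0 > 0" by (simp add: g0_def)
  define C' where "C' = C * (pi / 1024) * Cd powr (2 * s) / g0"
  have C': "C' \<ge> 0" using C(1) g0 by (simp add: C'_def)
  show thesis
  proof (rule that[OF C'])
    fix \<theta> l :: real assume l: "0 < l" "l \<le> 1"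
    let ?Q = "carleson_box \<theta> l"
    define a where "a = zc \<theta> l"
    define r where "r = l/32"
    define P where "P = cmod (deriv \<psi> a)"
    have aD: "a \<in> disc" unfolding a_def by (rule zc_disc[OF l])
    have na: "1 - cmod a = 3*l/4" using zbox_norm[OF l, of "\<theta> - l/2"] by (simp add: a_def zbox_zc(2))
    have r: "0 < r" "r < 1 - cmod a" using l na by (auto simp: r_def)
    have P: "P > 0" using deriv_nz[OF aD] by (simp add: P_def)
    have Q: "?Q \<in> sets lebesgue" "?Q \<subseteq> disc" using carleson_box_borel[OF l] carleson_disc by auto
    let ?B = "ball a r"
    have BL: "?B \<subseteq> layer (\<theta> - l/2) l 0" unfolding a_def r_def zbox_zc(2) by (rule zbox_ball[OF l])
    have BD: "?B \<subseteq> disc" using BL hbox_disc by blast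
    define F where "F w = (indicator ?B (k w) / deriv \<psi> (k w) :: complex)" for w
    have Fpsi: "F (\<psi> z) * deriv \<psi> z = indicator ?B z" if "z \<in> disc" for z
      using k(2)[OF that] deriv_nz[OF that] by (simp add: F_def)
    have km: "k \<in> lebesgue_on \<Omega> \<rightarrow>\<^sub>M borel"
      using holomorphic_on_imp_continuous_on[OF k(1)] by (intro continuous_imp_measurable_on_sets_lebesgue) auto
    have dk: "(\<lambda>w. deriv \<psi> (k w)) \<in> borel_measurable (lebesgue_on \<Omega>)"
      using k(4) by (intro continuous_imp_measurable_on_sets_lebesgue continuous_on_compose2[OF deriv_cont holomorphic_on_imp_continuous_on[OF k(1)]]) auto
    have ik: "(\<lambda>w. indicator ?B (k w) :: complex) \<in> borel_measurable (lebesgue_on \<Omega>)"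
      by (rule measurable_compose[OF km]) (intro borel_measurable_indicator borel_open open_ball)
    have Fm: "F \<in> borel_measurable (lebesgue_on \<Omega>)" unfolding F_def using ik dk by (rule borel_measurable_divide)
    interpret fm: finite_measure "lebesgue_on disc" by (rule finite_measure_disc)
    have im: "(\<lambda>z. indicator ?B z :: complex) \<in> borel_measurable (lebesgue_on disc)"
      by (intro measurable_restrict_space1 measurable_completion borel_measurable_indicator) simp
    have L2B: "L2_on disc (\<lambda>z. indicator ?B z :: complex)"
      unfolding L2_on_iff[OF S_sets]
    proof
      show "integrable (lebesgue_on disc) (\<lambda>z. (cmod (indicator ?B z))\<^sup>2)"
        by (rule fm.integrable_const_bound[where B = 1]) (use im in \<open>auto simp: indicator_def\<close>)
    qed (rule im)
    have "L2_on disc (\<lambda>z. F (\<psi> z) * deriv \<psi> z) \<longleftrightarrow> L2_on disc (\<lambda>z. indicator ?B z :: complex)"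
      unfolding L2_on_iff[OF S_sets]
      by (intro arg_cong2[where f = "(\<and>)"] measurable_cong Bochner_Integration.integrable_cong refl) (auto simp: Fpsi)
    then have FL: "L2_on \<Omega> F" using pullback_L2[OF Fm] L2B by simp
    define G where "G z = of_real (r\<^sup>2) * (1 / (1 - cnj a * z)\<^sup>2)" for z
    have a1: "cmod a < 1" using aD by simp
    note nz = one_minus_cnj_mult_nz(1)[OF a1]
    have Gh: "G holomorphic_on disc" unfolding G_def using nz by (auto intro!: holomorphic_intros)
    have Gm: "G \<in> borel_measurable (lebesgue_on disc)"
      using holomorphic_on_imp_continuous_on[OF Gh] by (intro continuous_imp_measurable_on_sets_lebesgue) auto
    have low: "1 - cmod a \<le> cmod (1 - cnj a * z)" if "z \<in> disc" for z
    proof -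
      have "cmod (cnj a * z) \<le> cmod a" using that by (simp add: norm_mult mult_left_le)
      then show ?thesis using norm_triangle_ineq2[of 1 "cnj a * z"] by simp
    qed
    have GL: "L2_on disc G" unfolding L2_on_iff[OF S_sets]
    proof
      show "integrable (lebesgue_on disc) (\<lambda>z. (cmod (G z))\<^sup>2)"
      proof (rule fm.integrable_const_bound[where B = "(r\<^sup>2 * (1 / (1 - cmod a)\<^sup>2))\<^sup>2"])
        show "AE z in lebesgue_on disc. norm ((cmod (G z))\<^sup>2) \<le> (r\<^sup>2 * (1 / (1 - cmod a)\<^sup>2))\<^sup>2"
        proof (rule AE_I2)
          fix z assume "z \<in> space (lebesgue_on disc)"
          then have z: "z \<in> disc" by simp
          have "cmod (G z) \<le> r\<^sup>2 * (1 / (1 - cmod a)\<^sup>2)"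
            unfolding G_def using low[OF z] a1 by (auto simp: norm_mult norm_divide norm_power intro!: mult_left_mono divide_left_mono power_mono mult_pos_pos)
          then show "norm ((cmod (G z))\<^sup>2) \<le> (r\<^sup>2 * (1 / (1 - cmod a)\<^sup>2))\<^sup>2" by (simp add: power_mono del: power_mult_distrib)
        qed
      qed (use Gm in measurable)
    qed (rule Gm)
    have orth: "(\<integral>z. (F (\<psi> z) * deriv \<psi> z - G z) * cnj (H z) \<partial>lebesgue_on disc) = 0" if H: "A2_on disc H" for H
    proof -
      have Hh: "H holomorphic_on disc" "L2_on disc H" using H by (auto simp: A2_on_def)
      have "(\<integral>z. (F (\<psi> z) * deriv \<psi> z - G z) * cnj (H z) \<partial>lebesgue_on disc)
         = (\<integral>z. indicator ?B z * cnj (H z) - G z * cnj (H z) \<partial>lebesgue_on disc)"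
        by (intro Bochner_Integration.integral_cong refl) (simp add: Fpsi left_diff_distrib)
      also have "\<dots> = (\<integral>z. indicator ?B z * cnj (H z) \<partial>lebesgue_on disc) - (\<integral>z. G z * cnj (H z) \<partial>lebesgue_on disc)"
        by (intro Bochner_Integration.integral_diff L2_mult_integrable L2B GL Hh(2) S_sets)
      also have "(\<integral>z. indicator ?B z * cnj (H z) \<partial>lebesgue_on disc) = (\<integral>z. cnj (H z) \<partial>lebesgue_on ?B)"
        using BD by (subst (1 2) integral_restrict_space) (auto intro!: Bochner_Integration.integral_cong simp: indicator_def)
      also have "\<dots> = cnj (\<integral>z. H z \<partial>lebesgue_on ?B)" by (rule Bochner_Integration.integral_cnj)
      also have "(\<integral>z. H z \<partial>lebesgue_on ?B) = of_real (pi * r\<^sup>2) * H a" by (rule area_mean_value_ball[OF Hh(1) r])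
      also have "(\<integral>z. G z * cnj (H z) \<partial>lebesgue_on disc) = (\<integral>z. of_real (r\<^sup>2) * cnj (H z * cnj (1 / (1 - cnj a * z)\<^sup>2)) \<partial>lebesgue_on disc)"
        by (intro Bochner_Integration.integral_cong refl) (simp add: G_def)
      also have "\<dots> = of_real (r\<^sup>2) * cnj (\<integral>z. H z * cnj (1 / (1 - cnj a * z)\<^sup>2) \<partial>lebesgue_on disc)"
        by (simp only: integral_mult_right_zero Bochner_Integration.integral_cnj)
      also have "(\<integral>z. H z * cnj (1 / (1 - cnj a * z)\<^sup>2) \<partial>lebesgue_on disc) = of_real pi * H a"
        by (rule bergman_reproducing[OF Hh aD])
      finally show ?thesis by simp
    qed
    have BP: "bergman_proj \<Omega> F (\<psi> z) * deriv \<psi> z = G z" if "z \<in> disc" for z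
      by (rule bergman_proj_transfer[OF FL _ orth that]) (use Gh GL in \<open>simp add: A2_on_def\<close>)
    have BPm: "bergman_proj \<Omega> F \<in> borel_measurable (lebesgue_on \<Omega>)"
    proof -
      have "bergman_proj \<Omega> F w = G (k w) / deriv \<psi> (k w)" if "w \<in> \<Omega>" for w
        using BP[OF k(4)[OF that]] k(3)[OF that] deriv_nz[OF k(4)[OF that]] by (simp add: field_simps)
      moreover have "(\<lambda>w. G (k w)) \<in> borel_measurable (lebesgue_on \<Omega>)"
        using k(4) by (intro continuous_imp_measurable_on_sets_lebesgue continuous_on_compose2[OF holomorphic_on_imp_continuous_on[OF Gh] holomorphic_on_imp_continuous_on[OF k(1)]]) auto
      then have "(\<lambda>w. G (k w) / deriv \<psi> (k w)) \<in> borel_measurable (lebesgue_on \<Omega>)" using dk by (rule borel_measurable_divide)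
      ultimately show ?thesis by (subst measurable_cong[of "lebesgue_on \<Omega>"]) auto
    qed
    \<comment> \<open>The Jacobian splits as |\<psi>'|^p |\<psi>'|^(2-p): the first factor completes
      the pullback of the function, the second is the weight on the disc.\<close>
    have pw: "(cmod (deriv \<psi> z))\<^sup>2 * cmod u powr p = cmod (u * deriv \<psi> z) powr p * cmod (deriv \<psi> z) powr (- 2 * s)" if "z \<in> disc" for z u
    proof -
      have d: "cmod (deriv \<psi> z) > 0" using deriv_nz[OF that] by simp
      have "(cmod (deriv \<psi> z))\<^sup>2 = cmod (deriv \<psi> z) powr p * cmod (deriv \<psi> z) powr (2 - p)"
        using d by (simp flip: powr_add)
      then show ?thesis unfolding p(2) by (simp add: norm_mult powr_mult mult_ac)
    qed
    have lhs: "(\<integral>\<^sup>+w. ennreal (cmod (bergman_proj \<Omega> F w) powr p) \<partial>lebesgue_on \<Omega>) = (\<integral>\<^sup>+z. ennreal (cmod (G z) powr p * cmod (deriv \<psi> z) powr (- 2 * s)) \<partial>lebesgue_on disc)"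
      using BPm by (subst nn_integral_conformal, measurable)
        (auto intro!: nn_integral_cong simp: pw BP simp flip: ennreal_mult')
    have rhs: "(\<integral>\<^sup>+w. ennreal (cmod (F w) powr p) \<partial>lebesgue_on \<Omega>) = (\<integral>\<^sup>+z. ennreal (cmod (indicator ?B z :: complex) powr p * cmod (deriv \<psi> z) powr (- 2 * s)) \<partial>lebesgue_on disc)"
      using Fm by (subst nn_integral_conformal, measurable)
        (auto intro!: nn_integral_cong simp: pw Fpsi simp flip: ennreal_mult')
    have Glow: "g0 \<le> cmod (G z) powr p" if z: "z \<in> ?Q" for z
    proof -
      have zD: "z \<in> disc" using z Q by auto
      \<comment> \<open>Compares \<open>z\<close> with the centre: 1 - |a|^2 is at most 3l/2 and |a
        - z| at most 2l, together less than 4l.\<close>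
      have "1 - cnj a * z = (1 - cnj a * a) + cnj a * (a - z)" by (simp add: algebra_simps)
      then have "cmod (1 - cnj a * z) \<le> cmod (1 - cnj a * a) + cmod (cnj a * (a - z))" using norm_triangle_ineq by metis
      also have "cmod (1 - cnj a * a) = 1 - (cmod a)\<^sup>2"
      proof -
        have "1 - cnj a * a = of_real (1 - (cmod a)\<^sup>2)" by (simp add: complex_norm_square mult.commute del: of_real_power)
        moreover have "(cmod a)\<^sup>2 \<le> 1" using a1 by (simp add: power_le_one)
        ultimately show ?thesis by (metis norm_of_real abs_of_nonneg diff_ge_0_iff_ge)
      qed
      also have "1 - (cmod a)\<^sup>2 \<le> 2 * (1 - cmod a)" using zero_le_power2[of "1 - cmod a"] by (simp add: power2_diff)
      also have "cmod (cnj a * (a - z)) \<le> 1 * (2 * l)"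
      proof -
        have "cmod (a - z) \<le> 2 * l" using carleson_box_dist[OF l z] by (simp only: a_def zc_def norm_minus_commute)
        then show ?thesis unfolding norm_mult complex_mod_cnj using a1 by (intro mult_mono) auto
      qed
      finally have "cmod (1 - cnj a * z) \<le> 4 * l" using na l by simp
      then have "(cmod (1 - cnj a * z))\<^sup>2 \<le> (4 * l)\<^sup>2" by (intro power_mono) auto
      then have "r\<^sup>2 * (1 / (4 * l)\<^sup>2) \<le> r\<^sup>2 * (1 / (cmod (1 - cnj a * z))\<^sup>2)"
        using nz[of z] zD l by (intro mult_left_mono divide_left_mono mult_pos_pos) auto
      also have "\<dots> = cmod (G z)" by (simp add: G_def norm_mult norm_divide norm_power)
      also have "r\<^sup>2 * (1 / (4 * l)\<^sup>2) = 1 / 16384" using l by (simp add: r_def power_mult_distrib power_divide)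
      finally show ?thesis unfolding g0_def using p by (intro powr_mono2) auto
    qed
    have "ennreal g0 * (\<integral>\<^sup>+z. ennreal (cmod (deriv \<psi> z) powr (- 2 * s)) \<partial>lebesgue_on ?Q)
        = (\<integral>\<^sup>+z. ennreal g0 * ennreal (cmod (deriv \<psi> z) powr (- 2 * s)) \<partial>lebesgue_on ?Q)"
      by (rule nn_integral_cmult[symmetric]) (rule measurable_compose[OF deriv_powr_meas[OF Q] measurable_ennreal])
    also have "\<dots> \<le> (\<integral>\<^sup>+z. ennreal (cmod (G z) powr p * cmod (deriv \<psi> z) powr (- 2 * s)) \<partial>lebesgue_on ?Q)"
      using Glow g0 by (intro nn_integral_mono) (auto intro!: ennreal_leI mult_right_mono simp flip: ennreal_mult')
    also have "\<dots> \<le> (\<integral>\<^sup>+z. ennreal (cmod (G z) powr p * cmod (deriv \<psi> z) powr (- 2 * s)) \<partial>lebesgue_on disc)"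
      using Q by (subst (1 2) nn_integral_restrict_space) (auto intro!: nn_integral_mono simp: indicator_def)
    also have "\<dots> \<le> ennreal C * (\<integral>\<^sup>+z. ennreal (cmod (indicator ?B z :: complex) powr p * cmod (deriv \<psi> z) powr (- 2 * s)) \<partial>lebesgue_on disc)"
      using C(2)[OF FL] unfolding lhs rhs .
    also have "\<dots> \<le> ennreal C * (ennreal (Cd powr (2 * s) * P powr (- 2 * s)) * ennreal (pi * r\<^sup>2))"
    proof (rule mult_left_mono)
      have pt: "ennreal (cmod (indicator ?B z :: complex) powr p * cmod (deriv \<psi> z) powr (- 2 * s)) \<le> ennreal (Cd powr (2 * s) * P powr (- 2 * s)) * indicator ?B z" for z
      proof (cases "z \<in> ?B")
        case True
        have PC: "P \<le> Cd * cmod (deriv \<psi> z)" using Cd(2)[OF l, of z "\<theta> - l/2"] BL True by (auto simp: P_def a_def zbox_zc(2))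
        have d: "cmod (deriv \<psi> z) > 0" using deriv_nz[of z] BD True by auto
        have "cmod (deriv \<psi> z) powr (- 2 * s) = Cd powr (2 * s) * (Cd * cmod (deriv \<psi> z)) powr (- 2 * s)"
          using Cd(1) d by (simp add: powr_mult powr_minus)
        also have "\<dots> \<le> Cd powr (2 * s) * P powr (- 2 * s)"
          using PC P s by (intro mult_left_mono powr_mono2') auto
        finally show ?thesis using True by (simp add: ennreal_leI)
      qed (use p in simp)
      have "(\<integral>\<^sup>+z. ennreal (cmod (indicator ?B z :: complex) powr p * cmod (deriv \<psi> z) powr (- 2 * s)) \<partial>lebesgue_on disc)
         \<le> (\<integral>\<^sup>+z. ennreal (Cd powr (2 * s) * P powr (- 2 * s)) * indicator ?B z \<partial>lebesgue)"
      proof -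
        have le: "x * indicator disc z \<le> x" for x :: ennreal and z by (simp add: indicator_def)
        show ?thesis
          by (subst nn_integral_restrict_space, simp, rule nn_integral_mono, rule order_trans[OF le pt])
      qed
      also have "\<dots> = ennreal (Cd powr (2 * s) * P powr (- 2 * s)) * ennreal (pi * r\<^sup>2)"
        using emeasure_ball_complex[of r a] r by (subst nn_integral_cmult_indicator) auto
      finally show "(\<integral>\<^sup>+z. ennreal (cmod (indicator ?B z :: complex) powr p * cmod (deriv \<psi> z) powr (- 2 * s)) \<partial>lebesgue_on disc)
         \<le> ennreal (Cd powr (2 * s) * P powr (- 2 * s)) * ennreal (pi * r\<^sup>2)" .
    qed simp
    also have "\<dots> = ennreal (g0 * (C' * (l\<^sup>2 * P powr (- 2 * s))))"
      using g0 C(1) by (simp add: C'_def r_def power_divide mult_ac flip: ennreal_mult')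
    finally have fin: "ennreal g0 * (\<integral>\<^sup>+z. ennreal (cmod (deriv \<psi> z) powr (- 2 * s)) \<partial>lebesgue_on ?Q) \<le> ennreal g0 * ennreal (C' * (l\<^sup>2 * P powr (- 2 * s)))"
      using g0 by (simp add: ennreal_mult')
    show "(\<integral>\<^sup>+z. ennreal (cmod (deriv \<psi> z) powr (- 2 * s)) \<partial>lebesgue_on ?Q) \<le> ennreal (C' * (l\<^sup>2 * cmod (deriv \<psi> (zc \<theta> l)) powr (- 2 * s)))"
      using fin g0 unfolding P_def a_def by (subst (asm) ennreal_mult_le_mult_iff) auto
  qed
qed

text \<open>Both averages are quotients of a number by itself, hence at most 1, also when that
  number is 0.\<close>

lemma one_in_Dp: "in_Dp \<Omega> p (\<lambda>_. 1)"
proof -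
  have m: "B \<inter> \<Omega> \<in> lmeasurable" if "B \<in> sets lebesgue" for B
    using that bounded_Omega by (intro bounded_set_imp_lmeasurable) auto
  have i: "set_integrable lebesgue (ball c r \<inter> \<Omega>) (\<lambda>_. 1 :: real)" for c r
    using m[of "ball c r"] unfolding set_integrable_def by (auto simp: fmeasurable_def)
  have k: "set_integrable lebesgue K (\<lambda>_. 1 :: real)" if "compact K" for K
    using lmeasurable_compact[OF that] unfolding set_integrable_def by (auto simp: fmeasurable_def)
  have "weight_on \<Omega> (\<lambda>_. 1)" unfolding weight_on_def using k by auto
  moreover have "wavg q (\<lambda>_. 1) E (\<lambda>_. 1) \<le> 1" "0 \<le> wavg q (\<lambda>_. 1) E (\<lambda>_. 1)" for q E
    unfolding wavg_def by (auto simp: divide_le_eq_1)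
  then have "wavg q (\<lambda>_. 1) E (\<lambda>_. 1) * wavg q' (\<lambda>_. 1) E (\<lambda>_. 1) \<le> 1" for q q' E
    by (simp add: mult_le_one)
  ultimately show ?thesis unfolding in_Dp_def wavg_finite_def using i by (auto intro!: exI[of _ 1])
qed

theorem Bp_necessity:
  assumes "\<forall>p>1. \<forall>\<sigma>. in_Dp \<Omega> p \<sigma> \<longrightarrow> bergman_bounded \<Omega> p \<sigma>" and q: "q > 1"
  shows "in_Bp q (\<lambda>z. (cmod (deriv \<psi> z))\<^sup>2)"
proof -
  have s: "1 / (q - 1) > 0" using q by simp
  then have "bergman_bounded \<Omega> (2 + 2 * (1 / (q - 1))) (\<lambda>_. 1)"
    using assms(1) one_in_Dp by (smt (verit))
  from bergman_bounded_imp_negative_moments[OF s this]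
  show ?thesis using negative_moments_imp_Bp[OF q] by metis
qed

end

subsection \<open>The positive Bergman operator on weighted spaces\<close>

text \<open>Jensen's inequality when the total mass is only bounded above by \<open>V\<close> and
  the integral only bounded below by \<open>G\<close>. Young's inequality supplies the tangent to
  x^p at t = G/V, and integrating it gives the claim.\<close>

lemma jensen_powr_nn_integral:
  fixes g :: "'a \<Rightarrow> real"
  assumes p: "p > 1" and g: "g \<in> borel_measurable M" "\<And>x. g x \<ge> 0"
    and V: "emeasure M (space M) \<le> ennreal V" "V > 0" and G: "G \<ge> 0" "ennreal G \<le> (\<integral>\<^sup>+x. ennreal (g x) \<partial>M)"
  shows "ennreal (G powr p) \<le> ennreal (V powr (p - 1)) * (\<integral>\<^sup>+x. ennreal (g x powr p) \<partial>M)"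
proof (cases "(\<integral>\<^sup>+x. ennreal (g x powr p) \<partial>M) = \<infinity>")
  case True
  then show ?thesis using V(2) by (simp add: ennreal_mult_top)
next
  case False
  then obtain I where I: "(\<integral>\<^sup>+x. ennreal (g x powr p) \<partial>M) = ennreal I" "I \<ge> 0"
    by (cases "\<integral>\<^sup>+x. ennreal (g x powr p) \<partial>M") auto
  define t where "t = G / V"
  have t: "t \<ge> 0" "G = t * V" using G V by (auto simp: t_def)
  have young: "p * t powr (p - 1) * x \<le> x powr p + (p - 1) * t powr p" if "x \<ge> 0" for x
  proof -
    have "x * t powr (p - 1) \<le> x powr p / p + (t powr (p - 1)) powr (p / (p - 1)) / (p / (p - 1))"
      using p that by (intro Youngs_inequality) (auto simp: field_simps)
    also have "(t powr (p - 1)) powr (p / (p - 1)) = t powr p" using p by (simp add: powr_powr)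
    finally have "p * (x * t powr (p - 1)) \<le> p * (x powr p / p + t powr p / (p / (p - 1)))" using p by (intro mult_left_mono) auto
    also have "\<dots> = x powr p + (p - 1) * t powr p" using p by (simp add: field_simps)
    finally show ?thesis by (simp add: mult_ac)
  qed
  have "ennreal (p * t powr (p - 1) * G) \<le> ennreal (p * t powr (p - 1)) * (\<integral>\<^sup>+x. ennreal (g x) \<partial>M)"
    using p G by (subst ennreal_mult') (auto intro: mult_left_mono)
  also have "\<dots> = (\<integral>\<^sup>+x. ennreal (p * t powr (p - 1)) * ennreal (g x) \<partial>M)"
    using g(1) by (intro nn_integral_cmult[symmetric]) measurable
  also have "\<dots> \<le> (\<integral>\<^sup>+x. ennreal (g x powr p) + ennreal ((p - 1) * t powr p) \<partial>M)"
    using young g(2) p by (intro nn_integral_mono) (auto intro!: ennreal_leI simp flip: ennreal_mult' ennreal_plus)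
  also have "\<dots> = ennreal I + ennreal ((p - 1) * t powr p) * emeasure M (space M)"
    using g(1) I by (subst nn_integral_add) auto
  also have "\<dots> \<le> ennreal I + ennreal ((p - 1) * t powr p) * ennreal V" by (intro add_mono mult_left_mono V) auto
  also have "\<dots> = ennreal (I + (p - 1) * t powr p * V)" using I V p by (simp add: ennreal_mult')
  finally have "p * t powr (p - 1) * G \<le> I + (p - 1) * t powr p * V"
    using I V p by (subst (asm) ennreal_le_iff) auto
  moreover have "t powr (p - 1) * G = t powr p * V"
    using t p by (cases "t = 0") (auto simp: powr_mult_base mult_ac powr_diff field_simps)
  then have "p * t powr (p - 1) * G = p * (t powr p * V)" by (simp only: mult.assoc)
  moreover have "(p - 1) * t powr p * V = p * (t powr p * V) - t powr p * V" by (simp add: algebra_simps)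
  ultimately have "t powr p * V \<le> I" by linarith
  then have "V powr (p - 1) * (t powr p * V) \<le> V powr (p - 1) * I" by (intro mult_left_mono) auto
  moreover have "G powr p = V powr (p - 1) * (t powr p * V)"
  proof -
    have "G powr p = t powr p * V powr p" unfolding t(2) using t V by (simp add: powr_mult)
    also have "V powr p = V powr (p - 1) * V powr 1" using powr_add[of V "p - 1" 1] by simp
    finally show ?thesis using V by (simp add: mult_ac)
  qed
  ultimately have "G powr p \<le> V powr (p - 1) * I" by simp
  then show ?thesis unfolding I using I(2) by (simp add: ennreal_leI flip: ennreal_mult')
qed

definition cell :: "nat \<times> nat \<Rightarrow> nat \<Rightarrow> complex set" where
  "cell = (\<lambda>(n, j) m. if j < 16 * 2 ^ n then layer (grid n j) (1 / 2 ^ n) m else {})"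

lemma cell_borel [measurable]: "cell nj m \<in> sets borel"
  by (cases nj) (auto simp: cell_def)

lemma cell_disc: "cell nj m \<subseteq> disc"
proof -
  have "layer \<theta> l m \<subseteq> disc" for \<theta> l using hbox_disc(1,3) by blast
  then show ?thesis by (cases nj) (simp add: cell_def)
qed

lemma cell_M: "cell nj m \<in> sets (lebesgue_on disc)"
  by (subst sets_restrict_space_iff) (simp_all add: cell_disc)

lemma cell_overlap: "(\<integral>\<^sup>+nj. indicator (cell nj m) z \<partial>count_space UNIV) \<le> (3::ennreal)"
proof -
  have e: "{nj. z \<in> cell nj m} = {(n, j). j < 16 * 2 ^ n \<and> z \<in> layer (grid n j) (1 / 2 ^ n) m}"
    by (auto simp: cell_def split: if_splits)
  have "(\<integral>\<^sup>+nj. indicator (cell nj m) z \<partial>count_space UNIV) = (\<integral>\<^sup>+nj. indicator {nj. z \<in> cell nj m} nj \<partial>count_space UNIV)"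
    by (intro nn_integral_cong) (auto simp: indicator_def)
  also have "\<dots> = emeasure (count_space UNIV) {nj. z \<in> cell nj m}" by (rule nn_integral_indicator) simp
  also have "\<dots> = of_nat (card {nj. z \<in> cell nj m})"
    unfolding e by (rule emeasure_count_space_finite) (use layer_overlap(1) in auto)
  also have "\<dots> \<le> of_nat 3" unfolding e of_nat_le_iff by (rule layer_overlap(2))
  finally show ?thesis by simp
qed

lemma geometric_double: 
  assumes r: "0 < r" "r < 1"
  shows "(\<integral>\<^sup>+mk. ennreal (r ^ (fst mk + snd mk)) \<partial>count_space (UNIV :: (nat \<times> nat) set)) = ennreal ((1 / (1 - r))\<^sup>2)"
proof -
  have g: "(\<Sum>k. ennreal (c * r ^ k)) = ennreal (c * (1 / (1 - r)))" if "c \<ge> 0" for c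
    using r that by (intro suminf_ennreal_eq sums_mult geometric_sums) auto
  have "(\<integral>\<^sup>+mk. ennreal (r ^ (fst mk + snd mk)) \<partial>count_space (UNIV :: (nat \<times> nat) set))
      = (\<integral>\<^sup>+m. \<integral>\<^sup>+k. ennreal (r ^ (m + k)) \<partial>count_space UNIV \<partial>count_space UNIV)"
    by (subst nn_integral_fst_count_space[symmetric]) simp
  also have "\<dots> = (\<Sum>m. \<Sum>k. ennreal (r ^ m * r ^ k))"
    by (simp add: nn_integral_count_space_nat power_add)
  also have "\<dots> = (\<Sum>m. ennreal (1 / (1 - r) * r ^ m))" using r by (subst g) (auto simp: mult.commute)
  also have "\<dots> = ennreal ((1 / (1 - r))\<^sup>2)" using r by (subst g) (auto simp: power2_eq_square)
  finally show ?thesis .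
qed

text \<open>The constant 64 = 8^2 serves the pairs with |1 - z cnj(w)| >= 1/8. For all others a
  single term suffices: the common box of generation n and the layers of it that contain
  \<open>z\<close> and \<open>w\<close>.\<close>

lemma bergman_kernel_sum:
  assumes z: "z \<in> disc" and w: "w \<in> disc"
  shows "ennreal (1 / (cmod (1 - z * cnj w))\<^sup>2) \<le> 64 +
    (\<integral>\<^sup>+i. ennreal (256 * 4 ^ fst (snd i)) * indicator (cell (snd i) (fst (fst i))) z * indicator (cell (snd i) (snd (fst i))) w \<partial>count_space (UNIV :: ((nat \<times> nat) \<times> (nat \<times> nat)) set))"
proof (cases "cmod (1 - z * cnj w) < 1/8")
  case False
  then have "(1/8)\<^sup>2 \<le> (cmod (1 - z * cnj w))\<^sup>2" by (intro power_mono) auto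
  then have "1 / (cmod (1 - z * cnj w))\<^sup>2 \<le> 1 / (1/8)\<^sup>2" by (intro divide_left_mono) (auto intro!: mult_pos_pos elim: less_le_trans[rotated])
  then have "ennreal (1 / (cmod (1 - z * cnj w))\<^sup>2) \<le> ennreal 64" by (intro ennreal_leI) (simp add: power2_eq_square)
  then show ?thesis by (simp add: add_increasing2)
next
  case True
  obtain n j where n: "1 / (cmod (1 - z * cnj w))\<^sup>2 \<le> 256 * 4 ^ n" and j: "j < 16 * 2 ^ n"
    "z \<in> hbox (grid n j) (1 / 2 ^ n)" "w \<in> hbox (grid n j) (1 / 2 ^ n)"
    using bergman_kernel_box[OF _ _ True] z w by auto
  obtain m k where mk: "z \<in> layer (grid n j) (1 / 2 ^ n) m" "w \<in> layer (grid n j) (1 / 2 ^ n) k"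
    using hbox_layer j by blast
  define i0 where "i0 = ((m, k), (n, j))"
  let ?f = "\<lambda>i::(nat \<times> nat) \<times> (nat \<times> nat). ennreal (256 * 4 ^ fst (snd i)) * indicator (cell (snd i) (fst (fst i))) z * indicator (cell (snd i) (snd (fst i))) w"
  have "ennreal (1 / (cmod (1 - z * cnj w))\<^sup>2) \<le> ennreal (256 * 4 ^ n)" using n by (rule ennreal_leI)
  also have "\<dots> = ?f i0" using mk j by (simp add: i0_def cell_def)
  also have "\<dots> = (\<integral>\<^sup>+i. ?f i0 * indicator {i0} i \<partial>count_space UNIV)"
    by (subst nn_integral_cmult_indicator) auto
  also have "\<dots> \<le> (\<integral>\<^sup>+i. ?f i \<partial>count_space UNIV)" by (intro nn_integral_mono) (auto simp: indicator_def[of "{i0}"])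
  finally show ?thesis by (simp add: add_increasing)
qed

lemma borel_measurable_nn_integral_count_space:
  fixes f :: "'i::countable \<Rightarrow> 'a \<Rightarrow> ennreal"
  assumes "\<And>i. f i \<in> borel_measurable M"
  shows "(\<lambda>x. \<integral>\<^sup>+i. f i x \<partial>count_space UNIV) \<in> borel_measurable M"
proof (rule sigma_finite_measure.borel_measurable_nn_integral)
  show "sigma_finite_measure (count_space (UNIV :: 'i set))" by (rule sigma_finite_measure_count_space)
  show "(\<lambda>(x, i). f i x) \<in> borel_measurable (M \<Otimes>\<^sub>M count_space UNIV)"
    using measurable_pair_swap[OF measurable_pair_measure_countable1[of UNIV "\<lambda>(i, x). f i x" M borel]] assms
    by (simp add: case_prod_beta')
qed

lemma bergman_kernel_measurable:
  "(\<lambda>w. 1 / (cmod (1 - z * cnj w))\<^sup>2) \<in> borel_measurable (lebesgue_on disc)"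
proof -
  have "(\<lambda>w. cmod (1 - z * cnj w)) \<in> borel_measurable (lebesgue_on disc)"
    by (intro continuous_imp_measurable_on_sets_lebesgue continuous_intros) auto
  then show ?thesis by measurable
qed

lemma bergman_kernel_low:
  assumes "cmod z < 1" "cmod w \<le> 1" shows "1 - cmod z \<le> cmod (1 - z * cnj w)"
proof -
  have "cmod (z * cnj w) \<le> cmod z" using assms by (simp add: norm_mult mult_left_le)
  then show ?thesis using norm_triangle_ineq2[of 1 "z * cnj w"] by simp
qed

lemma bergman_kernel_integrable:
  fixes F :: "complex \<Rightarrow> real"
  assumes F: "integrable (lebesgue_on disc) F" and z: "z \<in> disc"
  shows "integrable (lebesgue_on disc) (\<lambda>w. F w * (1 / (cmod (1 - z * cnj w))\<^sup>2))"
proof (rule Bochner_Integration.integrable_bound)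
  show "integrable (lebesgue_on disc) (\<lambda>w. F w * (1 / (1 - cmod z)\<^sup>2))" using F by simp
  show "(\<lambda>w. F w * (1 / (cmod (1 - z * cnj w))\<^sup>2)) \<in> borel_measurable (lebesgue_on disc)"
    using F bergman_kernel_measurable[of z] by (intro borel_measurable_times) auto
  show "AE w in lebesgue_on disc. norm (F w * (1 / (cmod (1 - z * cnj w))\<^sup>2)) \<le> norm (F w * (1 / (1 - cmod z)\<^sup>2))"
  proof (rule AE_I2)
    fix w assume "w \<in> space (lebesgue_on disc)"
    then have "cmod w \<le> 1" by simp
    then have "1 - cmod z \<le> cmod (1 - z * cnj w)" using z by (intro bergman_kernel_low) auto
    then have "1 / (cmod (1 - z * cnj w))\<^sup>2 \<le> 1 / (1 - cmod z)\<^sup>2"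
      using z by (intro divide_left_mono power_mono mult_pos_pos zero_less_power) auto
    then have "\<bar>F w\<bar> * (1 / (cmod (1 - z * cnj w))\<^sup>2) \<le> \<bar>F w\<bar> * (1 / (1 - cmod z)\<^sup>2)" by (intro mult_left_mono) auto
    then show "norm (F w * (1 / (cmod (1 - z * cnj w))\<^sup>2)) \<le> norm (F w * (1 / (1 - cmod z)\<^sup>2))" by (simp add: abs_mult)
  qed
qed

text \<open>\<open>b dA\<close> is the weight of the space and \<open>a = b\<^bsup>-1/(p-1)\<^esup>\<close> its dual.\<close>

locale weight_pair =
  fixes a b :: "complex \<Rightarrow> real" and p :: real
  assumes p: "p > 1" and am: "a \<in> borel_measurable (lebesgue_on disc)" and bm: "b \<in> borel_measurable (lebesgue_on disc)"
    and dual: "AE z in lebesgue_on disc. a z > 0 \<and> b z = a z powr (1 - p)"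
begin

text \<open>Jensen's inequality for F/a with respect to the measure a dA on \<open>L\<close>, since
  a (F/a)^p = F^p b by duality.\<close>

lemma holder:
  assumes F: "integrable (lebesgue_on disc) F" "\<And>w. F w \<ge> 0" and L: "L \<in> sets (lebesgue_on disc)"
    and \<alpha>: "(\<integral>\<^sup>+w. ennreal (a w) * indicator L w \<partial>lebesgue_on disc) \<le> ennreal \<alpha>" "\<alpha> > 0"
  shows "ennreal ((\<integral>w. F w * indicator L w \<partial>lebesgue_on disc) powr p)
     \<le> ennreal (\<alpha> powr (p - 1)) * (\<integral>\<^sup>+w. ennreal (F w powr p * b w) * indicator L w \<partial>lebesgue_on disc)"
proof -
  let ?M = "lebesgue_on disc"
  have Fm: "F \<in> borel_measurable ?M" using F by simp
  have aL: "(\<lambda>w. ennreal (a w) * indicator L w) \<in> borel_measurable ?M" using am L by measurable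
  define \<nu> where "\<nu> = density ?M (\<lambda>w. ennreal (a w) * indicator L w)"
  \<comment> \<open>The absolute value keeps \<open>g\<close> nonnegative at the exceptional points
    where \<open>a\<close> is not positive.\<close>
  define g where "g w = F w / \<bar>a w\<bar>" for w
  have gm: "g \<in> borel_measurable ?M" unfolding g_def using Fm am by measurable
  have FLi: "integrable ?M (\<lambda>w. F w * indicator L w)" using integrable_mult_indicator[OF L F(1)] by (simp add: mult.commute)
  have nn: "(\<integral>\<^sup>+w. ennreal (F w * indicator L w) \<partial>?M) = ennreal (\<integral>w. F w * indicator L w \<partial>?M)"
    using F(2) by (intro nn_integral_eq_integral FLi) auto
  have "ennreal ((\<integral>w. F w * indicator L w \<partial>?M) powr p) \<le> ennreal (\<alpha> powr (p - 1)) * (\<integral>\<^sup>+w. ennreal (g w powr p) \<partial>\<nu>)"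
  proof (rule jensen_powr_nn_integral[OF p])
    show "g \<in> borel_measurable \<nu>" using gm by (simp add: \<nu>_def)
    show "\<And>x. 0 \<le> g x" using F(2) by (simp add: g_def)
    have "emeasure \<nu> (space \<nu>) = (\<integral>\<^sup>+w. (ennreal (a w) * indicator L w) * indicator (space ?M) w \<partial>?M)"
      unfolding \<nu>_def using aL by (subst emeasure_density) auto
    also have "\<dots> = (\<integral>\<^sup>+w. ennreal (a w) * indicator L w \<partial>?M)" by (intro nn_integral_cong) (simp add: indicator_def)
    finally show "emeasure \<nu> (space \<nu>) \<le> ennreal \<alpha>" using \<alpha> by simp
    show "0 \<le> (\<integral>w. F w * indicator L w \<partial>?M)" using F(2) by (intro integral_nonneg_AE) auto
    have "(\<integral>\<^sup>+w. ennreal (g w) \<partial>\<nu>) = (\<integral>\<^sup>+w. (ennreal (a w) * indicator L w) * ennreal (g w) \<partial>?M)"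
      unfolding \<nu>_def using aL gm by (subst nn_integral_density) auto
    also have "\<dots> = (\<integral>\<^sup>+w. ennreal (F w * indicator L w) \<partial>?M)"
      using dual by (intro nn_integral_cong_AE) (auto elim!: eventually_mono simp: g_def indicator_def F(2) simp flip: ennreal_mult')
    finally show "ennreal (\<integral>w. F w * indicator L w \<partial>?M) \<le> (\<integral>\<^sup>+w. ennreal (g w) \<partial>\<nu>)" using nn by simp
  qed (use \<alpha> in auto)
  also have "(\<integral>\<^sup>+w. ennreal (g w powr p) \<partial>\<nu>) = (\<integral>\<^sup>+w. (ennreal (a w) * indicator L w) * ennreal (g w powr p) \<partial>?M)"
    unfolding \<nu>_def using aL gm by (subst nn_integral_density) auto
  also have "\<dots> = (\<integral>\<^sup>+w. ennreal (F w powr p * b w) * indicator L w \<partial>?M)"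
  proof (rule nn_integral_cong_AE, use dual in \<open>eventually_elim\<close>)
    fix w assume w: "a w > 0 \<and> b w = a w powr (1 - p)"
    have "a w * (F w / a w) powr p = F w powr p * a w powr (1 - p)"
      using w F(2)[of w] by (simp add: powr_divide powr_diff)
    then show "ennreal (a w) * indicator L w * ennreal (g w powr p) = ennreal (F w powr p * b w) * indicator L w"
      using w F(2)[of w] by (auto simp: g_def indicator_def simp flip: ennreal_mult')
  qed
  finally show ?thesis .
qed

text \<open>The index i = ((m, k), (n, j)) stands for the box (n, j) with \<open>z\<close> in its
  m-th layer and \<open>w\<close> in its k-th. Jensen's inequality with masses R_i = r^(m+k) moves
  the p-th power inside the sum over the cells that contain \<open>z\<close>; Holder's inequality on
  the cell of \<open>w\<close> and the hypothesis \<open>box\<close> then bound each term. The far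
  part of the kernel only sees the total masses.\<close>

theorem positive_operator_bound:
  assumes \<rho>: "0 < \<rho>" "\<rho> < 1" and C0: "C0 \<ge> 0"
    and box: "\<And>\<theta> l m k. 0 < l \<Longrightarrow> l \<le> 1 \<Longrightarrow> \<exists>\<alpha> \<beta>. 0 < \<alpha> \<and> 0 \<le> \<beta> \<and>
      (\<integral>\<^sup>+z. ennreal (b z) * indicator (layer \<theta> l m) z \<partial>lebesgue_on disc) \<le> ennreal \<beta> \<and>
      (\<integral>\<^sup>+z. ennreal (a z) * indicator (layer \<theta> l k) z \<partial>lebesgue_on disc) \<le> ennreal \<alpha> \<and>
      \<beta> * \<alpha> powr (p - 1) \<le> C0 * \<rho> ^ (m + k) * (l\<^sup>2) powr p"
    and tot: "(\<integral>\<^sup>+z. ennreal (b z) \<partial>lebesgue_on disc) \<le> ennreal Vb" "Vb \<ge> 0"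
      "(\<integral>\<^sup>+z. ennreal (a z) \<partial>lebesgue_on disc) \<le> ennreal Va" "Va > 0"
  shows "\<exists>C>0. \<forall>F. integrable (lebesgue_on disc) F \<longrightarrow> (\<forall>w. F w \<ge> 0) \<longrightarrow>
    (\<integral>\<^sup>+z. ennreal ((\<integral>w. F w * (1 / (cmod (1 - z * cnj w))\<^sup>2) \<partial>lebesgue_on disc) powr p * b z) \<partial>lebesgue_on disc)
      \<le> ennreal C * (\<integral>\<^sup>+z. ennreal (F z powr p * b z) \<partial>lebesgue_on disc)"
proof -
  let ?M = "lebesgue_on disc"
  \<comment> \<open>Because r^p = \<rho>, the factor R_i^(1-p) left by Jensen's inequality times the
    gain R_i^p is again R_i, which remains summable over the cells of \<open>w\<close>.\<close>
  define r where "r = \<rho> powr (1/p)"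
  have r: "0 < r" "r < 1" using \<rho> p powr_less_mono2[of "1/p" \<rho> 1] by (auto simp: r_def)
  have rp: "(r ^ N) powr p = \<rho> ^ N" for N
  proof -
    have "(r ^ N) powr p = (r powr p) ^ N" using r by (simp add: powr_realpow[symmetric] powr_powr mult.commute)
    also have "r powr p = \<rho>" using \<rho> p by (simp add: r_def powr_powr)
    finally show ?thesis .
  qed
  \<comment> \<open>At most three cells for each pair of layer indices contain a given point; the
    rest is the double geometric sum.\<close>
  define V where "V = 3 * (1 / (1 - r))\<^sup>2"
  have V: "V > 0" using r by (simp add: V_def)
  define C where "C = (128 powr p) * Va powr (p - 1) * Vb + (2 powr p * V powr (p - 1)) * (256 powr p * C0 * V) + 1"
  have C: "C > 0" using tot V C0 unfolding C_def by (intro add_nonneg_pos add_nonneg_nonneg mult_nonneg_nonneg) auto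
  have main: "(\<integral>\<^sup>+z. ennreal ((\<integral>w. F w * (1 / (cmod (1 - z * cnj w))\<^sup>2) \<partial>?M) powr p * b z) \<partial>?M)
      \<le> ennreal C * (\<integral>\<^sup>+z. ennreal (F z powr p * b z) \<partial>?M)"
    if F: "integrable ?M F" "\<And>w. F w \<ge> 0" for F
  proof -
    let ?I = "count_space (UNIV :: ((nat \<times> nat) \<times> (nat \<times> nat)) set)"
    have Fm: "F \<in> borel_measurable ?M" using F by simp
    define N where "N = (\<integral>\<^sup>+z. ennreal (F z powr p * b z) \<partial>?M)"
    define FD where "FD = (\<integral>w. F w \<partial>?M)"
    have FD: "FD \<ge> 0" unfolding FD_def using F(2) by (intro integral_nonneg_AE) auto
    define Fi where "Fi i = (\<integral>w. F w * indicator (cell (snd i) (snd (fst i))) w \<partial>?M)" for i :: "(nat \<times> nat) \<times> (nat \<times> nat)"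
    have Fi0: "Fi i \<ge> 0" for i unfolding Fi_def using F(2) by (intro integral_nonneg_AE) auto
    have Fi: "(\<integral>\<^sup>+w. ennreal (F w) * indicator (cell (snd i) (snd (fst i))) w \<partial>?M) = ennreal (Fi i)" for i
    proof -
      have "integrable ?M (\<lambda>w. F w * indicator (cell (snd i) (snd (fst i))) w)"
        using integrable_mult_indicator[OF cell_M F(1)] by (simp add: mult.commute)
      then have "(\<integral>\<^sup>+w. ennreal (F w * indicator (cell (snd i) (snd (fst i))) w) \<partial>?M) = ennreal (Fi i)"
        unfolding Fi_def using F(2) by (intro nn_integral_eq_integral) auto
      then show ?thesis using F(2) by (simp add: ennreal_mult' ennreal_indicator)
    qed
    define R where "R i = r ^ (fst (fst i) + snd (fst i))" for i :: "(nat \<times> nat) \<times> (nat \<times> nat)"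
    have R: "R i > 0" for i using r by (simp add: R_def)
    define x where "x i = 256 * 4 ^ fst (snd i) * Fi i" for i
    have x0: "x i \<ge> 0" for i using Fi0 by (simp add: x_def)
    \<comment> \<open>The summand of Jensen's inequality when x_i is written as R_i times x_i /
      R_i.\<close>
    define c where "c i = R i * (x i / R i) powr p" for i
    have c0: "c i \<ge> 0" for i using R[of i] by (simp add: c_def)
    have mass: "(\<integral>\<^sup>+i. ennreal (R i) * indicator (cell (snd i) (g (fst i))) z \<partial>?I) \<le> ennreal V" for z and g :: "nat \<times> nat \<Rightarrow> nat"
    proof -
      have "(\<integral>\<^sup>+i. ennreal (R i) * indicator (cell (snd i) (g (fst i))) z \<partial>?I)
          = (\<integral>\<^sup>+mk. \<integral>\<^sup>+nj. ennreal (r ^ (fst mk + snd mk)) * indicator (cell nj (g mk)) z \<partial>count_space UNIV \<partial>count_space UNIV)"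
        by (subst nn_integral_fst_count_space[symmetric]) (simp add: R_def)
      also have "\<dots> = (\<integral>\<^sup>+mk. ennreal (r ^ (fst mk + snd mk)) * (\<integral>\<^sup>+nj. indicator (cell nj (g mk)) z \<partial>count_space UNIV) \<partial>count_space UNIV)"
        by (intro nn_integral_cong nn_integral_cmult) auto
      also have "\<dots> \<le> (\<integral>\<^sup>+mk. ennreal (r ^ (fst mk + snd mk)) * 3 \<partial>count_space UNIV)"
        by (intro nn_integral_mono mult_left_mono cell_overlap) auto
      also have "\<dots> = ennreal ((1 / (1 - r))\<^sup>2) * 3"
        by (subst nn_integral_multc) (auto simp: geometric_double[OF r])
      also have "\<dots> = ennreal V" by (simp add: V_def ennreal_mult' mult.commute)
      finally show ?thesis .
    qed
    have stepA: "ennreal ((\<integral>w. F w * (1 / (cmod (1 - z * cnj w))\<^sup>2) \<partial>?M) powr p)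
        \<le> ennreal ((128 * FD) powr p) + ennreal (2 powr p * V powr (p - 1)) * (\<integral>\<^sup>+i. ennreal (c i) * indicator (cell (snd i) (fst (fst i))) z \<partial>?I)"
      if z: "z \<in> disc" for z
    proof -
      define G where "G = (\<integral>w. F w * (1 / (cmod (1 - z * cnj w))\<^sup>2) \<partial>?M)"
      have G0: "G \<ge> 0" unfolding G_def using F(2) by (intro integral_nonneg_AE) auto
      have "ennreal G = (\<integral>\<^sup>+w. ennreal (F w * (1 / (cmod (1 - z * cnj w))\<^sup>2)) \<partial>?M)"
        unfolding G_def using F(2) by (intro nn_integral_eq_integral[symmetric] bergman_kernel_integrable F z) auto
      also have "\<dots> \<le> (\<integral>\<^sup>+w. ennreal (F w) * 64 + (\<integral>\<^sup>+i. ennreal (F w) * (ennreal (256 * 4 ^ fst (snd i)) * indicator (cell (snd i) (fst (fst i))) z * indicator (cell (snd i) (snd (fst i))) w) \<partial>?I) \<partial>?M)"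
      proof (rule nn_integral_mono)
        fix w assume "w \<in> space ?M"
        then have w: "w \<in> disc" by simp
        have "ennreal (F w * (1 / (cmod (1 - z * cnj w))\<^sup>2)) = ennreal (F w) * ennreal (1 / (cmod (1 - z * cnj w))\<^sup>2)"
          using F(2) by (intro ennreal_mult) auto
        also have "\<dots> \<le> ennreal (F w) * (64 + (\<integral>\<^sup>+i. ennreal (256 * 4 ^ fst (snd i)) * indicator (cell (snd i) (fst (fst i))) z * indicator (cell (snd i) (snd (fst i))) w \<partial>?I))"
          by (intro mult_left_mono bergman_kernel_sum z w) simp
        also have "\<dots> = ennreal (F w) * 64 + (\<integral>\<^sup>+i. ennreal (F w) * (ennreal (256 * 4 ^ fst (snd i)) * indicator (cell (snd i) (fst (fst i))) z * indicator (cell (snd i) (snd (fst i))) w) \<partial>?I)"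
          by (subst nn_integral_cmult) (simp_all add: distrib_left)
        finally show "ennreal (F w * (1 / (cmod (1 - z * cnj w))\<^sup>2)) \<le> \<dots>" .
      qed
      also have "\<dots> = (\<integral>\<^sup>+w. ennreal (F w) * 64 \<partial>?M) + (\<integral>\<^sup>+i. \<integral>\<^sup>+w. ennreal (F w) * (ennreal (256 * 4 ^ fst (snd i)) * indicator (cell (snd i) (fst (fst i))) z * indicator (cell (snd i) (snd (fst i))) w) \<partial>?M \<partial>?I)"
      proof -
        have m1: "(\<lambda>w. ennreal (F w) * 64) \<in> borel_measurable ?M" using Fm by measurable
        have m2: "(\<lambda>w. ennreal (F w) * (ennreal (256 * 4 ^ fst (snd i)) * indicator (cell (snd i) (fst (fst i))) z * indicator (cell (snd i) (snd (fst i))) w)) \<in> borel_measurable ?M" for i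
          using Fm cell_M[of "snd i" "snd (fst i)"] by measurable
        have sw: "(\<integral>\<^sup>+w. \<integral>\<^sup>+i. ennreal (F w) * (ennreal (256 * 4 ^ fst (snd i)) * indicator (cell (snd i) (fst (fst i))) z * indicator (cell (snd i) (snd (fst i))) w) \<partial>?I \<partial>?M)
          = (\<integral>\<^sup>+i. \<integral>\<^sup>+w. ennreal (F w) * (ennreal (256 * 4 ^ fst (snd i)) * indicator (cell (snd i) (fst (fst i))) z * indicator (cell (snd i) (snd (fst i))) w) \<partial>?M \<partial>?I)"
          by (rule nn_integral_count_space_nn_integral) (use m2 in auto)
        show ?thesis
          by (subst nn_integral_add[OF m1 borel_measurable_nn_integral_count_space[OF m2]]) (simp only: sw)
      qed
      also have "(\<integral>\<^sup>+w. ennreal (F w) * 64 \<partial>?M) = ennreal (64 * FD)"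
      proof -
        have "(\<integral>\<^sup>+w. ennreal (F w) * 64 \<partial>?M) = (\<integral>\<^sup>+w. ennreal (F w) \<partial>?M) * 64" using Fm by (intro nn_integral_multc) measurable
        also have "(\<integral>\<^sup>+w. ennreal (F w) \<partial>?M) = ennreal FD" unfolding FD_def using F by (intro nn_integral_eq_integral) auto
        finally show ?thesis using FD by (simp add: ennreal_mult' mult.commute)
      qed
      also have "(\<integral>\<^sup>+i. \<integral>\<^sup>+w. ennreal (F w) * (ennreal (256 * 4 ^ fst (snd i)) * indicator (cell (snd i) (fst (fst i))) z * indicator (cell (snd i) (snd (fst i))) w) \<partial>?M \<partial>?I)
         = (\<integral>\<^sup>+i. ennreal (x i) * indicator (cell (snd i) (fst (fst i))) z \<partial>?I)"
      proof (rule nn_integral_cong)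
        fix i :: "(nat \<times> nat) \<times> (nat \<times> nat)"
        have m: "(\<lambda>w. ennreal (F w) * indicator (cell (snd i) (snd (fst i))) w) \<in> borel_measurable ?M" using Fm cell_M[of "snd i" "snd (fst i)"] by measurable
        have "(\<integral>\<^sup>+w. ennreal (F w) * (ennreal (256 * 4 ^ fst (snd i)) * indicator (cell (snd i) (fst (fst i))) z * indicator (cell (snd i) (snd (fst i))) w) \<partial>?M)
           = (\<integral>\<^sup>+w. (ennreal (256 * 4 ^ fst (snd i)) * indicator (cell (snd i) (fst (fst i))) z) * (ennreal (F w) * indicator (cell (snd i) (snd (fst i))) w) \<partial>?M)"
          by (intro nn_integral_cong) (simp only: mult_ac)
        also have "\<dots> = (ennreal (256 * 4 ^ fst (snd i)) * indicator (cell (snd i) (fst (fst i))) z) * ennreal (Fi i)"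
          using m by (subst nn_integral_cmult) (auto simp: Fi)
        also have "\<dots> = ennreal (x i) * indicator (cell (snd i) (fst (fst i))) z"
        proof -
          have "ennreal (x i) = ennreal (256 * 4 ^ fst (snd i)) * ennreal (Fi i)"
            unfolding x_def using Fi0[of i] by (intro ennreal_mult) auto
          then show ?thesis by (simp only: mult_ac)
        qed
        finally show "(\<integral>\<^sup>+w. ennreal (F w) * (ennreal (256 * 4 ^ fst (snd i)) * indicator (cell (snd i) (fst (fst i))) z * indicator (cell (snd i) (snd (fst i))) w) \<partial>?M)
          = ennreal (x i) * indicator (cell (snd i) (fst (fst i))) z" .
      qed
      finally have G1: "ennreal G \<le> ennreal (64 * FD) + (\<integral>\<^sup>+i. ennreal (x i) * indicator (cell (snd i) (fst (fst i))) z \<partial>?I)" .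
      \<comment> \<open>Either the far part 64 FD accounts for at least half of \<open>G\<close>, or
        the sum over cells does.\<close>
      show ?thesis
      proof (cases "G \<le> 128 * FD")
        case True
        then have "G powr p \<le> (128 * FD) powr p" using G0 p by (intro powr_mono2) auto
        then show ?thesis unfolding G_def[symmetric] by (simp add: add_increasing2 ennreal_leI)
      next
        case False
        have half: "ennreal (G/2) \<le> (\<integral>\<^sup>+i. ennreal (x i) * indicator (cell (snd i) (fst (fst i))) z \<partial>?I)" (is "_ \<le> ?S")
        proof (cases ?S)
          case (real s)
          then have "ennreal G \<le> ennreal (64 * FD + s)" using G1 FD by simp
          then have "G \<le> 64 * FD + s" using FD real(1) by (subst (asm) ennreal_le_iff) auto
          then show ?thesis using False real by (simp add: ennreal_leI)
        qed simp
        define \<nu> where "\<nu> = density ?I (\<lambda>i. ennreal (R i) * indicator (cell (snd i) (fst (fst i))) z)"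
        have "ennreal ((G/2) powr p) \<le> ennreal (V powr (p - 1)) * (\<integral>\<^sup>+i. ennreal ((x i / R i) powr p) \<partial>\<nu>)"
        proof (rule jensen_powr_nn_integral[OF p _ _ _ V])
          show "(\<lambda>i. x i / R i) \<in> borel_measurable \<nu>" by (simp add: \<nu>_def)
          show "0 \<le> x i / R i" for i using x0[of i] R[of i] by simp
          have "emeasure \<nu> (space \<nu>) = (\<integral>\<^sup>+i. ennreal (R i) * indicator (cell (snd i) (fst (fst i))) z \<partial>?I)"
            unfolding \<nu>_def by (subst emeasure_density) auto
          then show "emeasure \<nu> (space \<nu>) \<le> ennreal V" using mass[of fst z] by simp
          have "(\<integral>\<^sup>+i. ennreal (x i / R i) \<partial>\<nu>) = (\<integral>\<^sup>+i. (ennreal (R i) * indicator (cell (snd i) (fst (fst i))) z) * ennreal (x i / R i) \<partial>?I)"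
            unfolding \<nu>_def by (subst nn_integral_density) auto
          also have "\<dots> = ?S"
          proof (rule nn_integral_cong)
            fix i :: "(nat \<times> nat) \<times> (nat \<times> nat)"
            have "ennreal (R i) * ennreal (x i / R i) = ennreal (x i)"
              using R[of i] by (simp flip: ennreal_mult')
            then show "ennreal (R i) * indicator (cell (snd i) (fst (fst i))) z * ennreal (x i / R i) = ennreal (x i) * indicator (cell (snd i) (fst (fst i))) z"
              by (simp add: indicator_def)
          qed
          finally show "ennreal (G/2) \<le> (\<integral>\<^sup>+i. ennreal (x i / R i) \<partial>\<nu>)" using half by simp
        qed (use G0 in simp)
        also have "(\<integral>\<^sup>+i. ennreal ((x i / R i) powr p) \<partial>\<nu>) = (\<integral>\<^sup>+i. (ennreal (R i) * indicator (cell (snd i) (fst (fst i))) z) * ennreal ((x i / R i) powr p) \<partial>?I)"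
          unfolding \<nu>_def by (subst nn_integral_density) auto
        also have "\<dots> = (\<integral>\<^sup>+i. ennreal (c i) * indicator (cell (snd i) (fst (fst i))) z \<partial>?I)"
          using R by (intro nn_integral_cong) (auto simp: c_def indicator_def less_imp_le simp flip: ennreal_mult')
        finally have h: "ennreal ((G/2) powr p) \<le> ennreal (V powr (p - 1)) * (\<integral>\<^sup>+i. ennreal (c i) * indicator (cell (snd i) (fst (fst i))) z \<partial>?I)" .
        have "ennreal (G powr p) = ennreal (2 powr p) * ennreal ((G/2) powr p)"
          using G0 by (simp add: powr_divide flip: ennreal_mult')
        also have "\<dots> \<le> ennreal (2 powr p) * (ennreal (V powr (p - 1)) * (\<integral>\<^sup>+i. ennreal (c i) * indicator (cell (snd i) (fst (fst i))) z \<partial>?I))"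
          by (intro mult_left_mono h) simp
        finally show ?thesis unfolding G_def[symmetric] by (simp add: add_increasing ennreal_mult' mult.assoc)
      qed
    qed
    have holderD: "ennreal (FD powr p) \<le> ennreal (Va powr (p - 1)) * N"
    proof -
      have "ennreal ((\<integral>w. F w * indicator disc w \<partial>?M) powr p) \<le> ennreal (Va powr (p - 1)) * (\<integral>\<^sup>+w. ennreal (F w powr p * b w) * indicator disc w \<partial>?M)"
      proof (rule holder[OF F])
        show "(\<integral>\<^sup>+w. ennreal (a w) * indicator disc w \<partial>?M) \<le> ennreal Va"
          by (rule order_trans[OF _ tot(3)]) (auto intro!: nn_integral_mono simp: indicator_def)
      qed (use tot in auto)
      also have "(\<integral>w. F w * indicator disc w \<partial>?M) = FD" unfolding FD_def by (intro Bochner_Integration.integral_cong) auto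
      also have "(\<integral>\<^sup>+w. ennreal (F w powr p * b w) * indicator disc w \<partial>?M) = N" unfolding N_def by (intro nn_integral_cong) auto
      finally show ?thesis .
    qed
    define S where "S z = (\<integral>\<^sup>+i. ennreal (c i) * indicator (cell (snd i) (fst (fst i))) z \<partial>?I)" for z
    have cellm: "(\<lambda>z. ennreal (c i) * indicator (cell (snd i) (fst (fst i))) z) \<in> borel_measurable ?M" for i
      using cell_M[of "snd i" "fst (fst i)"] by measurable
    have Sm: "S \<in> borel_measurable ?M"
      unfolding S_def by (intro borel_measurable_nn_integral_count_space cellm)
    \<comment> \<open>The kernel size 4^n and the squared length 4^(-n) of the box cancel to the
      power p, so the bound does not depend on the generation.\<close>
    have cellterm: "(\<integral>\<^sup>+z. ennreal (c i) * indicator (cell (snd i) (fst (fst i))) z * ennreal (b z) \<partial>?M)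
        \<le> ennreal (256 powr p * C0) * (ennreal (R i) * (\<integral>\<^sup>+w. ennreal (F w powr p * b w) * indicator (cell (snd i) (snd (fst i))) w \<partial>?M))" for i
    proof -
      obtain m k n j where i: "i = ((m, k), (n, j))" by (metis prod.exhaust)
      show ?thesis
      proof (cases "j < 16 * 2 ^ n")
        case False
        then show ?thesis by (simp add: i cell_def)
      next
        case True
        then have cl: "cell (snd i) (fst (fst i)) = layer (grid n j) (1 / 2 ^ n) m" "cell (snd i) (snd (fst i)) = layer (grid n j) (1 / 2 ^ n) k"
          by (auto simp: i cell_def)
        obtain \<alpha> \<beta> where ab: "0 < \<alpha>" "0 \<le> \<beta>"
          "(\<integral>\<^sup>+z. ennreal (b z) * indicator (layer (grid n j) (1 / 2 ^ n) m) z \<partial>?M) \<le> ennreal \<beta>"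
          "(\<integral>\<^sup>+z. ennreal (a z) * indicator (layer (grid n j) (1 / 2 ^ n) k) z \<partial>?M) \<le> ennreal \<alpha>"
          "\<beta> * \<alpha> powr (p - 1) \<le> C0 * \<rho> ^ (m + k) * ((1 / 2 ^ n)\<^sup>2) powr p"
          using box[of "1 / 2 ^ n" "grid n j" m k] by auto
        define Ni where "Ni = (\<integral>\<^sup>+w. ennreal (F w powr p * b w) * indicator (cell (snd i) (snd (fst i))) w \<partial>?M)"
        have hi: "ennreal (Fi i powr p) \<le> ennreal (\<alpha> powr (p - 1)) * Ni"
          unfolding Fi_def Ni_def by (rule holder[OF F cell_M _ ab(1)]) (use ab(4) cl in simp)
        have ci: "c i = R i powr (1 - p) * (256 * 4 ^ n) powr p * Fi i powr p"
          using R[of i] Fi0[of i] by (simp add: c_def x_def i powr_divide powr_mult powr_diff)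
        have "(\<integral>\<^sup>+z. ennreal (c i) * indicator (cell (snd i) (fst (fst i))) z * ennreal (b z) \<partial>?M)
           = (\<integral>\<^sup>+z. ennreal (c i) * (ennreal (b z) * indicator (layer (grid n j) (1 / 2 ^ n) m) z) \<partial>?M)"
          unfolding cl by (intro nn_integral_cong) (simp only: mult_ac)
        also have "\<dots> = ennreal (c i) * (\<integral>\<^sup>+z. ennreal (b z) * indicator (layer (grid n j) (1 / 2 ^ n) m) z \<partial>?M)"
          using cell_M[of "snd i" "fst (fst i)"] unfolding cl
          by (intro nn_integral_cmult borel_measurable_times_ennreal borel_measurable_indicator measurable_compose[OF bm measurable_ennreal])
        also have "\<dots> \<le> ennreal (c i) * ennreal \<beta>" by (intro mult_left_mono ab) simp
        also have "\<dots> = ennreal (R i powr (1 - p) * (256 * 4 ^ n) powr p * \<beta>) * ennreal (Fi i powr p)"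
          unfolding ci using ab(2) by (simp add: mult_ac flip: ennreal_mult')
        also have "\<dots> \<le> ennreal (R i powr (1 - p) * (256 * 4 ^ n) powr p * \<beta>) * (ennreal (\<alpha> powr (p - 1)) * Ni)"
          by (intro mult_left_mono hi) simp
        also have "\<dots> = ennreal (R i powr (1 - p) * (256 * 4 ^ n) powr p * (\<beta> * \<alpha> powr (p - 1))) * Ni"
          using ab(2) by (simp add: ennreal_mult' mult_ac)
        also have "\<dots> \<le> ennreal (256 powr p * C0 * R i) * Ni"
        proof (intro mult_right_mono ennreal_leI)
          have e4: "(256 * 4 ^ n) powr p * ((1 / 2 ^ n)\<^sup>2) powr p = 256 powr p"
          proof -
            have "(256 * 4 ^ n) powr p * ((1 / 2 ^ n)\<^sup>2) powr p = (256 * 4 ^ n * (1 / 2 ^ n)\<^sup>2) powr p" by (simp add: powr_mult)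
            also have "256 * 4 ^ n * (1 / 2 ^ n)\<^sup>2 = (256::real)"
              by (simp add: power_divide power2_eq_square flip: power_mult_distrib)
            finally show ?thesis .
          qed
          have eR: "R i powr (1 - p) * \<rho> ^ (m + k) = R i"
          proof -
            have "\<rho> ^ (m + k) = R i powr p" unfolding rp[symmetric] by (simp add: R_def i)
            then show ?thesis using R[of i] by (simp flip: powr_add)
          qed
          have "R i powr (1 - p) * (256 * 4 ^ n) powr p * (\<beta> * \<alpha> powr (p - 1))
             \<le> R i powr (1 - p) * (256 * 4 ^ n) powr p * (C0 * \<rho> ^ (m + k) * ((1 / 2 ^ n)\<^sup>2) powr p)"
            by (intro mult_left_mono ab(5)) simp
          also have "\<dots> = ((256 * 4 ^ n) powr p * ((1 / 2 ^ n)\<^sup>2) powr p) * C0 * (R i powr (1 - p) * \<rho> ^ (m + k))"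
            by (simp only: mult_ac)
          also have "\<dots> = 256 powr p * C0 * R i" unfolding e4 eR ..
          finally show "R i powr (1 - p) * (256 * 4 ^ n) powr p * (\<beta> * \<alpha> powr (p - 1)) \<le> 256 powr p * C0 * R i" .
        qed simp
        finally show ?thesis unfolding Ni_def using C0 R[of i] by (simp add: ennreal_mult' mult_ac)
      qed
    qed
    \<comment> \<open>Summing first over the cells that contain \<open>w\<close> uses the same mass
      bound \<open>V\<close> a second time, now for the second layer index.\<close>
    have sumS: "(\<integral>\<^sup>+z. S z * ennreal (b z) \<partial>?M) \<le> ennreal (256 powr p * C0 * V) * N"
    proof -
      have m1: "(\<lambda>z. ennreal (c i) * indicator (cell (snd i) (fst (fst i))) z * ennreal (b z)) \<in> borel_measurable ?M" for i
        using cellm[of i] bm by measurable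
      have m2: "(\<lambda>w. ennreal (R i) * (ennreal (F w powr p * b w) * indicator (cell (snd i) (snd (fst i))) w)) \<in> borel_measurable ?M" for i
        using Fm bm cell_M[of "snd i" "snd (fst i)"] by measurable
      have m3: "(\<lambda>w. ennreal (F w powr p * b w) * indicator (cell (snd i) (snd (fst i))) w) \<in> borel_measurable ?M" for i
        using Fm bm cell_M[of "snd i" "snd (fst i)"] by measurable
      have "(\<integral>\<^sup>+z. S z * ennreal (b z) \<partial>?M) = (\<integral>\<^sup>+z. \<integral>\<^sup>+i. ennreal (c i) * indicator (cell (snd i) (fst (fst i))) z * ennreal (b z) \<partial>?I \<partial>?M)"
        unfolding S_def by (intro nn_integral_cong nn_integral_multc[symmetric]) simp
      also have "\<dots> = (\<integral>\<^sup>+i. \<integral>\<^sup>+z. ennreal (c i) * indicator (cell (snd i) (fst (fst i))) z * ennreal (b z) \<partial>?M \<partial>?I)"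
        using m1 by (intro nn_integral_count_space_nn_integral) auto
      also have "\<dots> \<le> (\<integral>\<^sup>+i. ennreal (256 powr p * C0) * (ennreal (R i) * (\<integral>\<^sup>+w. ennreal (F w powr p * b w) * indicator (cell (snd i) (snd (fst i))) w \<partial>?M)) \<partial>?I)"
        by (intro nn_integral_mono cellterm)
      also have "\<dots> = ennreal (256 powr p * C0) * (\<integral>\<^sup>+i. ennreal (R i) * (\<integral>\<^sup>+w. ennreal (F w powr p * b w) * indicator (cell (snd i) (snd (fst i))) w \<partial>?M) \<partial>?I)"
        by (intro nn_integral_cmult) simp
      finally have first: "(\<integral>\<^sup>+z. S z * ennreal (b z) \<partial>?M) \<le> ennreal (256 powr p * C0) * (\<integral>\<^sup>+i. ennreal (R i) * (\<integral>\<^sup>+w. ennreal (F w powr p * b w) * indicator (cell (snd i) (snd (fst i))) w \<partial>?M) \<partial>?I)" .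
      have "(\<integral>\<^sup>+i. ennreal (R i) * (\<integral>\<^sup>+w. ennreal (F w powr p * b w) * indicator (cell (snd i) (snd (fst i))) w \<partial>?M) \<partial>?I)
          = (\<integral>\<^sup>+i. \<integral>\<^sup>+w. ennreal (R i) * (ennreal (F w powr p * b w) * indicator (cell (snd i) (snd (fst i))) w) \<partial>?M \<partial>?I)"
        using m3 by (intro nn_integral_cong nn_integral_cmult[symmetric]) auto
      also have "\<dots> = (\<integral>\<^sup>+w. \<integral>\<^sup>+i. ennreal (R i) * (ennreal (F w powr p * b w) * indicator (cell (snd i) (snd (fst i))) w) \<partial>?I \<partial>?M)"
        using m2 by (intro nn_integral_count_space_nn_integral[symmetric]) auto
      also have "\<dots> = (\<integral>\<^sup>+w. \<integral>\<^sup>+i. ennreal (F w powr p * b w) * (ennreal (R i) * indicator (cell (snd i) (snd (fst i))) w) \<partial>?I \<partial>?M)"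
        by (intro nn_integral_cong) (simp only: mult_ac)
      also have "\<dots> = (\<integral>\<^sup>+w. ennreal (F w powr p * b w) * (\<integral>\<^sup>+i. ennreal (R i) * indicator (cell (snd i) (snd (fst i))) w \<partial>?I) \<partial>?M)"
        by (intro nn_integral_cong nn_integral_cmult) simp
      also have "\<dots> \<le> (\<integral>\<^sup>+w. ennreal (F w powr p * b w) * ennreal V \<partial>?M)"
        by (intro nn_integral_mono mult_left_mono mass) simp
      also have "\<dots> = N * ennreal V" unfolding N_def using Fm bm by (intro nn_integral_multc) measurable
      finally have "(\<integral>\<^sup>+i. ennreal (R i) * (\<integral>\<^sup>+w. ennreal (F w powr p * b w) * indicator (cell (snd i) (snd (fst i))) w \<partial>?M) \<partial>?I) \<le> N * ennreal V" .
      then have "(\<integral>\<^sup>+z. S z * ennreal (b z) \<partial>?M) \<le> ennreal (256 powr p * C0) * (N * ennreal V)"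
        by (intro order_trans[OF first] mult_left_mono) auto
      then show ?thesis using C0 V by (simp add: ennreal_mult' mult_ac)
    qed
    have "(\<integral>\<^sup>+z. ennreal ((\<integral>w. F w * (1 / (cmod (1 - z * cnj w))\<^sup>2) \<partial>?M) powr p * b z) \<partial>?M)
       \<le> (\<integral>\<^sup>+z. ennreal ((128 * FD) powr p) * ennreal (b z) + ennreal (2 powr p * V powr (p - 1)) * (S z * ennreal (b z)) \<partial>?M)"
    proof (rule nn_integral_mono)
      fix z assume "z \<in> space ?M"
      then have z: "z \<in> disc" by simp
      have "ennreal ((\<integral>w. F w * (1 / (cmod (1 - z * cnj w))\<^sup>2) \<partial>?M) powr p * b z) = ennreal ((\<integral>w. F w * (1 / (cmod (1 - z * cnj w))\<^sup>2) \<partial>?M) powr p) * ennreal (b z)"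
        by (rule ennreal_mult') simp
      also have "\<dots> \<le> (ennreal ((128 * FD) powr p) + ennreal (2 powr p * V powr (p - 1)) * S z) * ennreal (b z)"
        unfolding S_def by (intro mult_right_mono stepA z) simp
      finally show "ennreal ((\<integral>w. F w * (1 / (cmod (1 - z * cnj w))\<^sup>2) \<partial>?M) powr p * b z)
        \<le> ennreal ((128 * FD) powr p) * ennreal (b z) + ennreal (2 powr p * V powr (p - 1)) * (S z * ennreal (b z))"
        by (simp only: distrib_right mult.assoc)
    qed
    also have "\<dots> = ennreal ((128 * FD) powr p) * (\<integral>\<^sup>+z. ennreal (b z) \<partial>?M) + ennreal (2 powr p * V powr (p - 1)) * (\<integral>\<^sup>+z. S z * ennreal (b z) \<partial>?M)"
      using Sm bm by (simp add: nn_integral_add nn_integral_cmult)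
    also have "\<dots> \<le> (ennreal (128 powr p) * (ennreal (Va powr (p - 1)) * N)) * ennreal Vb + ennreal (2 powr p * V powr (p - 1)) * (ennreal (256 powr p * C0 * V) * N)"
    proof (intro add_mono mult_mono mult_left_mono sumS tot(1))
      show "ennreal ((128 * FD) powr p) \<le> ennreal (128 powr p) * (ennreal (Va powr (p - 1)) * N)"
        using FD mult_left_mono[OF holderD, of "ennreal (128 powr p)"] by (simp add: powr_mult ennreal_mult')
    qed auto
    also have "\<dots> = ennreal ((128 powr p) * Va powr (p - 1) * Vb + (2 powr p * V powr (p - 1)) * (256 powr p * C0 * V)) * N"
      using tot(2) V C0 by (simp add: ennreal_mult' distrib_right distrib_left mult_ac)
    also have "\<dots> \<le> ennreal C * N" unfolding C_def by (intro mult_right_mono ennreal_leI) auto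
    finally show ?thesis unfolding N_def .
  qed
  then show ?thesis using C by blast
qed

end

subsection \<open>The Bergman projection of the disc\<close>

text \<open>By the doubling hypothesis the top half carries at least the fraction 1/C of the mass of
  the box, which leaves 1 - 1/C for the two half boxes. Each next strip lies in strips of these, so
  the fraction is gained at every generation. Finiteness allows the top half to be
  subtracted.\<close>

lemma strip_decay:
  fixes \<tau> :: "complex \<Rightarrow> ennreal"
  defines "I \<equiv> \<lambda>A. \<integral>\<^sup>+z. \<tau> z * indicator A z \<partial>lebesgue_on disc"
  assumes m: "\<tau> \<in> borel_measurable (lebesgue_on disc)" and C: "C \<ge> 1"
    and fin: "\<And>\<theta> l. 0 < l \<Longrightarrow> l \<le> 1 \<Longrightarrow> I (hbox \<theta> l) < \<infinity>"
    and dbl: "\<And>\<theta> l. 0 < l \<Longrightarrow> l \<le> 1 \<Longrightarrow> I (hbox \<theta> l) \<le> ennreal C * I (layer \<theta> l 0)"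
    and l: "0 < l" "l \<le> 1"
  shows "I (strip \<theta> l n) \<le> ennreal ((1 - 1/C) ^ n) * I (hbox \<theta> l)"
  using l
proof (induction n arbitrary: \<theta> l)
  case 0
  then show ?case unfolding I_def using hbox_disc(2)[of \<theta> l 0] by (auto intro!: nn_integral_mono simp: indicator_def)
next
  case (Suc n)
  let ?M = "lebesgue_on disc"
  have Sets: "hbox \<theta> l \<in> sets ?M" "layer \<theta> l k \<in> sets ?M" "strip \<theta> l k \<in> sets ?M" for \<theta> l k
    using order_trans[OF hbox_disc(2) hbox_disc(1)] order_trans[OF hbox_disc(3) hbox_disc(1)] hbox_disc(1)
    by (simp_all add: sets_restrict_space_iff)
  have mi: "(\<lambda>z. \<tau> z * indicator A z) \<in> borel_measurable ?M" if "A \<in> sets ?M" for A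
    using m that by measurable
  note l = Suc.prems
  have l2: "0 < l/2" "l/2 \<le> 1" using l by auto
  let ?h1 = "hbox \<theta> (l/2)" and ?h2 = "hbox (\<theta> + l/2) (l/2)"
  have "I ?h1 + I ?h2 = (\<integral>\<^sup>+z. \<tau> z * indicator ?h1 z + \<tau> z * indicator ?h2 z \<partial>?M)"
    unfolding I_def by (rule nn_integral_add[symmetric]) (rule mi[OF Sets(1)])+
  moreover have "\<dots> + I (layer \<theta> l 0) = (\<integral>\<^sup>+z. \<tau> z * indicator ?h1 z + \<tau> z * indicator ?h2 z + \<tau> z * indicator (layer \<theta> l 0) z \<partial>?M)"
    unfolding I_def by (rule nn_integral_add[symmetric]) (intro borel_measurable_add mi Sets)+
  ultimately have "I ?h1 + I ?h2 + I (layer \<theta> l 0) = (\<integral>\<^sup>+z. \<tau> z * indicator ?h1 z + \<tau> z * indicator ?h2 z + \<tau> z * indicator (layer \<theta> l 0) z \<partial>?M)"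
    by simp
  also have "\<dots> \<le> I (hbox \<theta> l)"
    unfolding I_def using hbox_half(1,2,3,5)[OF l, of \<theta>] hbox_disc(3)[of \<theta> l 0]
    by (intro nn_integral_mono) (auto simp: indicator_def)
  finally have sum: "I ?h1 + I ?h2 + I (layer \<theta> l 0) \<le> I (hbox \<theta> l)" .
  have r: "1 - 1/C \<ge> 0" using C by simp
  have half: "I ?h1 + I ?h2 \<le> ennreal (1 - 1/C) * I (hbox \<theta> l)"
  proof -
    obtain x where x: "I (hbox \<theta> l) = ennreal x" "x \<ge> 0" using fin[OF l, of \<theta>] by (cases "I (hbox \<theta> l)") auto
    obtain y where y: "I (layer \<theta> l 0) = ennreal y" "y \<ge> 0" using sum x by (cases "I (layer \<theta> l 0)") (auto simp: top_unique)
    obtain h where h: "I ?h1 + I ?h2 = ennreal h" "h \<ge> 0" using sum x by (cases "I ?h1 + I ?h2") (auto simp: top_unique)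
    have "ennreal (h + y) \<le> ennreal x" using sum unfolding x y h using h y by simp
    then have 1: "h + y \<le> x" using x by (subst (asm) ennreal_le_iff) auto
    have "ennreal x \<le> ennreal (C * y)" using dbl[OF l, of \<theta>] C y unfolding x y by (simp add: ennreal_mult')
    then have "x \<le> C * y" using C y by (subst (asm) ennreal_le_iff) auto
    then have "x / C \<le> y" using C by (simp add: divide_le_eq mult.commute)
    then have "h \<le> (1 - 1/C) * x" using 1 by (simp add: algebra_simps)
    then show ?thesis unfolding h x using r by (simp add: ennreal_leI flip: ennreal_mult')
  qed
  have "I (strip \<theta> l (Suc n)) \<le> (\<integral>\<^sup>+z. \<tau> z * indicator (strip \<theta> (l/2) n) z + \<tau> z * indicator (strip (\<theta> + l/2) (l/2) n) z \<partial>?M)"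
    unfolding I_def using hbox_half(4)[OF l, of \<theta> n] by (intro nn_integral_mono) (auto simp: indicator_def)
  also have "\<dots> = I (strip \<theta> (l/2) n) + I (strip (\<theta> + l/2) (l/2) n)"
    unfolding I_def by (rule nn_integral_add) (rule mi[OF Sets(3)])+
  also have "\<dots> \<le> ennreal ((1 - 1/C) ^ n) * I ?h1 + ennreal ((1 - 1/C) ^ n) * I ?h2"
    by (intro add_mono Suc.IH l2)
  also have "\<dots> = ennreal ((1 - 1/C) ^ n) * (I ?h1 + I ?h2)" by (simp add: distrib_left)
  also have "\<dots> \<le> ennreal ((1 - 1/C) ^ n) * (ennreal (1 - 1/C) * I (hbox \<theta> l))"
    by (intro mult_left_mono half) simp
  also have "\<dots> = ennreal ((1 - 1/C) ^ Suc n) * I (hbox \<theta> l)"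
    using r by (simp add: ennreal_mult' mult_ac)
  finally show ?case .
qed

lemma layer_subset_strip: "layer \<theta> l m \<subseteq> strip \<theta> l m"
  by (auto simp: layer_def strip_def)

lemma hbox_emeasure_le:
  assumes l: "0 < l" "l \<le> 1"
  shows "emeasure lebesgue (hbox \<theta> l) \<le> ennreal (16 * pi * l\<^sup>2)"
proof -
  have "hbox \<theta> l \<subseteq> ball (zbox \<theta> l) (4*l)"
  proof
    fix z assume "z \<in> hbox \<theta> l"
    then have "cmod (z - zbox \<theta> l) \<le> 2*l"
      using carleson_box_dist[OF l, of z "\<theta> + l/2"] hbox_subset_carleson[OF l, of \<theta>] by (auto simp: zbox_def)
    then show "z \<in> ball (zbox \<theta> l) (4*l)" using l by (simp add: dist_norm norm_minus_commute)
  qed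
  then have "emeasure lebesgue (hbox \<theta> l) \<le> emeasure lebesgue (ball (zbox \<theta> l) (4*l))" by (intro emeasure_mono) auto
  also have "\<dots> = ennreal (16 * pi * l\<^sup>2)" using emeasure_ball_complex[of "4*l" "zbox \<theta> l"] l by (simp add: power_mult_distrib mult_ac)
  finally show ?thesis .
qed

lemma layer0_emeasure_ge:
  assumes l: "0 < l" "l \<le> 1"
  shows "ennreal (pi * (l/32)\<^sup>2) \<le> emeasure lebesgue (layer \<theta> l 0)"
  using emeasure_mono[OF zbox_ball[OF l, of \<theta>], of lebesgue] emeasure_ball_complex[of "l/32" "zbox \<theta> l"] l by simp

lemma nn_integral_indicator_disc:
  assumes "A \<in> sets lebesgue" "A \<subseteq> disc"
  shows "(\<integral>\<^sup>+z. indicator A z \<partial>lebesgue_on disc) = emeasure lebesgue A"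
proof -
  have "A \<in> sets (lebesgue_on disc)" using assms by (simp add: sets_restrict_space_iff)
  then have "(\<integral>\<^sup>+z. indicator A z \<partial>lebesgue_on disc) = emeasure (lebesgue_on disc) A" by (rule nn_integral_indicator)
  also have "\<dots> = emeasure lebesgue A" using assms by (intro emeasure_restrict_space) auto
  finally show ?thesis .
qed

text \<open>The unweighted case, which makes the kernel integral of an L^2 function an L^2 function
  and so allows it to be identified with the orthogonal projection.\<close>

lemma positive_operator_L2:
  "\<exists>C>0. \<forall>F. integrable (lebesgue_on disc) F \<longrightarrow> (\<forall>w. F w \<ge> 0) \<longrightarrow>
    (\<integral>\<^sup>+z. ennreal ((\<integral>w. F w * (1 / (cmod (1 - z * cnj w))\<^sup>2) \<partial>lebesgue_on disc) powr 2) \<partial>lebesgue_on disc)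
      \<le> ennreal C * (\<integral>\<^sup>+z. ennreal (F z powr 2) \<partial>lebesgue_on disc)"
proof -
  interpret weight_pair "\<lambda>_. 1" "\<lambda>_. 1" 2 by unfold_locales auto
  \<comment> \<open>16384 = 16 * 32^2 is the ratio of the upper area bound 16 pi l^2 for a box to
    the lower bound pi (l/32)^2 for its top half.\<close>
  define \<rho> :: real where "\<rho> = 1 - 1/16384"
  have ly: "(\<integral>\<^sup>+z. ennreal 1 * indicator (layer \<theta> l m) z \<partial>lebesgue_on disc) \<le> ennreal (\<rho> ^ m * (16 * pi * l\<^sup>2))"
    if l: "0 < l" "l \<le> 1" for \<theta> l m
  proof -
    have "(\<integral>\<^sup>+z. 1 * indicator (layer \<theta> l m) z \<partial>lebesgue_on disc) \<le> (\<integral>\<^sup>+z. 1 * indicator (strip \<theta> l m) z \<partial>lebesgue_on disc)"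
      using layer_subset_strip by (intro nn_integral_mono) (auto simp: indicator_def)
    also have "\<dots> \<le> ennreal ((1 - 1/16384) ^ m) * (\<integral>\<^sup>+z. 1 * indicator (hbox \<theta> l) z \<partial>lebesgue_on disc)"
    proof (rule strip_decay[OF _ _ _ _ l])
      fix \<theta> l :: real assume l: "0 < l" "l \<le> 1"
      have h: "(\<integral>\<^sup>+z. 1 * indicator (hbox \<theta> l) z \<partial>lebesgue_on disc) = emeasure lebesgue (hbox \<theta> l)"
        using hbox_disc(1) by (simp add: nn_integral_indicator_disc)
      show "(\<integral>\<^sup>+z. 1 * indicator (hbox \<theta> l) z \<partial>lebesgue_on disc) < \<infinity>"
        unfolding h using hbox_emeasure_le[OF l, of \<theta>] by (rule order_le_less_trans) simp
      have e: "(\<integral>\<^sup>+z. 1 * indicator (layer \<theta> l 0) z \<partial>lebesgue_on disc) = emeasure lebesgue (layer \<theta> l 0)"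
        using hbox_disc(1)[of \<theta> l] hbox_disc(3)[of \<theta> l 0] by (subst mult_1, intro nn_integral_indicator_disc hbox_lebesgue) (rule order_trans)
      have "emeasure lebesgue (hbox \<theta> l) \<le> ennreal (16 * pi * l\<^sup>2)" by (rule hbox_emeasure_le[OF l])
      also have "\<dots> = ennreal 16384 * ennreal (pi * (l/32)\<^sup>2)" by (subst ennreal_mult'[symmetric]) (auto simp: power_divide)
      also have "\<dots> \<le> ennreal 16384 * emeasure lebesgue (layer \<theta> l 0)" by (intro mult_left_mono layer0_emeasure_ge l) auto
      finally show "(\<integral>\<^sup>+z. 1 * indicator (hbox \<theta> l) z \<partial>lebesgue_on disc) \<le> ennreal 16384 * (\<integral>\<^sup>+z. 1 * indicator (layer \<theta> l 0) z \<partial>lebesgue_on disc)"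
        unfolding h e .
    qed auto
    also have "\<dots> \<le> ennreal (\<rho> ^ m) * ennreal (16 * pi * l\<^sup>2)"
      unfolding \<rho>_def using hbox_emeasure_le[OF l, of \<theta>] hbox_disc(1) by (intro mult_left_mono) (auto simp: nn_integral_indicator_disc)
    finally show ?thesis by (simp add: \<rho>_def ennreal_mult')
  qed
  have "\<exists>C>0. \<forall>F. integrable (lebesgue_on disc) F \<longrightarrow> (\<forall>w. F w \<ge> 0) \<longrightarrow>
    (\<integral>\<^sup>+z. ennreal ((\<integral>w. F w * (1 / (cmod (1 - z * cnj w))\<^sup>2) \<partial>lebesgue_on disc) powr 2 * 1) \<partial>lebesgue_on disc)
      \<le> ennreal C * (\<integral>\<^sup>+z. ennreal (F z powr 2 * 1) \<partial>lebesgue_on disc)"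
  proof (rule positive_operator_bound)
    show "0 < \<rho>" "\<rho> < 1" "0 \<le> (16 * pi)\<^sup>2" by (auto simp: \<rho>_def)
    fix \<theta> l :: real and m k :: nat assume l: "0 < l" "l \<le> 1"
    show "\<exists>\<alpha> \<beta>. 0 < \<alpha> \<and> 0 \<le> \<beta> \<and> (\<integral>\<^sup>+z. ennreal 1 * indicator (layer \<theta> l m) z \<partial>lebesgue_on disc) \<le> ennreal \<beta> \<and>
      (\<integral>\<^sup>+z. ennreal 1 * indicator (layer \<theta> l k) z \<partial>lebesgue_on disc) \<le> ennreal \<alpha> \<and>
      \<beta> * \<alpha> powr (2 - 1) \<le> (16 * pi)\<^sup>2 * \<rho> ^ (m + k) * (l\<^sup>2) powr 2"
      using ly[OF l, of \<theta> m] ly[OF l, of \<theta> k] l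
      by (intro exI[of _ "\<rho> ^ k * (16 * pi * l\<^sup>2)"] exI[of _ "\<rho> ^ m * (16 * pi * l\<^sup>2)"])
         (auto simp: \<rho>_def power_add power2_eq_square)
  next
    have "(\<integral>\<^sup>+z. ennreal 1 \<partial>lebesgue_on disc) = emeasure lebesgue disc"
      by (simp add: emeasure_restrict_space)
    then show "(\<integral>\<^sup>+z. ennreal 1 \<partial>lebesgue_on disc) \<le> ennreal pi" "(\<integral>\<^sup>+z. ennreal 1 \<partial>lebesgue_on disc) \<le> ennreal pi"
      using emeasure_ball_complex[of 1 0] by auto
  qed auto
  then show ?thesis by simp
qed

text \<open>The kernel integral that represents the projection; the division by pi is due to
  Lebesgue measure, which gives the disc mass pi.\<close>

definition bergman_disc :: "(complex \<Rightarrow> complex) \<Rightarrow> complex \<Rightarrow> complex" where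
  "bergman_disc F z = (\<integral>w. F w * (1 / (1 - z * cnj w)\<^sup>2) \<partial>lebesgue_on disc) / of_real pi"

lemma disc_id_measurable: "(\<lambda>z. z) \<in> borel_measurable (lebesgue_on disc)"
  by (intro measurable_restrict_space1 measurable_completion) simp

lemma cnj_measurable: "f \<in> borel_measurable M \<Longrightarrow> (\<lambda>x. cnj (f x)) \<in> borel_measurable M"
  by (rule measurable_compose) (auto intro!: borel_measurable_continuous_onI continuous_intros)

lemma bergman_disc_integrable:
  assumes F: "integrable (lebesgue_on disc) F" and z: "z \<in> disc"
  shows "integrable (lebesgue_on disc) (\<lambda>w. F w * (1 / (1 - z * cnj w)\<^sup>2))"
proof (rule Bochner_Integration.integrable_bound)
  show "integrable (lebesgue_on disc) (\<lambda>w. cmod (F w) * (1 / (cmod (1 - z * cnj w))\<^sup>2))"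
    using F z by (intro bergman_kernel_integrable) auto
  show "(\<lambda>w. F w * (1 / (1 - z * cnj w)\<^sup>2)) \<in> borel_measurable (lebesgue_on disc)"
    using F cnj_measurable[OF disc_id_measurable] by measurable
qed (auto simp: norm_mult norm_divide norm_power)

lemma bergman_disc_norm_le:
  assumes F: "integrable (lebesgue_on disc) F" and z: "z \<in> disc"
  shows "cmod (bergman_disc F z) \<le> (\<integral>w. cmod (F w) * (1 / (cmod (1 - z * cnj w))\<^sup>2) \<partial>lebesgue_on disc)"
proof -
  have "cmod (bergman_disc F z) = cmod (\<integral>w. F w * (1 / (1 - z * cnj w)\<^sup>2) \<partial>lebesgue_on disc) / pi"
    by (simp add: bergman_disc_def norm_divide)
  also have "\<dots> \<le> cmod (\<integral>w. F w * (1 / (1 - z * cnj w)\<^sup>2) \<partial>lebesgue_on disc) / 1"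
    using pi_gt3 by (intro divide_left_mono) auto
  also have "\<dots> \<le> (\<integral>w. cmod (F w * (1 / (1 - z * cnj w)\<^sup>2)) \<partial>lebesgue_on disc)"
    using integral_norm_bound by simp
  also have "\<dots> = (\<integral>w. cmod (F w) * (1 / (cmod (1 - z * cnj w))\<^sup>2) \<partial>lebesgue_on disc)"
    by (simp add: norm_mult norm_divide norm_power)
  finally show ?thesis .
qed

text \<open>The kernel is the series of (n+1) (z cnj(w))^n, which is integrated termwise against
  \<open>F\<close> to give a power series in z.\<close>

lemma bergman_disc_holomorphic:
  assumes F: "integrable (lebesgue_on disc) F"
  shows "bergman_disc F holomorphic_on disc"
proof (rule power_series_holomorphic)
  let ?M = "lebesgue_on disc"
  define A where "A n = of_nat (Suc n) * (\<integral>w. F w * cnj w ^ n \<partial>?M) / of_real pi" for n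
  fix z assume z: "z \<in> disc"
  have Fm: "F \<in> borel_measurable ?M" using F by simp
  have int1: "integrable ?M (\<lambda>w. F w * cnj w ^ n)" for n
  proof (rule Bochner_Integration.integrable_bound[OF F])
    show "(\<lambda>w. F w * cnj w ^ n) \<in> borel_measurable ?M" using Fm cnj_measurable[OF disc_id_measurable] by measurable
    show "AE w in ?M. norm (F w * cnj w ^ n) \<le> norm (F w)"
      by (rule AE_I2) (auto simp: norm_mult norm_power power_le_one intro!: mult_left_le)
  qed
  define f where "f n w = of_nat (Suc n) * z ^ n * (F w * cnj w ^ n)" for n w
  have int: "integrable ?M (f n)" for n unfolding f_def using int1 by simp
  have sz: "summable (\<lambda>n. of_nat (Suc n) * cmod z ^ n)"
    using geometric_deriv_sums[of "cmod z"] z by (auto simp: sums_iff)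
  have bd: "norm (f n w) \<le> cmod (F w) * (of_nat (Suc n) * cmod z ^ n)" if "w \<in> disc" for n w
  proof -
    have "cmod w ^ n \<le> 1" using that by (simp add: power_le_one)
    then have "cmod (F w) * cmod w ^ n \<le> cmod (F w)" by (simp add: mult_left_le)
    then have "(of_nat (Suc n) * cmod z ^ n) * (cmod (F w) * cmod w ^ n) \<le> (of_nat (Suc n) * cmod z ^ n) * cmod (F w)"
      by (intro mult_left_mono) auto
    then show ?thesis by (simp add: f_def norm_mult norm_power mult_ac del: of_nat_Suc)
  qed
  have "(\<lambda>n. \<integral>w. f n w \<partial>?M) sums (\<integral>w. (\<Sum>n. f n w) \<partial>?M)"
  proof (rule sums_integral[OF int])
    show "AE w in ?M. summable (\<lambda>n. norm (f n w))"
      using bd by (intro AE_I2 summable_comparison_test'[OF summable_mult[OF sz]]) auto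
    show "summable (\<lambda>n. \<integral>w. norm (f n w) \<partial>?M)"
    proof (rule summable_comparison_test'[OF summable_mult[OF sz, of "\<integral>w. cmod (F w) \<partial>?M"]])
      fix n
      have "(\<integral>w. norm (f n w) \<partial>?M) \<le> (\<integral>w. cmod (F w) * (of_nat (Suc n) * cmod z ^ n) \<partial>?M)"
        using bd int F by (intro integral_mono) auto
      then show "norm (\<integral>w. norm (f n w) \<partial>?M) \<le> (\<integral>w. cmod (F w) \<partial>?M) * (of_nat (Suc n) * cmod z ^ n)" by simp
    qed
  qed
  moreover have "(\<integral>w. (\<Sum>n. f n w) \<partial>?M) = (\<integral>w. F w * (1 / (1 - z * cnj w)\<^sup>2) \<partial>?M)"
  proof (rule Bochner_Integration.integral_cong[OF refl])
    fix w assume "w \<in> space ?M"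
    then have "cmod (z * cnj w) < 1" using z norm_mult_less[of z 1 "cnj w" 1] by simp
    then have "(\<lambda>n. F w * (of_nat (Suc n) * (z * cnj w) ^ n)) sums (F w * (1 / (1 - z * cnj w)\<^sup>2))"
      by (intro sums_mult geometric_deriv_sums)
    moreover have "(\<lambda>n. F w * (of_nat (Suc n) * (z * cnj w) ^ n)) = (\<lambda>n. f n w)"
      by (auto simp: f_def power_mult_distrib mult_ac)
    ultimately show "(\<Sum>n. f n w) = F w * (1 / (1 - z * cnj w)\<^sup>2)" by (simp add: sums_iff)
  qed
  moreover have "(\<integral>w. f n w \<partial>?M) = of_real pi * (A n * (z - 0) ^ n)" for n
    unfolding f_def A_def by simp
  ultimately have "(\<lambda>n. of_real pi * (A n * (z - 0) ^ n)) sums (\<integral>w. F w * (1 / (1 - z * cnj w)\<^sup>2) \<partial>?M)" by simp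
  from sums_divide[OF this, of "of_real pi"] show "(\<lambda>n. A n * (z - 0) ^ n) sums bergman_disc F z"
    by (simp add: bergman_disc_def)
qed

lemma ennreal_powr_2: "ennreal (x powr 2) = ennreal (x\<^sup>2)" if "x \<ge> 0"
  using that by (simp add: powr_numeral)

text \<open>The second claim, for the absolute value of the kernel, provides the integrability that
  Fubini's theorem asks for in the proof of orthogonality.\<close>

lemma bergman_disc_L2:
  assumes F: "L2_on disc F"
  shows "L2_on disc (bergman_disc F)" "L2_on disc (\<lambda>z. of_real (\<integral>w. cmod (F w) * (1 / (cmod (1 - z * cnj w))\<^sup>2) \<partial>lebesgue_on disc))"
proof -
  let ?M = "lebesgue_on disc"
  interpret fm: finite_measure ?M by (rule finite_measure_disc)
  define G where "G z = (\<integral>w. cmod (F w) * (1 / (cmod (1 - z * cnj w))\<^sup>2) \<partial>?M)" for z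
  have D: "disc \<in> sets lebesgue" by simp
  have Fi: "integrable ?M F" by (rule L2_ball_integrable[OF F])
  have Fm: "F \<in> borel_measurable ?M" using Fi by simp
  have F2: "integrable ?M (\<lambda>z. (cmod (F z))\<^sup>2)" using F by (simp add: L2_on_iff)
  have G0: "G z \<ge> 0" for z unfolding G_def by (intro integral_nonneg_AE) auto
  obtain C where C0: "C > 0" "\<And>F. integrable ?M F \<Longrightarrow> (\<And>w. F w \<ge> 0) \<Longrightarrow>
    (\<integral>\<^sup>+z. ennreal ((\<integral>w. F w * (1 / (cmod (1 - z * cnj w))\<^sup>2) \<partial>?M) powr 2) \<partial>?M) \<le> ennreal C * (\<integral>\<^sup>+z. ennreal (F z powr 2) \<partial>?M)"
    using positive_operator_L2 by blast
  have C: "C > 0" "(\<integral>\<^sup>+z. ennreal (G z powr 2) \<partial>?M) \<le> ennreal C * (\<integral>\<^sup>+z. ennreal (cmod (F z) powr 2) \<partial>?M)"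
    unfolding G_def by (rule C0(1), rule C0(2)[OF integrable_norm[OF Fi]]) simp
  have "(\<integral>\<^sup>+z. ennreal (cmod (F z) powr 2) \<partial>?M) = ennreal (\<integral>z. (cmod (F z))\<^sup>2 \<partial>?M)"
    using F2 by (simp add: nn_integral_eq_integral)
  then have fin: "(\<integral>\<^sup>+z. ennreal ((G z)\<^sup>2) \<partial>?M) < \<infinity>"
    using C G0 by (simp add: ennreal_powr_2 ennreal_mult_less_top le_less_trans)
  have Gm: "G \<in> borel_measurable ?M"
    unfolding G_def
  proof (rule fm.borel_measurable_lebesgue_integral)
    have 1: "fst \<in> borel_measurable (?M \<Otimes>\<^sub>M ?M)" "snd \<in> borel_measurable (?M \<Otimes>\<^sub>M ?M)"
      by (rule measurable_compose[OF measurable_fst disc_id_measurable], rule measurable_compose[OF measurable_snd disc_id_measurable])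
    have 2: "(\<lambda>x. F (snd x)) \<in> borel_measurable (?M \<Otimes>\<^sub>M ?M)" by (rule measurable_compose[OF measurable_snd Fm])
    have 3: "(\<lambda>x. cnj (snd x)) \<in> borel_measurable (?M \<Otimes>\<^sub>M ?M)" by (rule cnj_measurable[OF 1(2)])
    show "(\<lambda>(z, w). cmod (F w) * (1 / (cmod (1 - z * cnj w))\<^sup>2)) \<in> borel_measurable (?M \<Otimes>\<^sub>M ?M)"
      unfolding case_prod_beta using 1(1) 2 3 by measurable
  qed
  have G2: "integrable ?M (\<lambda>z. (G z)\<^sup>2)"
    using Gm fin by (intro integrableI_nonneg) auto
  then show "L2_on disc (\<lambda>z. of_real (\<integral>w. cmod (F w) * (1 / (cmod (1 - z * cnj w))\<^sup>2) \<partial>lebesgue_on disc))"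
    unfolding G_def[symmetric] L2_on_iff[OF D] using Gm by auto
  have hm: "bergman_disc F \<in> borel_measurable ?M"
    using holomorphic_on_imp_continuous_on[OF bergman_disc_holomorphic[OF Fi]] by (intro continuous_imp_measurable_on_sets_lebesgue) auto
  show "L2_on disc (bergman_disc F)"
    unfolding L2_on_iff[OF D]
  proof (intro conjI hm Bochner_Integration.integrable_bound[OF G2] AE_I2)
    show "(\<lambda>z. (cmod (bergman_disc F z))\<^sup>2) \<in> borel_measurable ?M" using hm by measurable
    fix z assume "z \<in> space ?M"
    then have "cmod (bergman_disc F z) \<le> G z" using bergman_disc_norm_le[OF Fi, of z] by (simp add: G_def)
    then show "norm ((cmod (bergman_disc F z))\<^sup>2) \<le> norm ((G z)\<^sup>2)" by (simp add: power_mono)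
  qed
qed

text \<open>The kernel is Hermitian, so Fubini's theorem moves the operator onto \<open>H\<close>,
  where the reproducing property gives back \<open>H\<close>.\<close>

lemma bergman_disc_orth:
  assumes F: "L2_on disc F" and H: "A2_on disc H"
  shows "(\<integral>z. (F z - bergman_disc F z) * cnj (H z) \<partial>lebesgue_on disc) = 0"
proof -
  let ?M = "lebesgue_on disc"
  interpret fm: finite_measure ?M by (rule finite_measure_disc)
  interpret pair_sigma_finite ?M ?M by unfold_locales
  have D: "disc \<in> sets lebesgue" by simp
  have HL: "H holomorphic_on disc" "L2_on disc H" using H by (auto simp: A2_on_def)
  have Fi: "integrable ?M F" by (rule L2_ball_integrable[OF F])
  have Fm: "F \<in> borel_measurable ?M" and Hm: "H \<in> borel_measurable ?M" using Fi HL by (auto simp: L2_on_iff)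
  define f where "f z w = F w * (1 / (1 - z * cnj w)\<^sup>2) * cnj (H z)" for z w
  define G where "G z = (\<integral>w. cmod (F w) * (1 / (cmod (1 - z * cnj w))\<^sup>2) \<partial>?M)" for z
  have G0: "G z \<ge> 0" for z unfolding G_def by (intro integral_nonneg_AE) auto
  have fm: "(\<lambda>(z, w). f z w) \<in> borel_measurable (?M \<Otimes>\<^sub>M ?M)"
  proof -
    have 1: "fst \<in> borel_measurable (?M \<Otimes>\<^sub>M ?M)" "snd \<in> borel_measurable (?M \<Otimes>\<^sub>M ?M)"
      by (rule measurable_compose[OF measurable_fst disc_id_measurable], rule measurable_compose[OF measurable_snd disc_id_measurable])
    have 2: "(\<lambda>x. F (snd x)) \<in> borel_measurable (?M \<Otimes>\<^sub>M ?M)" by (rule measurable_compose[OF measurable_snd Fm])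
    have 3: "(\<lambda>x. cnj (snd x)) \<in> borel_measurable (?M \<Otimes>\<^sub>M ?M)" by (rule cnj_measurable[OF 1(2)])
    have 4: "(\<lambda>x. cnj (H (fst x))) \<in> borel_measurable (?M \<Otimes>\<^sub>M ?M)"
      by (rule measurable_compose[OF measurable_fst cnj_measurable[OF Hm]])
    show ?thesis unfolding case_prod_beta f_def using 1(1) 2 3 4 by measurable
  qed
  have nf: "(\<integral>w. norm (f z w) \<partial>?M) = G z * cmod (H z)" for z
  proof -
    have "(\<integral>w. norm (f z w) \<partial>?M) = (\<integral>w. cmod (F w) * (1 / (cmod (1 - z * cnj w))\<^sup>2) * cmod (H z) \<partial>?M)"
      unfolding f_def by (intro Bochner_Integration.integral_cong refl) (simp add: norm_mult norm_divide norm_power)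
    also have "\<dots> = G z * cmod (H z)" unfolding G_def by (rule integral_mult_left_zero)
    finally show ?thesis .
  qed
  have fint: "integrable (?M \<Otimes>\<^sub>M ?M) (\<lambda>(z, w). f z w)"
  proof (rule Fubini_integrable[OF fm])
    have "integrable ?M (\<lambda>z. of_real (G z) * cnj (H z))"
      using L2_mult_integrable[OF bergman_disc_L2(2)[OF F] HL(2) D] by (simp add: G_def)
    then have "integrable ?M (\<lambda>z. norm (of_real (G z) * cnj (H z)))" by (rule integrable_norm)
    then show "integrable ?M (\<lambda>x. \<integral>y. norm (case (x, y) of (z, w) \<Rightarrow> f z w) \<partial>?M)" using G0 by (simp add: nf norm_mult)
    show "AE x in ?M. integrable ?M (\<lambda>y. case (x, y) of (z, w) \<Rightarrow> f z w)"
    proof (rule AE_I2)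
      fix z assume "z \<in> space ?M"
      then have z: "z \<in> disc" by simp
      show "integrable ?M (\<lambda>y. case (z, y) of (z, w) \<Rightarrow> f z w)"
        unfolding f_def prod.case by (intro integrable_mult_left bergman_disc_integrable[OF Fi z])
    qed
  qed
  have "(\<integral>z. bergman_disc F z * cnj (H z) \<partial>?M) = (\<integral>z. (\<integral>w. f z w \<partial>?M) / of_real pi \<partial>?M)"
    unfolding bergman_disc_def f_def by (simp only: integral_mult_left_zero times_divide_eq_left)
  also have "\<dots> = (\<integral>z. \<integral>w. f z w \<partial>?M \<partial>?M) / of_real pi" by simp
  also have "(\<integral>z. \<integral>w. f z w \<partial>?M \<partial>?M) = (\<integral>w. \<integral>z. f z w \<partial>?M \<partial>?M)"
    using Fubini_integral[OF fint] by simp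
  also have "\<dots> = (\<integral>w. F w * (of_real pi * cnj (H w)) \<partial>?M)"
  proof (rule Bochner_Integration.integral_cong[OF refl])
    fix w assume "w \<in> space ?M"
    then have w: "w \<in> disc" by simp
    have "(\<integral>z. f z w \<partial>?M) = (\<integral>z. F w * cnj (H z * cnj (1 / (1 - cnj w * z)\<^sup>2)) \<partial>?M)"
      unfolding f_def by (intro Bochner_Integration.integral_cong refl) (simp add: mult_ac)
    also have "\<dots> = F w * cnj (\<integral>z. H z * cnj (1 / (1 - cnj w * z)\<^sup>2) \<partial>?M)"
      by (simp only: integral_mult_right_zero Bochner_Integration.integral_cnj)
    also have "\<dots> = F w * (of_real pi * cnj (H w))" unfolding bergman_reproducing[OF HL w] by simp
    finally show "(\<integral>z. f z w \<partial>?M) = F w * (of_real pi * cnj (H w))" .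
  qed
  also have "\<dots> = (\<integral>w. of_real pi * (F w * cnj (H w)) \<partial>?M)" by (simp only: mult_ac)
  also have "\<dots> = of_real pi * (\<integral>w. F w * cnj (H w) \<partial>?M)" by (rule integral_mult_right_zero)
  finally have e: "(\<integral>z. bergman_disc F z * cnj (H z) \<partial>?M) = (\<integral>w. F w * cnj (H w) \<partial>?M)" by simp
  have "(\<integral>z. (F z - bergman_disc F z) * cnj (H z) \<partial>?M) = (\<integral>z. F z * cnj (H z) - bergman_disc F z * cnj (H z) \<partial>?M)"
    by (simp only: left_diff_distrib)
  also have "\<dots> = (\<integral>z. F z * cnj (H z) \<partial>?M) - (\<integral>z. bergman_disc F z * cnj (H z) \<partial>?M)"
    by (intro Bochner_Integration.integral_diff L2_mult_integrable F HL bergman_disc_L2 D)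
  finally show ?thesis using e by simp
qed

subsection \<open>Sufficiency\<close>

text \<open>\<open>x\<close> and \<open>y\<close> stand for the masses of the two dual weights, on a box \<open>Q\<close> and on its top half \<open>T\<close>.
  The lower bound ranges over upper bounds \<open>y\<close> of \<open>yT\<close> because \<open>yT > 0\<close> is only known afterwards.\<close>

lemma doubling_from_duality:
  fixes p :: real
  assumes p: "p > 1" and x: "0 \<le> xT" "xT \<le> xQ" and y: "0 \<le> yT" "yT \<le> yQ"
    and up: "xQ * yQ powr (p - 1) \<le> C * S" and low: "\<And>y. y > 0 \<Longrightarrow> yT \<le> y \<Longrightarrow> c * S \<le> xT * y powr (p - 1)"
    and pos: "C > 0" "c > 0" "S > 0"
  shows "yT > 0" "xQ \<le> (C/c) * xT" "yQ \<le> (C/c) powr (1/(p-1)) * yT"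
proof -
  have cS: "c * S > 0" using pos by simp
  show yT: "yT > 0"
  proof (rule ccontr)
    assume "\<not> yT > 0"
    then have "yT = 0" using y by simp
    \<comment> \<open>If yT were 0, the lower bound would hold for every y > 0; this choice makes
      its right-hand side at most half of c S.\<close>
    define u where "u = c * S / (2 * (xT + 1))"
    have u: "u > 0" using cS x by (simp add: u_def)
    have "c * S \<le> xT * (u powr (1/(p-1))) powr (p - 1)"
      using low[of "u powr (1/(p-1))"] u \<open>yT = 0\<close> by simp
    also have "(u powr (1/(p-1))) powr (p - 1) = u" using u p by (simp add: powr_powr)
    also have "xT * u \<le> (xT + 1) * u" using u by simp
    also have "\<dots> = c * S / 2" using x by (simp add: u_def field_simps)
    finally have "c * S \<le> c * S / 2" .
    then have "c * S \<le> 0" by linarith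
    then show False using cS by linarith
  qed
  have lT: "c * S \<le> xT * yT powr (p - 1)" using low[OF yT] by simp
  have ypos: "yT powr (p - 1) > 0" using yT by simp
  have xT: "xT > 0" using lT cS x ypos by (metis less_le_trans mult_zero_left order_le_less)
  have CS: "C * S \<le> (C/c) * (xT * yT powr (p - 1))"
  proof -
    have "C * S = (C/c) * (c * S)" using pos by simp
    also have "\<dots> \<le> (C/c) * (xT * yT powr (p - 1))" using pos by (intro mult_left_mono lT) auto
    finally show ?thesis .
  qed
  \<comment> \<open>Each factor on T is at most its counterpart on Q, so comparability of the
    products forces comparability of each factor.\<close>
  have "xQ * yT powr (p - 1) \<le> xQ * yQ powr (p - 1)" using x y p by (intro mult_left_mono powr_mono2) auto
  then have "xQ * yT powr (p - 1) \<le> ((C/c) * xT) * yT powr (p - 1)" using up CS by (simp add: mult.assoc)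
  then show "xQ \<le> (C/c) * xT" using ypos by (rule mult_right_le_imp_le)
  have "xT * yQ powr (p - 1) \<le> xQ * yQ powr (p - 1)" using x by (intro mult_right_mono) auto
  then have "yQ powr (p - 1) * xT \<le> ((C/c) * yT powr (p - 1)) * xT" using up CS by (simp add: mult_ac)
  then have "yQ powr (p - 1) \<le> (C/c) * yT powr (p - 1)" using xT by (rule mult_right_le_imp_le)
  then have "(yQ powr (p - 1)) powr (1/(p-1)) \<le> ((C/c) * yT powr (p - 1)) powr (1/(p-1))"
    using p by (intro powr_mono2) auto
  then show "yQ \<le> (C/c) powr (1/(p-1)) * yT" using p y yT pos by (subst (asm) powr_mult) (auto simp: powr_powr)
qed

text \<open>Sixteen boxes of length 1 cover the disc except for the origin, and each of them is the
  union of its layers, whose masses form a geometric series.\<close>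

lemma total_finite:
  fixes \<tau> :: "complex \<Rightarrow> ennreal"
  assumes m: "\<tau> \<in> borel_measurable (lebesgue_on disc)" and q: "0 < q" "q < 1"
    and B: "\<And>\<theta>. \<exists>B\<ge>0. \<forall>m. (\<integral>\<^sup>+z. \<tau> z * indicator (layer \<theta> 1 m) z \<partial>lebesgue_on disc) \<le> ennreal (B * q ^ m)"
  shows "\<exists>V\<ge>0. (\<integral>\<^sup>+z. \<tau> z \<partial>lebesgue_on disc) \<le> ennreal V"
proof -
  let ?M = "lebesgue_on disc"
  obtain B where B0: "\<And>\<theta>. B \<theta> \<ge> 0" and B1: "\<And>\<theta> m. (\<integral>\<^sup>+z. \<tau> z * indicator (layer \<theta> 1 m) z \<partial>?M) \<le> ennreal (B \<theta> * q ^ m)"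
    using B by metis
  have lM: "layer \<theta> l k \<in> sets ?M" for \<theta> l k
    using order_trans[OF hbox_disc(3) hbox_disc(1)] by (simp add: sets_restrict_space_iff)
  have cover: "\<tau> z \<le> (\<Sum>j<16. \<Sum>m. \<tau> z * indicator (layer (grid 0 j) 1 m) z)" if z: "z \<in> disc" "z \<noteq> 0" for z
  proof -
    define \<alpha> where "\<alpha> = Arg2pi z"
    have \<alpha>: "0 \<le> \<alpha>" "\<alpha> < 2 * pi" using Arg2pi_ge_0 Arg2pi_lt_2pi by (simp_all add: \<alpha>_def)
    define j where "j = nat \<lfloor>\<alpha> * 16 / (2 * pi)\<rfloor>"
    have x0: "0 \<le> \<alpha> * 16 / (2 * pi)" using \<alpha> by simp
    have "\<alpha> * 16 / (2 * pi) < 16" using \<alpha> by (simp add: divide_less_eq)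
    then have j16: "j < 16" unfolding j_def using x0 by linarith
    have jx: "real j \<le> \<alpha> * 16 / (2 * pi)" "\<alpha> * 16 / (2 * pi) < real j + 1" unfolding j_def using x0 by linarith+
    have g1: "grid 0 j \<le> \<alpha>" using jx(1) by (simp add: grid_def field_simps)
    have "\<alpha> < grid 0 j + pi / 8" using jx(2) by (simp add: grid_def field_simps)
    then have g2: "\<alpha> < grid 0 j + 1" using pi_less_4 by linarith
    have "of_real (cmod z) * cis \<alpha> \<in> hbox (grid 0 j) 1"
      using z g1 g2 by (intro mem_hboxI) auto
    then have "z \<in> hbox (grid 0 j) 1" unfolding \<alpha>_def using Arg2pi_cis[of z] by simp
    then obtain m where m: "z \<in> layer (grid 0 j) 1 m" using hbox_layer by blast
    have "\<tau> z = \<tau> z * indicator (layer (grid 0 j) 1 m) z" using m by simp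
    also have "\<dots> \<le> (\<Sum>m. \<tau> z * indicator (layer (grid 0 j) 1 m) z)" by (rule ennreal_term_le_suminf)
    also have "\<dots> \<le> (\<Sum>j<16. \<Sum>m. \<tau> z * indicator (layer (grid 0 j) 1 m) z)"
      by (rule member_le_sum[of j "{..<16}" "\<lambda>j. \<Sum>m. \<tau> z * indicator (layer (grid 0 j) 1 m) z"]) (use j16 in auto)
    finally show ?thesis .
  qed
  have ae: "AE z in ?M. \<tau> z \<le> (\<Sum>j<16. \<Sum>m. \<tau> z * indicator (layer (grid 0 j) 1 m) z)"
  proof (rule AE_mp[OF _ AE_I2])
    have "{0::complex} \<in> null_sets lebesgue" by simp
    from AE_not_in[OF this] have "AE z in lebesgue. z \<noteq> (0::complex)" by simp
    then show "AE z in ?M. z \<noteq> 0" by (subst AE_restrict_space_iff) (auto elim: eventually_mono)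
  qed (use cover in auto)
  have mm: "(\<lambda>z. \<tau> z * indicator (layer \<theta> 1 k) z) \<in> borel_measurable ?M" for \<theta> k
    by (intro borel_measurable_times_ennreal m borel_measurable_indicator lM)
  have "(\<integral>\<^sup>+z. \<tau> z \<partial>?M) \<le> (\<integral>\<^sup>+z. (\<Sum>j<16. \<Sum>m. \<tau> z * indicator (layer (grid 0 j) 1 m) z) \<partial>?M)"
    by (rule nn_integral_mono_AE[OF ae])
  also have "\<dots> = (\<Sum>j<16. \<Sum>m. \<integral>\<^sup>+z. \<tau> z * indicator (layer (grid 0 j) 1 m) z \<partial>?M)"
  proof -
    have "(\<integral>\<^sup>+z. (\<Sum>j<16. \<Sum>m. \<tau> z * indicator (layer (grid 0 j) 1 m) z) \<partial>?M) = (\<Sum>j<16. \<integral>\<^sup>+z. (\<Sum>m. \<tau> z * indicator (layer (grid 0 j) 1 m) z) \<partial>?M)"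
      by (rule nn_integral_sum) (intro borel_measurable_suminf_order mm)
    also have "\<dots> = (\<Sum>j<16. \<Sum>m. \<integral>\<^sup>+z. \<tau> z * indicator (layer (grid 0 j) 1 m) z \<partial>?M)"
      by (intro sum.cong refl nn_integral_suminf mm)
    finally show ?thesis .
  qed
  also have "\<dots> \<le> (\<Sum>j<16. \<Sum>m. ennreal (B (grid 0 j) * q ^ m))"
    by (intro sum_mono suminf_le B1 summableI)
  also have "\<dots> = (\<Sum>j<16. ennreal (B (grid 0 j) * (1 / (1 - q))))"
    using q B0 by (intro sum.cong refl suminf_ennreal_eq sums_mult geometric_sums) auto
  also have "\<dots> = ennreal (\<Sum>j<16. B (grid 0 j) * (1 / (1 - q)))"
    using q B0 by (intro sum_ennreal) auto
  finally show ?thesis using q B0 by (intro exI[of _ "\<Sum>j<16. B (grid 0 j) * (1 / (1 - q))"]) (auto intro!: sum_nonneg)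
qed

context quasidisc_map
begin

text \<open>The condition D_p concerns discs centred on the boundary, so the disc \<open>B\<close>
  around the image of the box has to reach the boundary. If \<open>B\<close> lay inside \<Omega>,
  its preimage would be compact in the unit disc, whereas the box approaches the circle.\<close>

lemma hbox_image_boundary:
  obtains K where "K > 0" "\<And>\<theta> l. 0 < l \<Longrightarrow> l \<le> 1 \<Longrightarrow>
    \<exists>c\<in>frontier \<Omega>. \<psi> ` hbox \<theta> l \<subseteq> ball c (K * (cmod (deriv \<psi> (zbox \<theta> l)) * l))"
proof -
  obtain K where K: "K > 0" "\<And>\<theta> l. 0 < l \<Longrightarrow> l \<le> 1 \<Longrightarrow> \<psi> ` carleson_box \<theta> l \<subseteq> cball (\<psi> (zc \<theta> l)) (K * (cmod (deriv \<psi> (zc \<theta> l)) * l))"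
    by (rule carleson_image) (rule that)
  obtain k where k: "k holomorphic_on \<Omega>" "\<And>z. z \<in> disc \<Longrightarrow> k (\<psi> z) = z" "\<And>w. w \<in> \<Omega> \<Longrightarrow> \<psi> (k w) = w"
    "\<And>w. w \<in> \<Omega> \<Longrightarrow> k w \<in> disc" by (rule inverse_holomorphic) (rule that)
  show thesis
  proof (rule that[of "3 * K"])
    fix \<theta> l :: real assume l: "0 < l" "l \<le> 1"
    let ?w = "\<psi> (zbox \<theta> l)" and ?s = "K * (cmod (deriv \<psi> (zbox \<theta> l)) * l)"
    define B where "B = cball ?w ?s"
    have s: "?s > 0" using K(1) l deriv_nz[OF zbox_disc[OF l]] by simp
    have sub: "\<psi> ` carleson_box (\<theta> + l/2) l \<subseteq> B" unfolding B_def zbox_zc(1) by (rule K(2)[OF l])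
    have wO: "?w \<in> \<Omega>" using image zbox_disc[OF l] by blast
    have "\<not> B \<subseteq> \<Omega>"
    proof
      assume BO: "B \<subseteq> \<Omega>"
      have "continuous_on B (\<lambda>w. cmod (k w))"
        by (intro continuous_intros continuous_on_subset[OF holomorphic_on_imp_continuous_on[OF k(1)] BO])
      moreover have "compact B" "B \<noteq> {}" using s by (auto simp: B_def)
      ultimately obtain w0 where w0: "w0 \<in> B" "\<And>w. w \<in> B \<Longrightarrow> cmod (k w) \<le> cmod (k w0)"
        using continuous_attains_sup by metis
      define t where "t = (1 + max (cmod (k w0)) (1 - l)) / 2"
      have "cmod (k w0) < 1" using k(4)[of w0] w0(1) BO by auto
      then have t: "cmod (k w0) < t" "1 - l < t" "t < 1" using l by (auto simp: t_def max_def)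
      then have t0: "t > 0" using l by linarith
      let ?z = "of_real t * cis (\<theta> + l/2)"
      have n: "cmod ?z = t" using t0 by (simp add: norm_mult)
      have "?z \<in> carleson_box (\<theta> + l/2) l"
        unfolding carleson_box_def mem_Collect_eq n using t l by (auto intro!: exI[of _ "\<theta> + l/2"])
      then have "\<psi> ?z \<in> B" using sub by blast
      then have "cmod (k (\<psi> ?z)) \<le> cmod (k w0)" by (rule w0(2))
      moreover have "k (\<psi> ?z) = ?z" using n t(3) by (intro k(2)) auto
      ultimately show False using n t(1) by simp
    qed
    moreover have "connected B" by (simp add: B_def convex_connected)
    moreover have "?w \<in> B" using s by (simp add: B_def)
    ultimately have "B \<inter> frontier \<Omega> \<noteq> {}" using wO by (intro connected_Int_frontier) auto
    then obtain c where c: "c \<in> B" "c \<in> frontier \<Omega>" by blast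
    have "B \<subseteq> ball c (3 * K * (cmod (deriv \<psi> (zbox \<theta> l)) * l))"
    proof
      fix x assume "x \<in> B"
      \<comment> \<open>Recentring \<open>B\<close> at one of its own points doubles the radius; 3
        instead of 2 gives an open disc.\<close>
      then have "dist c x \<le> 2 * ?s" using c(1) dist_triangle3[of c x ?w] unfolding B_def mem_cball by linarith
      then show "x \<in> ball c (3 * K * (cmod (deriv \<psi> (zbox \<theta> l)) * l))" using s by (simp add: mult.assoc)
    qed
    moreover have "\<psi> ` hbox \<theta> l \<subseteq> B" using sub hbox_subset_carleson[OF l, of \<theta>] by blast
    ultimately show "\<exists>c\<in>frontier \<Omega>. \<psi> ` hbox \<theta> l \<subseteq> ball c (3 * K * (cmod (deriv \<psi> (zbox \<theta> l)) * l))" using c(2) by blast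
  qed (use K in simp)
qed

text \<open>The top half of one box of length l/2^m has area of order 4^(-m) l^2, so the negative
  moment of order 2s over the large box bounds |\<psi>'|^(-2s) there by a multiple of 4^m
  |\<psi>'(z_Q)|^(-2s). A large s makes the resulting loss per generation as close to 1 as
  desired.\<close>

lemma deriv_lower:
  assumes Bp: "\<forall>p>1. in_Bp p (\<lambda>z. (cmod (deriv \<psi> z))\<^sup>2)" and \<eta>: "\<eta> > 1"
  obtains A where "A > 0" "\<And>\<theta> l m z. 0 < l \<Longrightarrow> l \<le> 1 \<Longrightarrow> z \<in> layer \<theta> l m \<Longrightarrow> cmod (deriv \<psi> (zbox \<theta> l)) \<le> A * \<eta> ^ m * cmod (deriv \<psi> z)"
proof -
  \<comment> \<open>Chosen so that 4^(1/(2s)) = \<eta>.\<close>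
  define s where "s = ln 2 / ln \<eta>"
  have s: "s > 0" using \<eta> by (simp add: s_def)
  have "in_Bp (1 + 1/s) (\<lambda>z. (cmod (deriv \<psi> z))\<^sup>2)" using Bp s by simp
  from Bp_imp_negative_moments[OF s this] obtain C where C: "C > 0" "\<And>\<theta> l. 0 < l \<Longrightarrow> l \<le> 1 \<Longrightarrow>
      (\<integral>\<^sup>+z. ennreal (cmod (deriv \<psi> z) powr (- 2 * s)) \<partial>lebesgue_on (carleson_box \<theta> l)) \<le> ennreal (C * (l\<^sup>2 * cmod (deriv \<psi> (zc \<theta> l)) powr (- 2 * s)))"
    by metis
  obtain Cd where Cd: "Cd \<ge> 1" "\<And>\<theta> l z. 0 < l \<Longrightarrow> l \<le> 1 \<Longrightarrow> z \<in> layer \<theta> l 0 \<Longrightarrow>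
    cmod (deriv \<psi> z) \<le> Cd * cmod (deriv \<psi> (zbox \<theta> l)) \<and> cmod (deriv \<psi> (zbox \<theta> l)) \<le> Cd * cmod (deriv \<psi> z)"
    by (rule layer_distortion) (rule that)
  have pw: "(x powr (- 2 * s)) powr (1/(2 * s)) = 1/x" if "x > 0" for x
  proof -
    have "- 2 * s * (1/(2 * s)) = - 1" using s by simp
    then show ?thesis using that unfolding powr_powr by (simp add: powr_minus_divide)
  qed
  define A1 where "A1 = C * 1024 / pi"
  have A1: "A1 > 0" using C by (simp add: A1_def)
  define A where "A = A1 powr (1 / (2 * s)) * Cd * Cd"
  show thesis
  proof (rule that[of A])
    show "A > 0" using A1 Cd(1) by (simp add: A_def)
    fix \<theta> l :: real and m z assume l: "0 < l" "l \<le> 1" and z: "z \<in> layer \<theta> l m"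
    define l' where "l' = l / 2 ^ m"
    have l': "0 < l'" "l' \<le> 1"
    proof -
      show "0 < l'" using l by (simp add: l'_def)
      have "l' \<le> l / 1" unfolding l'_def using l by (intro divide_left_mono) auto
      then show "l' \<le> 1" using l by simp
    qed
    have "z \<in> strip \<theta> l m" using z layer_subset_strip by blast
    then obtain \<theta>' where t: "z \<in> hbox \<theta>' l'" "hbox \<theta>' l' \<subseteq> hbox \<theta> l"
      using strip_descend[OF l] unfolding l'_def by blast
    have z0: "z \<in> layer \<theta>' l' 0" using z t(1) by (auto simp: layer_def l'_def hbox_def)
    define P where "P = cmod (deriv \<psi> (zbox \<theta> l))"
    define P' where "P' = cmod (deriv \<psi> (zbox \<theta>' l'))"
    have P: "P > 0" "P' > 0" using deriv_nz[OF zbox_disc[OF l]] deriv_nz[OF zbox_disc[OF l']] by (auto simp: P_def P'_def)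
    let ?Q = "carleson_box (\<theta> + l/2) l" and ?T = "layer \<theta>' l' 0"
    have TQ: "?T \<subseteq> ?Q" using t(2) hbox_disc(3)[of \<theta>' l' 0] hbox_subset_carleson[OF l, of \<theta>] by blast
    have Q: "?Q \<in> sets lebesgue" using carleson_box_borel[OF l] by auto
    have "ennreal ((Cd * P') powr (- 2 * s)) * ennreal (pi * (l'/32)\<^sup>2) \<le> ennreal ((Cd * P') powr (- 2 * s)) * emeasure lebesgue ?T"
      by (intro mult_left_mono layer0_emeasure_ge l') auto
    also have "\<dots> = (\<integral>\<^sup>+z. ennreal ((Cd * P') powr (- 2 * s)) * indicator ?T z \<partial>lebesgue)"
      by (subst nn_integral_cmult_indicator) auto
    also have "\<dots> \<le> (\<integral>\<^sup>+z. ennreal (cmod (deriv \<psi> z) powr (- 2 * s)) * indicator ?Q z \<partial>lebesgue)"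
    proof (rule nn_integral_mono)
      fix x :: complex
      show "ennreal ((Cd * P') powr (- 2 * s)) * indicator ?T x \<le> ennreal (cmod (deriv \<psi> x) powr (- 2 * s)) * indicator ?Q x"
      proof (cases "x \<in> ?T")
        case True
        have "x \<in> disc" using True TQ carleson_disc by blast
        then have "cmod (deriv \<psi> x) > 0" using deriv_nz by simp
        moreover have "cmod (deriv \<psi> x) \<le> Cd * P'" using Cd(2)[OF l' True] by (simp add: P'_def)
        ultimately have "(Cd * P') powr (- 2 * s) \<le> cmod (deriv \<psi> x) powr (- 2 * s)" using s by (intro powr_mono2') auto
        then show ?thesis using True TQ by (auto simp: indicator_def intro: ennreal_leI)
      qed simp
    qed
    also have "\<dots> = (\<integral>\<^sup>+z. ennreal (cmod (deriv \<psi> z) powr (- 2 * s)) \<partial>lebesgue_on ?Q)"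
      using Q by (subst nn_integral_restrict_space) auto
    also have "\<dots> \<le> ennreal (C * (l\<^sup>2 * P powr (- 2 * s)))" using C(2)[OF l, of "\<theta> + l/2"] by (simp add: P_def zbox_zc(1))
    finally have "ennreal ((Cd * P') powr (- 2 * s) * (pi * (l'/32)\<^sup>2)) \<le> ennreal (C * (l\<^sup>2 * P powr (- 2 * s)))"
      by (simp add: ennreal_mult')
    then have "(Cd * P') powr (- 2 * s) * (pi * (l'/32)\<^sup>2) \<le> C * (l\<^sup>2 * P powr (- 2 * s))"
      using C(1) by (subst (asm) ennreal_le_iff) auto
    then have "(Cd * P') powr (- 2 * s) \<le> C * (l\<^sup>2 * P powr (- 2 * s)) / (pi * (l'/32)\<^sup>2)"
      using l' by (simp add: le_divide_eq)
    also have "\<dots> = A1 * 4 ^ m * P powr (- 2 * s)"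
    proof -
      have "((2::real) ^ m)\<^sup>2 = 4 ^ m" by (simp add: power2_eq_square flip: power_mult_distrib)
      then show ?thesis using l by (simp add: A1_def l'_def power_divide)
    qed
    finally have "((Cd * P') powr (- 2 * s)) powr (1/(2 * s)) \<le> (A1 * 4 ^ m * P powr (- 2 * s)) powr (1/(2 * s))"
      using s by (intro powr_mono2) auto
    moreover have "((Cd * P') powr (- 2 * s)) powr (1/(2 * s)) = 1 / (Cd * P')"
      using P Cd(1) by (intro pw) auto
    moreover have "(A1 * 4 ^ m * P powr (- 2 * s)) powr (1/(2 * s)) = A1 powr (1/(2 * s)) * \<eta> ^ m * (1/P)"
    proof -
      have e: "(4 ^ m) powr (1/(2 * s)) = \<eta> ^ m"
      proof -
        have "(4::real) ^ m = exp (real m * ln 4)" by (simp add: exp_of_nat_mult)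
        then have "(4 ^ m) powr (1/(2 * s)) = exp (real m * ln 4 * (1/(2 * s)))" by (simp add: powr_def mult.commute)
        also have "ln 4 = 2 * ln (2::real)" using ln_realpow[of 2 2] by simp
        also have "real m * (2 * ln 2) * (1/(2 * s)) = real m * ln \<eta>" using \<eta> by (simp add: s_def)
        also have "exp (real m * ln \<eta>) = \<eta> ^ m" using \<eta> by (simp add: exp_of_nat_mult)
        finally show ?thesis .
      qed
      have "(A1 * 4 ^ m * P powr (- 2 * s)) powr (1/(2 * s)) = A1 powr (1/(2 * s)) * (4 ^ m) powr (1/(2 * s)) * (P powr (- 2 * s)) powr (1/(2 * s))"
        using A1 by (simp add: powr_mult)
      then show ?thesis unfolding e pw[OF P(1)] .
    qed
    ultimately have "1 / (Cd * P') \<le> A1 powr (1/(2 * s)) * \<eta> ^ m * (1/P)" by simp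
    then have "P \<le> A1 powr (1/(2 * s)) * \<eta> ^ m * (Cd * P')" using P Cd(1) by (simp add: field_simps)
    also have "\<dots> \<le> A1 powr (1/(2 * s)) * \<eta> ^ m * (Cd * (Cd * cmod (deriv \<psi> z)))"
      using Cd(2)[OF l' z0] Cd(1) \<eta> by (intro mult_left_mono) (auto simp: P'_def)
    finally show "cmod (deriv \<psi> (zbox \<theta> l)) \<le> A * \<eta> ^ m * cmod (deriv \<psi> z)" by (simp add: A_def P_def mult_ac)
  qed
qed

text \<open>The averages are cleared: the area of the truncated disc is at most pi r^2 and enters
  with total exponent 1 + (p-1) = p. One disc centred on the boundary contains the bounded set
  \<Omega>, which gives integrability on all of it. Absolute values appear because \<sigma> is
  positive only almost everywhere.\<close>

lemma Dp_expand:
  assumes Dp: "in_Dp \<Omega> p \<sigma>" and p: "p > 1"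
  obtains C where "C > 0" "integrable (lebesgue_on \<Omega>) (\<lambda>w. \<bar>\<sigma> w\<bar>)" "integrable (lebesgue_on \<Omega>) (\<lambda>w. \<bar>inverse (\<sigma> w)\<bar> powr (1/(p-1)))"
    "AE w in lebesgue_on \<Omega>. \<sigma> w > 0"
    "\<And>c r. c \<in> frontier \<Omega> \<Longrightarrow> r > 0 \<Longrightarrow> (\<integral>w. \<bar>\<sigma> w\<bar> * indicator (ball c r) w \<partial>lebesgue_on \<Omega>) *
       (\<integral>w. \<bar>inverse (\<sigma> w)\<bar> powr (1/(p-1)) * indicator (ball c r) w \<partial>lebesgue_on \<Omega>) powr (p - 1) \<le> C * (r\<^sup>2) powr p"
proof -
  define s where "s = 1/(p-1)"
  have s: "s > 0" "1/s = p - 1" using p by (auto simp: s_def)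
  obtain C0 where W: "weight_on \<Omega> \<sigma>" and D: "\<And>c r. c \<in> frontier \<Omega> \<Longrightarrow> 0 < r \<Longrightarrow>
        wavg_finite 1 (\<lambda>_. 1) (ball c r \<inter> \<Omega>) \<sigma> \<and>
        wavg_finite s (\<lambda>_. 1) (ball c r \<inter> \<Omega>) (\<lambda>z. inverse (\<sigma> z)) \<and>
        wavg 1 (\<lambda>_. 1) (ball c r \<inter> \<Omega>) \<sigma> * wavg s (\<lambda>_. 1) (ball c r \<inter> \<Omega>) (\<lambda>z. inverse (\<sigma> z)) \<le> C0"
    using Dp unfolding in_Dp_def s_def[symmetric] by blast
  define u where "u w = \<bar>inverse (\<sigma> w)\<bar> powr s" for w
  have si: "set_integrable lebesgue (ball c r \<inter> \<Omega>) f \<longleftrightarrow> integrable (lebesgue_on \<Omega>) (\<lambda>w. f w * indicator (ball c r) w)" for c r and f :: "complex \<Rightarrow> real"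
    unfolding set_integrable_def by (subst integrable_restrict_space) (auto simp: indicator_inter_arith mult_ac)
  have sI: "(LINT w:(ball c r \<inter> \<Omega>)|lebesgue. f w) = (\<integral>w. f w * indicator (ball c r) w \<partial>lebesgue_on \<Omega>)" for c r and f :: "complex \<Rightarrow> real"
    unfolding set_lebesgue_integral_def by (subst integral_restrict_space) (auto simp: indicator_inter_arith mult_ac)
  have fin: "integrable (lebesgue_on \<Omega>) (\<lambda>w. \<bar>\<sigma> w\<bar> * indicator (ball c r) w)" "integrable (lebesgue_on \<Omega>) (\<lambda>w. u w * indicator (ball c r) w)"
    if "c \<in> frontier \<Omega>" "r > 0" for c r
    using D[OF that] unfolding wavg_finite_def si by (simp_all add: u_def)
  have ne: "\<Omega> \<noteq> {}" "\<Omega> \<noteq> UNIV" using image bounded_Omega not_bounded_UNIV by auto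
  then obtain c0 where c0: "c0 \<in> frontier \<Omega>" using frontier_eq_empty by blast
  obtain r0 where r0: "\<Omega> \<subseteq> ball c0 r0" using bounded_subset_ballD[OF bounded_Omega] by blast
  have "r0 > 0" using r0 ne by (metis ball_eq_empty not_le subset_empty)
  have full: "integrable (lebesgue_on \<Omega>) f" if "integrable (lebesgue_on \<Omega>) (\<lambda>w. f w * indicator (ball c0 r0) w)" for f :: "complex \<Rightarrow> real"
    using that r0 by (subst Bochner_Integration.integrable_cong[OF refl, of _ _ "\<lambda>w. f w * indicator (ball c0 r0) w"]) auto
  define C where "C = (\<bar>C0\<bar> + 1) * pi powr p"
  show thesis
  proof (rule that[of C])
    show "C > 0" by (simp add: C_def)
    show "integrable (lebesgue_on \<Omega>) (\<lambda>w. \<bar>\<sigma> w\<bar>)" "integrable (lebesgue_on \<Omega>) (\<lambda>w. \<bar>inverse (\<sigma> w)\<bar> powr (1/(p-1)))"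
      using full[OF fin(1)[OF c0 \<open>r0 > 0\<close>]] full[OF fin(2)[OF c0 \<open>r0 > 0\<close>]] by (simp_all add: u_def s_def)
    show "AE w in lebesgue_on \<Omega>. \<sigma> w > 0" using W unfolding weight_on_def by (simp add: AE_restrict_space_iff)
    fix c r assume c: "c \<in> frontier \<Omega>" "r > (0::real)"
    let ?E = "ball c r \<inter> \<Omega>"
    define X where "X = (\<integral>w. \<bar>\<sigma> w\<bar> * indicator (ball c r) w \<partial>lebesgue_on \<Omega>)"
    define Y where "Y = (\<integral>w. u w * indicator (ball c r) w \<partial>lebesgue_on \<Omega>)"
    define V where "V = measure lebesgue ?E"
    have XY0: "X \<ge> 0" "Y \<ge> 0" unfolding X_def Y_def u_def by (intro integral_nonneg_AE; simp)+
    have V1: "(LINT z:?E|lebesgue. (1::real)) = V" unfolding set_lebesgue_integral_def V_def using openT by simp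
    have lm: "?E \<in> lmeasurable" using openT by (intro bounded_set_imp_lmeasurable) (auto intro: bounded_subset[OF bounded_ball])
    have V0: "V > 0"
    proof -
      have "c \<in> closure \<Omega>" using c(1) by (simp add: frontier_def)
      then have "?E \<noteq> {}" using c(2) by (metis closure_approachable disjoint_iff dist_commute mem_ball)
      then obtain x where "x \<in> ?E" by blast
      moreover have "open ?E" using openT by auto
      ultimately obtain e where e: "e > 0" "ball x e \<subseteq> ?E" using openE by blast
      have "measure lebesgue (ball x e) \<le> V" unfolding V_def using e lm by (intro measure_mono_fmeasurable) auto
      moreover have "measure lebesgue (ball x e) > 0" using e by simp
      ultimately show ?thesis by linarith
    qed
    have Vle: "V \<le> pi * r\<^sup>2"
    proof -
      have "V \<le> measure lebesgue (ball c r)" unfolding V_def using lm by (intro measure_mono_fmeasurable) auto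
      also have "\<dots> = pi * r\<^sup>2" using c(2) by (simp add: content_ball DIM_complex unit_ball_vol_2)
      finally show ?thesis .
    qed
    have "X / V * (Y powr (p - 1) / V powr (p - 1)) \<le> C0"
      using D[OF c] XY0 unfolding wavg_def sI[of c r "\<lambda>z. \<bar>\<sigma> z\<bar> powr 1 * 1"] sI[of c r "\<lambda>z. \<bar>inverse (\<sigma> z)\<bar> powr s * 1"] V1 s(2)
      by (simp add: X_def Y_def u_def abs_of_pos[OF V0])
    then have "X * Y powr (p - 1) \<le> C0 * (V * V powr (p - 1))" using V0 by (simp add: field_simps)
    also have "V * V powr (p - 1) = V powr p" using V0 by (simp add: powr_mult_base)
    also have "C0 * V powr p \<le> (\<bar>C0\<bar> + 1) * V powr p" by (intro mult_right_mono) auto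
    also have "\<dots> \<le> (\<bar>C0\<bar> + 1) * (pi * r\<^sup>2) powr p" using Vle V0 p by (intro mult_left_mono powr_mono2) auto
    also have "\<dots> = C * (r\<^sup>2) powr p" by (simp add: C_def powr_mult)
    finally show "(\<integral>w. \<bar>\<sigma> w\<bar> * indicator (ball c r) w \<partial>lebesgue_on \<Omega>) *
       (\<integral>w. \<bar>inverse (\<sigma> w)\<bar> powr (1/(p-1)) * indicator (ball c r) w \<partial>lebesgue_on \<Omega>) powr (p - 1) \<le> C * (r\<^sup>2) powr p"
      by (simp add: X_def Y_def u_def s_def)
  qed
qed

text \<open>The integral of |\<psi>'|^2 over the preimage of a null set is 0, and the integrand is
  positive there.\<close>

lemma AE_pullback:
  assumes "AE w in lebesgue_on \<Omega>. R w"
  shows "AE z in lebesgue_on disc. R (\<psi> z)"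
proof -
  obtain N where N: "N \<in> null_sets (lebesgue_on \<Omega>)" "{w \<in> space (lebesgue_on \<Omega>). \<not> R w} \<subseteq> N"
    using assms unfolding eventually_ae_filter by blast
  have Ns: "N \<in> sets (lebesgue_on \<Omega>)" using N by auto
  have im: "(\<lambda>w. indicator N w :: ennreal) \<in> borel_measurable (lebesgue_on \<Omega>)" using Ns by (rule borel_measurable_indicator)
  have "(\<integral>\<^sup>+z. ennreal ((cmod (deriv \<psi> z))\<^sup>2) * indicator N (\<psi> z) \<partial>lebesgue_on disc) = (\<integral>\<^sup>+w. indicator N w \<partial>lebesgue_on \<Omega>)"
    by (rule nn_integral_conformal[symmetric, OF im])
  also have "\<dots> = 0" using N(1) Ns by (simp add: null_setsD1)
  finally have "AE z in lebesgue_on disc. ennreal ((cmod (deriv \<psi> z))\<^sup>2) * indicator N (\<psi> z) = 0"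
    using measurable_compose[OF f_measurable im] by (subst (asm) nn_integral_0_iff_AE) auto
  then show ?thesis
  proof (rule AE_mp[OF _ AE_I2], intro impI)
    fix z assume z: "z \<in> space (lebesgue_on disc)" "ennreal ((cmod (deriv \<psi> z))\<^sup>2) * indicator N (\<psi> z) = 0"
    then have "\<psi> z \<notin> N" using deriv_nz[of z] by (auto simp: indicator_def split: if_splits)
    moreover have "\<psi> z \<in> \<Omega>" using z image by auto
    ultimately show "R (\<psi> z)" using N(2) by auto
  qed
qed

end

section \<open>Masses of the pulled-back weights on boxes and layers\<close>

locale quasidisc_weight = quasidisc_map +
  fixes p :: real and \<sigma> :: "complex \<Rightarrow> real"
  assumes p: "p > 1" and Dp: "in_Dp \<Omega> p \<sigma>" and Bp: "\<forall>q>1. in_Bp q (\<lambda>z. (cmod (deriv \<psi> z))\<^sup>2)"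
begin

definition sigma_pull :: "complex \<Rightarrow> real" where
  "sigma_pull z = (cmod (deriv \<psi> z))\<^sup>2 * \<bar>\<sigma> (\<psi> z)\<bar>"

definition dual_pull :: "complex \<Rightarrow> real" where
  "dual_pull z = (cmod (deriv \<psi> z))\<^sup>2 * \<bar>inverse (\<sigma> (\<psi> z))\<bar> powr (1/(p-1))"

text \<open>The product \<open>dscale \<theta> l * l\<close> is the size s of the image of the
  box.\<close>

definition dscale :: "real \<Rightarrow> real \<Rightarrow> real" where "dscale \<theta> l = cmod (deriv \<psi> (zbox \<theta> l))"

abbreviation "disc_measure \<equiv> lebesgue_on disc"

lemma dscale_pos: "0 < l \<Longrightarrow> l \<le> 1 \<Longrightarrow> dscale \<theta> l > 0"
  using deriv_nz[OF zbox_disc] by (simp add: dscale_def)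

lemma box_sets: "hbox \<theta> l \<in> sets disc_measure" "layer \<theta> l k \<in> sets disc_measure"
  using order_trans[OF hbox_disc(3) hbox_disc(1)] hbox_disc(1) by (simp_all add: sets_restrict_space_iff)

lemma pull_nonneg: "sigma_pull z \<ge> 0" "dual_pull z \<ge> 0" by (auto simp: sigma_pull_def dual_pull_def)

lemma pull_integrable: "integrable disc_measure sigma_pull" "integrable disc_measure dual_pull"
  and sigma_pos: "AE z in disc_measure. \<sigma> (\<psi> z) > 0"
proof -
  obtain C where C: "integrable (lebesgue_on \<Omega>) (\<lambda>w. \<bar>\<sigma> w\<bar>)"
      "integrable (lebesgue_on \<Omega>) (\<lambda>w. \<bar>inverse (\<sigma> w)\<bar> powr (1/(p-1)))" "AE w in lebesgue_on \<Omega>. \<sigma> w > 0"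
    by (rule Dp_expand[OF Dp p]) (rule that)
  show "integrable disc_measure sigma_pull" using C(1) by (subst (asm) integrable_conformal) (use borel_measurable_integrable[OF C(1)] in \<open>auto simp: sigma_pull_def[abs_def]\<close>)
  show "integrable disc_measure dual_pull" using C(2) by (subst (asm) integrable_conformal) (use borel_measurable_integrable[OF C(2)] in \<open>auto simp: dual_pull_def[abs_def]\<close>)
  show "AE z in disc_measure. \<sigma> (\<psi> z) > 0" by (rule AE_pullback[OF C(3)])
qed

lemma pull_measurable [measurable]: "sigma_pull \<in> borel_measurable disc_measure" "dual_pull \<in> borel_measurable disc_measure"
  using pull_integrable by auto

lemma pull_indicator:
  assumes "A \<in> sets disc_measure"
  shows "integrable disc_measure (\<lambda>z. sigma_pull z * indicator A z)" "integrable disc_measure (\<lambda>z. dual_pull z * indicator A z)"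
    "(\<integral>\<^sup>+z. ennreal (sigma_pull z) * indicator A z \<partial>disc_measure) = ennreal (\<integral>z. sigma_pull z * indicator A z \<partial>disc_measure)"
    "(\<integral>\<^sup>+z. ennreal (dual_pull z) * indicator A z \<partial>disc_measure) = ennreal (\<integral>z. dual_pull z * indicator A z \<partial>disc_measure)"
    "(\<integral>z. sigma_pull z * indicator A z \<partial>disc_measure) \<ge> 0" "(\<integral>z. dual_pull z * indicator A z \<partial>disc_measure) \<ge> 0"
proof -
  show i: "integrable disc_measure (\<lambda>z. sigma_pull z * indicator A z)" "integrable disc_measure (\<lambda>z. dual_pull z * indicator A z)"
    using integrable_mult_indicator[OF assms pull_integrable(1)] integrable_mult_indicator[OF assms pull_integrable(2)]
    by (simp_all add: mult.commute)
  have e: "ennreal x * indicator A z = ennreal (x * indicator A z)" for x :: real and z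
    by (simp add: indicator_def)
  show "(\<integral>\<^sup>+z. ennreal (sigma_pull z) * indicator A z \<partial>disc_measure) = ennreal (\<integral>z. sigma_pull z * indicator A z \<partial>disc_measure)"
    "(\<integral>\<^sup>+z. ennreal (dual_pull z) * indicator A z \<partial>disc_measure) = ennreal (\<integral>z. dual_pull z * indicator A z \<partial>disc_measure)"
    unfolding e using pull_nonneg i by (auto intro!: nn_integral_eq_integral)
  show "(\<integral>z. sigma_pull z * indicator A z \<partial>disc_measure) \<ge> 0" "(\<integral>z. dual_pull z * indicator A z \<partial>disc_measure) \<ge> 0"
    using pull_nonneg by (auto intro!: integral_nonneg_AE)
qed

lemma box_upper:
  obtains C where "C > 0" "\<And>\<theta> l. 0 < l \<Longrightarrow> l \<le> 1 \<Longrightarrow>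
    (\<integral>z. sigma_pull z * indicator (hbox \<theta> l) z \<partial>disc_measure) * (\<integral>z. dual_pull z * indicator (hbox \<theta> l) z \<partial>disc_measure) powr (p - 1) \<le> C * ((dscale \<theta> l * l)\<^sup>2) powr p"
proof -
  obtain C where C: "C > 0" "integrable (lebesgue_on \<Omega>) (\<lambda>w. \<bar>\<sigma> w\<bar>)" "integrable (lebesgue_on \<Omega>) (\<lambda>w. \<bar>inverse (\<sigma> w)\<bar> powr (1/(p-1)))"
    "\<And>c r. c \<in> frontier \<Omega> \<Longrightarrow> r > 0 \<Longrightarrow> (\<integral>w. \<bar>\<sigma> w\<bar> * indicator (ball c r) w \<partial>lebesgue_on \<Omega>) *
       (\<integral>w. \<bar>inverse (\<sigma> w)\<bar> powr (1/(p-1)) * indicator (ball c r) w \<partial>lebesgue_on \<Omega>) powr (p - 1) \<le> C * (r\<^sup>2) powr p"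
    by (rule Dp_expand[OF Dp p]) (rule that)
  obtain K where K: "K > 0" "\<And>\<theta> l. 0 < l \<Longrightarrow> l \<le> 1 \<Longrightarrow>
    \<exists>c\<in>frontier \<Omega>. \<psi> ` hbox \<theta> l \<subseteq> ball c (K * (cmod (deriv \<psi> (zbox \<theta> l)) * l))"
    by (rule hbox_image_boundary) (rule that)
  have push: "(\<integral>z. (cmod (deriv \<psi> z))\<^sup>2 * h (\<psi> z) * indicator (hbox \<theta> l) z \<partial>disc_measure) \<le> (\<integral>w. h w * indicator (ball c r) w \<partial>lebesgue_on \<Omega>)"
    if h: "integrable (lebesgue_on \<Omega>) h" "\<And>w. h w \<ge> 0" and sub: "\<psi> ` hbox \<theta> l \<subseteq> ball c r" for h :: "complex \<Rightarrow> real" and \<theta> l c r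
  proof -
    have hb: "integrable (lebesgue_on \<Omega>) (\<lambda>w. h w * indicator (ball c r) w)"
    proof -
      have "ball c r \<inter> \<Omega> \<in> sets (lebesgue_on \<Omega>)" by (auto simp: sets_restrict_space)
      from integrable_mult_indicator[OF this h(1)] show ?thesis
        by (rule Bochner_Integration.integrable_cong[THEN iffD1, rotated 2]) (auto simp: indicator_def)
    qed
    have hi: "integrable disc_measure (\<lambda>z. (cmod (deriv \<psi> z))\<^sup>2 * (h (\<psi> z) * indicator (ball c r) (\<psi> z)))"
      using hb by (subst (asm) integrable_conformal) (use hb in \<open>auto simp: borel_measurable_integrable\<close>)
    have "integrable disc_measure (\<lambda>z. (cmod (deriv \<psi> z))\<^sup>2 * h (\<psi> z))"
      using h(1) by (subst (asm) integrable_conformal) (use h in auto)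
    from integrable_mult_indicator[OF box_sets(1) this]
    have ii: "integrable disc_measure (\<lambda>z. (cmod (deriv \<psi> z))\<^sup>2 * h (\<psi> z) * indicator (hbox \<theta> l) z)" by (simp add: mult.commute)
    have "(\<integral>z. (cmod (deriv \<psi> z))\<^sup>2 * h (\<psi> z) * indicator (hbox \<theta> l) z \<partial>disc_measure) \<le> (\<integral>z. (cmod (deriv \<psi> z))\<^sup>2 * (h (\<psi> z) * indicator (ball c r) (\<psi> z)) \<partial>disc_measure)"
      using sub h(2) by (intro integral_mono ii hi) (auto simp: indicator_def image_subset_iff)
    also have "\<dots> = (\<integral>w. h w * indicator (ball c r) w \<partial>lebesgue_on \<Omega>)"
      using hb by (subst integral_conformal) auto
    finally show ?thesis .
  qed
  show thesis
  proof (rule that[of "C * (K\<^sup>2) powr p"])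
    show "C * (K\<^sup>2) powr p > 0" using C(1) K(1) by simp
    fix \<theta> l :: real assume l: "0 < l" "l \<le> 1"
    obtain c where c: "c \<in> frontier \<Omega>" "\<psi> ` hbox \<theta> l \<subseteq> ball c (K * (dscale \<theta> l * l))" using K(2)[OF l] unfolding dscale_def by blast
    let ?r = "K * (dscale \<theta> l * l)"
    have r: "?r > 0" using K(1) dscale_pos[OF l] l by simp
    have "(\<integral>z. sigma_pull z * indicator (hbox \<theta> l) z \<partial>disc_measure) * (\<integral>z. dual_pull z * indicator (hbox \<theta> l) z \<partial>disc_measure) powr (p - 1) \<le>
      (\<integral>w. \<bar>\<sigma> w\<bar> * indicator (ball c ?r) w \<partial>lebesgue_on \<Omega>) *
       (\<integral>w. \<bar>inverse (\<sigma> w)\<bar> powr (1/(p-1)) * indicator (ball c ?r) w \<partial>lebesgue_on \<Omega>) powr (p - 1)"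
      using push[OF C(2) _ c(2)] push[OF C(3) _ c(2)] pull_indicator(5,6)[OF box_sets(1)] p
      by (intro mult_mono powr_mono2) (auto simp: sigma_pull_def dual_pull_def intro!: integral_nonneg_AE)
    also have "\<dots> \<le> C * (?r\<^sup>2) powr p" by (rule C(4)[OF c(1) r])
    also have "(?r\<^sup>2) powr p = (K\<^sup>2) powr p * ((dscale \<theta> l * l)\<^sup>2) powr p" unfolding power_mult_distrib[of K] by (simp add: powr_mult)
    finally show "(\<integral>z. sigma_pull z * indicator (hbox \<theta> l) z \<partial>disc_measure) * (\<integral>z. dual_pull z * indicator (hbox \<theta> l) z \<partial>disc_measure) powr (p - 1) \<le> C * (K\<^sup>2) powr p * ((dscale \<theta> l * l)\<^sup>2) powr p"
      by (simp add: mult.assoc)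
  qed
qed

lemma deriv_sq_integrable: "integrable disc_measure (\<lambda>z. (cmod (deriv \<psi> z))\<^sup>2)"
proof -
  have "\<Omega> \<in> lmeasurable" using bounded_Omega by (intro bounded_set_imp_lmeasurable) auto
  then have "integrable (lebesgue_on \<Omega>) (\<lambda>_. 1 :: real)" by (simp add: lmeasurable_iff_integrable_on finite_measure.integrable_const finite_measure_lebesgue_on)
  then show ?thesis by (subst (asm) integrable_conformal) auto
qed

text \<open>Holder's inequality for |\<psi>'|^2 = (sigma_pull)^(1/p) (dual_pull)^(1-1/p). On the top
  half its integral is at least a multiple of (dscale l)^2 by distortion.\<close>

lemma layer_lower:
  obtains c where "c > 0" "\<And>\<theta> l y. 0 < l \<Longrightarrow> l \<le> 1 \<Longrightarrow> y > 0 \<Longrightarrow> (\<integral>z. dual_pull z * indicator (layer \<theta> l 0) z \<partial>disc_measure) \<le> y \<Longrightarrow>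
    c * ((dscale \<theta> l * l)\<^sup>2) powr p \<le> (\<integral>z. sigma_pull z * indicator (layer \<theta> l 0) z \<partial>disc_measure) * y powr (p - 1)"
proof -
  obtain Cd where Cd: "Cd \<ge> 1" "\<And>\<theta> l z. 0 < l \<Longrightarrow> l \<le> 1 \<Longrightarrow> z \<in> layer \<theta> l 0 \<Longrightarrow>
    cmod (deriv \<psi> z) \<le> Cd * cmod (deriv \<psi> (zbox \<theta> l)) \<and> cmod (deriv \<psi> (zbox \<theta> l)) \<le> Cd * cmod (deriv \<psi> z)"
    by (rule layer_distortion) (rule that)
  \<comment> \<open>The second weight is taken to be the dual power by definition; \<open>e\<close>
    then identifies |\<psi>'|^(2p) times it with \<open>sigma_pull\<close> almost
    everywhere.\<close>
  interpret W: weight_pair dual_pull "\<lambda>z. dual_pull z powr (1 - p)" p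
  proof
    show "AE z in disc_measure. dual_pull z > 0 \<and> dual_pull z powr (1 - p) = dual_pull z powr (1 - p)"
      using sigma_pos by (rule AE_mp) (rule AE_I2, use deriv_nz in \<open>auto simp: dual_pull_def\<close>)
  qed (use p in auto)
  define c0 where "c0 = pi / (1024 * Cd\<^sup>2)"
  have c0: "c0 > 0" using Cd(1) by (simp add: c0_def)
  have e: "(((cmod (deriv \<psi> z))\<^sup>2) powr p) * dual_pull z powr (1 - p) = sigma_pull z" if "\<sigma> (\<psi> z) > 0" "z \<in> disc" for z
  proof -
    define u where "u = (cmod (deriv \<psi> z))\<^sup>2"
    have u: "u > 0" using deriv_nz[OF that(2)] by (simp add: u_def)
    have "(\<bar>inverse (\<sigma> (\<psi> z))\<bar> powr (1/(p-1))) powr (1 - p) = \<bar>inverse (\<sigma> (\<psi> z))\<bar> powr (-1)"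
    proof -
      have e: "1/(p-1) * (1 - p) = -1" using p by (simp add: field_simps)
      show ?thesis unfolding powr_powr e ..
    qed
    also have "\<dots> = \<sigma> (\<psi> z)" using that(1) by (simp add: powr_minus)
    finally have "dual_pull z powr (1 - p) = u powr (1 - p) * \<sigma> (\<psi> z)"
      unfolding dual_pull_def u_def[symmetric] using u by (simp add: powr_mult)
    then have "u powr p * dual_pull z powr (1 - p) = (u powr p * u powr (1 - p)) * \<sigma> (\<psi> z)" by simp
    also have "u powr p * u powr (1 - p) = u" using u by (simp flip: powr_add)
    finally show ?thesis using that(1) by (simp add: sigma_pull_def u_def)
  qed
  show thesis
  proof (rule that[of "c0 powr p"])
    show "c0 powr p > 0" using c0 by simp
    fix \<theta> l y :: real assume l: "0 < l" "l \<le> 1" and y: "y > 0" "(\<integral>z. dual_pull z * indicator (layer \<theta> l 0) z \<partial>disc_measure) \<le> y"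
    let ?T = "layer \<theta> l 0"
    let ?F = "\<lambda>z. (cmod (deriv \<psi> z))\<^sup>2"
    define X where "X = (\<integral>z. sigma_pull z * indicator ?T z \<partial>disc_measure)"
    have X0: "X \<ge> 0" unfolding X_def by (rule pull_indicator(5)[OF box_sets(2)])
    have "ennreal ((\<integral>w. ?F w * indicator ?T w \<partial>disc_measure) powr p) \<le> ennreal (y powr (p - 1)) * (\<integral>\<^sup>+w. ennreal (?F w powr p * dual_pull w powr (1 - p)) * indicator ?T w \<partial>disc_measure)"
      by (rule W.holder[OF deriv_sq_integrable _ box_sets(2)]) (use y pull_indicator(4)[OF box_sets(2)] in \<open>auto intro: ennreal_leI\<close>)
    also have "(\<integral>\<^sup>+w. ennreal (?F w powr p * dual_pull w powr (1 - p)) * indicator ?T w \<partial>disc_measure) = (\<integral>\<^sup>+w. ennreal (sigma_pull w) * indicator ?T w \<partial>disc_measure)"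
      by (rule nn_integral_cong_AE, rule AE_mp[OF sigma_pos], rule AE_I2) (use e in auto)
    also have "\<dots> = ennreal X" unfolding X_def by (rule pull_indicator(3)[OF box_sets(2)])
    also have "ennreal (y powr (p - 1)) * ennreal X = ennreal (X * y powr (p - 1))" by (simp add: ennreal_mult'' mult.commute)
    finally have 1: "(\<integral>w. ?F w * indicator ?T w \<partial>disc_measure) powr p \<le> X * y powr (p - 1)"
      using X0 by (subst (asm) ennreal_le_iff) auto
    have "c0 * (dscale \<theta> l * l)\<^sup>2 \<le> (\<integral>w. ?F w * indicator ?T w \<partial>disc_measure)"
    proof -
      have fi: "integrable disc_measure (\<lambda>w. ?F w * indicator ?T w)"
        using integrable_mult_indicator[OF box_sets(2) deriv_sq_integrable, of \<theta> l 0] by (simp add: mult.commute)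
      have "ennreal ((dscale \<theta> l / Cd)\<^sup>2) * ennreal (pi * (l/32)\<^sup>2) \<le> ennreal ((dscale \<theta> l / Cd)\<^sup>2) * emeasure lebesgue ?T"
        by (intro mult_left_mono layer0_emeasure_ge l) auto
      also have "emeasure lebesgue ?T = (\<integral>\<^sup>+z. indicator ?T z \<partial>disc_measure)"
        using order_trans[OF hbox_disc(3) hbox_disc(1)] by (subst nn_integral_indicator_disc) auto
      also have "ennreal ((dscale \<theta> l / Cd)\<^sup>2) * (\<integral>\<^sup>+z. indicator ?T z \<partial>disc_measure) = (\<integral>\<^sup>+z. ennreal ((dscale \<theta> l / Cd)\<^sup>2) * indicator ?T z \<partial>disc_measure)"
        by (rule nn_integral_cmult[symmetric]) (use box_sets(2) in auto)
      also have "\<dots> \<le> (\<integral>\<^sup>+z. ennreal (?F z * indicator ?T z) \<partial>disc_measure)"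
      proof (rule nn_integral_mono)
        fix z
        show "ennreal ((dscale \<theta> l / Cd)\<^sup>2) * indicator ?T z \<le> ennreal (?F z * indicator ?T z)"
        proof (cases "z \<in> ?T")
          case True
          have "dscale \<theta> l / Cd \<le> cmod (deriv \<psi> z)" using Cd(2)[OF l True] Cd(1) by (simp add: dscale_def divide_le_eq mult.commute)
          then have "(dscale \<theta> l / Cd)\<^sup>2 \<le> ?F z" using dscale_pos[OF l, of \<theta>] Cd(1) by (intro power_mono) auto
          then show ?thesis using True by (simp add: ennreal_leI)
        qed auto
      qed
      also have "\<dots> = ennreal (\<integral>w. ?F w * indicator ?T w \<partial>disc_measure)" by (intro nn_integral_eq_integral fi) auto
      finally have "ennreal ((dscale \<theta> l / Cd)\<^sup>2 * (pi * (l/32)\<^sup>2)) \<le> ennreal (\<integral>w. ?F w * indicator ?T w \<partial>disc_measure)" by (simp add: ennreal_mult')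
      then have "(dscale \<theta> l / Cd)\<^sup>2 * (pi * (l/32)\<^sup>2) \<le> (\<integral>w. ?F w * indicator ?T w \<partial>disc_measure)"
        by (subst (asm) ennreal_le_iff) (auto intro!: integral_nonneg_AE)
      then show ?thesis by (simp add: c0_def power_divide power_mult_distrib mult_ac)
    qed
    then have "(c0 * (dscale \<theta> l * l)\<^sup>2) powr p \<le> (\<integral>w. ?F w * indicator ?T w \<partial>disc_measure) powr p"
      using c0 p by (intro powr_mono2) auto
    with 1 show "c0 powr p * ((dscale \<theta> l * l)\<^sup>2) powr p \<le> (\<integral>z. sigma_pull z * indicator ?T z \<partial>disc_measure) * y powr (p - 1)"
      using c0 by (simp add: powr_mult X_def)
  qed
qed

text \<open>D_p bounds the product of masses on the box from above and Holder's inequality bounds it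
  on the top half from below, both in terms of (dscale l)^(2p). So both densities are doubling and
  their strips decay.\<close>

lemma layer_decay:
  obtains r C where "0 < r" "r < 1" "C > 0" "\<And>\<theta> l. 0 < l \<Longrightarrow> l \<le> 1 \<Longrightarrow> \<exists>x y. x \<ge> 0 \<and> y > 0 \<and> x * y powr (p - 1) \<le> C * ((dscale \<theta> l * l)\<^sup>2) powr p \<and>
    (\<forall>m. (\<integral>\<^sup>+z. ennreal (sigma_pull z) * indicator (layer \<theta> l m) z \<partial>disc_measure) \<le> ennreal (x * r ^ m) \<and>
         (\<integral>\<^sup>+z. ennreal (dual_pull z) * indicator (layer \<theta> l m) z \<partial>disc_measure) \<le> ennreal (y * r ^ m))"
proof -
  let ?I1 = "\<lambda>A. \<integral>z. sigma_pull z * indicator A z \<partial>disc_measure" and ?I2 = "\<lambda>A. \<integral>z. dual_pull z * indicator A z \<partial>disc_measure"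
  obtain C where C: "C > 0" "\<And>\<theta> l. 0 < l \<Longrightarrow> l \<le> 1 \<Longrightarrow> ?I1 (hbox \<theta> l) * ?I2 (hbox \<theta> l) powr (p - 1) \<le> C * ((dscale \<theta> l * l)\<^sup>2) powr p"
    by (rule box_upper) (rule that)
  obtain c where c: "c > 0" "\<And>\<theta> l y. 0 < l \<Longrightarrow> l \<le> 1 \<Longrightarrow> y > 0 \<Longrightarrow> ?I2 (layer \<theta> l 0) \<le> y \<Longrightarrow>
    c * ((dscale \<theta> l * l)\<^sup>2) powr p \<le> ?I1 (layer \<theta> l 0) * y powr (p - 1)"
    by (rule layer_lower) (rule that)
  have mono: "?I1 (layer \<theta> l 0) \<le> ?I1 (hbox \<theta> l)" "?I2 (layer \<theta> l 0) \<le> ?I2 (hbox \<theta> l)" for \<theta> l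
    using hbox_disc(3)[of \<theta> l 0] pull_nonneg
    by (intro integral_mono pull_indicator(1,2) box_sets mult_left_mono; auto simp: indicator_def)+
  have dd: "?I2 (layer \<theta> l 0) > 0 \<and> ?I1 (hbox \<theta> l) \<le> (C/c) * ?I1 (layer \<theta> l 0) \<and> ?I2 (hbox \<theta> l) \<le> (C/c) powr (1/(p-1)) * ?I2 (layer \<theta> l 0)"
    if l: "0 < l" "l \<le> 1" for \<theta> l
  proof -
    have S: "((dscale \<theta> l * l)\<^sup>2) powr p > 0" using dscale_pos[OF l, of \<theta>] l by simp
    note D = doubling_from_duality[OF p pull_indicator(5)[OF box_sets(2)] mono(1) pull_indicator(6)[OF box_sets(2)] mono(2) C(2)[OF l] c(2)[OF l] C(1) c(1) S]
    show ?thesis using D by blast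
  qed
  \<comment> \<open>One constant serves both densities; the 2 keeps the rate 1 - 1/D
    positive.\<close>
  define D where "D = max 2 (max (C/c) ((C/c) powr (1/(p-1))))"
  have D: "D \<ge> 2" "C/c \<le> D" "(C/c) powr (1/(p-1)) \<le> D" by (auto simp: D_def)
  have D1: "D \<ge> 1" using D(1) by simp
  have dbl: "?I1 (hbox \<theta> l) \<le> D * ?I1 (layer \<theta> l 0)" "?I2 (hbox \<theta> l) \<le> D * ?I2 (layer \<theta> l 0)" if l: "0 < l" "l \<le> 1" for \<theta> l
    using dd[OF l, of \<theta>] mult_right_mono[OF D(2) pull_indicator(5)[OF box_sets(2), of \<theta> l 0]] mult_right_mono[OF D(3) pull_indicator(6)[OF box_sets(2), of \<theta> l 0]]
    by linarith+
  define r where "r = 1 - 1/D"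
  have r: "0 < r" "r < 1" using D(1) by (auto simp: r_def)
  show thesis
  proof (rule that[OF r C(1)])
    fix \<theta> l :: real assume l: "0 < l" "l \<le> 1"
    have le: "(\<integral>\<^sup>+z. \<tau> z * indicator (layer \<theta> l m) z \<partial>disc_measure) \<le> (\<integral>\<^sup>+z. \<tau> z * indicator (strip \<theta> l m) z \<partial>disc_measure)" for \<tau> m
      using layer_subset_strip by (intro nn_integral_mono) (auto simp: indicator_def)
    have 1: "(\<integral>\<^sup>+z. ennreal (sigma_pull z) * indicator (strip \<theta> l m) z \<partial>disc_measure) \<le> ennreal ((1 - 1/D) ^ m) * (\<integral>\<^sup>+z. ennreal (sigma_pull z) * indicator (hbox \<theta> l) z \<partial>disc_measure)" for m
      by (rule strip_decay[OF _ D1 _ _ l])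
         (use dbl(1) pull_indicator(3)[OF box_sets(1)] pull_indicator(3)[OF box_sets(2)] D1 in \<open>auto simp: ennreal_leI simp flip: ennreal_mult'\<close>)
    have 2: "(\<integral>\<^sup>+z. ennreal (dual_pull z) * indicator (strip \<theta> l m) z \<partial>disc_measure) \<le> ennreal ((1 - 1/D) ^ m) * (\<integral>\<^sup>+z. ennreal (dual_pull z) * indicator (hbox \<theta> l) z \<partial>disc_measure)" for m
      by (rule strip_decay[OF _ D1 _ _ l])
         (use dbl(2) pull_indicator(4)[OF box_sets(1)] pull_indicator(4)[OF box_sets(2)] D1 in \<open>auto simp: ennreal_leI simp flip: ennreal_mult'\<close>)
    have rm: "0 \<le> (1 - 1/D) ^ m" for m using r by (simp add: r_def)
    show "\<exists>x y. x \<ge> 0 \<and> y > 0 \<and> x * y powr (p - 1) \<le> C * ((dscale \<theta> l * l)\<^sup>2) powr p \<and>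
    (\<forall>m. (\<integral>\<^sup>+z. ennreal (sigma_pull z) * indicator (layer \<theta> l m) z \<partial>disc_measure) \<le> ennreal (x * r ^ m) \<and>
         (\<integral>\<^sup>+z. ennreal (dual_pull z) * indicator (layer \<theta> l m) z \<partial>disc_measure) \<le> ennreal (y * r ^ m))"
    proof (rule exI[of _ "?I1 (hbox \<theta> l)"], rule exI[of _ "?I2 (hbox \<theta> l)"], intro conjI allI)
      show "0 \<le> ?I1 (hbox \<theta> l)" by (rule pull_indicator(5)[OF box_sets(1)])
      show "0 < ?I2 (hbox \<theta> l)" using dd[OF l, of \<theta>] mono(2)[of \<theta> l] by linarith
      show "?I1 (hbox \<theta> l) * ?I2 (hbox \<theta> l) powr (p - 1) \<le> C * ((dscale \<theta> l * l)\<^sup>2) powr p" by (rule C(2)[OF l])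
      show "(\<integral>\<^sup>+z. ennreal (sigma_pull z) * indicator (layer \<theta> l m) z \<partial>disc_measure) \<le> ennreal (?I1 (hbox \<theta> l) * r ^ m)" for m
        using order_trans[OF le 1] unfolding pull_indicator(3)[OF box_sets(1)] r_def ennreal_mult'[OF rm, symmetric] by (simp add: mult.commute)
      show "(\<integral>\<^sup>+z. ennreal (dual_pull z) * indicator (layer \<theta> l m) z \<partial>disc_measure) \<le> ennreal (?I2 (hbox \<theta> l) * r ^ m)" for m
        using order_trans[OF le 2] unfolding pull_indicator(4)[OF box_sets(1)] r_def ennreal_mult'[OF rm, symmetric] by (simp add: mult.commute)
    qed
  qed
qed

text \<open>The dual of \<open>sigma_weight\<close> is a pulled-back density times a negative power
  of |\<psi>'|, as is \<open>sigma_weight\<close> itself. Written like this, both need only lower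
  bounds for |\<psi>'| on the layers.\<close>

definition dual_weight :: "complex \<Rightarrow> real" where "dual_weight z = dual_pull z * cmod (deriv \<psi> z) powr (- (p / (p - 1)))"

definition sigma_weight :: "complex \<Rightarrow> real" where "sigma_weight z = sigma_pull z * cmod (deriv \<psi> z) powr (- p)"

lemma weights_measurable [measurable]: "dual_weight \<in> borel_measurable disc_measure" "sigma_weight \<in> borel_measurable disc_measure"
  unfolding dual_weight_def[abs_def] sigma_weight_def[abs_def] by measurable

lemma sigma_weight_eq: "z \<in> disc \<Longrightarrow> sigma_weight z = cmod (deriv \<psi> z) powr (2 - p) * \<bar>\<sigma> (\<psi> z)\<bar>"
proof -
  assume "z \<in> disc"
  then have d: "cmod (deriv \<psi> z) > 0" using deriv_nz by simp
  then have "(cmod (deriv \<psi> z))\<^sup>2 * cmod (deriv \<psi> z) powr (- p) = cmod (deriv \<psi> z) powr (2 - p)"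
    by (simp add: powr_numeral powr_diff powr_minus divide_inverse)
  then show ?thesis by (simp add: sigma_weight_def sigma_pull_def mult_ac)
qed

sublocale weight_pair dual_weight sigma_weight p
proof
  show "AE z in disc_measure. 0 < dual_weight z \<and> sigma_weight z = dual_weight z powr (1 - p)"
    using sigma_pos
  proof (rule AE_mp, intro AE_I2 impI)
    fix z assume z: "z \<in> space disc_measure" "\<sigma> (\<psi> z) > 0"
    define d where "d = cmod (deriv \<psi> z)"
    have d: "d > 0" using deriv_nz z by (simp add: d_def)
    have e: "1/(p-1) * (1 - p) = -1" "- (p / (p - 1)) * (1 - p) = p" using p by (simp_all add: field_simps)
    have "dual_weight z powr (1 - p) = (d\<^sup>2) powr (1 - p) * (\<bar>inverse (\<sigma> (\<psi> z))\<bar> powr (1/(p-1))) powr (1 - p) * (d powr (- (p / (p - 1)))) powr (1 - p)"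
      unfolding dual_weight_def dual_pull_def d_def[symmetric] using d by (simp add: powr_mult)
    also have "(\<bar>inverse (\<sigma> (\<psi> z))\<bar> powr (1/(p-1))) powr (1 - p) = \<sigma> (\<psi> z)"
      unfolding powr_powr e using z(2) by (simp add: powr_minus)
    also have "(d powr (- (p / (p - 1)))) powr (1 - p) = d powr p" unfolding powr_powr e ..
    also have "(d\<^sup>2) powr (1 - p) = d powr (2 * (1 - p))" using d by (simp add: powr_numeral[symmetric] powr_powr del: powr_numeral)
    finally have "dual_weight z powr (1 - p) = d powr (2 * (1 - p) + p) * \<sigma> (\<psi> z)" by (simp only: powr_add mult_ac)
    also have "2 * (1 - p) + p = 2 - p" by simp
    finally have "sigma_weight z = dual_weight z powr (1 - p)" using sigma_weight_eq[of z] z by (simp add: d_def)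
    moreover have "dual_weight z > 0" using z d by (simp add: dual_weight_def dual_pull_def d_def)
    ultimately show "0 < dual_weight z \<and> sigma_weight z = dual_weight z powr (1 - p)" by blast
  qed
qed (use p in measurable)

text \<open>On the m-th layer the negative power of |\<psi>'| costs at most \<eta>^(m N), where N is
  the larger of the two exponents, and \<eta> is chosen so that this uses up only the square root of
  the decay r^m.\<close>

lemma layer_weights:
  obtains q A C where "0 < q" "q < 1" "A > 0" "C > 0" "\<And>\<theta> l. 0 < l \<Longrightarrow> l \<le> 1 \<Longrightarrow> \<exists>x y. x \<ge> 0 \<and> y > 0 \<and> x * y powr (p - 1) \<le> C * ((dscale \<theta> l * l)\<^sup>2) powr p \<and>
    (\<forall>m. (\<integral>\<^sup>+z. ennreal (sigma_weight z) * indicator (layer \<theta> l m) z \<partial>disc_measure) \<le> ennreal ((A / dscale \<theta> l) powr p * x * q ^ m) \<and>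
         (\<integral>\<^sup>+z. ennreal (dual_weight z) * indicator (layer \<theta> l m) z \<partial>disc_measure) \<le> ennreal ((A / dscale \<theta> l) powr (p / (p - 1)) * y * q ^ m))"
proof -
  obtain r C where r: "0 < r" "r < 1" and C: "C > 0" and t: "\<And>\<theta> l. 0 < l \<Longrightarrow> l \<le> 1 \<Longrightarrow> \<exists>x y. x \<ge> 0 \<and> y > 0 \<and> x * y powr (p - 1) \<le> C * ((dscale \<theta> l * l)\<^sup>2) powr p \<and>
    (\<forall>m. (\<integral>\<^sup>+z. ennreal (sigma_pull z) * indicator (layer \<theta> l m) z \<partial>disc_measure) \<le> ennreal (x * r ^ m) \<and>
         (\<integral>\<^sup>+z. ennreal (dual_pull z) * indicator (layer \<theta> l m) z \<partial>disc_measure) \<le> ennreal (y * r ^ m))"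
    by (rule layer_decay) (rule that)
  define N where "N = max p (p / (p - 1))"
  have N: "N > 0" "p \<le> N" "p / (p - 1) \<le> N" using p by (auto simp: N_def)
  \<comment> \<open>Gives \<eta>^N r = r^(1/2), which is the new rate \<open>q\<close>.\<close>
  define \<eta> where "\<eta> = r powr (- (1 / (2 * N)))"
  have \<eta>: "\<eta> > 1" using r N(1) powr_less_mono2_neg[of "- (1 / (2 * N))" r 1] by (simp add: \<eta>_def)
  obtain A where A: "A > 0" "\<And>\<theta> l m z. 0 < l \<Longrightarrow> l \<le> 1 \<Longrightarrow> z \<in> layer \<theta> l m \<Longrightarrow> cmod (deriv \<psi> (zbox \<theta> l)) \<le> A * \<eta> ^ m * cmod (deriv \<psi> z)"
    by (rule deriv_lower[OF Bp \<eta>]) (rule that)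
  define q where "q = r powr (1/2)"
  have q: "0 < q" "q < 1" using r powr_less_mono2[of "1/2" r 1] by (auto simp: q_def)
  have \<eta>N: "\<eta> powr N * r = q"
  proof -
    have "\<eta> powr N = r powr (- (1/2))" unfolding \<eta>_def powr_powr using N(1) by simp
    then have "\<eta> powr N * r = r powr (- (1/2)) * r powr 1" using r by simp
    also have "\<dots> = r powr (- (1/2) + 1)" by (rule powr_add[symmetric])
    finally show ?thesis by (simp add: q_def)
  qed
  have key: "(\<integral>\<^sup>+z. ennreal (t z * cmod (deriv \<psi> z) powr (- e)) * indicator (layer \<theta> l m) z \<partial>disc_measure) \<le> ennreal ((A / dscale \<theta> l) powr e * x * q ^ m)"
    if l: "0 < l" "l \<le> 1" and tt: "t \<in> borel_measurable disc_measure" "\<And>z. t z \<ge> 0"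
      and x: "x \<ge> 0" "(\<integral>\<^sup>+z. ennreal (t z) * indicator (layer \<theta> l m) z \<partial>disc_measure) \<le> ennreal (x * r ^ m)" and e: "0 < e" "e \<le> N" for t x e \<theta> l m
  proof -
    define k where "k = (A * \<eta> ^ m / dscale \<theta> l) powr e"
    have dscale: "dscale \<theta> l > 0" by (rule dscale_pos[OF l])
    have "(\<integral>\<^sup>+z. ennreal (t z * cmod (deriv \<psi> z) powr (- e)) * indicator (layer \<theta> l m) z \<partial>disc_measure) \<le> (\<integral>\<^sup>+z. ennreal k * (ennreal (t z) * indicator (layer \<theta> l m) z) \<partial>disc_measure)"
    proof (rule nn_integral_mono)
      fix z
      show "ennreal (t z * cmod (deriv \<psi> z) powr (- e)) * indicator (layer \<theta> l m) z \<le> ennreal k * (ennreal (t z) * indicator (layer \<theta> l m) z)"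
      proof (cases "z \<in> layer \<theta> l m")
        case True
        then have "z \<in> disc" using order_trans[OF hbox_disc(3) hbox_disc(1)] by blast
        then have d: "cmod (deriv \<psi> z) > 0" using deriv_nz by simp
        have "1 / cmod (deriv \<psi> z) \<le> A * \<eta> ^ m / dscale \<theta> l" using A(2)[OF l True, folded dscale_def] dscale d by (simp add: field_simps)
        then have "(1 / cmod (deriv \<psi> z)) powr e \<le> k" unfolding k_def using e by (intro powr_mono2) auto
        moreover have "(1 / cmod (deriv \<psi> z)) powr e = cmod (deriv \<psi> z) powr (- e)" by (simp add: powr_divide powr_minus_divide)
        ultimately have "cmod (deriv \<psi> z) powr (- e) \<le> k" by simp
        then have "cmod (deriv \<psi> z) powr (- e) * t z \<le> k * t z" using tt(2) by (rule mult_right_mono)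
        then have "t z * cmod (deriv \<psi> z) powr (- e) \<le> k * t z" by (simp only: mult.commute)
        then show ?thesis using True by (simp add: k_def ennreal_leI flip: ennreal_mult')
      qed auto
    qed
    also have "\<dots> = ennreal k * (\<integral>\<^sup>+z. ennreal (t z) * indicator (layer \<theta> l m) z \<partial>disc_measure)"
      by (intro nn_integral_cmult borel_measurable_times_ennreal borel_measurable_indicator box_sets measurable_compose[OF tt(1) measurable_ennreal])
    also have "\<dots> \<le> ennreal k * ennreal (x * r ^ m)" by (intro mult_left_mono x) simp
    also have "\<dots> = ennreal (k * (x * r ^ m))" by (simp add: k_def ennreal_mult')
    also have "k * (x * r ^ m) \<le> (A / dscale \<theta> l) powr e * x * q ^ m"
    proof -
      have "k = (A / dscale \<theta> l * \<eta> ^ m) powr e" by (simp add: k_def)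
      also have "\<dots> = (A / dscale \<theta> l) powr e * (\<eta> ^ m) powr e" using A(1) dscale \<eta> by (subst powr_mult) auto
      also have "(\<eta> ^ m) powr e \<le> (\<eta> ^ m) powr N" using \<eta> e by (intro powr_mono) auto
      also have "(\<eta> ^ m) powr N = (\<eta> powr N) ^ m" using \<eta> by (simp add: powr_realpow[symmetric] powr_powr mult.commute)
      finally have "k \<le> (A / dscale \<theta> l) powr e * (\<eta> powr N) ^ m" by (simp add: mult_left_mono)
      then have "k * (x * r ^ m) \<le> (A / dscale \<theta> l) powr e * (\<eta> powr N) ^ m * (x * r ^ m)" using x(1) r by (intro mult_right_mono) auto
      also have "\<dots> = (A / dscale \<theta> l) powr e * x * (\<eta> powr N * r) ^ m" by (simp add: power_mult_distrib mult_ac)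
      finally show ?thesis unfolding \<eta>N .
    qed
    finally show ?thesis by (simp add: ennreal_leI)
  qed
  show thesis
  proof (rule that[OF q A(1) C])
    fix \<theta> l :: real assume l: "0 < l" "l \<le> 1"
    obtain x y where xy: "x \<ge> 0" "y > 0" "x * y powr (p - 1) \<le> C * ((dscale \<theta> l * l)\<^sup>2) powr p"
      "\<And>m. (\<integral>\<^sup>+z. ennreal (sigma_pull z) * indicator (layer \<theta> l m) z \<partial>disc_measure) \<le> ennreal (x * r ^ m)"
      "\<And>m. (\<integral>\<^sup>+z. ennreal (dual_pull z) * indicator (layer \<theta> l m) z \<partial>disc_measure) \<le> ennreal (y * r ^ m)" using t[OF l, of \<theta>] by blast
    show "\<exists>x y. x \<ge> 0 \<and> y > 0 \<and> x * y powr (p - 1) \<le> C * ((dscale \<theta> l * l)\<^sup>2) powr p \<and>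
    (\<forall>m. (\<integral>\<^sup>+z. ennreal (sigma_weight z) * indicator (layer \<theta> l m) z \<partial>disc_measure) \<le> ennreal ((A / dscale \<theta> l) powr p * x * q ^ m) \<and>
         (\<integral>\<^sup>+z. ennreal (dual_weight z) * indicator (layer \<theta> l m) z \<partial>disc_measure) \<le> ennreal ((A / dscale \<theta> l) powr (p / (p - 1)) * y * q ^ m))"
      unfolding dual_weight_def sigma_weight_def
      by (rule exI[of _ x], rule exI[of _ y], intro conjI allI xy(1-3) key l pull_measurable pull_nonneg xy(4,5) less_imp_le[OF xy(2)] N) (use p in auto)
  qed
qed

text \<open>In the product of the mass of the weight and the (p-1)-st power of the dual mass, the
  factors dscale^(-p) from each of the two weights cancel against (dscale l)^(2p), leaving the gain
  and (l^2)^p as \<open>positive_operator_bound\<close> requires.\<close>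

theorem weighted_positive_operator:
  "\<exists>C>0. \<forall>F. integrable disc_measure F \<longrightarrow> (\<forall>w. F w \<ge> 0) \<longrightarrow>
    (\<integral>\<^sup>+z. ennreal ((\<integral>w. F w * (1 / (cmod (1 - z * cnj w))\<^sup>2) \<partial>disc_measure) powr p * sigma_weight z) \<partial>disc_measure)
      \<le> ennreal C * (\<integral>\<^sup>+z. ennreal (F z powr p * sigma_weight z) \<partial>disc_measure)"
proof -
  obtain q A C where q: "0 < q" "q < 1" and A: "A > 0" and C: "C > 0" and lw: "\<And>\<theta> l. 0 < l \<Longrightarrow> l \<le> 1 \<Longrightarrow> \<exists>x y. x \<ge> 0 \<and> y > 0 \<and> x * y powr (p - 1) \<le> C * ((dscale \<theta> l * l)\<^sup>2) powr p \<and>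
    (\<forall>m. (\<integral>\<^sup>+z. ennreal (sigma_weight z) * indicator (layer \<theta> l m) z \<partial>disc_measure) \<le> ennreal ((A / dscale \<theta> l) powr p * x * q ^ m) \<and>
         (\<integral>\<^sup>+z. ennreal (dual_weight z) * indicator (layer \<theta> l m) z \<partial>disc_measure) \<le> ennreal ((A / dscale \<theta> l) powr (p / (p - 1)) * y * q ^ m))"
    by (rule layer_weights) (rule that)
  \<comment> \<open>The dual mass enters with the power p - 1, so its decay rate becomes
    q^(p-1).\<close>
  define \<rho> where "\<rho> = max q (q powr (p - 1))"
  have qp: "0 < q powr (p - 1)" "q powr (p - 1) < 1" using q p powr_less_mono2[of "p - 1" q 1] by auto
  have \<rho>: "0 < \<rho>" "\<rho> < 1" "q \<le> \<rho>" "q powr (p - 1) \<le> \<rho>" using q qp by (auto simp: \<rho>_def)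
  have tot: "\<exists>V\<ge>0. (\<integral>\<^sup>+z. ennreal (sigma_weight z) \<partial>disc_measure) \<le> ennreal V" "\<exists>V\<ge>0. (\<integral>\<^sup>+z. ennreal (dual_weight z) \<partial>disc_measure) \<le> ennreal V"
  proof -
    have "\<exists>B\<ge>0. \<forall>m. (\<integral>\<^sup>+z. ennreal (sigma_weight z) * indicator (layer \<theta> 1 m) z \<partial>disc_measure) \<le> ennreal (B * q ^ m)" for \<theta>
    proof -
      obtain x where "x \<ge> 0" "\<And>m. (\<integral>\<^sup>+z. ennreal (sigma_weight z) * indicator (layer \<theta> 1 m) z \<partial>disc_measure) \<le> ennreal ((A / dscale \<theta> 1) powr p * x * q ^ m)"
        using lw[of 1 \<theta>] by auto
      then show ?thesis by (intro exI[of _ "(A / dscale \<theta> 1) powr p * x"]) auto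
    qed
    then show "\<exists>V\<ge>0. (\<integral>\<^sup>+z. ennreal (sigma_weight z) \<partial>disc_measure) \<le> ennreal V" by (intro total_finite[OF _ q]) measurable
    have "\<exists>B\<ge>0. \<forall>m. (\<integral>\<^sup>+z. ennreal (dual_weight z) * indicator (layer \<theta> 1 m) z \<partial>disc_measure) \<le> ennreal (B * q ^ m)" for \<theta>
    proof -
      obtain y where "y > 0" "\<And>m. (\<integral>\<^sup>+z. ennreal (dual_weight z) * indicator (layer \<theta> 1 m) z \<partial>disc_measure) \<le> ennreal ((A / dscale \<theta> 1) powr (p / (p - 1)) * y * q ^ m)"
        using lw[of 1 \<theta>] by auto
      then show ?thesis by (intro exI[of _ "(A / dscale \<theta> 1) powr (p / (p - 1)) * y"]) auto
    qed
    then show "\<exists>V\<ge>0. (\<integral>\<^sup>+z. ennreal (dual_weight z) \<partial>disc_measure) \<le> ennreal V" by (intro total_finite[OF _ q]) measurable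
  qed
  obtain Vb where Vb: "(\<integral>\<^sup>+z. ennreal (sigma_weight z) \<partial>disc_measure) \<le> ennreal Vb" "Vb \<ge> 0" using tot(1) by blast
  obtain Va where Va: "(\<integral>\<^sup>+z. ennreal (dual_weight z) \<partial>disc_measure) \<le> ennreal Va" "Va \<ge> 0" using tot(2) by blast
  \<comment> \<open>The bound for the total dual mass has to be strictly positive for Holder's
    inequality.\<close>
  have Va': "(\<integral>\<^sup>+z. ennreal (dual_weight z) \<partial>disc_measure) \<le> ennreal (Va + 1)" by (rule order_trans[OF Va(1)]) (simp add: ennreal_leI)
  show ?thesis
  proof (rule positive_operator_bound[OF \<rho>(1,2) _ _ Vb Va'])
    show "0 \<le> A powr (2 * p) * C" using C by simp
    show "0 < Va + 1" using Va(2) by simp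
    fix \<theta> l :: real and m k :: nat assume l: "0 < l" "l \<le> 1"
    have dscale: "dscale \<theta> l > 0" by (rule dscale_pos[OF l])
    obtain x y where xy: "x \<ge> 0" "y > 0" "x * y powr (p - 1) \<le> C * ((dscale \<theta> l * l)\<^sup>2) powr p"
      "\<And>m. (\<integral>\<^sup>+z. ennreal (sigma_weight z) * indicator (layer \<theta> l m) z \<partial>disc_measure) \<le> ennreal ((A / dscale \<theta> l) powr p * x * q ^ m)"
      "\<And>m. (\<integral>\<^sup>+z. ennreal (dual_weight z) * indicator (layer \<theta> l m) z \<partial>disc_measure) \<le> ennreal ((A / dscale \<theta> l) powr (p / (p - 1)) * y * q ^ m)"
      using lw[OF l, of \<theta>] by blast
    define R where "R = A / dscale \<theta> l"
    have R: "R > 0" using A dscale by (simp add: R_def)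
    define \<beta> where "\<beta> = R powr p * x * q ^ m"
    define \<alpha> where "\<alpha> = R powr (p / (p - 1)) * y * q ^ k"
    have "\<alpha> powr (p - 1) = R powr p * y powr (p - 1) * (q powr (p - 1)) ^ k"
    proof -
      have "(R powr (p / (p - 1))) powr (p - 1) = R powr p" unfolding powr_powr using p by simp
      moreover have "(q ^ k) powr (p - 1) = (q powr (p - 1)) ^ k" using q by (simp add: powr_realpow[symmetric] powr_powr mult.commute)
      ultimately show ?thesis unfolding \<alpha>_def using R xy(2) q by (simp add: powr_mult)
    qed
    then have "\<beta> * \<alpha> powr (p - 1) = (R powr p * R powr p) * (x * y powr (p - 1)) * (q ^ m * (q powr (p - 1)) ^ k)"
      by (simp add: \<beta>_def mult_ac)
    also have "\<dots> \<le> (R powr p * R powr p) * (C * ((dscale \<theta> l * l)\<^sup>2) powr p) * (\<rho> ^ m * \<rho> ^ k)"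
      using xy(1) C q qp \<rho> by (intro mult_mono[OF mult_left_mono[OF xy(3)] mult_mono[OF power_mono power_mono]]) auto
    also have "R powr p * R powr p = A powr (2 * p) / dscale \<theta> l powr (2 * p)"
      unfolding R_def using A dscale by (simp add: powr_divide flip: powr_add)
    also have "((dscale \<theta> l * l)\<^sup>2) powr p = dscale \<theta> l powr (2 * p) * (l\<^sup>2) powr p"
    proof -
      have "((dscale \<theta> l)\<^sup>2) powr p = dscale \<theta> l powr (2 * p)" using dscale by (simp add: powr_numeral[symmetric] powr_powr del: powr_numeral)
      then show ?thesis by (simp add: power_mult_distrib powr_mult)
    qed
    finally have "\<beta> * \<alpha> powr (p - 1) \<le> A powr (2 * p) * C * \<rho> ^ (m + k) * (l\<^sup>2) powr p"
      using dscale by (simp add: power_add mult_ac)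
    then show "\<exists>\<alpha> \<beta>. 0 < \<alpha> \<and> 0 \<le> \<beta> \<and>
      (\<integral>\<^sup>+z. ennreal (sigma_weight z) * indicator (layer \<theta> l m) z \<partial>disc_measure) \<le> ennreal \<beta> \<and>
      (\<integral>\<^sup>+z. ennreal (dual_weight z) * indicator (layer \<theta> l k) z \<partial>disc_measure) \<le> ennreal \<alpha> \<and>
      \<beta> * \<alpha> powr (p - 1) \<le> A powr (2 * p) * C * \<rho> ^ (m + k) * (l\<^sup>2) powr p"
    proof -
      assume "\<beta> * \<alpha> powr (p - 1) \<le> A powr (2 * p) * C * \<rho> ^ (m + k) * (l\<^sup>2) powr p"
      moreover have "0 < \<alpha>" "0 \<le> \<beta>" using R xy(1,2) q by (auto simp: \<alpha>_def \<beta>_def)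
      moreover note xy(4)[of m, folded R_def, folded \<beta>_def] xy(5)[of k, folded R_def, folded \<alpha>_def]
      ultimately show ?thesis by blast
    qed
  qed
qed

text \<open>The L^p(\<sigma>) norm of h equals the L^p(\<open>sigma_weight\<close>) norm of its
  pullback (h o \<psi>) \<psi>', and the pullback of the projection is
  \<open>bergman_disc F\<close>, which the positive operator applied to |F| dominates
  pointwise.\<close>

theorem Bp_sufficiency: "bergman_bounded \<Omega> p \<sigma>"
proof -
  obtain C where C0: "C > 0" "\<forall>F. integrable disc_measure F \<longrightarrow> (\<forall>w. F w \<ge> 0) \<longrightarrow>
    (\<integral>\<^sup>+z. ennreal ((\<integral>w. F w * (1 / (cmod (1 - z * cnj w))\<^sup>2) \<partial>disc_measure) powr p * sigma_weight z) \<partial>disc_measure)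
      \<le> ennreal C * (\<integral>\<^sup>+z. ennreal (F z powr p * sigma_weight z) \<partial>disc_measure)" using weighted_positive_operator by blast
  obtain k where k: "k holomorphic_on \<Omega>" "\<And>w. w \<in> \<Omega> \<Longrightarrow> \<psi> (k w) = w" "\<And>w. w \<in> \<Omega> \<Longrightarrow> k w \<in> disc"
    by (rule inverse_holomorphic) (rule that)
  obtain C' where \<sigma>: "integrable (lebesgue_on \<Omega>) (\<lambda>w. \<bar>\<sigma> w\<bar>)" "AE w in lebesgue_on \<Omega>. \<sigma> w > 0"
    by (rule Dp_expand[OF Dp p]) (rule that)
  have norm_eq: "set_nn_integral lebesgue \<Omega> (\<lambda>z. ennreal (cmod (h z) powr p * \<sigma> z)) = (\<integral>\<^sup>+z. ennreal (cmod (h (\<psi> z) * deriv \<psi> z) powr p * sigma_weight z) \<partial>disc_measure)"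
    if h: "h \<in> borel_measurable (lebesgue_on \<Omega>)" for h :: "complex \<Rightarrow> complex"
  proof -
    have "set_nn_integral lebesgue \<Omega> (\<lambda>z. ennreal (cmod (h z) powr p * \<sigma> z)) = (\<integral>\<^sup>+z. ennreal (cmod (h z) powr p * \<sigma> z) \<partial>lebesgue_on \<Omega>)"
      by (rule set_nn_integral_lebesgue_on[OF T_sets])
    also have "\<dots> = (\<integral>\<^sup>+z. ennreal (cmod (h z) powr p * \<bar>\<sigma> z\<bar>) \<partial>lebesgue_on \<Omega>)"
      by (rule nn_integral_cong_AE, rule AE_mp[OF \<sigma>(2)], rule AE_I2) auto
    also have "\<dots> = (\<integral>\<^sup>+z. ennreal ((cmod (deriv \<psi> z))\<^sup>2) * ennreal (cmod (h (\<psi> z)) powr p * \<bar>\<sigma> (\<psi> z)\<bar>) \<partial>disc_measure)"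
      using h borel_measurable_integrable[OF \<sigma>(1)] by (intro nn_integral_conformal) measurable
    also have "\<dots> = (\<integral>\<^sup>+z. ennreal (cmod (h (\<psi> z) * deriv \<psi> z) powr p * sigma_weight z) \<partial>disc_measure)"
    proof (rule nn_integral_cong)
      fix z assume "z \<in> space disc_measure"
      then have z: "z \<in> disc" by simp
      define d where "d = cmod (deriv \<psi> z)"
      have d: "d > 0" using deriv_nz[OF z] by (simp add: d_def)
      have "d powr p * d powr (2 - p) = d\<^sup>2" using d by (simp add: powr_numeral flip: powr_add)
      then have "cmod (h (\<psi> z) * deriv \<psi> z) powr p * sigma_weight z = d\<^sup>2 * (cmod (h (\<psi> z)) powr p * \<bar>\<sigma> (\<psi> z)\<bar>)"
        unfolding sigma_weight_eq[OF z] norm_mult d_def[symmetric] using d by (simp add: powr_mult mult_ac)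
      then show "ennreal ((cmod (deriv \<psi> z))\<^sup>2) * ennreal (cmod (h (\<psi> z)) powr p * \<bar>\<sigma> (\<psi> z)\<bar>) = ennreal (cmod (h (\<psi> z) * deriv \<psi> z) powr p * sigma_weight z)"
        by (simp add: d_def ennreal_mult')
    qed
    finally show ?thesis .
  qed
  show ?thesis
    unfolding bergman_bounded_def
  proof (intro exI[of _ C] conjI allI impI)
    show "0 \<le> C" using C0(1) by simp
    fix f assume f: "L2_on \<Omega> f"
    define F where "F z = f (\<psi> z) * deriv \<psi> z" for z
    have fm: "f \<in> borel_measurable (lebesgue_on \<Omega>)" using f by (simp add: L2_on_iff)
    have FL: "L2_on disc F" using pullback_L2[OF fm] f unfolding F_def by blast
    have Fi: "integrable disc_measure F" by (rule L2_ball_integrable[OF FL])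
    have A2: "A2_on disc (bergman_disc F)" using bergman_disc_holomorphic[OF Fi] bergman_disc_L2(1)[OF FL] by (simp add: A2_on_def)
    have tr: "bergman_proj \<Omega> f (\<psi> z) * deriv \<psi> z = bergman_disc F z" if "z \<in> disc" for z
      by (rule bergman_proj_transfer[OF f A2 _ that]) (use bergman_disc_orth[OF FL] in \<open>simp add: F_def\<close>)
    have pm: "bergman_proj \<Omega> f \<in> borel_measurable (lebesgue_on \<Omega>)"
    proof -
      have "continuous_on \<Omega> (\<lambda>w. bergman_disc F (k w) / deriv \<psi> (k w))"
        using k deriv_nz by (intro continuous_intros continuous_on_compose2[OF holomorphic_on_imp_continuous_on[OF bergman_disc_holomorphic[OF Fi]]]
          continuous_on_compose2[OF deriv_cont] holomorphic_on_imp_continuous_on) auto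
      then have "(\<lambda>w. bergman_disc F (k w) / deriv \<psi> (k w)) \<in> borel_measurable (lebesgue_on \<Omega>)"
        by (intro continuous_imp_measurable_on_sets_lebesgue) auto
      moreover have "bergman_disc F (k w) / deriv \<psi> (k w) = bergman_proj \<Omega> f w" if "w \<in> \<Omega>" for w
        using tr[OF k(3)[OF that]] k(2)[OF that] deriv_nz[OF k(3)[OF that]] by (simp add: divide_eq_eq)
      ultimately show ?thesis by (subst (asm) measurable_cong[where g = "bergman_proj \<Omega> f"]) auto
    qed
    have wb0: "sigma_weight z \<ge> 0" for z using pull_nonneg(1) by (simp add: sigma_weight_def)
    have "set_nn_integral lebesgue \<Omega> (\<lambda>z. ennreal (cmod (bergman_proj \<Omega> f z) powr p * \<sigma> z)) = (\<integral>\<^sup>+z. ennreal (cmod (bergman_disc F z) powr p * sigma_weight z) \<partial>disc_measure)"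
      unfolding norm_eq[OF pm] by (rule nn_integral_cong) (simp add: tr)
    also have "\<dots> \<le> (\<integral>\<^sup>+z. ennreal ((\<integral>w. cmod (F w) * (1 / (cmod (1 - z * cnj w))\<^sup>2) \<partial>disc_measure) powr p * sigma_weight z) \<partial>disc_measure)"
      using p wb0 by (intro nn_integral_mono ennreal_leI mult_right_mono powr_mono2 bergman_disc_norm_le[OF Fi]) auto
    also have "\<dots> \<le> ennreal C * (\<integral>\<^sup>+z. ennreal (cmod (F z) powr p * sigma_weight z) \<partial>disc_measure)"
      using C0(2)[rule_format, OF integrable_norm[OF Fi]] by simp
    also have "(\<integral>\<^sup>+z. ennreal (cmod (F z) powr p * sigma_weight z) \<partial>disc_measure) = set_nn_integral lebesgue \<Omega> (\<lambda>z. ennreal (cmod (f z) powr p * \<sigma> z))"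
      unfolding norm_eq[OF fm] F_def ..
    finally show "set_nn_integral lebesgue \<Omega> (\<lambda>z. ennreal (cmod (bergman_proj \<Omega> f z) powr p * \<sigma> z)) \<le> ennreal C * set_nn_integral lebesgue \<Omega> (\<lambda>z. ennreal (cmod (f z) powr p * \<sigma> z))" .
  qed
qed

end

theorem theorem1p3:
  fixes \<Omega> :: "complex set" and \<psi> :: "complex \<Rightarrow> complex"
  assumes "bounded \<Omega>" and "uniform_domain \<Omega>"
    and "\<psi> holomorphic_on ball 0 1" and "inj_on \<psi> (ball 0 1)" and "\<psi> ` ball 0 1 = \<Omega>"
  shows "(\<forall>p>1. in_Bp p (\<lambda>z. (cmod (deriv \<psi> z))\<^sup>2)) \<longleftrightarrow>
         (\<forall>p>1. \<forall>\<sigma>. in_Dp \<Omega> p \<sigma> \<longrightarrow> bergman_bounded \<Omega> p \<sigma>)"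
proof -
  interpret quasidisc_map \<Omega> \<psi> using assms by unfold_locales
  show ?thesis
  proof (intro iffI allI impI)
    fix p \<sigma> assume Bp: "\<forall>p>1. in_Bp p (\<lambda>z. (cmod (deriv \<psi> z))\<^sup>2)" and p: "(p::real) > 1" and Dp: "in_Dp \<Omega> p \<sigma>"
    then interpret quasidisc_weight \<Omega> \<psi> p \<sigma> by unfold_locales
    show "bergman_bounded \<Omega> p \<sigma>" by (rule Bp_sufficiency)
  qed (rule Bp_necessity)
qed

end
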